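(* If $k$ is a field of characteristic $p>0$, then $\Lambda_{L,p}=\Lambda_0$ in the cell algebra $S_L(\mathcal T_r,k)$, where $\Lambda_{L,p}=\{\lambda\in\Lambda : p\text{ does not divide }\lambda_j\text{ for at least one }j\}\cup\Lambda(r)$.
   Context: **Monoids.** $r\ge1$ and $n\ge r$ are integers; $\bar m=\{1,\dots,m\}$. $\bar\tau_r$ is the monoid (under composition) of all maps $\alpha:\bar r\cup\{0\}\to\bar r\cup\{0\}$ with $\alpha(0)=0$. Permutations of $\bar i$ are extended by $0\mapsto0$, so $\mathfrak S_r\subseteq\bar\tau_r$. $M$ denotes a monoid with $\mathfrak S_r\subseteq M\subseteq\bar\tau_r$. The full transformation semigroup $\mathcal T_r$ (all maps $\bar r\to\bar r$) is identified with the submonoid of $\alpha\in\bar\tau_r$ with $\alpha^{-1}(0)=\{0\}$. The index of $\alpha$ is $|\mathrm{image}(\alpha)\setminus\{0\}|$, and $I(M)$ is the set of indices of elements of $M$ (so $I(\mathcal T_r)=\bar r$). $\Lambda(r,n)$ is the set of compositions of $r$ with $n$ (nonnegative) parts; for $\mu\in\Lambda(r,n)$, $b^\mu_1,b^\mu_2,\dots$ are the consecutive blocks of $\bar r$ with $|b^\mu_j|=\mu_j$, and $\mathfrak S_\mu$ is the Young subgroup preserving each block (similarly for compositions of $i$). **The algebra.** For $\mu,\nu\in\Lambda(r,n)$, ${}^\mu A^\nu$ is the $\mathbb Z$-submodule of $\mathbb Z[M]$ of elements invariant under left multiplication by $\mathfrak S_\mu$ and right multiplication by $\mathfrak S_\nu$.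 ${}_\mu M_\nu$ is the set of double cosets $\mathbf D=\mathfrak S_\mu m\mathfrak S_\nu$, $m\in M$; the sums $X(\mathbf D)=\sum_{m\in\mathbf D}m$ form a $\mathbb Z$-basis of ${}^\mu A^\nu$. $\bar A=\bigoplus_{\mu,\nu\in\Lambda(r,n)}{}^\mu A^\nu$ (external direct sum) has $\mathbb Z$-basis the elements $b_{\mathbf D}=X(\mathbf D)$. For $\mathbf D_1\in{}_\mu M_\nu$, $\mathbf D_2\in{}_\nu M_\pi$ write, in $\mathbb Z[M]$, $X(\mathbf D_1)X(\mathbf D_2)=\sum_{\mathbf D\in{}_\mu M_\pi}a(\mathbf D_1,\mathbf D_2,\mathbf D)X(\mathbf D)$. For $\mathbf D\in{}_\mu M_\nu$ let $n_L(\mathbf D)=|\mathfrak S_\mu m|$ for any $m\in\mathbf D$. Define a bilinear product on $\bar A$ by $b_{\mathbf D_1}*_{L}b_{\mathbf D_2}=\sum_{\mathbf D}\frac{n_L(\mathbf D)}{n_L(\mathbf D_1)n_L(\mathbf D_2)}a(\mathbf D_1,\mathbf D_2,\mathbf D)b_{\mathbf D}$ for $\mathbf D_1\in{}_\mu M_\nu,\mathbf D_2\in{}_\nu M_\pi$, and $0$ for $\mathbf D_1\in{}_\mu M_\nu,\mathbf D_2\in{}_\rho M_\pi$ with $\nu\ne\rho$. It is known that the structure constants are integers and the product is associative with identity. $A_L^{\mathbb Z}$ denotes $\bar A$ with product $*_L$; for a field $k$, $S_L(M,k)=k\otimes_{\mathbb Z}A_L^{\mathbb Z}$. **Combinatorial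 data.** $C(i,r)$ is the set of $i$-element subsets of $\bar r$; for $C=\{c_1<\dots<c_i\}$, $\phi_C:\bar i\cup\{0\}\to\bar r\cup\{0\}$ is $\phi_C(j)=c_j$, $\phi_C(0)=0$. $P_r$ is the set of all subsets of $\bar r$; $\mathfrak S_\nu$ acts on the right by $S\pi=\pi^{-1}(S)$. For $\nu\in\Lambda(r,n)$ order $P_r$ as follows: $s(d)$ is the increasing string of elements of $d$; $\bar s(\nu,d)$ is the string of length $r$ obtained from $s(d)$ by replacing each $x$ by the number of the $\nu$-block containing it and appending $r-|d|$ zeros (it determines the $\mathfrak S_\nu$-orbit of $d$); $d<d'$ iff $\bar s(\nu,d)<\bar s(\nu,d')$ lexicographically, or these are equal and $s(d)<s(d')$ lexicographically. The orbits are ordered $O_1<\dots<O_{N_\nu}$ by $\bar s$. $D(i,r)$ is the collection of sets $D$ of $i$ nonempty pairwise disjoint subsets of $\bar r$; writing $D=\{S_{a_1}<\dots<S_{a_i}\}$ in the order for $\nu$, $\psi_D:\bar r\cup\{0\}\to\bar i\cup\{0\}$ sends $x\in S_{a_j}$ to $j$ and all other $x$ to $0$. Each $\alpha\in\bar\tau_r$ of index $i$ is uniquely $\alpha=\phi_{C_\alpha}\circ\sigma_\alpha\circ\psi_{D_\alpha}$ with $C_\alpha\in C(i,r)$, $\sigma_\alpha\in\mathfrak S_i$, $D_\alpha\in D(i,r)$; $D(M,i,r)=\{D_\alpha:\alpha\in M\text{ of index }i\}$. $\mathfrak S_\mu$ acts on the left on $C(i,r)$ by $\rho C=\rho(C)$;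 $\mathfrak S_\nu$ acts on the right on $D(M,i,r)$ by $D\pi=\{\pi^{-1}(d):d\in D\}$. For $C\in C(i,r)$, $\mu(C)$ is the composition of $i$ with $\mu(C)_j=|b^\mu_j\cap C|$; for $D\in D(M,i,r)$, $\nu(D)$ is the composition of $i$ with $N_\nu$ parts $\nu(D)_j=|D\cap O_j|$. These depend only on the orbits $O_\mu\ni C$, $O_\nu\ni D$; write $\mu(O_\mu)$, $\nu(O_\nu)$. **The cell basis.** $\Lambda(i)$ is the set of partitions of $i$ ($\Lambda(0)=\{\lambda_0\}$, the empty partition), $\Lambda=\bigcup_{i\in I(M)}\Lambda(i)$, ordered by $\lambda\ge\mu$ iff $\mathrm{index}(\lambda)<\mathrm{index}(\mu)$, or the indices agree and $\lambda$ dominates $\mu$ (index of $\lambda\in\Lambda(i)$ is $i$). For $\lambda\in\Lambda(i)$, $L(\lambda)$ is the set of pairs $(O_\mu,S)$ with $\mu\in\Lambda(r,n)$ (part of the data), $O_\mu$ an $\mathfrak S_\mu$-orbit in $C(i,r)$, $S$ a semistandard $\lambda$-tableau of type $\mu(O_\mu)$; $R(\lambda)$ is the set of pairs $(O_\nu,T)$ with $\nu\in\Lambda(r,n)$ (part of the data), $O_\nu$ an $\mathfrak S_\nu$-orbit in $D(M,i,r)$, $T$ a semistandard $\lambda$-tableau of type $\nu(O_\nu)$. The Murphy basis of $\mathbb Z[\mathfrak S_i]$: for a standard $\lambda$-tableau $s$ let $d(s)\in\mathfrak S_i$ be the permutation taking the entries of the row-reading tableau $t^\lambda$ to those of $s$,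 $r_\lambda=\sum_{\sigma\in\mathfrak S_\lambda}\sigma$, and ${}_sC_t^\lambda=d(s)\,r_\lambda\,d(t)^{-1}$. A standard tableau has type $S$ with respect to a composition if replacing each entry by the number of the block containing it gives $S$. Set ${}_SC_T^\lambda=\sum_{s,t}{}_sC_t^\lambda$, over standard $s$ of type $S$ (w.r.t. $\mu(O_\mu)$) and standard $t$ of type $T$ (w.r.t. $\nu(O_\nu)$), and ${}_{(O_\mu,S)}C^\lambda_{(O_\nu,T)}=\sum_{C\in O_\mu}\sum_{D\in O_\nu}\phi_C\circ{}_SC_T^\lambda\circ\psi_D\in{}^\mu A^\nu\subseteq\bar A$. These elements form a cell basis of $S_L(M,k)$. **$\Lambda_0$.** In a cell algebra with cell basis ${}_sC_t^\lambda$ ($\lambda\in\Lambda$, $s\in L(\lambda)$, $t\in R(\lambda)$), let $\hat A^\lambda$ be the span of the ${}_sC_t^\mu$ with $\mu>\lambda$. For $s\in L(\lambda)$, $t\in R(\lambda)$ there is a scalar $r_{st}$ with ${}_{s'}C_t^\lambda\cdot{}_sC_{t'}^\lambda\equiv r_{st}\,{}_{s'}C_{t'}^\lambda\bmod\hat A^\lambda$ for all $s'\in L(\lambda),t'\in R(\lambda)$; the bracket is the bilinear pairing with $\langle C_t^\lambda,{}_sC^\lambda\rangle=r_{st}$. $\Lambda_0$ is the set of $\lambda\in\Lambda$ for which the bracket is not identically zero, i.e. $r_{st}\neq0$ for some $s,t$. In the claim, $M=\mathcal T_r$, and $\Lambda(r)$ is the set of partitions of $r$. *)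

theory Defs
  imports Complex_Main "HOL-Library.Poly_Mapping" "HOL-Combinatorics.Permutations"
begin

section \<open>Maps and monoid rings\<close>

text \<open>
  A map \<open>{0..a} \<rightarrow> {0..b}\<close> fixing \<open>0\<close> is encoded as a function on \<open>nat\<close> with value \<open>0\<close> outside
  \<open>{1..a}\<close>, so that composition of such maps is the library composition. A permutation of \<open>{1..a}\<close>
  is a library permutation (\<open>permutes\<close>, the identity outside \<open>{1..a}\<close>); composing it on either side
  with an encoded map whose values, respectively arguments, it acts on gives an encoded map again.
  Formal linear combinations of functions form a ring under composition, in which \<open>\<int>[M]\<close> and
  \<open>\<int>[\<SS>\<^sub>i]\<close> both live.
\<close>

type_synonym tmap = "nat \<Rightarrow> nat"

definition full_transf :: "nat \<Rightarrow> tmap set" where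
  "full_transf r = {\<alpha>. (\<forall>x\<in>{1..r}. \<alpha> x \<in> {1..r}) \<and> (\<forall>x. x \<notin> {1..r} \<longrightarrow> \<alpha> x = 0)}"

definition map_index :: "tmap \<Rightarrow> nat" where
  "map_index \<alpha> = card (range \<alpha> - {0})"

definition ring_mult :: "(tmap \<Rightarrow>\<^sub>0 int) \<Rightarrow> (tmap \<Rightarrow>\<^sub>0 int) \<Rightarrow> (tmap \<Rightarrow>\<^sub>0 int)"  (infixl \<open>\<star>\<close> 70) where
  "f \<star> g = (\<Sum>x\<in>Poly_Mapping.keys f. \<Sum>y\<in>Poly_Mapping.keys g.
     Poly_Mapping.single (x \<circ> y) (Poly_Mapping.lookup f x * Poly_Mapping.lookup g y))"


section \<open>Compositions and Young subgroups\<close>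

text \<open>Compositions and partitions are lists; blocks, rows and parts are numbered from \<open>1\<close>.\<close>

definition compositions :: "nat \<Rightarrow> nat \<Rightarrow> nat list set" where
  "compositions r n = {\<mu>. length \<mu> = n \<and> sum_list \<mu> = r}"

definition block :: "nat list \<Rightarrow> nat \<Rightarrow> nat set" where
  "block \<mu> j = {sum_list (take (j - 1) \<mu>) <.. sum_list (take j \<mu>)}"

definition block_number :: "nat list \<Rightarrow> nat \<Rightarrow> nat" where
  "block_number \<mu> x = (THE j. j \<in> {1..length \<mu>} \<and> x \<in> block \<mu> j)"

definition young :: "nat list \<Rightarrow> (nat \<Rightarrow> nat) set" where
  "young \<mu> = {\<sigma>. \<sigma> permutes {1..sum_list \<mu>} \<and> (\<forall>j\<in>{1..length \<mu>}. \<sigma> ` block \<mu> j = block \<mu> j)}"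


section \<open>The algebra\<close>

definition double_coset :: "nat list \<Rightarrow> nat list \<Rightarrow> tmap \<Rightarrow> tmap set" where
  "double_coset \<mu> \<nu> m = {\<rho> \<circ> m \<circ> \<pi> | \<rho> \<pi>. \<rho> \<in> young \<mu> \<and> \<pi> \<in> young \<nu>}"

definition double_cosets :: "tmap set \<Rightarrow> nat list \<Rightarrow> nat list \<Rightarrow> tmap set set" where
  "double_cosets M \<mu> \<nu> = double_coset \<mu> \<nu> ` M"

definition coset_sum :: "tmap set \<Rightarrow> (tmap \<Rightarrow>\<^sub>0 int)" where
  "coset_sum D = (\<Sum>m\<in>D. Poly_Mapping.single m 1)"

text \<open>Coordinates, in the basis of the \<open>coset_sum D\<close>, of an element of \<open>\<int>[M]\<close> that is invariant under
  \<open>\<SS>\<^sub>\<mu>\<close> on the left and \<open>\<SS>\<^sub>\<nu>\<close> on the right.\<close>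

definition coords :: "tmap set \<Rightarrow> nat list \<Rightarrow> nat list \<Rightarrow> (tmap \<Rightarrow>\<^sub>0 int) \<Rightarrow> (tmap set \<Rightarrow>\<^sub>0 int)" where
  "coords M \<mu> \<nu> f = (THE c. Poly_Mapping.keys c \<subseteq> double_cosets M \<mu> \<nu> \<and>
     f = (\<Sum>D\<in>double_cosets M \<mu> \<nu>. frag_cmul (Poly_Mapping.lookup c D) (coset_sum D)))"

definition n_L :: "nat list \<Rightarrow> tmap set \<Rightarrow> nat" where
  "n_L \<mu> D = the_elem ((\<lambda>m. card ((\<lambda>\<rho>. \<rho> \<circ> m) ` young \<mu>)) ` D)"

text \<open>The division is exact.\<close>

definition struct_const ::
  "tmap set \<Rightarrow> nat list \<Rightarrow> nat list \<Rightarrow> nat list \<Rightarrow> tmap set \<Rightarrow> tmap set \<Rightarrow> tmap set \<Rightarrow> int" where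
  "struct_const M \<mu> \<nu> \<pi> D1 D2 D =
     (int (n_L \<mu> D) * Poly_Mapping.lookup (coords M \<mu> \<pi> (coset_sum D1 \<star> coset_sum D2)) D)
     div (int (n_L \<mu> D1) * int (n_L \<nu> D2))"

text \<open>
  The basis vector \<open>b\<^sub>D\<close> in the summand of \<open>\<mu>, \<nu>\<close> is the key \<open>(\<mu>, \<nu>, D)\<close>; the summands are external,
  so the same set \<open>D\<close> may occur with different \<open>\<mu>, \<nu>\<close>. The product is defined over any commutative
  ring \<open>'k\<close>: for \<open>'k = int\<close> it is that of \<open>A\<^sub>L\<^sup>\<int>\<close>, and in general that of its base change to \<open>'k\<close>.
\<close>

type_synonym bkey = "nat list \<times> nat list \<times> tmap set"

definition scale :: "'k::comm_ring_1 \<Rightarrow> (bkey \<Rightarrow>\<^sub>0 'k) \<Rightarrow> (bkey \<Rightarrow>\<^sub>0 'k)" where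
  "scale c f = Poly_Mapping.map ((*) c) f"

fun basis_mult :: "tmap set \<Rightarrow> bkey \<Rightarrow> bkey \<Rightarrow> (bkey \<Rightarrow>\<^sub>0 'k::comm_ring_1)" where
  "basis_mult M (\<mu>, \<nu>, D1) (\<rho>, \<pi>, D2) =
     (if \<nu> = \<rho>
      then \<Sum>D\<in>double_cosets M \<mu> \<pi>.
             Poly_Mapping.single (\<mu>, \<pi>, D) (of_int (struct_const M \<mu> \<nu> \<pi> D1 D2 D))
      else 0)"

definition SL_mult :: "tmap set \<Rightarrow> (bkey \<Rightarrow>\<^sub>0 'k) \<Rightarrow> (bkey \<Rightarrow>\<^sub>0 'k) \<Rightarrow> (bkey \<Rightarrow>\<^sub>0 'k::comm_ring_1)" where
  "SL_mult M f g = (\<Sum>x\<in>Poly_Mapping.keys f. \<Sum>y\<in>Poly_Mapping.keys g.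
     scale (Poly_Mapping.lookup f x * Poly_Mapping.lookup g y) (basis_mult M x y))"

text \<open>The image in the base change to \<open>'k\<close> of an invariant element of \<open>\<int>[M]\<close>, placed in the summand
  of \<open>\<mu>, \<nu>\<close>.\<close>

definition embed :: "tmap set \<Rightarrow> nat list \<Rightarrow> nat list \<Rightarrow> (tmap \<Rightarrow>\<^sub>0 int) \<Rightarrow> (bkey \<Rightarrow>\<^sub>0 'k::comm_ring_1)" where
  "embed M \<mu> \<nu> f =
     (\<Sum>D\<in>double_cosets M \<mu> \<nu>.
        Poly_Mapping.single (\<mu>, \<nu>, D) (of_int (Poly_Mapping.lookup (coords M \<mu> \<nu> f) D)))"

lemma lookup_scale [simp]: "Poly_Mapping.lookup (scale c f) x = c * Poly_Mapping.lookup f x"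
  by (simp add: scale_def Poly_Mapping.map.rep_eq when_def)

lemma vector_space_scale: "vector_space (scale :: 'k::field \<Rightarrow> _)"
  by unfold_locales (auto intro!: poly_mapping_eqI simp: lookup_add algebra_simps)


section \<open>Subsets, families of disjoint subsets and their orbits\<close>

text \<open>The increasing enumeration of a finite set that is strictly totally ordered by \<open>lt\<close>.\<close>

definition enumeration :: "('a \<Rightarrow> 'a \<Rightarrow> bool) \<Rightarrow> 'a set \<Rightarrow> 'a list" where
  "enumeration lt A = (THE xs. set xs = A \<and> distinct xs \<and> sorted_wrt lt xs)"

definition Csets :: "nat \<Rightarrow> nat \<Rightarrow> nat set set" where
  "Csets i r = {C. C \<subseteq> {1..r} \<and> card C = i}"

definition phi :: "nat set \<Rightarrow> tmap" where
  "phi C j = (if j \<in> {1..card C} then sorted_list_of_set C ! (j - 1) else 0)"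

definition block_string :: "nat list \<Rightarrow> nat set \<Rightarrow> nat list" where
  "block_string \<nu> d =
     map (block_number \<nu>) (sorted_list_of_set d) @ replicate (sum_list \<nu> - card d) 0"

definition subset_less :: "nat list \<Rightarrow> nat set \<Rightarrow> nat set \<Rightarrow> bool" where
  "subset_less \<nu> d d' \<longleftrightarrow> ord_class.lexordp (block_string \<nu> d) (block_string \<nu> d') \<or>
     block_string \<nu> d = block_string \<nu> d' \<and> ord_class.lexordp (sorted_list_of_set d) (sorted_list_of_set d')"

text \<open>The orbits \<open>O\<^sub>1, O\<^sub>2, \<dots>\<close> of \<open>\<SS>\<^sub>\<nu>\<close> on all subsets of \<open>{1..r}\<close>, \<open>r\<close> being the sum of \<open>\<nu>\<close>.\<close>

definition subset_orbit :: "nat list \<Rightarrow> nat set \<Rightarrow> nat set set" where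
  "subset_orbit \<nu> d = {\<pi> -` d | \<pi>. \<pi> \<in> young \<nu>}"

definition orbit_less :: "nat list \<Rightarrow> nat set set \<Rightarrow> nat set set \<Rightarrow> bool" where
  "orbit_less \<nu> Q Q' \<longleftrightarrow> (\<exists>d\<in>Q. \<exists>d'\<in>Q'. ord_class.lexordp (block_string \<nu> d) (block_string \<nu> d'))"

definition subset_orbits :: "nat list \<Rightarrow> nat set set list" where
  "subset_orbits \<nu> = enumeration (orbit_less \<nu>) (subset_orbit \<nu> ` Pow {1..sum_list \<nu>})"

definition Dsets :: "nat \<Rightarrow> nat \<Rightarrow> nat set set set" where
  "Dsets i r = {D. card D = i \<and> finite D \<and> (\<forall>d\<in>D. d \<noteq> {} \<and> d \<subseteq> {1..r}) \<and> pairwise disjnt D}"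

definition psi :: "nat list \<Rightarrow> nat set set \<Rightarrow> tmap" where
  "psi \<nu> D x = (if x \<in> \<Union>D
     then (THE j. j \<in> {1..card D} \<and> x \<in> enumeration (subset_less \<nu>) D ! (j - 1)) else 0)"

text \<open>The sets \<open>D\<^sub>\<alpha>\<close> for \<open>\<alpha>\<close> in \<open>M\<close> of index \<open>i\<close>. Each \<open>D\<^sub>\<alpha>\<close> is the collection of fibres of \<open>\<alpha>\<close> over
  nonzero points, so the result depends on \<open>\<nu>\<close> only through its sum \<open>r\<close>.\<close>

definition DMsets :: "tmap set \<Rightarrow> nat \<Rightarrow> nat list \<Rightarrow> nat set set set" where
  "DMsets M i \<nu> = {D \<in> Dsets i (sum_list \<nu>). \<exists>\<alpha>\<in>M. map_index \<alpha> = i \<and>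
     (\<exists>C\<in>Csets i (sum_list \<nu>). \<exists>\<sigma>. \<sigma> permutes {1..i} \<and> \<alpha> = phi C \<circ> \<sigma> \<circ> psi \<nu> D)}"

definition C_orbits :: "nat \<Rightarrow> nat list \<Rightarrow> nat set set set" where
  "C_orbits i \<mu> = (\<lambda>C. {\<rho> ` C | \<rho>. \<rho> \<in> young \<mu>}) ` Csets i (sum_list \<mu>)"

definition D_orbits :: "tmap set \<Rightarrow> nat \<Rightarrow> nat list \<Rightarrow> nat set set set set" where
  "D_orbits M i \<nu> = (\<lambda>D. {(\<lambda>d. \<pi> -` d) ` D | \<pi>. \<pi> \<in> young \<nu>}) ` DMsets M i \<nu>"

text \<open>The compositions \<open>\<mu>(C)\<close> and \<open>\<nu>(D)\<close>, and their common values on orbits.\<close>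

definition C_comp :: "nat list \<Rightarrow> nat set \<Rightarrow> nat list" where
  "C_comp \<mu> C = map (\<lambda>j. card (block \<mu> j \<inter> C)) [1..<Suc (length \<mu>)]"

definition D_comp :: "nat list \<Rightarrow> nat set set \<Rightarrow> nat list" where
  "D_comp \<nu> D = map (\<lambda>Q. card (D \<inter> Q)) (subset_orbits \<nu>)"

definition C_orbit_comp :: "nat list \<Rightarrow> nat set set \<Rightarrow> nat list" where
  "C_orbit_comp \<mu> Q = the_elem (C_comp \<mu> ` Q)"

definition D_orbit_comp :: "nat list \<Rightarrow> nat set set set \<Rightarrow> nat list" where
  "D_orbit_comp \<nu> Q = the_elem (D_comp \<nu> ` Q)"


section \<open>Partitions and tableaux\<close>

definition partitions :: "nat \<Rightarrow> nat list set" where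
  "partitions i = {lam. sorted_wrt (\<ge>) lam \<and> 0 \<notin> set lam \<and> sum_list lam = i}"

definition dominates :: "nat list \<Rightarrow> nat list \<Rightarrow> bool" where
  "dominates lam \<mu> \<longleftrightarrow> (\<forall>k. sum_list (take k \<mu>) \<le> sum_list (take k lam))"

definition Lambda :: "tmap set \<Rightarrow> nat list set" where
  "Lambda M = (\<Union>i\<in>map_index ` M. partitions i)"

definition Lambda_gt :: "nat list \<Rightarrow> nat list \<Rightarrow> bool" where
  "Lambda_gt lam \<mu> \<longleftrightarrow> lam \<noteq> \<mu> \<and>
     (sum_list lam < sum_list \<mu> \<or> sum_list lam = sum_list \<mu> \<and> dominates lam \<mu>)"

text \<open>A tableau is the list of its rows.\<close>

type_synonym tableau = "nat list list"

definition column_strict :: "tableau \<Rightarrow> bool" where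
  "column_strict t \<longleftrightarrow>
     (\<forall>i j. Suc i < length t \<and> j < length (t ! Suc i) \<longrightarrow> t ! i ! j < t ! Suc i ! j)"

definition standard_tableaux :: "nat list \<Rightarrow> tableau set" where
  "standard_tableaux lam = {t. map length t = lam \<and> distinct (concat t) \<and> set (concat t) = {1..sum_list lam} \<and>
     (\<forall>row\<in>set t. sorted_wrt (<) row) \<and> column_strict t}"

definition semistandard_tableaux :: "nat list \<Rightarrow> nat list \<Rightarrow> tableau set" where
  "semistandard_tableaux lam \<kappa> = {t. map length t = lam \<and>
     (\<forall>j. count_list (concat t) j = (if j \<in> {1..length \<kappa>} then \<kappa> ! (j - 1) else 0)) \<and>
     (\<forall>row\<in>set t. sorted_wrt (\<le>) row) \<and> column_strict t}"

definition standard_of_type :: "nat list \<Rightarrow> nat list \<Rightarrow> tableau \<Rightarrow> tableau set" where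
  "standard_of_type lam \<kappa> S = {s \<in> standard_tableaux lam. map (map (block_number \<kappa>)) s = S}"

text \<open>The rows of the row-reading tableau are the blocks of its shape.\<close>

definition row_reading :: "nat list \<Rightarrow> tableau" where
  "row_reading lam = map (\<lambda>j. sorted_list_of_set (block lam j)) [1..<Suc (length lam)]"

definition tab_perm :: "nat list \<Rightarrow> tableau \<Rightarrow> nat \<Rightarrow> nat" where
  "tab_perm lam s = (THE d. d permutes {1..sum_list lam} \<and> map (map d) (row_reading lam) = s)"


section \<open>The cell basis\<close>

definition murphy :: "nat list \<Rightarrow> tableau \<Rightarrow> tableau \<Rightarrow> (tmap \<Rightarrow>\<^sub>0 int)" where
  "murphy lam s t = Poly_Mapping.single (tab_perm lam s) 1 \<star> (\<Sum>\<sigma>\<in>young lam. Poly_Mapping.single \<sigma> 1)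
     \<star> Poly_Mapping.single (inv (tab_perm lam t)) 1"

definition murphy_sum :: "nat list \<Rightarrow> nat list \<Rightarrow> tableau \<Rightarrow> nat list \<Rightarrow> tableau \<Rightarrow> (tmap \<Rightarrow>\<^sub>0 int)" where
  "murphy_sum lam \<kappa> S \<kappa>' T =
     (\<Sum>s\<in>standard_of_type lam \<kappa> S. \<Sum>t\<in>standard_of_type lam \<kappa>' T. murphy lam s t)"

type_synonym lkey = "nat list \<times> nat set set \<times> tableau"
type_synonym rkey = "nat list \<times> nat set set set \<times> tableau"

definition Lset :: "nat \<Rightarrow> nat \<Rightarrow> nat list \<Rightarrow> lkey set" where
  "Lset r n lam = {(\<mu>, Q, S). \<mu> \<in> compositions r n \<and> Q \<in> C_orbits (sum_list lam) \<mu> \<and>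
     S \<in> semistandard_tableaux lam (C_orbit_comp \<mu> Q)}"

definition Rset :: "tmap set \<Rightarrow> nat \<Rightarrow> nat \<Rightarrow> nat list \<Rightarrow> rkey set" where
  "Rset M r n lam = {(\<nu>, Q, T). \<nu> \<in> compositions r n \<and> Q \<in> D_orbits M (sum_list lam) \<nu> \<and>
     T \<in> semistandard_tableaux lam (D_orbit_comp \<nu> Q)}"

fun cell_elt :: "tmap set \<Rightarrow> nat list \<Rightarrow> lkey \<Rightarrow> rkey \<Rightarrow> (bkey \<Rightarrow>\<^sub>0 'k::comm_ring_1)" where
  "cell_elt M lam (\<mu>, Q, S) (\<nu>, Q', T) = embed M \<mu> \<nu>
     (\<Sum>C\<in>Q. \<Sum>D\<in>Q'. Poly_Mapping.single (phi C) 1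
        \<star> murphy_sum lam (C_orbit_comp \<mu> Q) S (D_orbit_comp \<nu> Q') T
        \<star> Poly_Mapping.single (psi \<nu> D) 1)"


section \<open>The bracket of a cell algebra\<close>

text \<open>The data of a cell algebra: scalar multiplication, product, index poset \<open>\<Lambda>\<close> with strict order
  \<open>gt \<mu> lam\<close> (\<open>\<mu> > lam\<close>), and the basis \<open>C lam s t\<close> for \<open>s \<in> L lam\<close>, \<open>t \<in> R lam\<close>. The axioms of a cell algebra,
  which make \<open>bracket\<close> well defined, are not part of the locale.\<close>

locale cell_data =
  fixes smult :: "'k::field \<Rightarrow> 'a::ab_group_add \<Rightarrow> 'a"
    and mult :: "'a \<Rightarrow> 'a \<Rightarrow> 'a"
    and \<Lambda> :: "'i set"
    and gt :: "'i \<Rightarrow> 'i \<Rightarrow> bool"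
    and L :: "'i \<Rightarrow> 'l set"
    and R :: "'i \<Rightarrow> 'r set"
    and C :: "'i \<Rightarrow> 'l \<Rightarrow> 'r \<Rightarrow> 'a"
begin

definition upper :: "'i \<Rightarrow> 'a set" where
  "upper lam = module.span smult {C \<mu> s t | \<mu> s t. \<mu> \<in> \<Lambda> \<and> gt \<mu> lam \<and> s \<in> L \<mu> \<and> t \<in> R \<mu>}"

definition bracket :: "'i \<Rightarrow> 'r \<Rightarrow> 'l \<Rightarrow> 'k" where
  "bracket lam t s = (THE c. \<forall>s'\<in>L lam. \<forall>t'\<in>R lam.
     mult (C lam s' t) (C lam s t') - smult c (C lam s' t') \<in> upper lam)"

definition Lambda0 :: "'i set" where
  "Lambda0 = {lam \<in> \<Lambda>. \<exists>s\<in>L lam. \<exists>t\<in>R lam. bracket lam t s \<noteq> 0}"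

end

definition SL_Lambda0 :: "'k::field itself \<Rightarrow> tmap set \<Rightarrow> nat \<Rightarrow> nat \<Rightarrow> nat list set" where
  "SL_Lambda0 _ M r n = cell_data.Lambda0 (scale :: 'k \<Rightarrow> _) (SL_mult M)
     (Lambda M) Lambda_gt (Lset r n) (Rset M r n) (cell_elt M)"

definition Lambda_Lp :: "nat \<Rightarrow> nat \<Rightarrow> nat list set" where
  "Lambda_Lp p r =
     {lam \<in> Lambda (full_transf r). \<exists>j<length lam. \<not> p dvd lam ! j} \<union> partitions r"

end

theory Submission
  imports Defs "HOL-Library.FuncSet" "HOL-Library.Multiset" "HOL-Computational_Algebra.Primes"
begin

text \<open>
  An element of index \<open>i\<close> is determined up to its double coset by the pairs (block of an image point,
  orbit of the fibre over it), so the part of index \<open>i\<close> becomes the space of \<open>\<SS>\<^sub>i\<close>-invariant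
  matrices whose rows and columns are words of length \<open>i\<close>, and a cell element is a product of
  two such 0/1-matrices \<open>X\<^sub>S\<close> (transposed) and \<open>X\<^sub>T\<close>. Up to lower index, the product of two cell
  elements with inner tableaux \<open>T\<close>, \<open>S\<close> inserts between the outer factors a matrix \<open>\<Theta>\<close> that counts sections
  of embeddings \<open>{1..i} \<rightarrow> {1..r}\<close>. Both weights of \<open>\<Theta>\<close> are the shape, so modulo dominating shapes it is a
  multiple of the identity of that weight space, the bracket, and the column antisymmetriser of the
  diagram reads off this scalar.

  If \<open>i < r\<close> and \<open>p\<close> divides all parts, rotating each row cyclically in segments of length \<open>p\<close> permutes the
  terms of the scalar, and the fixed terms are divisible by \<open>p\<close> because the rotation has no fixed point among the
  possible values of a section at a point outside the embedding; so the bracket vanishes. Conversely, when the \<open>r - i\<close>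
  surplus points form a block of their own and are all mapped to one point of row \<open>j\<close>, the bracket is the number of
  points of that row, and it is \<open>1\<close> when there are no surplus points.
\<close>

text \<open>The axioms of a cell algebra are not at hand, so what makes the bracket well defined is
  proved directly, over the integers. Spanning is a straightening argument. This is a Garnir
  relation, and all its other terms increase a bounded weighted sum. Column strictness is phrased by
  counting because then it makes sense for words, independently of the order of positions. Instead
  of linear independence of the whole basis, one functional for each shape suffices: the signed sum
  over the column group kills everything of larger shape or smaller index and takes the value 1 on
  one cell element, which stays nonzero in every characteristic. The divisions in the product cause
  no trouble because products are only computed modulo smaller index: in top index the quotient
  turns out to be a count, and below it any value is absorbed.\<close>

abbreviation (input) "lookup \<equiv> Poly_Mapping.lookup"
abbreviation (input) "keys \<equiv> Poly_Mapping.keys"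
abbreviation (input) "single \<equiv> Poly_Mapping.single"

lemma bij_betw_same_label_counts:
  assumes "finite X" "finite X'"
    and counts: "\<And>l. card {x\<in>X. h x = l} = card {x\<in>X'. h' x = l}"
  obtains g where "bij_betw g X X'" "\<And>x. x \<in> X \<Longrightarrow> h' (g x) = h x"
proof -
  have "\<exists>g. bij_betw g {x\<in>X. h x = l} {x\<in>X'. h' x = l}" for l
    using assms by (intro finite_same_card_bij) auto
  then obtain G where G: "\<And>l. bij_betw (G l) {x\<in>X. h x = l} {x\<in>X'. h' x = l}"
    by metis
  define g where "g x = G (h x) x" for x
  have mem: "g x \<in> X' \<and> h' (g x) = h x" if "x \<in> X" for x
    using bij_betwE[OF G[of "h x"]] that by (auto simp: g_def)
  have "inj_on g X"
  proof (rule inj_onI)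
    fix x y assume xy: "x \<in> X" "y \<in> X" "g x = g y"
    then have "h x = h y" using mem by metis
    then show "x = y" using xy bij_betw_imp_inj_on[OF G[of "h x"]]
      by (auto simp: g_def inj_on_def)
  qed
  moreover have "X' \<subseteq> g ` X"
  proof
    fix y assume "y \<in> X'"
    then have "y \<in> G (h' y) ` {x\<in>X. h x = h' y}"
      using bij_betw_imp_surj_on[OF G[of "h' y"]] by auto
    then obtain x where "x \<in> X" "h x = h' y" "y = G (h' y) x" by auto
    then show "y \<in> g ` X" by (intro image_eqI[of _ _ x]) (auto simp: g_def)
  qed
  ultimately have "bij_betw g X X'" using mem by (auto simp: bij_betw_def)
  then show thesis by (rule that) (simp add: mem)
qed

lemma bij_betw_permutes_extend:
  assumes "bij_betw g A A"
  shows "(\<lambda>x. if x \<in> A then g x else x) permutes A"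
proof (rule bij_imp_permutes)
  show "bij_betw (\<lambda>x. if x \<in> A then g x else x) A A"
    using assms by (simp cong: bij_betw_cong)
qed auto

lemma ball_permutes:
  assumes "\<sigma> permutes A"
  shows "(\<forall>x\<in>A. P (\<sigma> x)) \<longleftrightarrow> (\<forall>x\<in>A. P x)"
proof -
  have "(\<forall>x\<in>A. P (\<sigma> x)) \<longleftrightarrow> (\<forall>x\<in>\<sigma> ` A. P x)" by simp
  then show ?thesis by (simp only: permutes_image[OF assms])
qed

lemma card_permutes_Collect:
  assumes "\<sigma> permutes A"
  shows "card {x\<in>A. P (\<sigma> x)} = card {x\<in>A. P x}"
proof -
  have "\<sigma> ` {x\<in>A. P (\<sigma> x)} = {x\<in>\<sigma> ` A. P x}" by auto
  then have "\<sigma> ` {x\<in>A. P (\<sigma> x)} = {x\<in>A. P x}" by (simp only: permutes_image[OF assms])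
  then show ?thesis
    using card_image[OF permutes_inj_on[OF assms, of "{x\<in>A. P (\<sigma> x)}"]] by metis
qed

section \<open>The Schur algebra as an algebra of invariant matrices on words\<close>

text \<open>Positions \<open>I\<close> and an alphabet of size \<open>K\<close>. One alphabet serves
  for row words, whose letters number rows from 0, and for label words, whose letters number blocks
  and orbits from 1. Since \<open>cont\<close>, \<open>ps\<close>, \<open>xi\<close> and
  \<open>semistd\<close> do not depend on \<open>K\<close>, they are exported with \<open>I\<close>
  as their only locale parameter.\<close>

locale words =
  fixes I :: "nat set" and K :: nat
  assumes finite_I [simp]: "finite I"
begin

definition F :: "(nat \<Rightarrow> nat) set" where "F = I \<rightarrow>\<^sub>E {..<K}"

text \<open>The contingency table of two words, a complete invariant of the pair under simultaneous
  permutation of positions (\<open>cont_eqE\<close>).\<close>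

definition cont :: "(nat \<Rightarrow> nat) \<Rightarrow> (nat \<Rightarrow> nat) \<Rightarrow> nat \<Rightarrow> nat \<Rightarrow> nat" where
  "cont a b = (\<lambda>k l. card {x\<in>I. a x = k \<and> b x = l})"

text \<open>Partial sums of the weight of a word. The pointwise order on them is the dominance
  order, so \<open>w < ps \<rho>\<close> below always means strict dominance.\<close>

definition ps :: "(nat \<Rightarrow> nat) \<Rightarrow> nat \<Rightarrow> nat" where
  "ps a = (\<lambda>q. card {x\<in>I. a x < q})"

definition mm :: "((nat \<Rightarrow> nat) \<Rightarrow> (nat \<Rightarrow> nat) \<Rightarrow> int) \<Rightarrow> ((nat \<Rightarrow> nat) \<Rightarrow> (nat \<Rightarrow> nat) \<Rightarrow> int)
    \<Rightarrow> (nat \<Rightarrow> nat) \<Rightarrow> (nat \<Rightarrow> nat) \<Rightarrow> int" where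
  "mm f g a b = (\<Sum>\<rho>\<in>F. f a \<rho> * g \<rho> b)"

definition tr :: "((nat \<Rightarrow> nat) \<Rightarrow> (nat \<Rightarrow> nat) \<Rightarrow> int) \<Rightarrow> (nat \<Rightarrow> nat) \<Rightarrow> (nat \<Rightarrow> nat) \<Rightarrow> int" where
  "tr f a b = f b a"

definition Inv :: "((nat \<Rightarrow> nat) \<Rightarrow> (nat \<Rightarrow> nat) \<Rightarrow> int) \<Rightarrow> bool" where
  "Inv f \<longleftrightarrow> (\<forall>\<sigma> a b. \<sigma> permutes I \<longrightarrow> a \<in> F \<longrightarrow> b \<in> F \<longrightarrow> f (a \<circ> \<sigma>) (b \<circ> \<sigma>) = f a b)"

text \<open>Schur's basis of the Schur algebra: the indicator of one orbit of the symmetric group on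
  pairs of words.\<close>

definition xi :: "(nat \<Rightarrow> nat \<Rightarrow> nat) \<Rightarrow> (nat \<Rightarrow> nat) \<Rightarrow> (nat \<Rightarrow> nat) \<Rightarrow> int" where
  "xi N a b = of_bool (cont a b = N)"

text \<open>The additive span, up to equality on words.\<close>

inductive_set lin :: "((nat \<Rightarrow> nat) \<Rightarrow> (nat \<Rightarrow> nat) \<Rightarrow> int) set \<Rightarrow> ((nat \<Rightarrow> nat) \<Rightarrow> (nat \<Rightarrow> nat) \<Rightarrow> int) set"
  for G where
  zero: "(\<lambda>a b. 0) \<in> lin G"
| gen: "g \<in> G \<Longrightarrow> g \<in> lin G"
| comb: "f \<in> lin G \<Longrightarrow> g \<in> lin G \<Longrightarrow> (\<lambda>a b. c * f a b + g a b) \<in> lin G"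
| eqv: "f \<in> lin G \<Longrightarrow> (\<And>a b. a \<in> F \<Longrightarrow> b \<in> F \<Longrightarrow> f a b = g a b) \<Longrightarrow> g \<in> lin G"

text \<open>The span \<open>J w\<close> of these products plays the role of the cell elements of shape strictly dominating \<open>w\<close>.\<close>

definition through :: "(nat \<Rightarrow> nat) \<Rightarrow> ((nat \<Rightarrow> nat) \<Rightarrow> (nat \<Rightarrow> nat) \<Rightarrow> int) set" where
  "through w = {mm f g | f g. Inv f \<and> Inv g \<and>
     (\<forall>a\<in>F. \<forall>\<rho>\<in>F. \<forall>b\<in>F. f a \<rho> \<noteq> 0 \<longrightarrow> g \<rho> b \<noteq> 0 \<longrightarrow> w < ps \<rho>)}"

definition J :: "(nat \<Rightarrow> nat) \<Rightarrow> ((nat \<Rightarrow> nat) \<Rightarrow> (nat \<Rightarrow> nat) \<Rightarrow> int) set" where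
  "J w = lin (through w)"

text \<open>If \<open>\<rho>\<close> gives the rows and \<open>b\<close> the entries of a tableau with weakly increasing rows, this is strictness of
  the columns, expressed by counting.\<close>

definition semistd :: "(nat \<Rightarrow> nat) \<Rightarrow> (nat \<Rightarrow> nat) \<Rightarrow> bool" where
  "semistd \<rho> b \<longleftrightarrow> (\<forall>k v. card {x\<in>I. \<rho> x = Suc k \<and> b x \<le> v} \<le> card {x\<in>I. \<rho> x = k \<and> b x < v})"

lemma finite_F [simp]: "finite F"
  by (auto simp: F_def intro!: finite_PiE)

lemma F_less: "a \<in> F \<Longrightarrow> x \<in> I \<Longrightarrow> a x < K"
  by (auto simp: F_def)

lemma F_comp:
  assumes "a \<in> F" "\<sigma> permutes I"
  shows "a \<circ> \<sigma> \<in> F"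
  unfolding F_def
proof (rule PiE_I)
  fix x assume "x \<in> I"
  then have "\<sigma> x \<in> I" by (simp only: permutes_in_image[OF assms(2)])
  from F_less[OF assms(1) this] show "(a \<circ> \<sigma>) x \<in> {..<K}" by simp
next
  fix x assume "x \<notin> I"
  then have "(a \<circ> \<sigma>) x = a x" using permutes_not_in[OF assms(2) \<open>x \<notin> I\<close>] by simp
  then show "(a \<circ> \<sigma>) x = undefined"
    using assms(1) \<open>x \<notin> I\<close> unfolding F_def by (metis PiE_arb)
qed

lemma F_comp_bij: "\<sigma> permutes I \<Longrightarrow> bij_betw (\<lambda>a. a \<circ> \<sigma>) F F"
  by (rule bij_betwI[where g = "\<lambda>a. a \<circ> inv \<sigma>"])
     (auto simp: F_comp permutes_inv o_assoc[symmetric] permutes_inv_o)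

lemma F_eqI: "a \<in> F \<Longrightarrow> b \<in> F \<Longrightarrow> (\<And>x. x \<in> I \<Longrightarrow> a x = b x) \<Longrightarrow> a = b"
  unfolding F_def by (rule PiE_ext)

lemma sum_F_comp:
  assumes "\<sigma> permutes I"
  shows "(\<Sum>a\<in>F. h (a \<circ> \<sigma>)) = (\<Sum>a\<in>F. h a)"
  using sum.reindex_bij_betw[OF F_comp_bij[OF assms]] by auto

lemma cont_comp: "\<sigma> permutes I \<Longrightarrow> cont (a \<circ> \<sigma>) (b \<circ> \<sigma>) = cont a b"
  unfolding cont_def comp_apply
  by (intro ext card_permutes_Collect[where P = "\<lambda>x. a x = k \<and> b x = l" for k l])

lemma ps_comp: "\<sigma> permutes I \<Longrightarrow> ps (a \<circ> \<sigma>) = ps a"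
  unfolding ps_def comp_apply
  by (intro ext card_permutes_Collect[where P = "\<lambda>x. a x < q" for q])

lemma cont_eqE:
  assumes "cont a b = cont a' b'" "a \<in> F" "b \<in> F" "a' \<in> F" "b' \<in> F"
  obtains \<sigma> where "\<sigma> permutes I" "a = a' \<circ> \<sigma>" "b = b' \<circ> \<sigma>"
proof -
  have c: "card {x\<in>I. a x = k \<and> b x = l} = card {x\<in>I. a' x = k \<and> b' x = l}" for k l
    using assms(1) by (auto simp: cont_def fun_eq_iff)
  have "card {x\<in>I. (a x, b x) = p} = card {x\<in>I. (a' x, b' x) = p}" for p
    using c[of "fst p" "snd p"] by (simp add: prod_eq_iff)
  then obtain g where g: "bij_betw g I I" "\<And>x. x \<in> I \<Longrightarrow> (a' (g x), b' (g x)) = (a x, b x)"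
    using bij_betw_same_label_counts[of "I" "I" "\<lambda>x. (a x, b x)" "\<lambda>x. (a' x, b' x)"] by auto
  define \<sigma> where "\<sigma> x = (if x \<in> I then g x else x)" for x
  have s: "\<sigma> permutes I" unfolding \<sigma>_def using bij_betw_permutes_extend[OF g(1)] .
  show thesis
  proof
    show "\<sigma> permutes I" by (fact s)
    show "a = a' \<circ> \<sigma>" using g(2) assms by (intro F_eqI F_comp s) (auto simp: \<sigma>_def)
    show "b = b' \<circ> \<sigma>" using g(2) assms by (intro F_eqI F_comp s) (auto simp: \<sigma>_def)
  qed
qed

lemma Inv_cont_eq:
  assumes "Inv f" "cont a b = cont a' b'" "a \<in> F" "b \<in> F" "a' \<in> F" "b' \<in> F"
  shows "f a b = f a' b'"
  using cont_eqE[OF assms(2-6)] assms by (metis Inv_def)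

lemma cont_imp_ps_left:
  assumes "cont a b = cont a' b'" "a \<in> F" "b \<in> F" "a' \<in> F" "b' \<in> F"
  shows "ps a = ps a'" "ps b = ps b'"
  using cont_eqE[OF assms] by (metis ps_comp)+

lemma Inv_xi [simp]: "Inv (xi N)"
  by (auto simp: Inv_def xi_def cont_comp)

lemma Inv_tr: "Inv f \<Longrightarrow> Inv (tr f)"
  by (auto simp: Inv_def tr_def)

lemma Inv_mm: "Inv f \<Longrightarrow> Inv g \<Longrightarrow> Inv (mm f g)"
  unfolding Inv_def
proof (intro allI impI)
  fix \<sigma> a b
  assume f: "\<forall>\<sigma> a b. \<sigma> permutes I \<longrightarrow> a \<in> F \<longrightarrow> b \<in> F \<longrightarrow> f (a \<circ> \<sigma>) (b \<circ> \<sigma>) = f a b"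
    and g: "\<forall>\<sigma> a b. \<sigma> permutes I \<longrightarrow> a \<in> F \<longrightarrow> b \<in> F \<longrightarrow> g (a \<circ> \<sigma>) (b \<circ> \<sigma>) = g a b"
    and s: "\<sigma> permutes I" and "a \<in> F" "b \<in> F"
  have "mm f g (a \<circ> \<sigma>) (b \<circ> \<sigma>) = (\<Sum>\<rho>\<in>F. f (a \<circ> \<sigma>) (\<rho> \<circ> \<sigma>) * g (\<rho> \<circ> \<sigma>) (b \<circ> \<sigma>))"
    unfolding mm_def by (rule sum_F_comp[OF s, symmetric])
  also have "\<dots> = mm f g a b"
    unfolding mm_def using f g s \<open>a \<in> F\<close> \<open>b \<in> F\<close> by (intro sum.cong) auto
  finally show "mm f g (a \<circ> \<sigma>) (b \<circ> \<sigma>) = mm f g a b" .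
qed

lemma Inv_comb: "Inv f \<Longrightarrow> Inv g \<Longrightarrow> Inv (\<lambda>a b. c * f a b + g a b)"
  by (simp add: Inv_def)

lemma mm_assoc: "mm (mm f g) h = mm f (mm g h)"
proof (intro ext)
  fix a b
  have "mm (mm f g) h a b = (\<Sum>\<rho>'\<in>F. \<Sum>\<rho>\<in>F. f a \<rho> * g \<rho> \<rho>' * h \<rho>' b)"
    by (simp add: mm_def sum_distrib_right)
  also have "\<dots> = (\<Sum>\<rho>\<in>F. \<Sum>\<rho>'\<in>F. f a \<rho> * g \<rho> \<rho>' * h \<rho>' b)" by (rule sum.swap)
  also have "\<dots> = mm f (mm g h) a b"
    by (simp add: mm_def sum_distrib_left mult.assoc)
  finally show "mm (mm f g) h a b = mm f (mm g h) a b" .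
qed

lemma tr_mm: "tr (mm f g) = mm (tr g) (tr f)"
  by (auto simp: fun_eq_iff tr_def mm_def mult.commute)

lemma tr_tr [simp]: "tr (tr f) = f"
  by (simp add: tr_def fun_eq_iff)

lemma mm_comb_left: "mm (\<lambda>a b. c * f a b + g a b) h = (\<lambda>a b. c * mm f h a b + mm g h a b)"
  by (auto simp: fun_eq_iff mm_def sum.distrib sum_distrib_left algebra_simps)

lemma mm_comb_right: "mm h (\<lambda>a b. c * f a b + g a b) = (\<lambda>a b. c * mm h f a b + mm h g a b)"
  by (auto simp: fun_eq_iff mm_def sum.distrib sum_distrib_left algebra_simps)

lemma mm_cong: "(\<And>a \<rho>. a \<in> F \<Longrightarrow> \<rho> \<in> F \<Longrightarrow> f a \<rho> = f' a \<rho>) \<Longrightarrow> (\<And>\<rho> b. \<rho> \<in> F \<Longrightarrow> b \<in> F \<Longrightarrow> g \<rho> b = g' \<rho> b)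
  \<Longrightarrow> a \<in> F \<Longrightarrow> b \<in> F \<Longrightarrow> mm f g a b = mm f' g' a b"
  by (auto simp: mm_def intro!: sum.cong)

lemma lin_add: "f \<in> lin G \<Longrightarrow> g \<in> lin G \<Longrightarrow> (\<lambda>a b. f a b + g a b) \<in> lin G"
  using lin.comb[of f G g 1] by simp

lemma lin_sum: "(\<And>j. j \<in> A \<Longrightarrow> f j \<in> lin G) \<Longrightarrow> (\<lambda>a b. \<Sum>j\<in>A. c j * f j a b) \<in> lin G"
  by (induction A rule: infinite_finite_induct) (auto intro: lin.zero lin.comb)

lemma lin_mono:
  assumes "f \<in> lin G" "G \<subseteq> lin H"
  shows "f \<in> lin H"
  using assms by (induction rule: lin.induct) (auto intro: lin.intros)

lemma lin_image:
  assumes "f \<in> lin G"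
    and "\<And>g. g \<in> G \<Longrightarrow> \<phi> g \<in> lin H"
    and "\<And>c f g. \<phi> (\<lambda>a b. c * f a b + g a b) = (\<lambda>a b. c * \<phi> f a b + \<phi> g a b)"
    and "\<And>f g. (\<And>a b. a \<in> F \<Longrightarrow> b \<in> F \<Longrightarrow> f a b = g a b) \<Longrightarrow> (\<And>a b. a \<in> F \<Longrightarrow> b \<in> F \<Longrightarrow> \<phi> f a b = \<phi> g a b)"
  shows "\<phi> f \<in> lin H"
  using assms(1)
proof (induction rule: lin.induct)
  case zero
  \<comment> \<open>Linearity at \<open>c = -1\<close> with both matrices zero gives \<phi> 0 = -
    \<phi> 0 + \<phi> 0.\<close>
  have "\<phi> (\<lambda>a b. 0) = (\<lambda>a b. 0)"
    using assms(3)[of "-1" "\<lambda>a b. 0" "\<lambda>a b. 0"] by (simp add: fun_eq_iff)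
  then show ?case by (simp add: lin.zero)
next
  case (eqv f g)
  then show ?case by (intro lin.eqv[OF eqv.IH]) (rule assms(4))
qed (auto simp: assms intro: lin.intros)

lemma lin_insertE:
  assumes "f \<in> lin (insert g (lin G))"
  obtains c where "(\<lambda>a b. f a b - c * g a b) \<in> lin G"
proof -
  have "\<exists>c. (\<lambda>a b. f a b - c * g a b) \<in> lin G"
    using assms
  proof (induction rule: lin.induct)
    case zero
    then show ?case by (intro exI[of _ 0]) (simp add: lin.zero)
  next
    case (gen h)
    then show ?case
    proof
      assume "h = g" then show ?thesis by (intro exI[of _ 1]) (simp add: lin.zero)
    next
      assume "h \<in> lin G" then show ?thesis by (intro exI[of _ 0]) simp
    qed
  next
    case (comb f1 f2 c)
    then obtain c1 c2 where "(\<lambda>a b. f1 a b - c1 * g a b) \<in> lin G" "(\<lambda>a b. f2 a b - c2 * g a b) \<in> lin G"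
      by blast
    from lin.comb[OF this, of c] show ?case
      by (intro exI[of _ "c * c1 + c2"]) (simp add: algebra_simps)
  next
    case (eqv f1 f2)
    then obtain c where "(\<lambda>a b. f1 a b - c * g a b) \<in> lin G" by blast
    then show ?case by (intro exI[of _ c], rule lin.eqv) (simp add: eqv.hyps)
  qed
  then show thesis using that by blast
qed

text \<open>An invariant matrix is constant on orbits of pairs. Only tables at which
  \<open>f\<close> is nonzero enter, so conditions on the support of \<open>f\<close> pass to the
  generators.\<close>

lemma Inv_expand:
  assumes "Inv f" "\<And>N. (\<exists>a\<in>F. \<exists>b\<in>F. cont a b = N \<and> f a b \<noteq> 0) \<Longrightarrow> xi N \<in> lin G"
  shows "f \<in> lin G"
proof -
  define Ns where "Ns = (\<lambda>(a, b). cont a b) ` (F \<times> F)"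
  define v where "v N = (SOME z. \<exists>a\<in>F. \<exists>b\<in>F. cont a b = N \<and> f a b = z)" for N
  have v: "v (cont a b) = f a b" if "a \<in> F" "b \<in> F" for a b
  proof -
    have "\<exists>a'\<in>F. \<exists>b'\<in>F. cont a' b' = cont a b \<and> f a' b' = v (cont a b)"
      unfolding v_def by (rule someI[of _ "f a b"]) (use that in blast)
    then obtain a' b' where ab: "a' \<in> F" "b' \<in> F" "cont a' b' = cont a b" "f a' b' = v (cont a b)"
      by blast
    show ?thesis using Inv_cont_eq[OF assms(1) ab(3,1,2) that] ab(4) by simp
  qed
  have "(\<lambda>a b. \<Sum>N\<in>{N\<in>Ns. v N \<noteq> 0}. v N * xi N a b) \<in> lin G"
    by (intro lin_sum assms(2)) (auto simp: Ns_def v, blast)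
  then show ?thesis
  proof (rule lin.eqv)
    fix a b assume ab: "a \<in> F" "b \<in> F"
    have "(\<Sum>N\<in>{N\<in>Ns. v N \<noteq> 0}. v N * xi N a b) = (\<Sum>N\<in>Ns. v N * xi N a b)"
      by (rule sum.mono_neutral_left) (auto simp: Ns_def)
    also have "\<dots> = (\<Sum>N\<in>Ns. if N = cont a b then v N else 0)"
      by (intro sum.cong) (auto simp: xi_def)
    also have "\<dots> = f a b" using ab by (subst sum.delta) (auto simp: Ns_def v)
    finally show "(\<Sum>N\<in>{N\<in>Ns. v N \<noteq> 0}. v N * xi N a b) = f a b" .
  qed
qed

lemma throughI:
  assumes "Inv f" "Inv g"
    and "\<And>a \<rho> b. a \<in> F \<Longrightarrow> \<rho> \<in> F \<Longrightarrow> b \<in> F \<Longrightarrow> f a \<rho> \<noteq> 0 \<Longrightarrow> g \<rho> b \<noteq> 0 \<Longrightarrow> w < ps \<rho>"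
  shows "mm f g \<in> through w"
  unfolding through_def mem_Collect_eq
  by (intro exI[of _ f] exI[of _ g] conjI refl assms(1,2) ballI impI assms(3))

lemma throughE:
  assumes "h \<in> through w"
  obtains f g where "h = mm f g" "Inv f" "Inv g"
    "\<forall>a\<in>F. \<forall>\<rho>\<in>F. \<forall>b\<in>F. f a \<rho> \<noteq> 0 \<longrightarrow> g \<rho> b \<noteq> 0 \<longrightarrow> w < ps \<rho>"
  using assms unfolding through_def mem_Collect_eq by blast

lemma J_I:
  assumes "Inv f" "Inv g" "\<And>a \<rho> b. a \<in> F \<Longrightarrow> \<rho> \<in> F \<Longrightarrow> b \<in> F \<Longrightarrow> f a \<rho> \<noteq> 0 \<Longrightarrow> g \<rho> b \<noteq> 0 \<Longrightarrow> w < ps \<rho>"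
  shows "mm f g \<in> J w"
  unfolding J_def by (rule lin.gen, rule throughI) (fact assms)+

text \<open>The support condition in \<open>through\<close> concerns the middle word, so a further
  factor on the outside does not disturb it. With \<open>tr_J\<close> and \<open>J_mm_right\<close>
  this makes \<open>J w\<close> a two-sided ideal of the invariant matrices.\<close>

lemma J_mm_left:
  assumes "f \<in> J w" "Inv h"
  shows "mm h f \<in> J w"
  using assms(1) unfolding J_def
proof (rule lin_image)
  fix g assume "g \<in> through w"
  then obtain f1 g1 where g: "g = mm f1 g1" "Inv f1" "Inv g1"
    and s: "\<forall>a\<in>F. \<forall>\<rho>\<in>F. \<forall>b\<in>F. f1 a \<rho> \<noteq> 0 \<longrightarrow> g1 \<rho> b \<noteq> 0 \<longrightarrow> w < ps \<rho>"
    by (rule throughE)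
  have "mm (mm h f1) g1 \<in> J w"
  proof (rule J_I)
    fix a \<rho> b assume a: "a \<in> F" "\<rho> \<in> F" "b \<in> F" "mm h f1 a \<rho> \<noteq> 0" "g1 \<rho> b \<noteq> 0"
    obtain a' where "a' \<in> F" "h a a' * f1 a' \<rho> \<noteq> 0"
      using a(4) unfolding mm_def by (rule sum.not_neutral_contains_not_neutral)
    then show "w < ps \<rho>" using s a by fastforce
  qed (use g assms in \<open>auto intro: Inv_mm\<close>)
  then show "mm h g \<in> lin (through w)"
    by (simp add: g mm_assoc J_def)
qed (auto simp: mm_comb_right intro: mm_cong)

text \<open>Transposition reverses a product and keeps the middle word; it turns left-handed
  statements into right-handed ones.\<close>

lemma tr_J:
  assumes "f \<in> J w"
  shows "tr f \<in> J w"
  using assms unfolding J_def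
proof (rule lin_image)
  fix g assume "g \<in> through w"
  then obtain f1 g1 where g: "g = mm f1 g1" "Inv f1" "Inv g1"
    and s: "\<forall>a\<in>F. \<forall>\<rho>\<in>F. \<forall>b\<in>F. f1 a \<rho> \<noteq> 0 \<longrightarrow> g1 \<rho> b \<noteq> 0 \<longrightarrow> w < ps \<rho>"
    by (rule throughE)
  have "mm (tr g1) (tr f1) \<in> J w"
    by (intro J_I Inv_tr g) (use s in \<open>auto simp: tr_def\<close>)
  then show "tr g \<in> lin (through w)"
    by (simp add: g tr_mm J_def)
qed (auto simp: tr_def)

lemma J_mm_right:
  assumes "f \<in> J w" "Inv h"
  shows "mm f h \<in> J w"
  using tr_J[OF J_mm_left[OF tr_J[OF assms(1)] Inv_tr[OF assms(2)]]] by (simp add: tr_mm)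

lemma ps_le: "ps a q \<le> card I"
  unfolding ps_def using card_mono[of "I" "{x\<in>I. a x < q}"] by auto

end

lemma fun_lessI: "(\<And>q. f q \<le> g q) \<Longrightarrow> f q < g q \<Longrightarrow> f < g" for f g :: "'a \<Rightarrow> 'b::linorder"
  unfolding less_le_not_le[of f g] le_fun_def by (meson not_le)

section \<open>Entries of products and the Garnir relation\<close>

context words
begin

text \<open>Explicit products are evaluated below by exhibiting the only middle word that can
  contribute.\<close>

lemma mm_unique:
  assumes "r \<in> F" "\<And>\<rho>. \<rho> \<in> F \<Longrightarrow> f a \<rho> \<noteq> 0 \<Longrightarrow> g \<rho> b \<noteq> 0 \<Longrightarrow> \<rho> = r"
  shows "mm f g a b = f a r * g r b"
proof -
  have "mm f g a b = (\<Sum>\<rho>\<in>{r}. f a \<rho> * g \<rho> b)"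
    unfolding mm_def by (rule sum.mono_neutral_right) (use assms in auto)
  then show ?thesis by simp
qed

lemma mm_nonzeroE:
  assumes "mm f g a b \<noteq> 0"
  obtains \<rho> where "\<rho> \<in> F" "f a \<rho> \<noteq> 0" "g \<rho> b \<noteq> 0"
proof -
  obtain \<rho> where "\<rho> \<in> F" "f a \<rho> * g \<rho> b \<noteq> 0"
    using assms unfolding mm_def by (rule sum.not_neutral_contains_not_neutral)
  then show thesis using that by auto
qed

lemma card_level: "card {x\<in>I. \<rho> x = k} = ps \<rho> (Suc k) - ps \<rho> k"
proof -
  have "{x\<in>I. \<rho> x = k} = {x\<in>I. \<rho> x < Suc k} - {x\<in>I. \<rho> x < k}" by auto
  then show ?thesis unfolding ps_def by (simp add: card_Diff_subset Collect_mono_iff)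
qed

lemma ps_Suc: "ps \<rho> (Suc k) = ps \<rho> k + card {x\<in>I. \<rho> x = k}"
proof -
  have "{x\<in>I. \<rho> x < Suc k} = {x\<in>I. \<rho> x < k} \<union> {x\<in>I. \<rho> x = k}" by auto
  then show ?thesis unfolding ps_def by (simp add: card_Un_disjoint disjoint_iff)
qed

lemma ps_fullD:
  assumes "ps \<rho> u = card I" "x \<in> I"
  shows "\<rho> x < u"
proof -
  have "{x\<in>I. \<rho> x < u} = I"
    using assms(1) unfolding ps_def by (intro card_subset_eq) auto
  then show ?thesis using assms(2) by blast
qed

text \<open>In passing from \<rho> to \<rho>', some entries of the rows \<open>k\<close> and
  \<open>k + 1\<close> are parked in row \<open>u\<close>. The parked entries are the Garnir set of
  the classical argument.\<close>

definition split_row :: "nat \<Rightarrow> nat \<Rightarrow> (nat \<Rightarrow> nat) \<Rightarrow> (nat \<Rightarrow> nat) \<Rightarrow> bool" where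
  "split_row k u \<rho> \<rho>' \<longleftrightarrow> (\<forall>x\<in>I. \<rho>' x = \<rho> x \<or> \<rho>' x = u \<and> \<rho> x \<in> {k, Suc k})"

text \<open>The words \<open>\<rho>\<close> of weight \<open>w\<close> that arise from \<open>\<rho>'\<close> by distributing the letters \<open>u\<close> over the rows
  \<open>k\<close> and \<open>k + 1\<close>.\<close>

definition split_mat :: "(nat \<Rightarrow> nat) \<Rightarrow> nat \<Rightarrow> nat \<Rightarrow> nat \<Rightarrow> nat \<Rightarrow> (nat \<Rightarrow> nat) \<Rightarrow> (nat \<Rightarrow> nat) \<Rightarrow> int" where
  "split_mat w k u j z \<rho> \<rho>' = of_bool (ps \<rho> = w \<and> split_row k u \<rho> \<rho>' \<and>
     card {x\<in>I. \<rho>' x = k} = j \<and> card {x\<in>I. \<rho>' x = u} = z)"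

lemma ball_comp: "\<sigma> permutes I \<Longrightarrow> (\<forall>x\<in>I. P (a (\<sigma> x)) (b (\<sigma> x))) \<longleftrightarrow> (\<forall>x\<in>I. P (a x) (b x))"
  using ball_permutes[of \<sigma> I "\<lambda>x. P (a x) (b x)"] by simp

lemma card_comp: "\<sigma> permutes I \<Longrightarrow> card {x\<in>I. P (a (\<sigma> x))} = card {x\<in>I. P (a x)}"
  using card_permutes_Collect[of \<sigma> I "\<lambda>x. P (a x)"] by simp

lemma Inv_split_mat: "Inv (split_mat w k u j z)"
  unfolding Inv_def split_mat_def split_row_def
  by (intro allI impI) (simp only: comp_apply ps_comp card_comp[where P = "\<lambda>y. y = c" for c]
      ball_comp[where P = "\<lambda>y z. z = y \<or> z = u \<and> y \<in> {k, Suc k}"])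

text \<open>Row \<open>k\<close> has \<open>w (Suc k) - w k\<close> entries, so more than a row's
  worth of entries is parked, and gathering them in row \<open>k\<close> must raise the weight. The
  induction is on the number \<open>j\<close> of entries that \<rho>' still has in row
  \<open>k\<close>. By \<open>w u = card I\<close>, row \<open>u\<close> is empty in every word of
  weight \<open>w\<close>.\<close>

lemma split_mat_in_J:
  assumes "Suc k < u" "u < K" "w u = card I" "w (Suc k) - w k < z"
  shows "split_mat w k u j z \<in> J w"
  using assms(4)
proof (induction j arbitrary: z rule: less_induct)
  case (less j)
  show ?case
  proof (cases "j = 0")
    case True
    \<comment> \<open>When row \<open>k\<close> of \<rho>' is empty, the parked entries comprise all
      of row \<open>k\<close> of \<rho>. Calling the parking row \<open>k\<close> gives a middle
      word with \<open>z\<close> entries in row \<open>k\<close>, the additional ones taken from row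
      \<open>k + 1\<close>, and this is strictly dominating. The factor \<open>g\<close> merely
      renames \<open>k\<close> to \<open>u\<close>.\<close>
    define f where "f \<rho> \<rho>' = (of_bool (ps \<rho> = w \<and> (\<forall>x\<in>I. \<rho>' x = \<rho> x \<or> \<rho>' x = k \<and> \<rho> x = Suc k) \<and>
       card {x\<in>I. \<rho>' x = k} = z) :: int)" for \<rho> \<rho>'
    define g where "g \<rho>' \<rho> = (of_bool ((\<forall>x\<in>I. \<rho>' x = (if \<rho> x = u then k else \<rho> x)) \<and>
       card {x\<in>I. \<rho> x = k} = 0) :: int)" for \<rho>' \<rho>
    have "Inv f" unfolding Inv_def f_def
      by (intro allI impI) (simp only: comp_apply ps_comp card_comp[where P = "\<lambda>y. y = c" for c]
        ball_comp[where P = "\<lambda>y z. z = y \<or> z = k \<and> y = Suc k"])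
    moreover have "Inv g" unfolding Inv_def g_def
      by (intro allI impI) (simp only: comp_apply card_comp[where P = "\<lambda>y. y = c" for c]
        ball_comp[where P = "\<lambda>y z. y = (if z = u then k else z)"])
    moreover have "w < ps \<rho>'" if "f \<rho> \<rho>' \<noteq> 0" for \<rho> \<rho>'
    proof -
      from that have w: "ps \<rho> = w" and c: "card {x\<in>I. \<rho>' x = k} = z"
        and m: "\<And>x. x \<in> I \<Longrightarrow> \<rho>' x = \<rho> x \<or> \<rho>' x = k \<and> \<rho> x = Suc k" by (auto simp: f_def)
      have le: "ps \<rho> q \<le> ps \<rho>' q" for q
        unfolding ps_def by (rule card_mono) (auto dest: m)
      have "w (Suc k) < ps \<rho>' (Suc k)"
        using le[of k] ps_Suc[of \<rho> k] ps_Suc[of \<rho>' k] c w less.prems by auto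
      then show ?thesis using le w by (intro fun_lessI) auto
    qed
    ultimately have "mm f g \<in> J w" by (intro J_I)
    then show ?thesis unfolding J_def
    proof (rule lin.eqv)
      fix \<rho> \<rho>' assume F: "\<rho> \<in> F" "\<rho>' \<in> F"
      define r where "r = restrict (\<lambda>x. if \<rho>' x = u then k else \<rho>' x) I"
      have r: "r \<in> F" using F assms(1,2) by (auto simp: r_def F_def)
      have "mm f g \<rho> \<rho>' = f \<rho> r * g r \<rho>'"
        by (rule mm_unique[OF r]) (use r in \<open>auto simp: g_def r_def intro!: F_eqI\<close>)
      also have "\<dots> = split_mat w k u j z \<rho> \<rho>'"
      proof (cases "ps \<rho> = w \<and> card {x\<in>I. \<rho>' x = k} = 0")
        case True
        then have nk: "\<forall>x\<in>I. \<rho>' x \<noteq> k" by auto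
        have nu: "\<forall>x\<in>I. \<rho> x \<noteq> u" using ps_fullD[of \<rho> u] True assms(3) by auto
        have "{x\<in>I. r x = k} = {x\<in>I. \<rho>' x = u}" by (auto simp: r_def nk)
        moreover have "(\<forall>x\<in>I. r x = \<rho> x \<or> r x = k \<and> \<rho> x = Suc k) \<longleftrightarrow> split_row k u \<rho> \<rho>'"
          unfolding split_row_def using nk nu by (intro ball_cong) (auto simp: r_def)
        ultimately show ?thesis using True \<open>j = 0\<close>
          by (auto simp: f_def g_def split_mat_def r_def)
      qed (use \<open>j = 0\<close> in \<open>auto simp: f_def g_def split_mat_def\<close>)
      finally show "mm f g \<rho> \<rho>' = split_mat w k u j z \<rho> \<rho>'" .
    qed
  next
    case False
    \<comment> \<open>For \<open>j > 0\<close>, the relation \<open>Q\<close> allows the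
      \<open>j\<close> positions of row \<open>k\<close> in \<rho>' to lie in row \<open>k\<close>
      or \<open>k + 1\<close> of \<rho>. All such pairs arise by parking \<open>j + z\<close>
      entries and then releasing \<open>j\<close> of them into row \<open>k\<close>
      (\<open>N0\<close>). Sorted by the number j' of these positions that lie in row
      \<open>k\<close> of \<rho>, they become products with \<open>N\<close>, which moves entries
      from row \<open>k + 1\<close> to row \<open>k\<close>. The part with j' = j is the matrix
      sought, all others are covered by the induction hypothesis.\<close>
    define N where "N \<rho> \<rho>' = (of_bool (card {x\<in>I. \<rho>' x = k} = j \<and> card {x\<in>I. \<rho>' x = u} = z \<and>
       (\<forall>x\<in>I. \<rho> x = \<rho>' x \<or> \<rho> x = Suc k \<and> \<rho>' x = k)) :: int)" for \<rho> \<rho>'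
    define N0 where "N0 \<rho> \<rho>' = (of_bool (card {x\<in>I. \<rho>' x = k} = j \<and> card {x\<in>I. \<rho>' x = u} = z \<and>
       (\<forall>x\<in>I. \<rho> x = (if \<rho>' x = k then u else \<rho>' x))) :: int)" for \<rho> \<rho>'
    define Q where "Q \<rho> \<rho>' \<longleftrightarrow> card {x\<in>I. \<rho>' x = k} = j \<and> card {x\<in>I. \<rho>' x = u} = z \<and> ps \<rho> = w \<and>
      (\<forall>x\<in>I. if \<rho>' x = k then \<rho> x \<in> {k, Suc k} else \<rho>' x = \<rho> x \<or> \<rho>' x = u \<and> \<rho> x \<in> {k, Suc k})" for \<rho> \<rho>'
    have InvN: "Inv N" unfolding Inv_def N_def
      by (intro allI impI) (simp only: comp_apply card_comp[where P = "\<lambda>y. y = c" for c]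
        ball_comp[where P = "\<lambda>y z. y = z \<or> y = Suc k \<and> z = k"])
    have InvN0: "Inv N0" unfolding Inv_def N0_def
      by (intro allI impI) (simp only: comp_apply card_comp[where P = "\<lambda>y. y = c" for c]
        ball_comp[where P = "\<lambda>y z. y = (if z = k then u else z)"])
    have split: "mm (split_mat w k u j' z) N \<rho> \<rho>' =
        of_bool (Q \<rho> \<rho>' \<and> j' = card {x\<in>I. \<rho>' x = k \<and> \<rho> x = k})" if F: "\<rho> \<in> F" "\<rho>' \<in> F" for \<rho> \<rho>' j'
    proof -
      define r where "r = restrict (\<lambda>x. if \<rho>' x = k then \<rho> x else \<rho>' x) I"
      have r: "r \<in> F" using F assms(1,2) by (auto simp: r_def F_def)
      have "mm (split_mat w k u j' z) N \<rho> \<rho>' = split_mat w k u j' z \<rho> r * N r \<rho>'"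
      proof (rule mm_unique[OF r])
        fix \<rho>2 assume h: "\<rho>2 \<in> F" "split_mat w k u j' z \<rho> \<rho>2 \<noteq> 0" "N \<rho>2 \<rho>' \<noteq> 0"
        then show "\<rho>2 = r" using assms(1) r
          by (intro F_eqI) (fastforce simp: split_mat_def split_row_def N_def r_def split: if_splits)+
      qed
      also have "\<dots> = of_bool (Q \<rho> \<rho>' \<and> j' = card {x\<in>I. \<rho>' x = k \<and> \<rho> x = k})"
      proof (cases "ps \<rho> = w")
        case True
        have nu: "\<forall>x\<in>I. \<rho> x \<noteq> u" using ps_fullD[of \<rho> u] True assms(3) by auto
        have e1: "{x\<in>I. r x = k} = {x\<in>I. \<rho>' x = k \<and> \<rho> x = k}" by (auto simp: r_def)
        have e2: "{x\<in>I. r x = u} = {x\<in>I. \<rho>' x = u}" using nu assms(1) by (auto simp: r_def)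
        define A where "A \<longleftrightarrow> split_row k u \<rho> r"
        define B where "B \<longleftrightarrow> (\<forall>x\<in>I. r x = \<rho>' x \<or> r x = Suc k \<and> \<rho>' x = k)"
        define C where "C \<longleftrightarrow> (\<forall>x\<in>I. if \<rho>' x = k then \<rho> x \<in> {k, Suc k} else \<rho>' x = \<rho> x \<or> \<rho>' x = u \<and> \<rho> x \<in> {k, Suc k})"
        have "A \<and> B \<longleftrightarrow> C"
          unfolding A_def B_def C_def split_row_def ball_conj_distrib[symmetric]
          by (intro ball_cong) (auto simp: r_def)
        then show ?thesis unfolding split_mat_def N_def Q_def e1 e2 A_def[symmetric] B_def[symmetric] C_def[symmetric]
          using True by (cases A; cases B) auto
      qed (auto simp: split_mat_def Q_def)
      finally show ?thesis .
    qed
    have lhs: "mm (split_mat w k u 0 (j + z)) N0 \<rho> \<rho>' = of_bool (Q \<rho> \<rho>')" if F: "\<rho> \<in> F" "\<rho>' \<in> F" for \<rho> \<rho>'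
    proof -
      define r where "r = restrict (\<lambda>x. if \<rho>' x = k then u else \<rho>' x) I"
      have r: "r \<in> F" using F assms(1,2) by (auto simp: r_def F_def)
      have "mm (split_mat w k u 0 (j + z)) N0 \<rho> \<rho>' = split_mat w k u 0 (j + z) \<rho> r * N0 r \<rho>'"
        by (rule mm_unique[OF r]) (use r in \<open>auto simp: N0_def r_def intro!: F_eqI\<close>)
      also have "\<dots> = of_bool (Q \<rho> \<rho>')"
      proof (cases "ps \<rho> = w")
        case True
        have nu: "\<forall>x\<in>I. \<rho> x \<noteq> u" using ps_fullD[of \<rho> u] True assms(3) by auto
        have e1: "{x\<in>I. r x = k} = {}" using assms(1) by (auto simp: r_def)
        have "{x\<in>I. r x = u} = {x\<in>I. \<rho>' x = k} \<union> {x\<in>I. \<rho>' x = u}" by (auto simp: r_def)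
        then have e2: "card {x\<in>I. r x = u} = card {x\<in>I. \<rho>' x = k} + card {x\<in>I. \<rho>' x = u}"
          using assms(1) by (simp add: card_Un_disjoint disjoint_iff)
        define A where "A \<longleftrightarrow> split_row k u \<rho> r"
        define B where "B \<longleftrightarrow> (\<forall>x\<in>I. r x = (if \<rho>' x = k then u else \<rho>' x))"
        define C where "C \<longleftrightarrow> (\<forall>x\<in>I. if \<rho>' x = k then \<rho> x \<in> {k, Suc k} else \<rho>' x = \<rho> x \<or> \<rho>' x = u \<and> \<rho> x \<in> {k, Suc k})"
        have "A \<longleftrightarrow> C" unfolding A_def C_def split_row_def using nu by (intro ball_cong) (auto simp: r_def)
        moreover have B unfolding B_def by (simp add: r_def)
        ultimately show ?thesis
          unfolding split_mat_def N0_def Q_def e1 e2 A_def[symmetric] B_def[symmetric] C_def[symmetric]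
          using True by (cases A) auto
      qed (auto simp: split_mat_def Q_def)
      finally show ?thesis .
    qed
    have "mm (split_mat w k u 0 (j + z)) N0 \<in> J w"
      using less.IH[of 0 "j + z"] False less.prems by (intro J_mm_right InvN0) auto
    moreover have "(\<lambda>a b. \<Sum>j'\<in>{..<j}. (-1) * mm (split_mat w k u j' z) N a b) \<in> J w"
      unfolding J_def using less.IH less.prems
      by (intro lin_sum) (auto simp flip: J_def intro!: J_mm_right InvN)
    ultimately have "(\<lambda>a b. mm (split_mat w k u 0 (j + z)) N0 a b + (\<Sum>j'\<in>{..<j}. (-1) * mm (split_mat w k u j' z) N a b)) \<in> J w"
      unfolding J_def by (rule lin_add)
    then show ?thesis unfolding J_def
    proof (rule lin.eqv)
      fix \<rho> \<rho>' assume F: "\<rho> \<in> F" "\<rho>' \<in> F"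
      define c where "c = card {x\<in>I. \<rho>' x = k \<and> \<rho> x = k}"
      have cj: "c \<le> j" if "Q \<rho> \<rho>'"
        using that card_mono[of "{x\<in>I. \<rho>' x = k}" "{x\<in>I. \<rho>' x = k \<and> \<rho> x = k}"] by (auto simp: Q_def c_def)
      have "split_mat w k u j z \<rho> \<rho>' = of_bool (Q \<rho> \<rho>' \<and> j = c)"
      proof -
        define A where "A \<longleftrightarrow> split_row k u \<rho> \<rho>'"
        define C where "C \<longleftrightarrow> (\<forall>x\<in>I. if \<rho>' x = k then \<rho> x \<in> {k, Suc k} else \<rho>' x = \<rho> x \<or> \<rho>' x = u \<and> \<rho> x \<in> {k, Suc k})"
        have "A \<longleftrightarrow> C \<and> j = c" if cj: "card {x\<in>I. \<rho>' x = k} = j"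
        proof -
          have "j = c \<longleftrightarrow> {x\<in>I. \<rho>' x = k \<and> \<rho> x = k} = {x\<in>I. \<rho>' x = k}"
          proof
            assume "j = c"
            then show "{x\<in>I. \<rho>' x = k \<and> \<rho> x = k} = {x\<in>I. \<rho>' x = k}"
              unfolding c_def cj[symmetric] by (intro card_subset_eq) auto
          next
            assume "{x\<in>I. \<rho>' x = k \<and> \<rho> x = k} = {x\<in>I. \<rho>' x = k}"
            then show "j = c" unfolding c_def using cj by simp
          qed
          also have "\<dots> \<longleftrightarrow> (\<forall>x\<in>I. \<rho>' x = k \<longrightarrow> \<rho> x = k)" by blast
          finally show ?thesis unfolding A_def C_def split_row_def using assms(1) by (auto split: if_splits)
        qed
        then show ?thesis unfolding split_mat_def Q_def A_def[symmetric] C_def[symmetric]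
          by (intro arg_cong[of _ _ of_bool]) blast
      qed
      moreover have "(\<Sum>j'\<in>{..<j}. (-1) * mm (split_mat w k u j' z) N \<rho> \<rho>') = - of_bool (Q \<rho> \<rho>' \<and> c < j)"
        using F by (cases "Q \<rho> \<rho>'") (auto simp: split c_def[symmetric] of_bool_def sum_negf)
      ultimately show "mm (split_mat w k u 0 (j + z)) N0 \<rho> \<rho>' + (\<Sum>j'\<in>{..<j}. (-1) * mm (split_mat w k u j' z) N \<rho> \<rho>') = split_mat w k u j z \<rho> \<rho>'"
        using lhs[OF F] cj by (auto simp: of_bool_def)
    qed
  qed
qed

end

section \<open>Straightening of orbit indicators\<close>

context words
begin

lemma card_filter_split: "card {x\<in>I. P x} = card {x\<in>I. P x \<and> Q x} + card {x\<in>I. P x \<and> \<not> Q x}"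
proof -
  have "{x\<in>I. P x} = {x\<in>I. P x \<and> Q x} \<union> {x\<in>I. P x \<and> \<not> Q x}" by auto
  then show ?thesis by (simp add: card_Un_disjoint disjoint_iff)
qed

text \<open>Only positions carrying the letter \<open>v\<close> change row, so every other column of
  the table is untouched, and the column of \<open>v\<close> is then forced by the row sums.\<close>

lemma cont_eq_of_exchange:
  assumes "\<And>x. x \<in> I \<Longrightarrow> b x \<noteq> v \<Longrightarrow> \<rho> x = \<rho>' x" "ps \<rho> = ps \<rho>'"
  shows "cont \<rho> b = cont \<rho>' b"
proof (intro ext)
  fix k l
  have ne: "{x\<in>I. \<rho> x = k \<and> b x \<noteq> v} = {x\<in>I. \<rho>' x = k \<and> b x \<noteq> v}"
    using assms(1) by auto
  show "cont \<rho> b k l = cont \<rho>' b k l"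
  proof (cases "l = v")
    case True
    have "card {x\<in>I. \<rho> x = k} = card {x\<in>I. \<rho>' x = k}"
      by (simp add: card_level assms(2))
    then show ?thesis
      using card_filter_split[of "\<lambda>x. \<rho> x = k" "\<lambda>x. b x = v"]
        card_filter_split[of "\<lambda>x. \<rho>' x = k" "\<lambda>x. b x = v"] ne True
      by (simp add: cont_def)
  next
    case False
    then have "{x\<in>I. \<rho> x = k \<and> b x = l} = {x\<in>I. \<rho>' x = k \<and> b x = l}" using assms(1) by auto
    then show ?thesis by (simp add: cont_def)
  qed
qed

text \<open>\<open>A\<close> and \<open>B\<close> are the entries exchanged between the two rows,
  equally many each way because the weights agree. Letters going to row \<open>k + 1\<close> are at
  least \<open>v\<close>, those going to row \<open>k\<close> at most \<open>v\<close>. So the sum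
  of \<open>\<rho> x * b x\<close> grows unless every exchanged letter equals \<open>v\<close>, and
  then the table does not change.\<close>

lemma split_row_weight_gain:
  assumes "ps \<rho>' = ps \<rho>"
    and off: "\<And>x. x \<in> I \<Longrightarrow> x \<notin> Z \<Longrightarrow> \<rho>' x = \<rho> x"
    and on: "\<And>x. x \<in> I \<Longrightarrow> x \<in> Z \<Longrightarrow> \<rho>' x \<in> {k, Suc k}"
    and Z: "\<And>x. x \<in> I \<Longrightarrow> x \<in> Z \<Longrightarrow> \<rho> x = k \<and> v \<le> b x \<or> \<rho> x = Suc k \<and> b x \<le> v"
  shows "cont \<rho>' b = cont \<rho> b \<or> (\<Sum>x\<in>I. \<rho> x * b x) < (\<Sum>x\<in>I. \<rho>' x * b x)"
proof -
  define A where "A = {x\<in>I. \<rho>' x = Suc k \<and> \<rho> x = k}"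
  define B where "B = {x\<in>I. \<rho>' x = k \<and> \<rho> x = Suc k}"
  have fin: "finite A" "finite B" by (auto simp: A_def B_def)
  have rest: "\<rho>' x = \<rho> x" if "x \<in> I" "x \<notin> A" "x \<notin> B" for x
    using that off[of x] on[of x] Z[of x] by (cases "x \<in> Z") (auto simp: A_def B_def)
  have vA: "v \<le> b x" if "x \<in> A" for x
    using that off[of x] Z[of x] by (cases "x \<in> Z") (auto simp: A_def)
  have vB: "b x \<le> v" if "x \<in> B" for x
    using that off[of x] Z[of x] by (cases "x \<in> Z") (auto simp: B_def)
  have "card A = card B"
  proof -
    have 1: "card {x\<in>I. \<rho>' x = Suc k} = card {x\<in>I. \<rho> x = Suc k}" by (simp add: card_level assms(1))
    have "{x\<in>I. \<rho>' x = Suc k \<and> \<rho> x = Suc k} = {x\<in>I. \<rho> x = Suc k \<and> \<rho>' x = Suc k}" by auto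
    moreover have "{x\<in>I. \<rho>' x = Suc k \<and> \<rho> x \<noteq> Suc k} = A" unfolding A_def
      using off on Z by (metis (mono_tags, opaque_lifting) insertE n_not_Suc_n singletonD)
    moreover have "{x\<in>I. \<rho> x = Suc k \<and> \<rho>' x \<noteq> Suc k} = B" unfolding B_def
      using off on Z by (metis (mono_tags, opaque_lifting) insertE n_not_Suc_n singletonD)
    ultimately show ?thesis
      using 1 card_filter_split[of "\<lambda>x. \<rho>' x = Suc k" "\<lambda>x. \<rho> x = Suc k"]
        card_filter_split[of "\<lambda>x. \<rho> x = Suc k" "\<lambda>x. \<rho>' x = Suc k"] by simp
  qed
  have sum: "(\<Sum>x\<in>I. int (\<rho>' x * b x)) - (\<Sum>x\<in>I. int (\<rho> x * b x)) = (\<Sum>x\<in>A. int (b x) - v) + (\<Sum>x\<in>B. v - int (b x))"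
  proof -
    have "(\<Sum>x\<in>I. int (\<rho>' x * b x)) - (\<Sum>x\<in>I. int (\<rho> x * b x)) = (\<Sum>x\<in>I. (int (\<rho>' x) - \<rho> x) * b x)"
      by (simp add: sum_subtractf algebra_simps)
    also have "\<dots> = (\<Sum>x\<in>A \<union> B. (int (\<rho>' x) - \<rho> x) * b x)"
      by (rule sum.mono_neutral_right) (use rest in \<open>auto simp: A_def B_def\<close>)
    also have "\<dots> = (\<Sum>x\<in>A. (int (\<rho>' x) - \<rho> x) * b x) + (\<Sum>x\<in>B. (int (\<rho>' x) - \<rho> x) * b x)"
      by (rule sum.union_disjoint) (auto simp: A_def B_def)
    also have "(\<Sum>x\<in>A. (int (\<rho>' x) - \<rho> x) * b x) = (\<Sum>x\<in>A. int (b x))"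
      by (rule sum.cong) (auto simp: A_def)
    also have "(\<Sum>x\<in>B. (int (\<rho>' x) - \<rho> x) * b x) = (\<Sum>x\<in>B. - int (b x))"
      by (rule sum.cong) (auto simp: B_def)
    finally show ?thesis using \<open>card A = card B\<close> by (simp add: sum_subtractf sum_negf)
  qed
  show ?thesis
  proof (cases "\<forall>x\<in>A \<union> B. b x = v")
    case True
    then have "cont \<rho>' b = cont \<rho> b"
      using rest assms(1) by (intro cont_eq_of_exchange[where v = v]) blast+
    then show ?thesis ..
  next
    case False
    have nA: "0 \<le> (\<Sum>x\<in>A. int (b x) - v)" and nB: "0 \<le> (\<Sum>x\<in>B. v - int (b x))"
      using vA vB by (auto intro!: sum_nonneg)
    from False consider x where "x \<in> A" "b x > v" | x where "x \<in> B" "b x < v"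
      using vA vB by (metis Un_iff nat_neq_iff not_le)
    then have "0 < (\<Sum>x\<in>A. int (b x) - v) + (\<Sum>x\<in>B. v - int (b x))"
    proof cases
      case 1
      have "0 < (\<Sum>x\<in>A. int (b x) - v)" by (rule sum_pos2[OF fin(1) 1(1)]) (use 1 vA in auto)
      then show ?thesis using nB by simp
    next
      case 2
      have "0 < (\<Sum>x\<in>B. v - int (b x))" by (rule sum_pos2[OF fin(2) 2(1)]) (use 2 vB in auto)
      then show ?thesis using nA by simp
    qed
    then have "int (\<Sum>x\<in>I. \<rho> x * b x) < int (\<Sum>x\<in>I. \<rho>' x * b x)" using sum by simp
    then show ?thesis by linarith
  qed
qed

text \<open>A failure of column strictness yields an element of \<open>J\<close> with coefficient 1
  at the offending table; all its other tables have a larger sum of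
  \<open>\<rho> x * b x\<close>.\<close>

lemma straighten_step:
  assumes F: "\<rho>0 \<in> F" "b0 \<in> F" and u: "ps \<rho>0 u = card I" "u < K"
    and viol: "card {x\<in>I. \<rho>0 x = k \<and> b0 x < v} < card {x\<in>I. \<rho>0 x = Suc k \<and> b0 x \<le> v}"
  obtains R where "R \<in> J (ps \<rho>0)" "Inv R" "R \<rho>0 b0 = 1"
    "\<forall>\<rho>\<in>F. \<forall>b\<in>F. R \<rho> b \<noteq> 0 \<longrightarrow> (\<exists>\<rho>'\<in>F. ps \<rho>' = ps \<rho>0 \<and> cont \<rho> b = cont \<rho>' b0 \<and>
       (cont \<rho>' b0 = cont \<rho>0 b0 \<or> (\<Sum>x\<in>I. \<rho>0 x * b0 x) < (\<Sum>x\<in>I. \<rho>' x * b0 x)))"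
proof -
  have "card {x\<in>I. \<rho>0 x = Suc k \<and> b0 x \<le> v} \<noteq> 0" using viol by linarith
  then have "{x\<in>I. \<rho>0 x = Suc k \<and> b0 x \<le> v} \<noteq> {}" by (metis card.empty)
  then obtain x0 where x0: "x0 \<in> I" "\<rho>0 x0 = Suc k" by blast
  have ku: "Suc k < u" using ps_fullD[OF u(1) x0(1)] x0(2) by simp
  have lt: "\<forall>x\<in>I. \<rho>0 x < u" using ps_fullD[OF u(1)] by blast
  \<comment> \<open>The Garnir set: the part of row \<open>k\<close> with letters from
    \<open>v\<close> on, and the part of row \<open>k + 1\<close> with letters up to
    \<open>v\<close>. The violation says exactly that it is larger than row
    \<open>k\<close>.\<close>
  define Z where "Z = {x\<in>I. \<rho>0 x = k \<and> v \<le> b0 x \<or> \<rho>0 x = Suc k \<and> b0 x \<le> v}"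
  define s where "s = restrict (\<lambda>x. if x \<in> Z then u else \<rho>0 x) I"
  have s: "s \<in> F" using F u(2) by (auto simp: s_def F_def)
  define M where "M = split_mat (ps \<rho>0) k u (card {x\<in>I. s x = k}) (card Z)"
  have Zs: "{x\<in>I. s x = u} = Z" using lt by (auto simp: s_def Z_def)
  have row: "split_row k u \<rho>0 s" by (auto simp: split_row_def s_def Z_def)
  have M0: "M \<rho>0 s = 1" by (simp add: M_def split_mat_def row Zs)
  have "card Z = card {x\<in>I. \<rho>0 x = k \<and> v \<le> b0 x} + card {x\<in>I. \<rho>0 x = Suc k \<and> b0 x \<le> v}"
  proof -
    have "Z = {x\<in>I. \<rho>0 x = k \<and> v \<le> b0 x} \<union> {x\<in>I. \<rho>0 x = Suc k \<and> b0 x \<le> v}" by (auto simp: Z_def)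
    then show ?thesis by (simp add: card_Un_disjoint disjoint_iff)
  qed
  then have "card {x\<in>I. \<rho>0 x = k} < card Z"
    using viol card_filter_split[of "\<lambda>x. \<rho>0 x = k" "\<lambda>x. b0 x < v"] by (simp add: not_less)
  then have "M \<in> J (ps \<rho>0)"
    unfolding M_def using ku u by (intro split_mat_in_J) (auto simp: card_level)
  then have J: "mm M (xi (cont s b0)) \<in> J (ps \<rho>0)" by (rule J_mm_right) simp
  have InvM: "Inv M" unfolding M_def by (rule Inv_split_mat)
  \<comment> \<open>Within one row of \<rho>0, membership in \<open>Z\<close> depends only on the
    letter, so the table with \<open>b0\<close> already tells which entries were parked. Hence a
    single middle word contributes and the coefficient is 1.\<close>
  have uniq: "\<rho> = s" if h: "\<rho> \<in> F" "M \<rho>0 \<rho> \<noteq> 0" "xi (cont s b0) \<rho> b0 \<noteq> 0" for \<rho>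
  proof (rule F_eqI[OF h(1) s])
    fix x assume x: "x \<in> I"
    have c: "card {x\<in>I. \<rho> x = k' \<and> b0 x = l} = card {x\<in>I. s x = k' \<and> b0 x = l}" for k' l
      using h(3) by (auto simp: xi_def cont_def fun_eq_iff)
    have r: "\<And>x. x \<in> I \<Longrightarrow> \<rho> x = \<rho>0 x \<or> \<rho> x = u \<and> \<rho>0 x \<in> {k, Suc k}"
      using h(2) by (auto simp: M_def split_mat_def split_row_def)
    have key: "\<rho> x = s x" if k': "\<rho>0 x = k'" "k' \<in> {k, Suc k}" and
      Z': "\<And>y. y \<in> I \<Longrightarrow> \<rho>0 y = k' \<Longrightarrow> b0 y = b0 x \<Longrightarrow> y \<in> Z \<longleftrightarrow> x \<in> Z" for k'
    proof (cases "x \<in> Z")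
      case True
      have e: "{y\<in>I. s y = k' \<and> b0 y = b0 x} = {}" using Z' True k' ku by (auto simp: s_def)
      have "card {y\<in>I. \<rho> y = k' \<and> b0 y = b0 x} = 0" unfolding c e by (rule card.empty)
      moreover have "finite {y\<in>I. \<rho> y = k' \<and> b0 y = b0 x}" by simp
      ultimately have "{y\<in>I. \<rho> y = k' \<and> b0 y = b0 x} = {}" by (simp only: card_0_eq)
      then have "\<rho> x \<noteq> k'" using x by auto
      then show ?thesis using r[OF x] k' True x by (auto simp: s_def)
    next
      case False
      have e: "{y\<in>I. s y = k' \<and> b0 y = b0 x} = {y\<in>I. \<rho>0 y = k' \<and> b0 y = b0 x}"
        using Z' False k' ku by (auto simp: s_def)
      have "{y\<in>I. \<rho> y = k' \<and> b0 y = b0 x} = {y\<in>I. \<rho>0 y = k' \<and> b0 y = b0 x}"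
      proof (rule card_subset_eq)
        show "{y\<in>I. \<rho> y = k' \<and> b0 y = b0 x} \<subseteq> {y\<in>I. \<rho>0 y = k' \<and> b0 y = b0 x}"
          using r k' ku by fastforce
      qed (use c[of k' "b0 x"] e in auto)
      then have "\<rho> x = k'" using x k' by auto
      then show ?thesis using False x k' by (simp add: s_def)
    qed
    show "\<rho> x = s x"
    proof (cases "\<rho>0 x \<in> {k, Suc k}")
      case True
      then show ?thesis by (intro key[OF refl]) (auto simp: Z_def x)
    next
      case False
      then have "x \<notin> Z" by (auto simp: Z_def)
      then show ?thesis using False r[OF x] x by (auto simp: s_def)
    qed
  qed
  show thesis
  proof (rule that[of "mm M (xi (cont s b0))"])
    show "mm M (xi (cont s b0)) \<in> J (ps \<rho>0)" by (fact J)
    show "Inv (mm M (xi (cont s b0)))" using InvM by (simp add: Inv_mm)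
    show "mm M (xi (cont s b0)) \<rho>0 b0 = 1"
      using mm_unique[of s M \<rho>0 "xi (cont s b0)" b0, OF s uniq] M0 by (simp add: xi_def)
    show "\<forall>\<rho>\<in>F. \<forall>b\<in>F. mm M (xi (cont s b0)) \<rho> b \<noteq> 0 \<longrightarrow> (\<exists>\<rho>'\<in>F. ps \<rho>' = ps \<rho>0 \<and> cont \<rho> b = cont \<rho>' b0 \<and>
       (cont \<rho>' b0 = cont \<rho>0 b0 \<or> (\<Sum>x\<in>I. \<rho>0 x * b0 x) < (\<Sum>x\<in>I. \<rho>' x * b0 x)))"
    proof (intro ballI impI)
      fix \<rho> b assume rb: "\<rho> \<in> F" "b \<in> F" and "mm M (xi (cont s b0)) \<rho> b \<noteq> 0"
      then obtain s' where s': "s' \<in> F" "M \<rho> s' \<noteq> 0" "cont s' b = cont s b0"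
        by (elim mm_nonzeroE) (auto simp: xi_def)
      obtain \<sigma> where \<sigma>: "\<sigma> permutes I" "s' = s \<circ> \<sigma>" "b = b0 \<circ> \<sigma>"
        using cont_eqE[OF s'(3,1) rb(2) s F(2)] .
      \<comment> \<open>Undoing \<sigma> moves \<open>b\<close> back to \<open>b0\<close>, so that
        \<rho>' can be compared with \<rho>0 position by position.\<close>
      define \<rho>' where "\<rho>' = \<rho> \<circ> inv \<sigma>"
      have r': "\<rho>' \<in> F" "\<rho>' \<circ> \<sigma> = \<rho>"
        using \<sigma>(1) rb(1) by (auto simp: \<rho>'_def F_comp permutes_inv o_assoc[symmetric] permutes_inv_o)
      have "M \<rho>' s \<noteq> 0"
        using InvM \<sigma> r' s s'(2) unfolding Inv_def by metis
      then have ps: "ps \<rho>' = ps \<rho>0" and sr: "split_row k u \<rho>' s" by (auto simp: M_def split_mat_def)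
      have lt': "\<forall>x\<in>I. \<rho>' x < u" using ps_fullD[of \<rho>' u] u(1) ps by simp
      have "cont \<rho>' b0 = cont \<rho>0 b0 \<or> (\<Sum>x\<in>I. \<rho>0 x * b0 x) < (\<Sum>x\<in>I. \<rho>' x * b0 x)"
      proof (rule split_row_weight_gain[OF ps])
        fix x assume x: "x \<in> I"
        have sx: "s x = \<rho>' x \<or> s x = u \<and> \<rho>' x \<in> {k, Suc k}"
          using sr x unfolding split_row_def by blast
        show "\<rho>' x = \<rho>0 x" if "x \<notin> Z" using sx that x lt by (auto simp: s_def)
        show "\<rho>' x \<in> {k, Suc k}" if "x \<in> Z" using sx that x lt' by (auto simp: s_def)
        show "\<rho>0 x = k \<and> v \<le> b0 x \<or> \<rho>0 x = Suc k \<and> b0 x \<le> v" if "x \<in> Z" using that by (simp add: Z_def)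
      qed
      moreover have "cont \<rho> b = cont \<rho>' b0" using cont_comp[OF \<sigma>(1), of \<rho>' b0] r'(2) \<sigma>(3) by simp
      ultimately show "\<exists>\<rho>'\<in>F. ps \<rho>' = ps \<rho>0 \<and> cont \<rho> b = cont \<rho>' b0 \<and>
         (cont \<rho>' b0 = cont \<rho>0 b0 \<or> (\<Sum>x\<in>I. \<rho>0 x * b0 x) < (\<Sum>x\<in>I. \<rho>' x * b0 x))"
        using r'(1) ps by blast
    qed
  qed
qed

text \<open>The sum of \<open>\<rho> x * b0 x\<close> increases in each step and is bounded by the
  sum of \<open>K * b0 x\<close>, since the letters of \<rho> lie below \<open>K\<close>. The letter
  \<open>u\<close> is the parking row: it does not occur in \<rho>0 and still belongs to the
  alphabet.\<close>

lemma straighten: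
  assumes "\<rho>0 \<in> F" "b0 \<in> F" "ps \<rho>0 u = card I" "u < K"
  shows "xi (cont \<rho>0 b0) \<in> lin ({xi (cont \<rho> b0) |\<rho>. \<rho> \<in> F \<and> ps \<rho> = ps \<rho>0 \<and> semistd \<rho> b0} \<union> J (ps \<rho>0))"
  using assms(1,3)
proof (induction "(\<Sum>x\<in>I. K * b0 x) - (\<Sum>x\<in>I. \<rho>0 x * b0 x)" arbitrary: \<rho>0 rule: less_induct)
  case less
  show ?case
  proof (cases "semistd \<rho>0 b0")
    case True
    then show ?thesis using less.prems by (intro lin.gen) blast
  next
    case False
    then obtain k v where viol: "card {x\<in>I. \<rho>0 x = k \<and> b0 x < v} < card {x\<in>I. \<rho>0 x = Suc k \<and> b0 x \<le> v}"
      by (auto simp: semistd_def not_le)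
    obtain R where R: "R \<in> J (ps \<rho>0)" "Inv R" "R \<rho>0 b0 = 1"
      "\<forall>\<rho>\<in>F. \<forall>b\<in>F. R \<rho> b \<noteq> 0 \<longrightarrow> (\<exists>\<rho>'\<in>F. ps \<rho>' = ps \<rho>0 \<and> cont \<rho> b = cont \<rho>' b0 \<and>
       (cont \<rho>' b0 = cont \<rho>0 b0 \<or> (\<Sum>x\<in>I. \<rho>0 x * b0 x) < (\<Sum>x\<in>I. \<rho>' x * b0 x)))"
      by (rule straighten_step[OF less.prems(1) assms(2) less.prems(2) assms(4) viol])
    define G where "G = {xi (cont \<rho> b0) |\<rho>. \<rho> \<in> F \<and> ps \<rho> = ps \<rho>0 \<and> semistd \<rho> b0} \<union> J (ps \<rho>0)"
    \<comment> \<open>The relation \<open>R\<close> without its leading table: only tables of larger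
      sum remain, so the induction hypothesis covers \<open>D\<close>.\<close>
    define D where "D = (\<lambda>\<rho> b. (-1) * xi (cont \<rho>0 b0) \<rho> b + R \<rho> b)"
    have "D \<in> lin G"
    proof (rule Inv_expand)
      show "Inv D" unfolding D_def by (intro Inv_comb R Inv_xi)
      fix N assume "\<exists>a\<in>F. \<exists>b\<in>F. cont a b = N \<and> D a b \<noteq> 0"
      then obtain a b where ab: "a \<in> F" "b \<in> F" "cont a b = N" "D a b \<noteq> 0" by blast
      have ne: "N \<noteq> cont \<rho>0 b0"
      proof
        assume "N = cont \<rho>0 b0"
        then have "R a b = R \<rho>0 b0" using ab(3) by (intro Inv_cont_eq[OF R(2) _ ab(1,2) less.prems(1) assms(2)]) simp
        then show False using ab \<open>N = cont \<rho>0 b0\<close> R(3) by (simp add: D_def xi_def)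
      qed
      then have "R a b \<noteq> 0" using ab by (auto simp: D_def xi_def)
      then obtain \<rho>' where r': "\<rho>' \<in> F" "ps \<rho>' = ps \<rho>0" "N = cont \<rho>' b0"
        "(\<Sum>x\<in>I. \<rho>0 x * b0 x) < (\<Sum>x\<in>I. \<rho>' x * b0 x)"
        using R(4)[rule_format, OF ab(1,2)] ab(3) ne by auto
      have "(\<Sum>x\<in>I. \<rho>' x * b0 x) \<le> (\<Sum>x\<in>I. K * b0 x)"
        using F_less[OF r'(1)] by (intro sum_mono mult_right_mono) (auto intro: less_imp_le)
      then have "(\<Sum>x\<in>I. K * b0 x) - (\<Sum>x\<in>I. \<rho>' x * b0 x) < (\<Sum>x\<in>I. K * b0 x) - (\<Sum>x\<in>I. \<rho>0 x * b0 x)"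
        using r'(4) by linarith
      from less.hyps[OF this r'(1)] show "xi N \<in> lin G"
        using less.prems(2) r' by (simp add: G_def)
    qed
    moreover have "R \<in> lin G" using R(1) by (auto simp: G_def intro: lin.gen)
    ultimately have "(\<lambda>\<rho> b. (-1) * D \<rho> b + R \<rho> b) \<in> lin G" by (rule lin.comb)
    then show ?thesis unfolding G_def[symmetric] by (rule lin.eqv) (simp add: D_def)
  qed
qed

text \<open>Green's standard codeterminants whose shape strictly dominates \<open>w\<close>. By
  \<open>cell_elt_vec\<close> they are the cell elements in the language of matrices.\<close>

definition semistd_prods :: "(nat \<Rightarrow> nat) \<Rightarrow> ((nat \<Rightarrow> nat) \<Rightarrow> (nat \<Rightarrow> nat) \<Rightarrow> int) set" where
  "semistd_prods w = {mm (tr (xi (cont \<rho> a))) (xi (cont \<rho>' b)) | \<rho> a \<rho>' b.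
     \<rho> \<in> F \<and> a \<in> F \<and> \<rho>' \<in> F \<and> b \<in> F \<and> semistd \<rho> a \<and> semistd \<rho>' b \<and> ps \<rho> = ps \<rho>' \<and> w < ps \<rho>}"

lemma semistd_prodsI:
  "\<rho> \<in> F \<Longrightarrow> a \<in> F \<Longrightarrow> \<rho>' \<in> F \<Longrightarrow> b \<in> F \<Longrightarrow> semistd \<rho> a \<Longrightarrow> semistd \<rho>' b \<Longrightarrow> ps \<rho> = ps \<rho>' \<Longrightarrow> w < ps \<rho> \<Longrightarrow>
     mm (tr (xi (cont \<rho> a))) (xi (cont \<rho>' b)) \<in> semistd_prods w"
  unfolding semistd_prods_def by blast

lemma tr_comb: "tr (\<lambda>a b. c * f a b + g a b) = (\<lambda>a b. c * tr f a b + tr g a b)"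
  by (simp add: tr_def fun_eq_iff)

lemma xi_ps: "\<rho> \<in> F \<Longrightarrow> b \<in> F \<Longrightarrow> \<rho>' \<in> F \<Longrightarrow> b' \<in> F \<Longrightarrow> xi (cont \<rho> b) \<rho>' b' \<noteq> 0 \<Longrightarrow> ps \<rho>' = ps \<rho> \<and> ps b' = ps b"
  using cont_imp_ps_left[of \<rho>' b' \<rho> b] by (simp add: xi_def)

lemma ps_full_mono: "ps \<rho> u = card I \<Longrightarrow> u \<le> q \<Longrightarrow> ps \<rho> q = card I"
  using ps_le[of \<rho> q] card_mono[of "{x\<in>I. \<rho> x < q}" "{x\<in>I. \<rho> x < u}"]
  by (fastforce simp: ps_def)

text \<open>The measure for induction along the dominance order, starting from the most dominant
  weight. All partial sums agree from \<open>u\<close> on, so a finite sum suffices.\<close>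

lemma sum_ps_less:
  assumes "w < ps \<rho>" "\<forall>q\<ge>u. w q = card I"
  shows "(\<Sum>q<u. card I - ps \<rho> q) < (\<Sum>q<u. card I - w q)"
proof -
  obtain q where q: "w q < ps \<rho> q" and le: "\<And>q. w q \<le> ps \<rho> q"
    using assms(1) unfolding less_le_not_le[of w] le_fun_def by (meson not_le)
  have "q < u"
  proof (rule ccontr)
    assume "\<not> q < u"
    then show False using assms(2) q ps_le[of \<rho> q] by simp
  qed
  then show ?thesis
    using q le ps_le[of \<rho> q] by (intro sum_strict_mono_ex1) (auto intro!: bexI[of _ q] diff_le_mono2)
qed

lemma J_full: "w < ps \<rho> \<Longrightarrow> w u = card I \<Longrightarrow> ps \<rho> u = card I"
  using ps_le[of \<rho> u] by (metis le_antisym le_funD less_imp_le)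

text \<open>A product in \<open>through w\<close> is expanded into orbit indicators and both factors
  are straightened. The error terms lie in \<open>J\<close> of a strictly larger weight and fall
  under the induction hypothesis.\<close>

lemma J_subset_span:
  assumes "\<forall>q\<ge>u. w q = card I" "u < K"
  shows "J w \<subseteq> lin (semistd_prods w)"
  using assms(1)
proof (induction "\<Sum>q<u. card I - w q" arbitrary: w rule: less_induct)
  case less
  have mono: "semistd_prods w' \<subseteq> semistd_prods w" if "w \<le> w'" for w'
  proof
    fix h assume "h \<in> semistd_prods w'"
    then show "h \<in> semistd_prods w" using le_less_trans[OF that] unfolding semistd_prods_def by blast
  qed
  have IH: "h \<in> lin (semistd_prods w)" if "h \<in> J (ps \<rho>)" "w < ps \<rho>" for h \<rho>
  proof -
    have "J (ps \<rho>) \<subseteq> lin (semistd_prods (ps \<rho>))"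
      using sum_ps_less[OF that(2) less.prems] J_full[OF that(2)] less.prems
      by (intro less.hyps) (auto intro: ps_full_mono)
    then have "h \<in> lin (semistd_prods (ps \<rho>))" using that(1) by blast
    moreover have "semistd_prods (ps \<rho>) \<subseteq> lin (semistd_prods w)"
      using mono[OF less_imp_le[OF that(2)]] lin.gen by blast
    ultimately show ?thesis by (rule lin_mono)
  qed
  \<comment> \<open>\<open>two\<close> straightens the right factor while the left one is
    semistandard; \<open>one\<close> then straightens the left factor, whose indicator occurs
    transposed.\<close>
  have two: "mm (tr (xi (cont \<rho> a))) (xi (cont \<rho>' b)) \<in> lin (semistd_prods w)"
    if F: "\<rho> \<in> F" "a \<in> F" "\<rho>' \<in> F" "b \<in> F" and ss: "semistd \<rho> a" and ps: "ps \<rho>' = ps \<rho>" "w < ps \<rho>"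
    for \<rho> a \<rho>' b
  proof -
    let ?G = "{xi (cont r b) |r. r \<in> F \<and> ps r = ps \<rho>' \<and> semistd r b} \<union> J (ps \<rho>')"
    have "ps \<rho>' u = card I" using J_full[OF ps(2)] less.prems ps by simp
    then have "xi (cont \<rho>' b) \<in> lin ?G"
      using F \<open>u < K\<close> by (intro straighten)
    then show ?thesis
    proof (rule lin_image)
      fix g assume "g \<in> ?G"
      then show "mm (tr (xi (cont \<rho> a))) g \<in> lin (semistd_prods w)"
      proof
        assume "g \<in> J (ps \<rho>')"
        then show ?thesis using ps by (intro IH[of _ \<rho>] J_mm_left Inv_tr) auto
      next
        assume "g \<in> {xi (cont r b) |r. r \<in> F \<and> ps r = ps \<rho>' \<and> semistd r b}"
        then show ?thesis using F ss ps by (auto intro!: lin.gen semistd_prodsI)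
      qed
    qed (auto simp: mm_comb_right intro: mm_cong)
  qed
  have one: "mm (tr (xi (cont \<rho> a))) (xi (cont \<rho>' b)) \<in> lin (semistd_prods w)"
    if F: "\<rho> \<in> F" "a \<in> F" "\<rho>' \<in> F" "b \<in> F" and ps: "ps \<rho>' = ps \<rho>" "w < ps \<rho>"
    for \<rho> a \<rho>' b
  proof -
    let ?G = "{xi (cont r a) |r. r \<in> F \<and> ps r = ps \<rho> \<and> semistd r a} \<union> J (ps \<rho>)"
    have "ps \<rho> u = card I" using J_full[OF ps(2)] less.prems ps by simp
    then have "xi (cont \<rho> a) \<in> lin ?G"
      using F \<open>u < K\<close> by (intro straighten)
    then show ?thesis
    proof (rule lin_image[where \<phi> = "\<lambda>g. mm (tr g) (xi (cont \<rho>' b))"])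
      fix g assume "g \<in> ?G"
      then show "mm (tr g) (xi (cont \<rho>' b)) \<in> lin (semistd_prods w)"
      proof
        assume "g \<in> J (ps \<rho>)"
        then show ?thesis using ps by (intro IH[of _ \<rho>] J_mm_right tr_J) auto
      next
        assume "g \<in> {xi (cont r a) |r. r \<in> F \<and> ps r = ps \<rho> \<and> semistd r a}"
        then show ?thesis using F ps by (auto intro!: two)
      qed
    next
      show "mm (tr (\<lambda>a b. c * f a b + g a b)) (xi (cont \<rho>' b)) =
        (\<lambda>a' b'. c * mm (tr f) (xi (cont \<rho>' b)) a' b' + mm (tr g) (xi (cont \<rho>' b)) a' b')" for c f g
        by (simp only: tr_comb mm_comb_left)
    qed (auto intro!: mm_cong simp: tr_def)
  qed
  show ?case
  proof
    fix h assume "h \<in> J w"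
    then show "h \<in> lin (semistd_prods w)" unfolding J_def
    proof (rule lin_mono, intro subsetI)
      fix h assume "h \<in> through w"
      then obtain f g where h: "h = mm f g" "Inv f" "Inv g" and
        fg: "\<forall>a\<in>F. \<forall>\<rho>\<in>F. \<forall>b\<in>F. f a \<rho> \<noteq> 0 \<longrightarrow> g \<rho> b \<noteq> 0 \<longrightarrow> w < ps \<rho>"
        by (rule throughE)
      text \<open>Expand both factors into orbit indicators, keeping only the dominating middle weights.\<close>
      define f' where "f' a \<rho> = (of_bool (w < ps \<rho>) * f a \<rho>)" for a \<rho>
      define g' where "g' \<rho> b = (of_bool (w < ps \<rho>) * g \<rho> b)" for \<rho> b
      have Inv': "Inv f'" "Inv g'" using h unfolding Inv_def f'_def g'_def by (auto simp: ps_comp)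
      have trf: "tr f' \<in> lin {xi (cont \<rho> a) | \<rho> a. \<rho> \<in> F \<and> a \<in> F \<and> w < ps \<rho>}"
        by (rule Inv_expand[OF Inv_tr[OF Inv'(1)]]) (auto simp: tr_def f'_def intro!: lin.gen)
      have gen: "mm (tr k) g' \<in> lin (semistd_prods w)"
        if k: "k \<in> {xi (cont \<rho> a) | \<rho> a. \<rho> \<in> F \<and> a \<in> F \<and> w < ps \<rho>}" for k
      proof -
        obtain \<rho> a where k: "k = xi (cont \<rho> a)" "\<rho> \<in> F" "a \<in> F" "w < ps \<rho>" using k by blast
        have "g' \<in> lin {xi (cont \<rho>' b) | \<rho>' b. \<rho>' \<in> F \<and> b \<in> F}"
          by (rule Inv_expand[OF Inv'(2)]) (auto intro!: lin.gen)
        then show ?thesis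
        proof (rule lin_image)
          fix g assume "g \<in> {xi (cont \<rho>' b) | \<rho>' b. \<rho>' \<in> F \<and> b \<in> F}"
          then obtain \<rho>' b where g: "g = xi (cont \<rho>' b)" "\<rho>' \<in> F" "b \<in> F" by blast
          show "mm (tr k) g \<in> lin (semistd_prods w)"
          proof (cases "ps \<rho>' = ps \<rho>")
            case True
            then show ?thesis unfolding k g using k g by (intro one)
          next
            case False
            \<comment> \<open>A contributing middle word would have to carry two different
              weights.\<close>
            have "mm (tr k) g a' b' = 0" if "a' \<in> F" "b' \<in> F" for a' b'
            proof (rule ccontr)
              assume "mm (tr k) g a' b' \<noteq> 0"
              then obtain r where r: "r \<in> F" "tr k a' r \<noteq> 0" "g r b' \<noteq> 0" by (rule mm_nonzeroE)
              then show False using False xi_ps[of \<rho> a r a'] xi_ps[of \<rho>' b r b'] k g that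
                by (simp add: tr_def)
            qed
            then show ?thesis by (intro lin.eqv[OF lin.zero]) simp
          qed
        qed (auto simp: mm_comb_right intro: mm_cong)
      qed
      have "mm (tr (tr f')) g' \<in> lin (semistd_prods w)"
      proof (rule lin_image[where \<phi> = "\<lambda>k. mm (tr k) g'", OF trf gen])
        show "mm (tr (\<lambda>a b. c * f a b + g a b)) g' =
          (\<lambda>a' b'. c * mm (tr f) g' a' b' + mm (tr g) g' a' b')" for c f g
          by (simp only: tr_comb mm_comb_left)
      qed (auto intro!: mm_cong simp: tr_def)
      then show "h \<in> lin (semistd_prods w)"
      proof (rule lin.eqv)
        fix a b assume "a \<in> F" "b \<in> F"
        then show "mm (tr (tr f')) g' a b = h a b"
          unfolding h(1) mm_def by (intro sum.cong) (use fg in \<open>auto simp: f'_def g'_def of_bool_def\<close>)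
      qed
    qed
  qed
qed

text \<open>The weight here is that of the constant word \<open>u - 1\<close>. Every word with
  letters below \<open>u - 1\<close> strictly dominates it, so inserting the identity
  \<open>e\<close> of these weight spaces exhibits \<open>f\<close> as an element of
  \<open>through\<close>. This later shows that everything of a given index is spanned by cell
  elements.\<close>

lemma Inv_in_J:
  assumes "Inv f" "0 < card I" "\<And>a b. a \<in> F \<Longrightarrow> b \<in> F \<Longrightarrow> f a b \<noteq> 0 \<Longrightarrow> ps a (u - 1) = card I" "0 < u"
  shows "f \<in> J (\<lambda>q. if u \<le> q then card I else 0)"
proof -
  define e where "e a \<rho> = (of_bool (a = \<rho> \<and> ps a (u - 1) = card I) :: int)" for a \<rho> :: "nat \<Rightarrow> nat"
  have "Inv e"
  proof -
    have "a \<circ> \<sigma> = \<rho> \<circ> \<sigma> \<longleftrightarrow> a = \<rho>" if "\<sigma> permutes I" for a \<rho> :: "nat \<Rightarrow> nat" and \<sigma>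
      using that by (metis comp_assoc comp_id permutes_inv_o(1))
    then show ?thesis by (simp add: Inv_def e_def ps_comp)
  qed
  then have "mm e f \<in> J (\<lambda>q. if u \<le> q then card I else 0)"
  proof (rule J_I[OF _ assms(1)])
    fix a \<rho> b assume "e a \<rho> \<noteq> 0"
    then have p: "ps \<rho> (u - 1) = card I" by (auto simp: e_def)
    then show "(\<lambda>q. if u \<le> q then card I else 0) < ps \<rho>"
      using assms(2,4) ps_full_mono[OF p] by (intro fun_lessI[where q = "u - 1"]) auto
  qed
  then show ?thesis unfolding J_def
  proof (rule lin.eqv)
    fix a b assume ab: "a \<in> F" "b \<in> F"
    have "mm e f a b = e a a * f a b" by (rule mm_unique[OF ab(1)]) (auto simp: e_def)
    then show "mm e f a b = f a b" using assms(3)[OF ab] by (auto simp: e_def)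
  qed
qed

end

text \<open>Orbit counting for a group of prime order: an orbit of length \<open>p\<close>
  contributes \<open>p\<close> equal terms, a fixed point is covered by the last hypothesis. Orbits
  are split off one by one.\<close>

lemma dvd_sum_cyclic_action:
  fixes w :: "'a \<Rightarrow> int"
  assumes "prime p" "finite A"
    and "\<And>x. x \<in> A \<Longrightarrow> T x \<in> A" "\<And>x. x \<in> A \<Longrightarrow> (T ^^ p) x = x"
    and "\<And>x. x \<in> A \<Longrightarrow> w (T x) = w x"
    and "\<And>x. x \<in> A \<Longrightarrow> T x = x \<Longrightarrow> int p dvd w x"
  shows "int p dvd (\<Sum>x\<in>A. w x)"
  using assms(2-)
proof (induction A rule: finite_psubset_induct)
  case (psubset A)
  show ?case
  proof (cases "A = {}")
    case False
    then obtain x where x: "x \<in> A" by blast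
    define Q where "Q = (\<lambda>j. (T ^^ j) x) ` {..<p}"
    have p: "0 < p" using assms(1) by (simp add: prime_gt_0_nat)
    have memA: "(T ^^ j) x \<in> A" for j using x psubset.prems(1) by (induction j) auto
    have wQ: "w ((T ^^ j) x) = w x" for j
      using psubset.prems(3)[OF memA] by (induction j) auto
    have memQ: "(T ^^ j) x \<in> Q" for j
      unfolding Q_def using p funpow_mod_eq[where f = T and n = p and x = x and m = j] psubset.prems(2)[OF x]
      by (intro image_eqI[of _ _ "j mod p"]) auto
    have TQ: "T y \<in> Q" if "y \<in> Q" for y
    proof -
      obtain j where "y = (T ^^ j) x" using \<open>y \<in> Q\<close> by (auto simp: Q_def)
      then have "T y = (T ^^ Suc j) x" by simp
      then show ?thesis using memQ by metis
    qed
    have powQ: "(T ^^ j) y \<in> Q" if "y \<in> Q" for y j using that TQ by (induction j) auto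
    have "Q \<subseteq> A" using memA by (auto simp: Q_def)
    have "int p dvd (\<Sum>y\<in>A - Q. w y)"
    proof (rule psubset.IH)
      show "A - Q \<subset> A" using memQ[of 0] x by auto
      fix y assume y: "y \<in> A - Q"
      have "T y \<notin> Q"
      proof
        assume "T y \<in> Q"
        \<comment> \<open>\<open>T ^^ (p - 1)\<close> inverts \<open>T\<close>, so the complement of
          an orbit is stable.\<close>
        then have "(T ^^ (p - 1)) (T y) \<in> Q" by (rule powQ)
        also have "(T ^^ (p - 1)) (T y) = (T ^^ p) y"
          using p by (metis Suc_pred' funpow_Suc_right o_apply)
        finally show False using psubset.prems(2) y by auto
      qed
      then show "T y \<in> A - Q" using psubset.prems(1) y by blast
    qed (use psubset.prems in auto)
    moreover have "int p dvd (\<Sum>y\<in>Q. w y)"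
    proof (cases "T x = x")
      case True
      have "(T ^^ j) x = x" for j by (induction j) (auto simp: True)
      then have "Q = {x}" using p by (auto simp: Q_def)
      then show ?thesis using psubset.prems(4) x True by simp
    next
      case False
      have "inj_on (\<lambda>j. (T ^^ j) x) {..<p}"
      proof (rule linorder_inj_onI)
        fix a b assume ab: "a < b" "a \<in> {..<p}" "b \<in> {..<p}"
        show "(T ^^ a) x \<noteq> (T ^^ b) x"
        proof
          assume "(T ^^ a) x = (T ^^ b) x"
          then have "(T ^^ (p - a)) ((T ^^ a) x) = (T ^^ (p - a)) ((T ^^ b) x)" by simp
          then have "(T ^^ p) x = (T ^^ (p - a + b)) x" using ab
            by (simp add: funpow_add[symmetric, THEN fun_cong, unfolded o_apply])
          also have "p - a + b = (b - a) + p" using ab by simp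
          finally have d: "(T ^^ (b - a)) x = x"
            using psubset.prems(2)[OF x] by (simp add: funpow_add)
          \<comment> \<open>A repetition in the orbit makes \<open>T ^^ (b - a)\<close> fix
            \<open>x\<close>; as \<open>b - a\<close> is prime to \<open>p\<close>, Bezout turns
            this into \<open>T x = x\<close>.\<close>
          have "coprime (b - a) p"
            using ab assms(1) by (metis coprime_commute prime_imp_coprime nat_dvd_not_less zero_less_diff diff_less_mono2 lessThan_iff less_imp_diff_less)
          then obtain e f where "(b - a) * e = p * f + 1"
            using bezout_nat[of "b - a" p] ab by auto
          have Td: "(T ^^ ((b - a) * e)) x = x" using d by (induction e) (simp_all add: funpow_add)
          have "(T ^^ (p * f)) x = x" using psubset.prems(2)[OF x] by (induction f) (simp_all add: funpow_add)
          then have "(T ^^ (p * f + 1)) x = T x" by simp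
          then show False using Td \<open>(b - a) * e = p * f + 1\<close> False by simp
        qed
      qed (use linear in blast)
      then have "card Q = p" by (simp add: Q_def card_image)
      moreover have "(\<Sum>y\<in>Q. w y) = (\<Sum>y\<in>Q. w x)" by (rule sum.cong) (auto simp: Q_def wQ)
      ultimately show ?thesis by simp
    qed
    ultimately have "int p dvd (\<Sum>y\<in>A - Q. w y) + (\<Sum>y\<in>Q. w y)" by (rule dvd_add)
    also have "(\<Sum>y\<in>A - Q. w y) + (\<Sum>y\<in>Q. w y) = (\<Sum>y\<in>A. w y)"
      by (rule sum.subset_diff[OF \<open>Q \<subseteq> A\<close> \<open>finite A\<close>, symmetric])
    finally show ?thesis .
  qed simp
qed

section \<open>The column antisymmetriser\<close>

context words
begin

text \<open>Positions are boxes with coordinates \<open>row\<close> and \<open>col\<close>. By the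
  last condition every column occupies an initial segment of rows; this is how the partition shape
  enters the dominance argument.\<close>

definition diagram :: "(nat \<Rightarrow> nat) \<Rightarrow> (nat \<Rightarrow> nat) \<Rightarrow> bool" where
  "diagram row col \<longleftrightarrow> row \<in> F \<and> (\<forall>x\<in>I. \<forall>y\<in>I. row x = row y \<longrightarrow> col x = col y \<longrightarrow> x = y) \<and>
     (\<forall>x\<in>I. \<forall>k. row x = Suc k \<longrightarrow> (\<exists>y\<in>I. row y = k \<and> col y = col x))"

definition col_group :: "(nat \<Rightarrow> nat) \<Rightarrow> (nat \<Rightarrow> nat) set" where
  "col_group col = {\<sigma>. \<sigma> permutes I \<and> (\<forall>x\<in>I. col (\<sigma> x) = col x)}"

text \<open>The signed column sum acts on the second word. As a functional of \<open>f\<close> it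
  vanishes on the dominating ideal and is 1 on the diagonal, so it reads off scalars.\<close>

definition alternating :: "(nat \<Rightarrow> nat) \<Rightarrow> ((nat \<Rightarrow> nat) \<Rightarrow> (nat \<Rightarrow> nat) \<Rightarrow> int) \<Rightarrow> (nat \<Rightarrow> nat) \<Rightarrow> (nat \<Rightarrow> nat) \<Rightarrow> int" where
  "alternating col f a c = (\<Sum>\<sigma>\<in>col_group col. sign \<sigma> * f a (c \<circ> \<sigma>))"

lemma finite_col_group [simp]: "finite (col_group col)"
  unfolding col_group_def by (rule finite_subset[OF _ finite_permutations[OF finite_I]]) auto

lemma permutation_I: "\<sigma> permutes I \<Longrightarrow> permutation \<sigma>"
  using permutation_permutes finite_I by blast

lemma diagram_column_initial:
  assumes "diagram row col" "x \<in> I" "k \<le> row x"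
  shows "\<exists>y\<in>I. row y = k \<and> col y = col x"
proof -
  have "\<exists>y\<in>I. row y = row x - d \<and> col y = col x" if "d \<le> row x" for d
    using that
  proof (induction d)
    case (Suc d)
    then obtain y where y: "y \<in> I" "row y = Suc (row x - Suc d)" "col y = col x"
      using Suc_diff_Suc by fastforce
    then show ?case using assms(1) unfolding diagram_def by metis
  qed (use assms in auto)
  from this[of "row x - k"] show ?thesis using assms(3) by simp
qed

text \<open>If \<rho> were injective on each column, a column would contain at most \<open>q\<close>
  entries below \<open>q\<close>, and at most as many as its length. The diagram attains this bound
  in every column, so \<rho> could not dominate strictly.\<close>

lemma column_repetition:
  assumes d: "diagram row col" and "ps row < ps \<rho>"
  obtains x y where "x \<in> I" "y \<in> I" "x \<noteq> y" "col x = col y" "\<rho> x = \<rho> y"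
proof -
  have False if inj: "\<forall>x\<in>I. \<forall>y\<in>I. col x = col y \<longrightarrow> \<rho> x = \<rho> y \<longrightarrow> x = y"
  proof -
    have le: "card {x\<in>I. \<rho> x < q \<and> col x = c} \<le> card {x\<in>I. row x < q \<and> col x = c}" for q c
    proof (cases "\<exists>x\<in>I. col x = c \<and> q \<le> row x")
      case False
      then have "{x\<in>I. \<rho> x < q \<and> col x = c} \<subseteq> {x\<in>I. row x < q \<and> col x = c}" by (auto simp: not_le)
      then show ?thesis by (intro card_mono) auto
    next
      case True
      then obtain x where x: "x \<in> I" "col x = c" "q \<le> row x" by blast
      have "{..<q} \<subseteq> row ` {x\<in>I. row x < q \<and> col x = c}"
      proof
        fix k assume "k \<in> {..<q}"
        then obtain y where "y \<in> I" "row y = k" "col y = c"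
          using diagram_column_initial[OF d x(1), of k] x by auto
        then show "k \<in> row ` {x\<in>I. row x < q \<and> col x = c}" using \<open>k \<in> {..<q}\<close> by auto
      qed
      then have "q \<le> card {x\<in>I. row x < q \<and> col x = c}"
        using surj_card_le[of "{x\<in>I. row x < q \<and> col x = c}" "{..<q}" row] by simp
      moreover have "card {x\<in>I. \<rho> x < q \<and> col x = c} \<le> card {..<q}"
        by (rule card_inj_on_le[where f = \<rho>]) (use inj in \<open>auto simp: inj_on_def\<close>)
      ultimately show ?thesis by simp
    qed
    have col: "card {x\<in>I. P x} = (\<Sum>c\<in>col ` I. card {x\<in>I. P x \<and> col x = c})" for P
    proof -
      have "card {x\<in>I. P x} = (\<Sum>c\<in>col ` I. sum (\<lambda>_. 1) {x. x \<in> {x\<in>I. P x} \<and> col x = c})"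
        unfolding card_eq_sum by (rule sum.group[symmetric]) auto
      also have "\<dots> = (\<Sum>c\<in>col ` I. card {x\<in>I. P x \<and> col x = c})"
        by (intro sum.cong refl) (simp add: conj_assoc)
      finally show ?thesis .
    qed
    have "ps \<rho> q \<le> ps row q" for q
      unfolding ps_def col[of "\<lambda>x. \<rho> x < q"] col[of "\<lambda>x. row x < q"] by (intro sum_mono le)
    then have "ps \<rho> \<le> ps row" by (simp add: le_fun_def)
    then show False using assms(2) by simp
  qed
  then show thesis using that by blast
qed

text \<open>A middle word of strictly larger weight takes equal values at two boxes of one column.
  Composing with their transposition fixes the middle word and reverses the sign, so the terms
  cancel.\<close>

lemma alternating_J:
  assumes d: "diagram row col" and "f \<in> J (ps row)" "a \<in> F" "c \<in> F"
  shows "alternating col f a c = 0"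
  using assms(2) unfolding J_def
proof (induction rule: lin.induct)
  case (gen h)
  then obtain f g where h: "h = mm f g" "Inv f" "Inv g" and
    fg: "\<forall>a\<in>F. \<forall>\<rho>\<in>F. \<forall>b\<in>F. f a \<rho> \<noteq> 0 \<longrightarrow> g \<rho> b \<noteq> 0 \<longrightarrow> ps row < ps \<rho>"
    by (rule throughE)
  have "alternating col h a c = (\<Sum>\<sigma>\<in>col_group col. \<Sum>\<rho>\<in>F. f a \<rho> * (sign \<sigma> * g \<rho> (c \<circ> \<sigma>)))"
    by (simp add: alternating_def h(1) mm_def sum_distrib_left mult.left_commute)
  also have "\<dots> = (\<Sum>\<rho>\<in>F. \<Sum>\<sigma>\<in>col_group col. f a \<rho> * (sign \<sigma> * g \<rho> (c \<circ> \<sigma>)))" by (rule sum.swap)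
  also have "\<dots> = (\<Sum>\<rho>\<in>F. 0)"
  proof (rule sum.cong[OF refl])
    fix \<rho> assume \<rho>: "\<rho> \<in> F"
    show "(\<Sum>\<sigma>\<in>col_group col. f a \<rho> * (sign \<sigma> * g \<rho> (c \<circ> \<sigma>))) = 0"
    proof (cases "f a \<rho> = 0 \<or> (\<forall>b\<in>F. g \<rho> b = 0)")
      case True
      then show ?thesis using F_comp[OF assms(4)] by (auto simp: col_group_def intro!: sum.neutral)
    next
      case False
      then have "ps row < ps \<rho>" using fg \<rho> assms(3) by blast
      then obtain x y where xy: "x \<in> I" "y \<in> I" "x \<noteq> y" "col x = col y" "\<rho> x = \<rho> y"
        using column_repetition[OF d] by metis
      let ?t = "transpose x y"
      have t: "?t permutes I" using xy by (simp add: permutes_swap_id)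
      have \<rho>t: "\<rho> \<circ> ?t = \<rho>" using xy by (auto simp: transpose_def fun_eq_iff)
      have colt: "col (?t z) = col z" for z using xy by (auto simp: transpose_def)
      have bij: "bij_betw (\<lambda>\<sigma>. \<sigma> \<circ> ?t) (col_group col) (col_group col)"
        by (rule bij_betwI[where g = "\<lambda>\<sigma>. \<sigma> \<circ> ?t"])
          (use colt permutes_in_image[OF t] in \<open>auto simp: col_group_def o_assoc[symmetric] intro!: permutes_compose[OF t]\<close>)
      have "(\<Sum>\<sigma>\<in>col_group col. sign \<sigma> * g \<rho> (c \<circ> \<sigma>)) = (\<Sum>\<sigma>\<in>col_group col. sign (\<sigma> \<circ> ?t) * g \<rho> (c \<circ> (\<sigma> \<circ> ?t)))"
        by (rule sum.reindex_bij_betw[OF bij, symmetric])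
      also have "\<dots> = (\<Sum>\<sigma>\<in>col_group col. - (sign \<sigma> * g \<rho> (c \<circ> \<sigma>)))"
      proof (rule sum.cong[OF refl])
        fix \<sigma> assume "\<sigma> \<in> col_group col"
        then have s: "\<sigma> permutes I" by (simp add: col_group_def)
        have "g (\<rho> \<circ> ?t) ((c \<circ> \<sigma>) \<circ> ?t) = g \<rho> (c \<circ> \<sigma>)"
          using h(3) t \<rho> F_comp[OF assms(4) s] unfolding Inv_def by blast
        then have "g \<rho> (c \<circ> (\<sigma> \<circ> ?t)) = g \<rho> (c \<circ> \<sigma>)" by (simp add: \<rho>t o_assoc)
        moreover have "sign (\<sigma> \<circ> ?t) = - sign \<sigma>"
          using xy(3) by (simp add: sign_compose permutation_I s t sign_swap_id)
        ultimately show "sign (\<sigma> \<circ> ?t) * g \<rho> (c \<circ> (\<sigma> \<circ> ?t)) = - (sign \<sigma> * g \<rho> (c \<circ> \<sigma>))" by simp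
      qed
      finally have "(\<Sum>\<sigma>\<in>col_group col. sign \<sigma> * g \<rho> (c \<circ> \<sigma>)) = 0" by (simp add: sum_negf)
      then show ?thesis by (simp add: sum_distrib_left[symmetric])
    qed
  qed
  finally show ?case by simp
next
  case (eqv f g)
  have "alternating col g a c = alternating col f a c"
    unfolding alternating_def
    by (intro sum.cong refl) (use eqv.hyps assms(3) F_comp[OF assms(4)] in \<open>auto simp: col_group_def\<close>)
  then show ?case using eqv.IH by simp
qed (auto simp: alternating_def algebra_simps sum.distrib sum_distrib_left[symmetric])

text \<open>A column permutation that keeps the table preserves rows, because the letters of
  \<open>b\<close> determine the rows; preserving rows and columns, it is the identity.\<close>

lemma alternating_cont:
  assumes d: "diagram row col" and b: "b \<in> F" "\<forall>x\<in>I. \<forall>y\<in>I. b x = b y \<longrightarrow> row x = row y"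
  shows "alternating col (xi (cont row b)) row b = 1"
proof -
  have one: "\<sigma> = id" if s: "\<sigma> \<in> col_group col" "cont row (b \<circ> \<sigma>) = cont row b" for \<sigma>
  proof
    fix x
    show "\<sigma> x = id x"
    proof (cases "x \<in> I")
      case True
      have sx: "\<sigma> x \<in> I" using s(1) True permutes_in_image by (fastforce simp: col_group_def)
      have "card {z\<in>I. row z = row x \<and> b z = b (\<sigma> x)} = card {z\<in>I. row z = row x \<and> b (\<sigma> z) = b (\<sigma> x)}"
        using s(2) by (auto simp: cont_def fun_eq_iff)
      moreover have "card {z\<in>I. row z = row x \<and> b (\<sigma> z) = b (\<sigma> x)} \<noteq> 0"
        using True by auto
      ultimately have "{z\<in>I. row z = row x \<and> b z = b (\<sigma> x)} \<noteq> {}" by (metis card.empty)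
      then obtain z where "z \<in> I" "row z = row x" "b z = b (\<sigma> x)" by blast
      then have "row (\<sigma> x) = row x" using b(2) sx by metis
      moreover have "col (\<sigma> x) = col x" using s(1) True by (simp add: col_group_def)
      ultimately show ?thesis using d True sx by (auto simp: diagram_def)
    qed (use s in \<open>auto simp: col_group_def permutes_not_in\<close>)
  qed
  have "alternating col (xi (cont row b)) row b = (\<Sum>\<sigma>\<in>{id}. sign \<sigma> * xi (cont row b) row (b \<circ> \<sigma>))"
    unfolding alternating_def
  proof (rule sum.mono_neutral_right)
    show "{id} \<subseteq> col_group col" by (simp add: col_group_def permutes_id)
  qed (use one in \<open>auto simp: xi_def\<close>)
  then show ?thesis by (simp add: xi_def sign_id)
qed

text \<open>Entries of row \<open>k\<close> are at least \<open>k\<close> by column strictness; if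
  the weight equals the shape, counting leaves only equality. This is the unique semistandard
  tableau whose weight is its shape.\<close>

lemma semistd_diag:
  assumes "\<rho> \<in> F" "b \<in> F" "semistd \<rho> b" "ps \<rho> = ps b"
  shows "\<rho> = b"
proof -
  have ge: "\<forall>x\<in>I. \<rho> x = k \<longrightarrow> k \<le> b x" for k
  proof (induction k)
    case (Suc k)
    then have e: "{x\<in>I. \<rho> x = k \<and> b x < k} = {}" by auto
    have "card {x\<in>I. \<rho> x = Suc k \<and> b x \<le> k} \<le> card {x\<in>I. \<rho> x = k \<and> b x < k}"
      using assms(3) by (simp add: semistd_def)
    then have "card {x\<in>I. \<rho> x = Suc k \<and> b x \<le> k} = 0" unfolding e by simp
    then show ?case by (auto simp: not_less_eq_eq)
  qed simp
  have eq: "{x\<in>I. b x < q} = {x\<in>I. \<rho> x < q}" for q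
  proof (rule card_subset_eq)
    show "{x\<in>I. b x < q} \<subseteq> {x\<in>I. \<rho> x < q}" using ge by fastforce
    show "card {x\<in>I. b x < q} = card {x\<in>I. \<rho> x < q}" using assms(4) by (metis ps_def)
  qed simp
  show ?thesis
  proof (rule F_eqI[OF assms(1,2)])
    fix x assume "x \<in> I"
    then have "b x < q \<longleftrightarrow> \<rho> x < q" for q using eq[of q] by blast
    then show "\<rho> x = b x" by (metis nat_neq_iff)
  qed
qed

lemma cont_diag: "cont b b k l = (if k = l then card {x\<in>I. b x = k} else 0)"
  by (auto simp: cont_def)

text \<open>Modulo the dominating part, an invariant matrix of weight \<open>ps row\<close> on both sides is a multiple
  of the identity of that weight space; the column antisymmetriser reads off the factor.\<close>

lemma Inv_weight_reduce:
  assumes d: "diagram row col" and u: "ps row u = card I" "u < K" and "Inv f"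
    and f: "\<And>a b. a \<in> F \<Longrightarrow> b \<in> F \<Longrightarrow> f a b \<noteq> 0 \<Longrightarrow> ps a = ps row \<and> ps b = ps row"
  shows "(\<lambda>a b. f a b - alternating col f row row * xi (cont row row) a b) \<in> J (ps row)"
proof -
  have row: "row \<in> F" using d by (simp add: diagram_def)
  have "f \<in> lin (insert (xi (cont row row)) (lin (through (ps row))))"
  proof (rule Inv_expand[OF \<open>Inv f\<close>])
    fix N assume "\<exists>a\<in>F. \<exists>b\<in>F. cont a b = N \<and> f a b \<noteq> 0"
    then obtain a b where ab: "a \<in> F" "b \<in> F" "N = cont a b" "ps a = ps row" "ps b = ps row"
      using f by blast
    have "xi N \<in> lin ({xi (cont \<rho> b) |\<rho>. \<rho> \<in> F \<and> ps \<rho> = ps a \<and> semistd \<rho> b} \<union> J (ps a))"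
      unfolding ab(3) by (rule straighten) (use ab u in auto)
    then show "xi N \<in> lin (insert (xi (cont row row)) (lin (through (ps row))))"
    proof (rule lin_mono, intro subsetI)
      fix h assume h: "h \<in> {xi (cont \<rho> b) |\<rho>. \<rho> \<in> F \<and> ps \<rho> = ps a \<and> semistd \<rho> b} \<union> J (ps a)"
      have "cont b b = cont row row"
        using ab by (intro ext) (simp add: cont_diag card_level)
      from h have "h = xi (cont row row) \<or> h \<in> lin (through (ps row))"
      proof
        assume "h \<in> {xi (cont \<rho> b) |\<rho>. \<rho> \<in> F \<and> ps \<rho> = ps a \<and> semistd \<rho> b}"
        then obtain \<rho> where "h = xi (cont \<rho> b)" "\<rho> \<in> F" "ps \<rho> = ps a" "semistd \<rho> b" by blast
        \<comment> \<open>Straightening leaves semistandard words of equal shape and weight, hence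
          only the diagonal table.\<close>
        moreover have "\<rho> = b"
          by (rule semistd_diag[OF _ ab(2)]) (use calculation ab in auto)
        ultimately show ?thesis using \<open>cont b b = cont row row\<close> by simp
      qed (use ab in \<open>simp add: J_def\<close>)
      then show "h \<in> lin (insert (xi (cont row row)) (lin (through (ps row))))" by (auto intro: lin.gen)
    qed
  qed
  then obtain c where c: "(\<lambda>a b. f a b - c * xi (cont row row) a b) \<in> J (ps row)"
    unfolding J_def by (rule lin_insertE)
  have "alternating col (\<lambda>a b. f a b - c * xi (cont row row) a b) row row = 0"
    by (rule alternating_J[OF d c row row])
  then have "alternating col f row row = c * alternating col (xi (cont row row)) row row"
    by (simp add: alternating_def right_diff_distrib sum_subtractf sum_distrib_left mult.left_commute)
  then show ?thesis using c alternating_cont[OF d row] by simp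
qed

text \<open>After exchanging sums the scalar is the sum of \<open>H row l * W l\<close> over words
  \<open>l\<close>, where \<open>W\<close> collects the signed column sum. As \<zeta> fixes
  \<open>row\<close> and respects the relation of lying in one column, it normalises the column
  group and keeps signs, so \<open>l\<close> and \<open>l \<circ> \<zeta>\<close> give the same
  term. Modulo \<open>p\<close> only the words fixed by \<zeta> remain.\<close>

lemma dvd_alternating:
  assumes d: "diagram row col" and p: "prime p" and "Inv H"
    and z: "\<zeta> permutes I" "\<And>x. x \<in> I \<Longrightarrow> row (\<zeta> x) = row x" "(\<zeta> ^^ p) = id"
    and zc: "\<And>x y. x \<in> I \<Longrightarrow> y \<in> I \<Longrightarrow> col (\<zeta> x) = col (\<zeta> y) \<longleftrightarrow> col x = col y"
    and dvd: "\<And>l. l \<in> F \<Longrightarrow> l \<circ> \<zeta> = l \<Longrightarrow> int p dvd H row l"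
  shows "int p dvd alternating col (mm H (tr (xi N))) row row"
proof -
  have row: "row \<in> F" using d by (simp add: diagram_def)
  have rz: "row \<circ> \<zeta> = row" using z row by (intro F_eqI F_comp) auto
  define W where "W l = (\<Sum>\<sigma>\<in>col_group col. sign \<sigma> * xi N (row \<circ> \<sigma>) l)" for l
  have "alternating col (mm H (tr (xi N))) row row = (\<Sum>\<sigma>\<in>col_group col. \<Sum>l\<in>F. H row l * (sign \<sigma> * xi N (row \<circ> \<sigma>) l))"
    by (simp add: alternating_def mm_def tr_def sum_distrib_left mult.left_commute)
  also have "\<dots> = (\<Sum>l\<in>F. \<Sum>\<sigma>\<in>col_group col. H row l * (sign \<sigma> * xi N (row \<circ> \<sigma>) l))" by (rule sum.swap)
  also have "\<dots> = (\<Sum>l\<in>F. H row l * W l)" by (simp add: W_def sum_distrib_left)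
  finally have eq: "alternating col (mm H (tr (xi N))) row row = (\<Sum>l\<in>F. H row l * W l)" .
  have zi: "inv \<zeta> permutes I" using z(1) by (rule permutes_inv)
  have conj: "\<zeta> \<circ> \<sigma> \<circ> inv \<zeta> \<in> col_group col" if "\<sigma> \<in> col_group col" for \<sigma>
  proof -
    have s: "\<sigma> permutes I" "\<And>x. x \<in> I \<Longrightarrow> col (\<sigma> x) = col x" using that by (auto simp: col_group_def)
    have "col (\<zeta> (\<sigma> (inv \<zeta> x))) = col x" if "x \<in> I" for x
    proof -
      have i: "inv \<zeta> x \<in> I" using permutes_in_image[OF zi] that by simp
      moreover have "\<sigma> (inv \<zeta> x) \<in> I" using permutes_in_image[OF s(1)] i by simp
      ultimately have "col (\<zeta> (\<sigma> (inv \<zeta> x))) = col (\<zeta> (inv \<zeta> x))" using zc s(2) by blast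
      then show ?thesis by (simp add: permutes_inverses(1)[OF z(1)])
    qed
    then show ?thesis
      using permutes_compose[OF zi permutes_compose[OF s(1) z(1)]] by (simp add: col_group_def o_assoc)
  qed
  have conj': "inv \<zeta> \<circ> \<sigma> \<circ> \<zeta> \<in> col_group col" if "\<sigma> \<in> col_group col" for \<sigma>
  proof -
    have s: "\<sigma> permutes I" "\<And>x. x \<in> I \<Longrightarrow> col (\<sigma> x) = col x" using that by (auto simp: col_group_def)
    have "col (inv \<zeta> (\<sigma> (\<zeta> x))) = col x" if "x \<in> I" for x
    proof -
      have i: "\<zeta> x \<in> I" using permutes_in_image[OF z(1)] that by simp
      moreover have j: "\<sigma> (\<zeta> x) \<in> I" using permutes_in_image[OF s(1)] i by simp
      moreover have "inv \<zeta> (\<sigma> (\<zeta> x)) \<in> I" using permutes_in_image[OF zi] j by simp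
      ultimately show ?thesis using zc[of "inv \<zeta> (\<sigma> (\<zeta> x))" x] that s(2)[OF i]
        by (simp add: permutes_inverses(1)[OF z(1)])
    qed
    then show ?thesis
      using permutes_compose[OF z(1) permutes_compose[OF s(1) zi]] by (simp add: col_group_def o_assoc)
  qed
  have bij: "bij_betw (\<lambda>\<sigma>. \<zeta> \<circ> \<sigma> \<circ> inv \<zeta>) (col_group col) (col_group col)"
  proof (rule bij_betwI[where g = "\<lambda>\<sigma>. inv \<zeta> \<circ> \<sigma> \<circ> \<zeta>"])
    show "inv \<zeta> \<circ> (\<zeta> \<circ> \<sigma> \<circ> inv \<zeta>) \<circ> \<zeta> = \<sigma>" for \<sigma>
      by (simp add: fun_eq_iff permutes_inverses[OF z(1)])
    show "\<zeta> \<circ> (inv \<zeta> \<circ> \<sigma> \<circ> \<zeta>) \<circ> inv \<zeta> = \<sigma>" for \<sigma>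
      by (simp add: fun_eq_iff permutes_inverses[OF z(1)])
  qed (use conj conj' in auto)
  have Wz: "W (l \<circ> \<zeta>) = W l" if l: "l \<in> F" for l
  proof -
    have "W l = (\<Sum>\<sigma>\<in>col_group col. sign (\<zeta> \<circ> \<sigma> \<circ> inv \<zeta>) * xi N (row \<circ> (\<zeta> \<circ> \<sigma> \<circ> inv \<zeta>)) l)"
      unfolding W_def by (rule sum.reindex_bij_betw[OF bij, symmetric])
    also have "\<dots> = W (l \<circ> \<zeta>)" unfolding W_def
    proof (rule sum.cong[OF refl])
      fix \<sigma> assume "\<sigma> \<in> col_group col"
      then have s: "\<sigma> permutes I" by (simp add: col_group_def)
      have sg: "sign (\<zeta> \<circ> \<sigma> \<circ> inv \<zeta>) = sign \<sigma>"
        using s z(1) zi by (simp add: sign_compose permutation_I permutation_compose sign_inverse)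
      have "row \<circ> (\<zeta> \<circ> \<sigma> \<circ> inv \<zeta>) = row \<circ> \<sigma> \<circ> inv \<zeta>" by (simp add: o_assoc rz)
      moreover have "xi N (row \<circ> \<sigma>) (l \<circ> \<zeta>) = xi N (row \<circ> \<sigma> \<circ> inv \<zeta>) l"
      proof -
        have "(row \<circ> \<sigma> \<circ> inv \<zeta>) \<circ> \<zeta> = row \<circ> \<sigma>"
          by (simp add: o_assoc[symmetric] permutes_inv_o[OF z(1)])
        then show ?thesis
          using Inv_xi[of N, unfolded Inv_def] z(1) l F_comp[OF F_comp[OF row s] zi] by metis
      qed
      ultimately show "sign (\<zeta> \<circ> \<sigma> \<circ> inv \<zeta>) * xi N (row \<circ> (\<zeta> \<circ> \<sigma> \<circ> inv \<zeta>)) l = sign \<sigma> * xi N (row \<circ> \<sigma>) (l \<circ> \<zeta>)"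
        using sg by simp
    qed
    finally show ?thesis by simp
  qed
  have pow: "((\<lambda>l. l \<circ> \<zeta>) ^^ n) l = l \<circ> (\<zeta> ^^ n)" for l :: "nat \<Rightarrow> nat" and n
    by (induction n) (simp_all add: o_assoc[symmetric] funpow_swap1[symmetric] fun_eq_iff)
  show ?thesis unfolding eq
  proof (rule dvd_sum_cyclic_action[OF p finite_F, where T = "\<lambda>l. l \<circ> \<zeta>"])
    fix l assume l: "l \<in> F"
    show "l \<circ> \<zeta> \<in> F" using l z(1) by (rule F_comp)
    show "((\<lambda>l. l \<circ> \<zeta>) ^^ p) l = l" by (simp add: pow z(3))
    have "H row (l \<circ> \<zeta>) = H row l" using \<open>Inv H\<close> z(1) row l rz unfolding Inv_def by metis
    then show "H row (l \<circ> \<zeta>) * W (l \<circ> \<zeta>) = H row l * W l" using Wz[OF l] by simp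
    show "int p dvd H row l * W l" if "l \<circ> \<zeta> = l" using dvd[OF l that] by simp
  qed
qed

end

section \<open>Blocks and Young subgroups\<close>

lemma sum_list_take_mono: "k \<le> k' \<Longrightarrow> sum_list (take k \<mu>) \<le> sum_list (take k' (\<mu> :: nat list))"
  by (metis le_add1 le_iff_add sum_list.append take_add)

lemma sum_list_take_Suc: "k < length \<mu> \<Longrightarrow> sum_list (take (Suc k) \<mu>) = sum_list (take k \<mu>) + (\<mu> ! k :: nat)"
  by (simp add: take_Suc_conv_app_nth)

lemma block_disjoint:
  assumes "x \<in> block \<mu> j" "x \<in> block \<mu> j'" "1 \<le> j" "1 \<le> j'"
  shows "j = j'"
proof (rule ccontr)
  assume "j \<noteq> j'"
  then consider "j \<le> j' - 1" | "j' \<le> j - 1" using assms(3,4) by linarith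
  then show False
    using assms sum_list_take_mono[of j "j' - 1" \<mu>] sum_list_take_mono[of j' "j - 1" \<mu>]
    by cases (auto simp: block_def)
qed

lemma block_number_unique:
  assumes "x \<in> block \<mu> j" "j \<in> {1..length \<mu>}"
  shows "block_number \<mu> x = j"
  unfolding block_number_def using assms block_disjoint[of x \<mu>] by (intro the_equality) auto

lemma block_exists:
  assumes "x \<in> {1..sum_list \<mu>}"
  obtains j where "j \<in> {1..length \<mu>}" "x \<in> block \<mu> j"
proof -
  define j where "j = (LEAST j. x \<le> sum_list (take j \<mu>))"
  have ex: "x \<le> sum_list (take (length \<mu>) \<mu>)" using assms by simp
  have j: "x \<le> sum_list (take j \<mu>)" unfolding j_def using ex by (rule LeastI)
  have "j \<noteq> 0" using j assms by (metis atLeastAtMost_iff not_one_le_zero le_zero_eq sum_list.Nil take0)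
  then have "\<not> x \<le> sum_list (take (j - 1) \<mu>)"
    using not_less_Least[of "j - 1" "\<lambda>j. x \<le> sum_list (take j \<mu>)"] unfolding j_def by simp
  moreover have "j \<le> length \<mu>" unfolding j_def using ex by (rule Least_le)
  ultimately show thesis using that[of j] j \<open>j \<noteq> 0\<close> by (auto simp: block_def)
qed

lemma block_number_in:
  assumes "x \<in> {1..sum_list \<mu>}"
  shows "block_number \<mu> x \<in> {1..length \<mu>}" "x \<in> block \<mu> (block_number \<mu> x)"
  using block_exists[OF assms] block_number_unique by metis+

lemma block_subset: "block \<mu> j \<subseteq> {1..sum_list \<mu>}"
  using sum_list_take_mono[of j "max j (length \<mu>)" \<mu>] by (auto simp: block_def)

lemma block_number_eq_iff:
  assumes "x \<in> {1..sum_list \<mu>}" "j \<in> {1..length \<mu>}"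
  shows "block_number \<mu> x = j \<longleftrightarrow> x \<in> block \<mu> j"
  using block_number_unique[OF _ assms(2)] block_number_in[OF assms(1)] by blast

lemma block_number_mono:
  assumes "x \<in> {1..sum_list \<mu>}" "y \<in> {1..sum_list \<mu>}" "x \<le> y"
  shows "block_number \<mu> x \<le> block_number \<mu> y"
proof (rule ccontr)
  assume "\<not> ?thesis"
  then have "sum_list (take (block_number \<mu> y) \<mu>) \<le> sum_list (take (block_number \<mu> x - 1) \<mu>)"
    by (intro sum_list_take_mono) simp
  then show False using block_number_in(2)[OF assms(1)] block_number_in(2)[OF assms(2)] assms(3)
    by (auto simp: block_def)
qed

lemma card_block: "j \<in> {1..length \<mu>} \<Longrightarrow> card (block \<mu> j) = \<mu> ! (j - 1)"
  using sum_list_take_Suc[of "j - 1" \<mu>] by (auto simp: block_def)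

lemma young_iff:
  "\<sigma> \<in> young \<mu> \<longleftrightarrow> \<sigma> permutes {1..sum_list \<mu>} \<and> (\<forall>x\<in>{1..sum_list \<mu>}. block_number \<mu> (\<sigma> x) = block_number \<mu> x)"
proof (intro iffI conjI ballI)
  assume s: "\<sigma> \<in> young \<mu>"
  then show "\<sigma> permutes {1..sum_list \<mu>}" by (simp add: young_def)
  fix x assume x: "x \<in> {1..sum_list \<mu>}"
  have "\<sigma> x \<in> \<sigma> ` block \<mu> (block_number \<mu> x)" using block_number_in(2)[OF x] by blast
  also have "\<dots> = block \<mu> (block_number \<mu> x)" using s block_number_in(1)[OF x] by (simp add: young_def)
  finally show "block_number \<mu> (\<sigma> x) = block_number \<mu> x"
    using block_number_in(1)[OF x] by (rule block_number_unique)
next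
  assume s: "\<sigma> permutes {1..sum_list \<mu>} \<and> (\<forall>x\<in>{1..sum_list \<mu>}. block_number \<mu> (\<sigma> x) = block_number \<mu> x)"
  have "\<sigma> ` block \<mu> j = block \<mu> j" if j: "j \<in> {1..length \<mu>}" for j
  proof (rule card_subset_eq)
    show "\<sigma> ` block \<mu> j \<subseteq> block \<mu> j"
    proof
      fix y assume "y \<in> \<sigma> ` block \<mu> j"
      then obtain x where x: "x \<in> block \<mu> j" "y = \<sigma> x" by blast
      have xr: "x \<in> {1..sum_list \<mu>}" using x(1) block_subset by blast
      have y: "y \<in> {1..sum_list \<mu>}" using permutes_in_image[OF conjunct1[OF s]] xr x(2) by blast
      have "block_number \<mu> y = block_number \<mu> x" using s xr x(2) by blast
      also have "\<dots> = j" using block_number_unique[OF x(1) j] .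
      finally show "y \<in> block \<mu> j" using block_number_eq_iff[OF y j] by blast
    qed
    show "card (\<sigma> ` block \<mu> j) = card (block \<mu> j)"
      using s by (intro card_image permutes_inj_on) auto
  qed (simp add: block_def)
  then show "\<sigma> \<in> young \<mu>" using s by (simp add: young_def)
qed

lemma young_permutes: "\<sigma> \<in> young \<mu> \<Longrightarrow> \<sigma> permutes {1..sum_list \<mu>}"
  by (simp add: young_def)

lemma young_block_number: "\<sigma> \<in> young \<mu> \<Longrightarrow> x \<in> {1..sum_list \<mu>} \<Longrightarrow> block_number \<mu> (\<sigma> x) = block_number \<mu> x"
  by (simp add: young_iff)

lemma young_id [simp]: "id \<in> young \<mu>"
  by (simp add: young_iff permutes_id)

lemma finite_young [simp]: "finite (young \<mu>)"
  by (rule finite_subset[OF _ finite_permutations[of "{1..sum_list \<mu>}"]]) (auto simp: young_def)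

text \<open>Complements of sets with equal block counts again have equal block counts, so the given
  bijection can be completed block by block.\<close>

lemma young_extend:
  assumes "C \<subseteq> {1..sum_list \<mu>}" "C' \<subseteq> {1..sum_list \<mu>}" "bij_betw g C C'"
    and "\<And>x. x \<in> C \<Longrightarrow> block_number \<mu> (g x) = block_number \<mu> x"
  obtains \<rho> where "\<rho> \<in> young \<mu>" "\<And>x. x \<in> C \<Longrightarrow> \<rho> x = g x"
proof -
  let ?A = "{1..sum_list \<mu>}" and ?h = "block_number \<mu>"
  have cnt: "card {x\<in>?A - C. ?h x = l} = card {x\<in>?A - C'. ?h x = l}" for l
  proof -
    have "bij_betw g {x\<in>C. ?h x = l} {x\<in>C'. ?h x = l}"
      using assms(3,4) by (auto simp: bij_betw_def inj_on_def image_iff)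
    then have 1: "card {x\<in>C. ?h x = l} = card {x\<in>C'. ?h x = l}" by (rule bij_betw_same_card)
    have 2: "card {x\<in>?A - B. ?h x = l} = card {x\<in>?A. ?h x = l} - card {x\<in>B. ?h x = l}" if "B \<subseteq> ?A" for B
    proof -
      have "{x\<in>?A - B. ?h x = l} = {x\<in>?A. ?h x = l} - {x\<in>B. ?h x = l}" by auto
      then show ?thesis using that by (simp add: card_Diff_subset[OF finite_subset[of _ ?A]] subset_iff)
    qed
    show ?thesis using 1 2[OF assms(1)] 2[OF assms(2)] by simp
  qed
  obtain g' where g': "bij_betw g' (?A - C) (?A - C')" "\<And>x. x \<in> ?A - C \<Longrightarrow> ?h (g' x) = ?h x"
    using bij_betw_same_label_counts[of "?A - C" "?A - C'" ?h ?h] cnt by auto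
  define f where "f x = (if x \<in> C then g x else g' x)" for x
  have "bij_betw f (C \<union> (?A - C)) (C' \<union> (?A - C'))"
  proof (rule bij_betw_combine)
    show "bij_betw f C C'" using assms(3) by (simp add: f_def cong: bij_betw_cong)
    have "bij_betw f (?A - C) (?A - C') \<longleftrightarrow> bij_betw g' (?A - C) (?A - C')"
      by (rule bij_betw_cong) (auto simp: f_def)
    then show "bij_betw f (?A - C) (?A - C')" using g' by blast
  qed auto
  then have "bij_betw f ?A ?A" using assms(1,2) by (simp add: Un_absorb1)
  from bij_betw_permutes_extend[OF this] have p: "(\<lambda>x. if x \<in> ?A then f x else x) permutes ?A" .
  show thesis
  proof (rule that[of "\<lambda>x. if x \<in> ?A then f x else x"])
    show "(\<lambda>x. if x \<in> ?A then f x else x) \<in> young \<mu>"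
      using p assms(4) g'(2) by (auto simp: young_iff f_def)
  qed (use assms(1) in \<open>auto simp: f_def\<close>)
qed

text \<open>A weakly increasing function is determined by its fibre sizes: its fibres are the
  consecutive blocks of \<kappa>. Thus the types of tableaux, given by the compositions of orbits,
  can be read through the labels of points.\<close>

lemma block_number_fibre_sizes:
  fixes h :: "nat \<Rightarrow> nat"
  assumes h: "\<And>x. x \<in> {1..i} \<Longrightarrow> h x \<in> {1..N}"
    and mono: "\<And>x y. x \<in> {1..i} \<Longrightarrow> y \<in> {1..i} \<Longrightarrow> x \<le> y \<Longrightarrow> h x \<le> h y"
    and \<kappa>: "\<kappa> = map (\<lambda>l. card {x\<in>{1..i}. h x = l}) [1..<Suc N]"
  shows "sum_list \<kappa> = i" "x \<in> {1..i} \<Longrightarrow> block_number \<kappa> x = h x"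
proof -
  have take: "sum_list (take k \<kappa>) = card {x\<in>{1..i}. h x \<le> k}" if "k \<le> N" for k
    using that
  proof (induction k)
    case 0
    have "{x\<in>{1..i}. h x \<le> 0} = {}" using h by fastforce
    then show ?case by (simp only: take0 sum_list.Nil card.empty)
  next
    case (Suc k)
    have "{x\<in>{1..i}. h x \<le> Suc k} = {x\<in>{1..i}. h x \<le> k} \<union> {x\<in>{1..i}. h x = Suc k}" by auto
    then have "card {x\<in>{1..i}. h x \<le> Suc k} = card {x\<in>{1..i}. h x \<le> k} + card {x\<in>{1..i}. h x = Suc k}"
      by (subst card_Un_disjoint[symmetric]) (auto simp: disjoint_iff)
    moreover have "\<kappa> ! k = card {x\<in>{1..i}. h x = Suc k}" using Suc.prems by (simp add: \<kappa> del: upt_Suc)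
    ultimately show ?case using Suc by (simp add: sum_list_take_Suc \<kappa> del: upt_Suc)
  qed
  have len: "length \<kappa> = N" by (simp add: \<kappa>)
  have "{x\<in>{1..i}. h x \<le> N} = {1..i}" using h by auto
  then show "sum_list \<kappa> = i" using take[of N] by (simp add: len)
  assume x: "x \<in> {1..i}"
  have hx: "h x \<in> {1..N}" using h x .
  \<comment> \<open>Monotonicity makes the elements with \<open>h \<le> k\<close> an initial
    segment, so membership is a comparison with their number.\<close>
  have init: "y \<in> {1..i} \<Longrightarrow> h y \<le> k \<longleftrightarrow> y \<le> card {x\<in>{1..i}. h x \<le> k}" for y k
  proof -
    assume y: "y \<in> {1..i}"
    show ?thesis
    proof
      assume "h y \<le> k"
      have "h z \<le> k" if "z \<in> {1..y}" for z
        using mono[of z y] that y \<open>h y \<le> k\<close> by auto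
      then have "{1..y} \<subseteq> {x\<in>{1..i}. h x \<le> k}" using y by auto
      from card_mono[OF _ this] show "y \<le> card {x\<in>{1..i}. h x \<le> k}" by simp
    next
      assume le: "y \<le> card {x\<in>{1..i}. h x \<le> k}"
      show "h y \<le> k"
      proof (rule ccontr)
        assume n: "\<not> h y \<le> k"
        have "{x\<in>{1..i}. h x \<le> k} \<subseteq> {1..<y}"
        proof
          fix z assume z: "z \<in> {x\<in>{1..i}. h x \<le> k}"
          then have "\<not> y \<le> z" using mono[of y z] y n by auto
          then show "z \<in> {1..<y}" using z by auto
        qed
        from card_mono[OF _ this] show False using le y by auto
      qed
    qed
  qed
  have "x \<in> block \<kappa> (h x)"
    using hx init[OF x, of "h x"] init[OF x, of "h x - 1"] take[of "h x"] take[of "h x - 1"]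
    by (auto simp: block_def)
  then show "block_number \<kappa> x = h x" using hx len by (intro block_number_unique) auto
qed

section \<open>Subsets and their orbits\<close>

lemma phi_bij:
  assumes "finite C"
  shows "bij_betw (phi C) {1..card C} C"
proof -
  have "bij_betw ((!) (sorted_list_of_set C)) {..<card C} C"
    using assms by (intro bij_betw_nth) auto
  moreover have "bij_betw (\<lambda>j. j - 1) {1..card C} {..<card C}"
    by (rule bij_betwI[where g = Suc]) auto
  ultimately have "bij_betw ((!) (sorted_list_of_set C) \<circ> (\<lambda>j. j - 1)) {1..card C} C"
    by (rule bij_betw_trans[rotated])
  then show ?thesis by (rule bij_betw_cong[THEN iffD1, rotated]) (simp add: phi_def)
qed

lemma phi_less:
  assumes "j \<in> {1..card C}" "j' \<in> {1..card C}" "j < j'" "finite C"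
  shows "phi C j < phi C j'"
  using assms strict_sorted_list_of_set[of C] unfolding phi_def
  by (auto simp: sorted_wrt_iff_nth_less)

lemma phi_in: "finite C \<Longrightarrow> j \<in> {1..card C} \<Longrightarrow> phi C j \<in> C"
  using bij_betwE[OF phi_bij] by blast

text \<open>Existence and uniqueness behind \<open>THE\<close>, by splitting off the least
  element.\<close>

lemma enumeration_props:
  assumes "finite A"
    and "\<And>x. x \<in> A \<Longrightarrow> \<not> lt x x"
    and "\<And>x y z. x \<in> A \<Longrightarrow> y \<in> A \<Longrightarrow> z \<in> A \<Longrightarrow> lt x y \<Longrightarrow> lt y z \<Longrightarrow> lt x z"
    and "\<And>x y. x \<in> A \<Longrightarrow> y \<in> A \<Longrightarrow> x \<noteq> y \<Longrightarrow> lt x y \<or> lt y x"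
  shows "set (enumeration lt A) = A" "distinct (enumeration lt A)" "sorted_wrt lt (enumeration lt A)"
proof -
  let ?P = "\<lambda>A xs. set xs = A \<and> distinct xs \<and> sorted_wrt lt xs"
  have "\<exists>!xs. ?P A xs" using assms
  proof (induction A rule: finite_psubset_induct)
    case (psubset A)
    show ?case
    proof (cases "A = {}")
      case False
      have "\<exists>m\<in>A. \<forall>x\<in>A. x \<noteq> m \<longrightarrow> \<not> lt x m"
      proof (rule Finite_Set.bex_min_element[OF psubset.hyps _ _ False])
        show "asymp_on A lt" by (rule asymp_onI) (use psubset.prems(1,2) in blast)
        show "transp_on A lt" by (rule transp_onI) (use psubset.prems(2) in blast)
      qed
      then obtain m where m: "m \<in> A" "\<And>y. y \<in> A \<Longrightarrow> y \<noteq> m \<Longrightarrow> lt m y"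
        using psubset.prems(3) by metis
      have "\<exists>!xs. ?P (A - {m}) xs"
      proof (rule psubset.IH)
        show "A - {m} \<subset> A" using m(1) by blast
      qed (use psubset.prems in blast)+
      then obtain xs where xs: "?P (A - {m}) xs" and uniq: "\<forall>ys. ?P (A - {m}) ys \<longrightarrow> ys = xs"
        by (rule ex1E)
      show ?thesis
      proof (rule ex1I[of _ "m # xs"])
        show "?P A (m # xs)" using xs m by auto
        fix ys assume ys: "?P A ys"
        then obtain z zs where z: "ys = z # zs" using False by (cases ys) auto
        have "z = m"
        proof (rule ccontr)
          assume "z \<noteq> m"
          then have "m \<in> set zs" "z \<in> A" using ys z m(1) by auto
          then have "lt z m" "lt m z" using ys z m(2) \<open>z \<noteq> m\<close> by auto
          then show False using psubset.prems(1,2) m(1) \<open>z \<in> A\<close> by blast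
        qed
        then show "ys = m # xs" using uniq[rule_format, of zs] ys z by auto
      qed
    qed auto
  qed
  then have "?P A (enumeration lt A)" unfolding enumeration_def by (rule theI')
  then show "set (enumeration lt A) = A" "distinct (enumeration lt A)" "sorted_wrt lt (enumeration lt A)"
    by auto
qed

text \<open>Block content of a subset. It is a complete invariant for the Young group
  (\<open>subset_orbit_iff\<close>) and carries the same information as
  \<open>block_string\<close>.\<close>

definition cnt :: "nat list \<Rightarrow> nat set \<Rightarrow> nat \<Rightarrow> nat" where
  "cnt \<nu> d l = card {x\<in>d. block_number \<nu> x = l}"

definition oidx :: "nat list \<Rightarrow> nat set \<Rightarrow> nat" where
  "oidx \<nu> d = (THE j. j \<in> {1..length (subset_orbits \<nu>)} \<and> d \<in> subset_orbits \<nu> ! (j - 1))"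

lemma count_mset_map_distinct:
  "distinct xs \<Longrightarrow> count (mset (map f xs)) l = card {x\<in>set xs. f x = l}"
  by (induction xs) (auto simp: Collect_conj_eq insert_compr[symmetric] intro!: arg_cong[of _ _ card]
      simp flip: card_insert_disjoint)

lemma sorted_map_block_number:
  assumes "d \<subseteq> {1..sum_list \<nu>}"
  shows "sorted (map (block_number \<nu>) (sorted_list_of_set d))"
  unfolding sorted_map
proof (rule sorted_wrt_mono_rel[OF _ sorted_sorted_list_of_set])
  have "finite d" using assms finite_subset by blast
  fix x y assume "x \<in> set (sorted_list_of_set d)" "y \<in> set (sorted_list_of_set d)" "x \<le> y"
  then show "block_number \<nu> x \<le> block_number \<nu> y"
    using assms \<open>finite d\<close> by (intro block_number_mono) auto
qed

text \<open>The padding zeros are not block numbers, so removing them recovers the sorted list of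
  block numbers, that is, the block content.\<close>

lemma block_string_eq_iff:
  assumes d: "d \<subseteq> {1..sum_list \<nu>}" "d' \<subseteq> {1..sum_list \<nu>}"
  shows "block_string \<nu> d = block_string \<nu> d' \<longleftrightarrow> cnt \<nu> d = cnt \<nu> d'"
proof -
  let ?m = "\<lambda>d. map (block_number \<nu>) (sorted_list_of_set d)"
  have fin: "finite d" "finite d'" using d finite_subset by blast+
  have cnt: "count (mset (?m e)) = cnt \<nu> e" if "finite e" for e
    using that by (intro ext, subst count_mset_map_distinct) (auto simp: cnt_def)
  have nz: "filter (\<lambda>x. x \<noteq> 0) (block_string \<nu> e) = ?m e" if "e \<subseteq> {1..sum_list \<nu>}" for e
  proof -
    have "finite e" using that finite_subset by blast
    then have "block_number \<nu> x \<noteq> 0" if "x \<in> set (sorted_list_of_set e)" for x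
      using block_number_in(1)[of x \<nu>] that \<open>e \<subseteq> {1..sum_list \<nu>}\<close> by fastforce
    then show ?thesis by (auto simp: block_string_def filter_empty_conv)
  qed
  show ?thesis
  proof
    assume "block_string \<nu> d = block_string \<nu> d'"
    then have "?m d = ?m d'" using nz d by metis
    then show "cnt \<nu> d = cnt \<nu> d'" using cnt fin by metis
  next
    assume "cnt \<nu> d = cnt \<nu> d'"
    then have ms: "mset (?m d) = mset (?m d')" using cnt fin by (metis count_inverse)
    then have "?m d = ?m d'"
      using properties_for_sort[OF ms sorted_map_block_number[OF d(1)]] sorted_map_block_number[OF d(2)]
      by (simp add: sorted_sort_id)
    moreover have "card d = card d'" using arg_cong[OF ms, of size] fin by simp
    ultimately show "block_string \<nu> d = block_string \<nu> d'" by (simp add: block_string_def)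
  qed
qed

lemma cnt_bij:
  assumes "bij_betw g d d'" "\<And>x. x \<in> d \<Longrightarrow> block_number \<nu> (g x) = block_number \<nu> x"
  shows "cnt \<nu> d = cnt \<nu> d'"
proof
  fix l
  have "bij_betw g {x\<in>d. block_number \<nu> x = l} {x\<in>d'. block_number \<nu> x = l}"
    using assms by (auto simp: bij_betw_def inj_on_def image_iff)
  then show "cnt \<nu> d l = cnt \<nu> d' l" unfolding cnt_def by (rule bij_betw_same_card)
qed

lemma cnt_eq_bij:
  assumes "cnt \<nu> d = cnt \<nu> d'" "finite d" "finite d'"
  obtains g where "bij_betw g d d'" "\<And>x. x \<in> d \<Longrightarrow> block_number \<nu> (g x) = block_number \<nu> x"
  using bij_betw_same_label_counts[OF assms(2,3), of "block_number \<nu>" "block_number \<nu>"] assms(1)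
  unfolding cnt_def fun_eq_iff by blast

lemma subset_orbit_iff:
  assumes "d \<subseteq> {1..sum_list \<nu>}"
  shows "d' \<in> subset_orbit \<nu> d \<longleftrightarrow> d' \<subseteq> {1..sum_list \<nu>} \<and> cnt \<nu> d' = cnt \<nu> d"
proof
  assume "d' \<in> subset_orbit \<nu> d"
  then obtain \<pi> where \<pi>: "\<pi> \<in> young \<nu>" "d' = \<pi> -` d" by (auto simp: subset_orbit_def)
  note p = young_permutes[OF \<pi>(1)]
  have sub: "d' \<subseteq> {1..sum_list \<nu>}"
    using assms permutes_in_image[OF p] \<pi>(2) by blast
  have "bij_betw \<pi> d' d"
    unfolding \<pi>(2) bij_betw_def using permutes_inj_on[OF p] permutes_surj[OF p] by (simp add: surj_image_vimage_eq)
  then have "cnt \<nu> d' = cnt \<nu> d"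
    by (rule cnt_bij) (use sub young_block_number[OF \<pi>(1)] in blast)
  then show "d' \<subseteq> {1..sum_list \<nu>} \<and> cnt \<nu> d' = cnt \<nu> d" using sub by blast
next
  assume d': "d' \<subseteq> {1..sum_list \<nu>} \<and> cnt \<nu> d' = cnt \<nu> d"
  have fin: "finite d" "finite d'" using assms d' finite_subset by blast+
  obtain g where g: "bij_betw g d' d" "\<And>x. x \<in> d' \<Longrightarrow> block_number \<nu> (g x) = block_number \<nu> x"
    using cnt_eq_bij[of \<nu> d' d] d' fin by metis
  obtain \<rho> where \<rho>: "\<rho> \<in> young \<nu>" "\<And>x. x \<in> d' \<Longrightarrow> \<rho> x = g x"
    using young_extend[OF _ assms g] d' by metis
  have "\<rho> ` d' = d" using \<rho>(2) bij_betw_imp_surj_on[OF g(1)] by auto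
  moreover have "\<rho> -` (\<rho> ` d') = d'"
    using permutes_inj[OF young_permutes[OF \<rho>(1)]] by (rule inj_vimage_image_eq)
  ultimately show "d' \<in> subset_orbit \<nu> d" using \<rho>(1) unfolding subset_orbit_def by blast
qed

lemma subset_orbit_self: "d \<in> subset_orbit \<nu> d"
  unfolding subset_orbit_def using young_id by (metis (mono_tags, lifting) mem_Collect_eq vimage_id id_apply)

lemma subset_orbit_eq_iff:
  assumes "d \<subseteq> {1..sum_list \<nu>}" "d' \<subseteq> {1..sum_list \<nu>}"
  shows "subset_orbit \<nu> d = subset_orbit \<nu> d' \<longleftrightarrow> cnt \<nu> d = cnt \<nu> d'"
  using subset_orbit_iff[OF assms(1)] subset_orbit_iff[OF assms(2)] assms by (metis set_eqI)

lemma orbit_less_iff: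
  assumes "d \<subseteq> {1..sum_list \<nu>}" "d' \<subseteq> {1..sum_list \<nu>}"
  shows "orbit_less \<nu> (subset_orbit \<nu> d) (subset_orbit \<nu> d') \<longleftrightarrow>
    ord_class.lexordp (block_string \<nu> d) (block_string \<nu> d')"
proof -
  have "block_string \<nu> e = block_string \<nu> d" if "e \<in> subset_orbit \<nu> d" for e
    using that block_string_eq_iff[of e \<nu> d] subset_orbit_iff[OF assms(1)] assms(1) by blast
  moreover have "block_string \<nu> e = block_string \<nu> d'" if "e \<in> subset_orbit \<nu> d'" for e
    using that block_string_eq_iff[of e \<nu> d'] subset_orbit_iff[OF assms(2)] assms(2) by blast
  ultimately show ?thesis unfolding orbit_less_def using subset_orbit_self by metis
qed

lemma subset_orbits_props:
  "set (subset_orbits \<nu>) = subset_orbit \<nu> ` Pow {1..sum_list \<nu>}"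
  "distinct (subset_orbits \<nu>)" "sorted_wrt (orbit_less \<nu>) (subset_orbits \<nu>)"
proof -
  let ?A = "subset_orbit \<nu> ` Pow {1..sum_list \<nu>}"
  have fin: "finite ?A" by simp
  have 1: "\<not> orbit_less \<nu> Q Q" if "Q \<in> ?A" for Q
    using that by (auto simp: orbit_less_iff lexordp_irreflexive')
  have 2: "orbit_less \<nu> Q R" if "Q \<in> ?A" "P \<in> ?A" "R \<in> ?A" "orbit_less \<nu> Q P" "orbit_less \<nu> P R" for Q P R
    using that by (auto simp: orbit_less_iff intro: lexordp_trans)
  have 3: "orbit_less \<nu> Q P \<or> orbit_less \<nu> P Q" if h: "Q \<in> ?A" "P \<in> ?A" "Q \<noteq> P" for Q P
  proof -
    obtain d where d1: "Q = subset_orbit \<nu> d" "d \<in> Pow {1..sum_list \<nu>}" using h(1) by (rule imageE)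
    obtain d' where d2: "P = subset_orbit \<nu> d'" "d' \<in> Pow {1..sum_list \<nu>}" using h(2) by (rule imageE)
    note d = PowD[OF d1(2)] PowD[OF d2(2)] d1(1) d2(1)
    have "block_string \<nu> d \<noteq> block_string \<nu> d'"
      using h(3) unfolding d(3,4) subset_orbit_eq_iff[OF d(1,2)] block_string_eq_iff[OF d(1,2)] .
    then show ?thesis unfolding d(3,4) orbit_less_iff[OF d(1,2)] orbit_less_iff[OF d(2,1)]
      using lexordp_linear by blast
  qed
  show "set (subset_orbits \<nu>) = ?A" "distinct (subset_orbits \<nu>)" "sorted_wrt (orbit_less \<nu>) (subset_orbits \<nu>)"
    unfolding subset_orbits_def by (rule enumeration_props[OF fin]; fact 1 2 3)+
qed

lemma oidx_props:
  assumes "d \<subseteq> {1..sum_list \<nu>}"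
  shows "oidx \<nu> d \<in> {1..length (subset_orbits \<nu>)}" "subset_orbits \<nu> ! (oidx \<nu> d - 1) = subset_orbit \<nu> d"
proof -
  let ?P = "\<lambda>j. j \<in> {1..length (subset_orbits \<nu>)} \<and> d \<in> subset_orbits \<nu> ! (j - 1)"
  have "subset_orbit \<nu> d \<in> set (subset_orbits \<nu>)" using assms by (auto simp: subset_orbits_props)
  then obtain k where k: "k < length (subset_orbits \<nu>)" "subset_orbits \<nu> ! k = subset_orbit \<nu> d"
    by (auto simp: in_set_conv_nth)
  have Pk: "?P (Suc k)" using k subset_orbit_self by auto
  have "j = Suc k" if j: "?P j" for j
  proof -
    have "subset_orbits \<nu> ! (j - 1) \<in> set (subset_orbits \<nu>)" using j by (intro nth_mem) auto
    then obtain e where e: "e \<subseteq> {1..sum_list \<nu>}" "subset_orbits \<nu> ! (j - 1) = subset_orbit \<nu> e"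
      by (auto simp: subset_orbits_props)
    then have "subset_orbit \<nu> e = subset_orbit \<nu> d"
      using j subset_orbit_iff[OF e(1)] subset_orbit_eq_iff[OF e(1) assms] by metis
    then have "subset_orbits \<nu> ! (j - 1) = subset_orbits \<nu> ! k" using e k by simp
    moreover have "j - 1 < length (subset_orbits \<nu>)" using j by auto
    ultimately have "j - 1 = k" using nth_eq_iff_index_eq[OF subset_orbits_props(2)] k(1) by blast
    then show ?thesis using j by auto
  qed
  then have "oidx \<nu> d = Suc k" unfolding oidx_def using Pk by (intro the_equality)
  then show "oidx \<nu> d \<in> {1..length (subset_orbits \<nu>)}" "subset_orbits \<nu> ! (oidx \<nu> d - 1) = subset_orbit \<nu> d"
    using k by auto
qed

lemma oidx_eq_iff:
  assumes "d \<subseteq> {1..sum_list \<nu>}" "d' \<subseteq> {1..sum_list \<nu>}"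
  shows "oidx \<nu> d = oidx \<nu> d' \<longleftrightarrow> cnt \<nu> d = cnt \<nu> d'"
proof -
  have "oidx \<nu> d = oidx \<nu> d' \<longleftrightarrow> oidx \<nu> d - 1 = oidx \<nu> d' - 1"
    using oidx_props(1)[OF assms(1)] oidx_props(1)[OF assms(2)] by auto
  also have "\<dots> \<longleftrightarrow> subset_orbit \<nu> d = subset_orbit \<nu> d'"
    using nth_eq_iff_index_eq[OF subset_orbits_props(2)[of \<nu>], of "oidx \<nu> d - 1" "oidx \<nu> d' - 1"]
      oidx_props[OF assms(1)] oidx_props[OF assms(2)] by auto
  finally show ?thesis using subset_orbit_eq_iff[OF assms] by simp
qed

lemma oidx_less:
  assumes "d \<subseteq> {1..sum_list \<nu>}" "d' \<subseteq> {1..sum_list \<nu>}" "ord_class.lexordp (block_string \<nu> d) (block_string \<nu> d')"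
  shows "oidx \<nu> d < oidx \<nu> d'"
proof (rule ccontr)
  assume "\<not> ?thesis"
  then consider "oidx \<nu> d = oidx \<nu> d'" | "oidx \<nu> d' - 1 < oidx \<nu> d - 1"
    using oidx_props(1)[OF assms(1)] oidx_props(1)[OF assms(2)] by fastforce
  then show False
  proof cases
    case 1
    then have "block_string \<nu> d = block_string \<nu> d'"
      using oidx_eq_iff[OF assms(1,2)] block_string_eq_iff[OF assms(1,2)] by blast
    then show False using assms(3) lexordp_irreflexive' by metis
  next
    case 2
    then have "orbit_less \<nu> (subset_orbit \<nu> d') (subset_orbit \<nu> d)"
      using sorted_wrt_nth_less[OF subset_orbits_props(3)[of \<nu>] 2] oidx_props[OF assms(1)] oidx_props[OF assms(2)]
      by auto
    then show False using assms(3) orbit_less_iff[OF assms(2,1)] lexordp_antisym by blast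
  qed
qed

lemma subset_less_oidx:
  assumes "d \<subseteq> {1..sum_list \<nu>}" "d' \<subseteq> {1..sum_list \<nu>}" "subset_less \<nu> d d'"
  shows "oidx \<nu> d \<le> oidx \<nu> d'"
  using assms oidx_less[OF assms(1,2)] oidx_eq_iff[OF assms(1,2)] block_string_eq_iff[OF assms(1,2)]
  unfolding subset_less_def by fastforce

text \<open>Orbit numbers are used as letters of words; this bound is the origin of the summand
  \<open>2 ^ r\<close> in the size of the alphabet.\<close>

lemma length_subset_orbits: "length (subset_orbits \<nu>) \<le> 2 ^ sum_list \<nu>"
proof -
  have "length (subset_orbits \<nu>) = card (subset_orbit \<nu> ` Pow {1..sum_list \<nu>})"
    using distinct_card[OF subset_orbits_props(2)] by (simp add: subset_orbits_props(1))
  also have "\<dots> \<le> card (Pow {1..sum_list \<nu>})" by (intro card_image_le) simp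
  finally show ?thesis by (simp add: card_Pow)
qed

lemma D_comp_oidx:
  assumes "\<And>d. d \<in> D \<Longrightarrow> d \<subseteq> {1..sum_list \<nu>}"
  shows "D_comp \<nu> D = map (\<lambda>l. card {d\<in>D. oidx \<nu> d = l}) [1..<Suc (length (subset_orbits \<nu>))]"
proof (rule nth_equalityI)
  fix j assume "j < length (D_comp \<nu> D)"
  then have j: "j < length (subset_orbits \<nu>)" by (simp add: D_comp_def)
  have "d \<in> subset_orbits \<nu> ! j \<longleftrightarrow> oidx \<nu> d = Suc j" if "d \<in> D" for d
  proof
    have dd: "d \<subseteq> {1..sum_list \<nu>}" using assms that .
    show "oidx \<nu> d = Suc j \<Longrightarrow> d \<in> subset_orbits \<nu> ! j"
      using oidx_props(2)[OF dd] subset_orbit_self[of d \<nu>] by simp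
    assume "d \<in> subset_orbits \<nu> ! j"
    moreover have "subset_orbits \<nu> ! j \<in> set (subset_orbits \<nu>)" using j by (rule nth_mem)
    then obtain e where e: "e \<subseteq> {1..sum_list \<nu>}" "subset_orbits \<nu> ! j = subset_orbit \<nu> e"
      by (auto simp: subset_orbits_props)
    ultimately have "subset_orbits \<nu> ! j = subset_orbits \<nu> ! (oidx \<nu> d - 1)"
      using subset_orbit_iff[OF e(1)] subset_orbit_eq_iff[OF e(1) dd] oidx_props(2)[OF dd] by auto
    moreover have "oidx \<nu> d - 1 < length (subset_orbits \<nu>)" using oidx_props(1)[OF dd] by auto
    ultimately have "j = oidx \<nu> d - 1"
      using nth_eq_iff_index_eq[OF subset_orbits_props(2)[of \<nu>] j] by blast
    then show "oidx \<nu> d = Suc j" using oidx_props(1)[OF dd] by auto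
  qed
  then have "D \<inter> subset_orbits \<nu> ! j = {d\<in>D. oidx \<nu> d = Suc j}" by auto
  then show "D_comp \<nu> D ! j = map (\<lambda>l. card {d\<in>D. oidx \<nu> d = l}) [1..<Suc (length (subset_orbits \<nu>))] ! j"
    using j by (simp add: D_comp_def del: upt_Suc)
qed (simp add: D_comp_def del: upt_Suc)

text \<open>The order on subsets compares orbits first, so orbit numbers increase weakly along the
  numbering by \<open>psi\<close>. This monotonicity is what \<open>block_number_fibre_sizes\<close>
  needs for families of fibres.\<close>

lemma psi_props:
  assumes fin: "finite D" and D': "\<forall>d\<in>D. d \<noteq> {} \<and> d \<subseteq> {1..sum_list \<nu>}" and disj: "pairwise disjnt D"
  shows "bij_betw (\<lambda>j. psi \<nu> D -` {j}) {1..card D} D"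
    and "x \<in> \<Union>D \<Longrightarrow> psi \<nu> D x \<in> {1..card D}"
    and "x \<notin> \<Union>D \<Longrightarrow> psi \<nu> D x = 0"
    and "j \<in> {1..card D} \<Longrightarrow> j' \<in> {1..card D} \<Longrightarrow> j \<le> j' \<Longrightarrow> oidx \<nu> (psi \<nu> D -` {j}) \<le> oidx \<nu> (psi \<nu> D -` {j'})"
proof -
  have D: "d \<noteq> {} \<and> d \<subseteq> {1..sum_list \<nu>}" if "d \<in> D" for d using D' that by blast
  define xs where "xs = enumeration (subset_less \<nu>) D"
  have finD: "finite d" if "d \<in> D" for d using D[OF that] finite_subset by blast
  have 1: "\<not> subset_less \<nu> d d" for d by (simp add: subset_less_def lexordp_irreflexive')
  have 2: "subset_less \<nu> d d''" if "subset_less \<nu> d d'" "subset_less \<nu> d' d''" for d d' d''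
    using that unfolding subset_less_def by (metis lexordp_trans)
  have 3: "subset_less \<nu> d d' \<or> subset_less \<nu> d' d" if "d \<in> D" "d' \<in> D" "d \<noteq> d'" for d d'
    using that finD lexordp_linear unfolding subset_less_def by (metis sorted_list_of_set_inject)
  have set: "set xs = D" unfolding xs_def by (rule enumeration_props[OF fin]) (rule 1, erule (1) 2, erule (2) 3)
  have dist: "distinct xs" unfolding xs_def by (rule enumeration_props[OF fin]) (rule 1, erule (1) 2, erule (2) 3)
  have sorted: "sorted_wrt (subset_less \<nu>) xs" unfolding xs_def by (rule enumeration_props[OF fin]) (rule 1, erule (1) 2, erule (2) 3)
  have len: "length xs = card D" using distinct_card[OF dist] set by simp
  have nthD: "xs ! (j - 1) \<in> D" if "j \<in> {1..card D}" for j
  proof -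
    have "j - 1 < length xs" using that len by auto
    then show ?thesis using nth_mem set by blast
  qed
  have nth_inj: "j = j'" if "j \<in> {1..card D}" "j' \<in> {1..card D}" "xs ! (j - 1) = xs ! (j' - 1)" for j j'
  proof -
    have "j - 1 < length xs" "j' - 1 < length xs" using that len by auto
    then have "j - 1 = j' - 1" using nth_eq_iff_index_eq[OF dist] that(3) by blast
    then show ?thesis using that(1,2) by auto
  qed
  have psi: "psi \<nu> D x = j" if "j \<in> {1..card D}" "x \<in> xs ! (j - 1)" for x j
  proof -
    have "x \<in> \<Union>D" using nthD that by blast
    moreover have "(THE j. j \<in> {1..card D} \<and> x \<in> xs ! (j - 1)) = j"
    proof (rule the_equality)
      fix j' assume j': "j' \<in> {1..card D} \<and> x \<in> xs ! (j' - 1)"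
      then have "xs ! (j' - 1) = xs ! (j - 1)"
        using disj nthD that unfolding pairwise_def disjnt_def by blast
      then show "j' = j" using nth_inj j' that by blast
    qed (use that in blast)
    ultimately show ?thesis by (simp add: psi_def xs_def)
  qed
  have ex: "\<exists>j\<in>{1..card D}. x \<in> xs ! (j - 1)" if x: "x \<in> \<Union>D" for x
  proof -
    obtain d where d: "d \<in> D" "x \<in> d" using x by blast
    then obtain k where "k < length xs" "xs ! k = d" using set by (metis in_set_conv_nth)
    then show ?thesis using d len by (intro bexI[of _ "Suc k"]) auto
  qed
  show p2: "psi \<nu> D x \<in> {1..card D}" if "x \<in> \<Union>D" for x
    using ex[OF that] psi by metis
  show p3: "psi \<nu> D x = 0" if "x \<notin> \<Union>D" for x using that by (simp add: psi_def)
  have vim: "psi \<nu> D -` {j} = xs ! (j - 1)" if j: "j \<in> {1..card D}" for j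
  proof (intro equalityI subsetI)
    fix x assume "x \<in> psi \<nu> D -` {j}"
    then have e: "psi \<nu> D x = j" by simp
    then have "x \<in> \<Union>D" using p3[of x] j by fastforce
    then obtain j' where "j' \<in> {1..card D}" "x \<in> xs ! (j' - 1)" using ex by blast
    then show "x \<in> xs ! (j - 1)" using psi e by metis
  qed (use psi[OF j] in auto)
  have "bij_betw (\<lambda>j. xs ! (j - 1)) {1..card D} D"
    unfolding bij_betw_def
  proof
    show "inj_on (\<lambda>j. xs ! (j - 1)) {1..card D}" by (rule inj_onI) (rule nth_inj)
    show "(\<lambda>j. xs ! (j - 1)) ` {1..card D} = D"
    proof (intro equalityI subsetI)
      fix d assume "d \<in> D"
      then obtain k where "k < length xs" "xs ! k = d" using set by (metis in_set_conv_nth)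
      then show "d \<in> (\<lambda>j. xs ! (j - 1)) ` {1..card D}" using len by (intro image_eqI[of _ _ "Suc k"]) auto
    qed (use nthD in auto)
  qed
  then show "bij_betw (\<lambda>j. psi \<nu> D -` {j}) {1..card D} D"
    by (rule bij_betw_cong[THEN iffD1, rotated]) (simp add: vim)
  show "oidx \<nu> (psi \<nu> D -` {j}) \<le> oidx \<nu> (psi \<nu> D -` {j'})"
    if j: "j \<in> {1..card D}" "j' \<in> {1..card D}" "j \<le> j'"
  proof (cases "j = j'")
    case False
    then have "subset_less \<nu> (xs ! (j - 1)) (xs ! (j' - 1))"
      using j len by (intro sorted_wrt_nth_less[OF sorted]) auto
    then show ?thesis unfolding vim[OF j(1)] vim[OF j(2)]
      using D[OF nthD[OF j(1)]] D[OF nthD[OF j(2)]] by (intro subset_less_oidx) auto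
  qed simp
qed

section \<open>Tableaux and words\<close>

abbreviation W :: "nat \<Rightarrow> nat \<Rightarrow> (nat \<Rightarrow> nat) set" where "W i K \<equiv> words.F {1..i} K"
abbreviation Cont :: "nat \<Rightarrow> (nat \<Rightarrow> nat) \<Rightarrow> (nat \<Rightarrow> nat) \<Rightarrow> nat \<Rightarrow> nat \<Rightarrow> nat" where
  "Cont i \<equiv> words.cont {1..i}"

lemma words_range: "words {1..i}"
  by unfold_locales simp

text \<open>The contingency table of a tableau. Rows are numbered from 0 as in row words, entries
  keep their numbering from 1.\<close>

definition tab_matrix :: "tableau \<Rightarrow> nat \<Rightarrow> nat \<Rightarrow> nat" where
  "tab_matrix S k l = (if k < length S then count_list (S ! k) l else 0)"

definition row_word :: "nat list \<Rightarrow> nat \<Rightarrow> nat" where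
  "row_word lam = restrict (\<lambda>x. block_number lam x - 1) {1..sum_list lam}"

text \<open>The row word of a tableau. Words replace standard tableaux because they forget the order
  within rows, so that the action of the row group becomes an equality of words.\<close>

definition tab_word :: "tableau \<Rightarrow> nat \<Rightarrow> nat" where
  "tab_word s = restrict (\<lambda>x. THE k. k < length s \<and> x \<in> set (s ! k)) (set (concat s))"

lemma block_set: "block lam (Suc k) = {sum_list (take k lam) <.. sum_list (take (Suc k) lam)}"
  by (simp add: block_def)

lemma concat_row_reading: "concat (row_reading lam) = [1..<Suc (sum_list lam)]"
proof -
  have "concat (map (\<lambda>j. sorted_list_of_set (block lam j)) [1..<Suc k]) = [1..<Suc (sum_list (take k lam))]" for k
  proof (induction k)
    case (Suc k)
    have "sorted_list_of_set (block lam (Suc k)) = [Suc (sum_list (take k lam))..<Suc (sum_list (take (Suc k) lam))]"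
      unfolding block_set by (simp add: atLeastSucAtMost_greaterThanAtMost[symmetric] atLeastLessThanSuc_atLeastAtMost[symmetric] del: upt_Suc)
    moreover have "sum_list (take k lam) \<le> sum_list (take (Suc k) lam)" by (rule sum_list_take_mono) simp
    ultimately show ?case using Suc
      using upt_add_eq_append[of 1 "Suc (sum_list (take k lam))" "sum_list (take (Suc k) lam) - sum_list (take k lam)"]
      by (simp add: upt_Suc_append[of "Suc 0" "Suc k"] del: upt_Suc)
  qed simp
  then show ?thesis by (simp add: row_reading_def del: upt_Suc)
qed

lemma row_reading_props:
  "length (row_reading lam) = length lam"
  "k < length lam \<Longrightarrow> set (row_reading lam ! k) = block lam (Suc k)"
  "k < length lam \<Longrightarrow> length (row_reading lam ! k) = lam ! k"
  using card_block[of "Suc k" lam] by (auto simp: row_reading_def block_def simp del: upt_Suc)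

lemma tab_perm_props:
  assumes "s \<in> standard_tableaux lam"
  shows "tab_perm lam s permutes {1..sum_list lam}" "map (map (tab_perm lam s)) (row_reading lam) = s"
proof -
  let ?i = "sum_list lam"
  have s: "map length s = lam" "distinct (concat s)" "set (concat s) = {1..?i}"
    using assms by (auto simp: standard_tableaux_def)
  have len: "length (concat s) = ?i" using s(1) by (simp add: length_concat)
  define d where "d x = (if x \<in> {1..?i} then (\<lambda>x. concat s ! (x - 1)) x else x)" for x
  have "bij_betw (\<lambda>x. concat s ! (x - 1)) {1..?i} {1..?i}"
  proof -
    have "bij_betw ((!) (concat s)) {..<?i} {1..?i}" using s len by (intro bij_betw_nth) auto
    moreover have "bij_betw (\<lambda>j. j - 1) {1..?i} {..<?i}" by (rule bij_betwI[where g = Suc]) auto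
    ultimately have "bij_betw ((!) (concat s) \<circ> (\<lambda>j. j - 1)) {1..?i} {1..?i}" by (rule bij_betw_trans[rotated])
    then show ?thesis by (simp add: comp_def)
  qed
  then have d: "d permutes {1..?i}" unfolding d_def by (rule bij_betw_permutes_extend)
  have "map d [1..<Suc ?i] = concat s"
    by (rule nth_equalityI) (auto simp: len d_def nth_upt simp del: upt_Suc)
  then have cc: "concat (map (map d) (row_reading lam)) = concat s"
    by (simp add: concat_row_reading map_concat[symmetric] del: upt_Suc)
  have ll: "length s = length lam" using s(1) by (metis length_map)
  have eq: "map (map d) (row_reading lam) = s"
  proof (rule concat_injective[OF cc])
    show "length (map (map d) (row_reading lam)) = length s" using ll by (simp add: row_reading_props)
    show "\<forall>(x, y)\<in>set (zip (map (map d) (row_reading lam)) s). length x = length y"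
    proof clarify
      fix x y assume "(x, y) \<in> set (zip (map (map d) (row_reading lam)) s)"
      then obtain k where k: "k < length lam" "x = map d (row_reading lam ! k)" "y = s ! k"
        using ll by (auto simp: set_zip row_reading_props)
      have "length (s ! k) = lam ! k" using s(1) k(1) ll by (metis nth_map)
      then show "length x = length y" using k row_reading_props(3)[OF k(1)] by simp
    qed
  qed
  have uniq: "e = d" if e: "e permutes {1..?i}" "map (map e) (row_reading lam) = s" for e
  proof
    fix x
    show "e x = d x"
    proof (cases "x \<in> {1..?i}")
      case True
      have "map e (concat (row_reading lam)) = map d (concat (row_reading lam))"
        using e(2) eq by (metis map_concat)
      then have "\<forall>x\<in>set [1..<Suc ?i]. e x = d x" unfolding concat_row_reading by (simp only: map_eq_conv)
      moreover have "x \<in> set [1..<Suc ?i]" using True unfolding set_upt by simp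
      ultimately show ?thesis by blast
    next
      case False
      then show ?thesis using permutes_not_in[OF e(1)] permutes_not_in[OF d] by metis
    qed
  qed
  have "tab_perm lam s = d"
    unfolding tab_perm_def
  proof (rule the_equality)
    show "d permutes {1..?i} \<and> map (map d) (row_reading lam) = s" using d eq ..
    show "\<And>e. e permutes {1..?i} \<and> map (map e) (row_reading lam) = s \<Longrightarrow> e = d"
      by (elim conjE) (rule uniq)
  qed
  then show "tab_perm lam s permutes {1..?i}" "map (map (tab_perm lam s)) (row_reading lam) = s"
    using d eq by (simp_all only:)
qed

lemma distinct_concat_nth:
  assumes "distinct (concat s)" "k < length s" "k' < length s" "x \<in> set (s ! k)" "x \<in> set (s ! k')"
  shows "k = k'"
  using assms
proof (induction s arbitrary: k k')
  case (Cons a s)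
  have "x \<notin> set a \<or> x \<notin> set (s ! j)" if "j < length s" for j
  proof -
    have "set (s ! j) \<subseteq> \<Union> (set ` set s)" using nth_mem[OF that] by blast
    then show ?thesis using Cons.prems(1) by auto
  qed
  then show ?case using Cons by (cases k; cases k') auto
qed simp

lemma tab_word_eq:
  assumes "distinct (concat s)" "k < length s" "x \<in> set (s ! k)"
  shows "tab_word s x = k"
proof -
  have "x \<in> set (concat s)" using assms by auto
  moreover have "(THE k. k < length s \<and> x \<in> set (s ! k)) = k"
    using assms distinct_concat_nth[OF assms(1)] by (intro the_equality) auto
  ultimately show ?thesis by (simp add: tab_word_def)
qed

lemma in_set_concat_nth: "x \<in> set (concat s) \<longleftrightarrow> (\<exists>j<length s. x \<in> set (s ! j))"
  unfolding set_concat set_conv_nth[of s] by auto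

lemma tab_word_level:
  assumes "distinct (concat s)"
  shows "{x \<in> set (concat s). tab_word s x = k} = (if k < length s then set (s ! k) else {})"
proof -
  have ex: "\<exists>j<length s. x \<in> set (s ! j) \<and> tab_word s x = j" if x: "x \<in> set (concat s)" for x
  proof -
    obtain j where "j < length s" "x \<in> set (s ! j)" using x unfolding in_set_concat_nth by blast
    then show ?thesis using tab_word_eq[OF assms] by blast
  qed
  have "x \<in> set (concat s) \<and> tab_word s x = k \<longleftrightarrow> k < length s \<and> x \<in> set (s ! k)" for x
    using ex[of x] tab_word_eq[OF assms, of k x] in_set_concat_nth[of x s] by blast
  then show ?thesis by auto
qed

lemma tab_word_tab_perm:
  assumes s: "s \<in> standard_tableaux lam" and x: "x \<in> {1..sum_list lam}"
  shows "tab_word s (tab_perm lam s x) = row_word lam x"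
proof -
  have st: "distinct (concat s)" "map length s = lam" using s by (auto simp: standard_tableaux_def)
  obtain k where k: "k < length lam" "block_number lam x = Suc k" "x \<in> block lam (Suc k)"
    using block_number_in[OF x] by (cases "block_number lam x") auto
  have ls: "length s = length lam" using st(2) by (metis length_map)
  have "s ! k = map (tab_perm lam s) (row_reading lam ! k)"
    using tab_perm_props(2)[OF s] k(1) by (metis nth_map row_reading_props(1))
  then have "tab_perm lam s x \<in> set (s ! k)"
    using k row_reading_props(2)[OF k(1)] by simp
  then have "tab_word s (tab_perm lam s x) = k" using tab_word_eq[OF st(1)] ls k(1) by simp
  then show ?thesis using k(2) x by (simp add: row_word_def)
qed

lemma young_row_word:
  assumes "\<sigma> permutes {1..sum_list lam}"
  shows "\<sigma> \<in> young lam \<longleftrightarrow> (\<forall>x\<in>{1..sum_list lam}. row_word lam (\<sigma> x) = row_word lam x)"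
proof -
  have "block_number lam (\<sigma> x) = block_number lam x \<longleftrightarrow> row_word lam (\<sigma> x) = row_word lam x"
    if x: "x \<in> {1..sum_list lam}" for x
  proof -
    have y: "\<sigma> x \<in> {1..sum_list lam}" using permutes_in_image[OF assms] x by blast
    show ?thesis using block_number_in(1)[OF x] block_number_in(1)[OF y] x y
      by (auto simp: row_word_def)
  qed
  then show ?thesis using assms by (auto simp: young_iff)
qed

lemma sorted_eq_of_counts:
  assumes "sorted xs" "sorted ys" "\<And>l. count_list xs l = count_list ys l"
  shows "xs = (ys :: nat list)"
proof -
  have "mset xs = mset ys" using assms(3) by (auto simp: multiset_eq_iff count_mset)
  then show ?thesis using assms by (metis properties_for_sort sorted_sort_id)
qed

lemma count_list_map_sorted_list_of_set:
  assumes "finite A"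
  shows "count_list (map h (sorted_list_of_set A)) l = card {x\<in>A. h x = l}"
  using count_mset_map_distinct[of "sorted_list_of_set A" h l] assms unfolding count_mset by simp

text \<open>A standard tableau is determined by the sets of entries of its rows, hence by its row
  word. Conversely, the sorted rows of a word with the right table map to the rows of
  \<open>S\<close> under \<open>h\<close>; since \<open>h\<close> is weakly increasing, strict
  columns of \<open>S\<close> force strict columns before applying \<open>h\<close>.\<close>

lemma standard_of_type_bij:
  assumes lam: "sum_list lam = i" "sorted_wrt (\<ge>) lam"
    and h: "\<And>x. x \<in> {1..i} \<Longrightarrow> block_number \<kappa> x = h x"
    and mono: "\<And>x y. x \<in> {1..i} \<Longrightarrow> y \<in> {1..i} \<Longrightarrow> x \<le> y \<Longrightarrow> h x \<le> h y"
    and S: "S \<in> semistandard_tableaux lam \<kappa>"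
    and K: "length lam \<le> K"
  shows "bij_betw tab_word (standard_of_type lam \<kappa> S) {\<rho> \<in> W i K. Cont i \<rho> h = tab_matrix S}"
proof -
  interpret words "{1..i}" K by (rule words_range)
  have S': "map length S = lam" "\<And>row. row \<in> set S \<Longrightarrow> sorted row" "column_strict S"
    using S by (auto simp: semistandard_tableaux_def)
  have lS: "length S = length lam" using S'(1) by (metis length_map)
  have std: "distinct (concat s)" "set (concat s) = {1..i}" "length s = length lam"
     "map (map h) s = S" "\<And>k. k < length s \<Longrightarrow> sorted_wrt (<) (s ! k)" if "s \<in> standard_of_type lam \<kappa> S" for s
  proof -
    have ss: "map length s = lam" "distinct (concat s)" "set (concat s) = {1..i}" "map (map (block_number \<kappa>)) s = S"
      "\<forall>row\<in>set s. sorted_wrt (<) row"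
      using that lam by (auto simp: standard_of_type_def standard_tableaux_def)
    show "distinct (concat s)" "set (concat s) = {1..i}" by fact+
    show "length s = length lam" using ss(1) by (metis length_map)
    show "sorted_wrt (<) (s ! k)" if "k < length s" for k using ss(5) that by simp
    have "\<forall>x\<in>set (concat s). block_number \<kappa> x = h x" using h unfolding ss(3) by blast
    then have "map (map h) s = map (map (block_number \<kappa>)) s"
      by (intro map_cong refl) auto
    then show "map (map h) s = S" using ss(4) by simp
  qed
  have cont_tab: "tab_word s \<in> W i K \<and> Cont i (tab_word s) h = tab_matrix S" if s: "s \<in> standard_of_type lam \<kappa> S" for s
  proof
    note st = std[OF s]
    have "tab_word s x < K" if x: "x \<in> {1..i}" for x
    proof -
      obtain k where "k < length s" "x \<in> set (s ! k)"
        using x unfolding st(2)[symmetric] in_set_concat_nth by blast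
      then show ?thesis using tab_word_eq[OF st(1)] st(3) K by force
    qed
    then show "tab_word s \<in> W i K"
      unfolding F_def
    proof (intro PiE_I)
      show "tab_word s x = undefined" if "x \<notin> {1..i}" for x
        using that unfolding tab_word_def st(2) by (simp only: restrict_def if_False)
    qed blast
    show "Cont i (tab_word s) h = tab_matrix S"
    proof (intro ext)
      fix k l
      have e: "{x\<in>{1..i}. tab_word s x = k} = (if k < length s then set (s ! k) else {})"
        using tab_word_level[OF st(1), of k] unfolding st(2) .
      have "{x\<in>{1..i}. tab_word s x = k \<and> h x = l} = {x\<in>{x\<in>{1..i}. tab_word s x = k}. h x = l}" by auto
      also have "\<dots> = {x\<in>(if k < length s then set (s ! k) else {}). h x = l}" unfolding e ..
      finally have "Cont i (tab_word s) h k l = card {x\<in>(if k < length s then set (s ! k) else {}). h x = l}"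
        unfolding cont_def by simp
      also have "\<dots> = tab_matrix S k l"
      proof (cases "k < length s")
        case True
        then have "distinct (s ! k)" using st(1) by (simp add: distinct_concat_iff)
        then have "card {x\<in>set (s ! k). h x = l} = count_list (map h (s ! k)) l"
          using count_mset_map_distinct[of "s ! k" h l] unfolding count_mset by simp
        moreover have "map h (s ! k) = S ! k" using st(4) True by (metis nth_map)
        ultimately show ?thesis using True st(3) lS by (simp add: tab_matrix_def)
      qed (use st(3) lS in \<open>simp add: tab_matrix_def\<close>)
      finally show "Cont i (tab_word s) h k l = tab_matrix S k l" .
    qed
  qed
  have row_of: "s ! k = sorted_list_of_set {x\<in>{1..i}. tab_word s x = k}"
    if s: "s \<in> standard_of_type lam \<kappa> S" "k < length lam" for s k
  proof -
    have "{x\<in>{1..i}. tab_word s x = k} = set (s ! k)"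
      using tab_word_level[OF std(1)[OF s(1)], of k] s(2) unfolding std(2,3)[OF s(1)] by (simp only: if_True)
    then show ?thesis
      using std(5)[OF s(1), of k] std(3)[OF s(1)] s(2) by (metis sorted_list_of_set.idem_if_sorted_distinct strict_sorted_iff)
  qed
  have inj: "inj_on tab_word (standard_of_type lam \<kappa> S)"
  proof (rule inj_onI)
    fix s s' assume s: "s \<in> standard_of_type lam \<kappa> S" "s' \<in> standard_of_type lam \<kappa> S" "tab_word s = tab_word s'"
    show "s = s'"
      using std(3)[OF s(1)] std(3)[OF s(2)] row_of[OF s(1)] row_of[OF s(2)] s(3)
      by (intro nth_equalityI) auto
  qed
  have surj: "\<rho> \<in> tab_word ` standard_of_type lam \<kappa> S"
    if \<rho>: "\<rho> \<in> W i K" "Cont i \<rho> h = tab_matrix S" for \<rho>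
  proof -
    define R where "R k = {x\<in>{1..i}. \<rho> x = k}" for k
    define s where "s = map (\<lambda>k. sorted_list_of_set (R k)) [0..<length lam]"
    have finR: "finite (R k)" for k by (simp add: R_def)
    have nth: "s ! k = sorted_list_of_set (R k)" if "k < length lam" for k using that by (simp add: s_def)
    have ls: "length s = length lam" by (simp add: s_def)
    have cR: "card {x\<in>R k. h x = l} = tab_matrix S k l" for k l
      using fun_cong[OF fun_cong[OF \<rho>(2), of k], of l] unfolding cont_def R_def by (simp add: conj_assoc)
    have mapS: "map h (s ! k) = S ! k" if k: "k < length lam" for k
    proof (rule sorted_eq_of_counts)
      show "sorted (map h (s ! k))" unfolding nth[OF k] sorted_map
        by (rule sorted_wrt_mono_rel[OF _ sorted_sorted_list_of_set]) (use mono finR in \<open>auto simp: R_def\<close>)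
      show "sorted (S ! k)" using S'(2) k lS by simp
      show "count_list (map h (s ! k)) l = count_list (S ! k) l" for l
        unfolding nth[OF k] count_list_map_sorted_list_of_set[OF finR] cR using k lS by (simp add: tab_matrix_def)
    qed
    have small: "\<rho> x < length lam" if x: "x \<in> {1..i}" for x
    proof (rule ccontr)
      assume "\<not> ?thesis"
      then have "card {y\<in>R (\<rho> x). h y = h x} = 0" unfolding cR using lS by (simp add: tab_matrix_def)
      moreover have "x \<in> {y\<in>R (\<rho> x). h y = h x}" using x by (simp add: R_def)
      moreover have "finite {y\<in>R (\<rho> x). h y = h x}" using finR by simp
      ultimately show False by (metis card_0_eq empty_iff)
    qed
    have setc: "set (concat s) = {1..i}"
      using small finR by (auto simp: s_def R_def)
    have mapSs: "map (map h) s = S"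
      using mapS ls lS by (intro nth_equalityI) auto
    have lens: "map length s = lam"
    proof -
      have "map length (map (map h) s) = map length s" by simp
      then show ?thesis using mapSs S'(1) by metis
    qed
    have dist: "distinct (concat s)"
      by (rule card_distinct) (simp only: length_concat lens setc lam(1), simp)
    have cs: "column_strict s" unfolding column_strict_def
    proof (intro allI impI)
      fix k j assume kj: "Suc k < length s \<and> j < length (s ! Suc k)"
      have l1: "length (s ! Suc k) = length (S ! Suc k)" "length (s ! k) = length (S ! k)"
        using mapS[of k] mapS[of "Suc k"] kj ls by (metis Suc_lessD length_map)+
      have lt: "S ! k ! j < S ! Suc k ! j"
        using S'(3) kj l1 ls lS unfolding column_strict_def by auto
      have jj: "j < length (s ! k)"
      proof -
        have "lam ! Suc k \<le> lam ! k" using sorted_wrt_nth_less[OF lam(2), of k "Suc k"] kj ls by simp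
        moreover have "length (s ! k) = lam ! k" "length (s ! Suc k) = lam ! Suc k"
          using lens kj by (metis Suc_lessD nth_map)+
        ultimately show ?thesis using kj by simp
      qed
      have hh: "h (s ! k ! j) < h (s ! Suc k ! j)"
        using lt mapS[of k] mapS[of "Suc k"] kj jj ls by (metis Suc_lessD nth_map)
      have "s ! k ! j \<in> {1..i}" "s ! Suc k ! j \<in> {1..i}"
        using nth_mem[OF jj] nth_mem[of j "s ! Suc k"] kj unfolding setc[symmetric] in_set_concat_nth
        by (meson Suc_lessD)+
      then show "s ! k ! j < s ! Suc k ! j" using mono[of "s ! Suc k ! j" "s ! k ! j"] hh
        by (meson not_le)
    qed
    have "s \<in> standard_of_type lam \<kappa> S"
    proof -
      have "\<forall>x\<in>set (concat s). block_number \<kappa> x = h x" using h unfolding setc by blast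
      then have "map (map (block_number \<kappa>)) s = map (map h) s"
        by (intro map_cong refl) auto
      moreover have "\<forall>row\<in>set s. sorted_wrt (<) row"
        by (auto simp: s_def)
      ultimately show ?thesis unfolding standard_of_type_def standard_tableaux_def mem_Collect_eq lam(1)
        using lens dist setc cs mapSs by (intro conjI) simp_all
    qed
    moreover have "tab_word s = \<rho>"
    proof (rule F_eqI)
      show "tab_word s \<in> F" using cont_tab[OF calculation] by simp
      fix x assume x: "x \<in> {1..i}"
      show "tab_word s x = \<rho> x"
        using small[OF x] finR x by (intro tab_word_eq[OF dist]) (auto simp: ls nth R_def)
    qed (rule \<rho>)
    ultimately show ?thesis by blast
  qed
  show ?thesis unfolding bij_betw_def using inj cont_tab surj by blast
qed

declare One_nat_def [simp del]

section \<open>Semistandard words as tableaux\<close>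

lemma sorted_nth_less_filter:
  assumes "sorted xs" "j < length (filter (\<lambda>y. y < v) xs)"
  shows "xs ! j < (v :: nat)"
  using assms
proof (induction xs arbitrary: j)
  case (Cons x xs)
  show ?case
  proof (cases "x < v")
    case True
    then show ?thesis using Cons by (cases j) auto
  next
    case False
    then have "filter (\<lambda>y. y < v) xs = []" using Cons.prems(1) by (auto simp: filter_empty_conv)
    then show ?thesis using Cons.prems False by simp
  qed
qed simp

lemma sorted_less_filter_le:
  assumes "sorted ys" "j < length ys"
  shows "j < length (filter (\<lambda>y. y \<le> (ys ! j :: nat)) ys)"
  using assms
proof (induction ys arbitrary: j)
  case (Cons y ys)
  show ?case
  proof (cases j)
    case (Suc j')
    then have "y \<le> ys ! j'" using Cons.prems by auto
    then show ?thesis using Cons Suc by auto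
  qed simp
qed simp

lemma length_filter_sort_map:
  assumes "finite A"
  shows "length (filter P (sort (map b (sorted_list_of_set A)))) = card {x\<in>A. P (b x)}"
proof -
  have "length (filter P (sort (map b (sorted_list_of_set A)))) = length (filter (P \<circ> b) (sorted_list_of_set A))"
    by (metis filter_map length_map mset_filter mset_sort size_mset)
  also have "\<dots> = card (set (filter (P \<circ> b) (sorted_list_of_set A)))"
    by (rule distinct_card[symmetric]) simp
  also have "set (filter (P \<circ> b) (sorted_list_of_set A)) = {x\<in>A. P (b x)}" using assms by auto
  finally show ?thesis .
qed

lemma count_list_sort_map:
  assumes "finite A"
  shows "count_list (sort (map b (sorted_list_of_set A))) l = card {x\<in>A. b x = l}"
  using count_list_map_sorted_list_of_set[OF assms, of b l] by (simp add: count_mset[symmetric])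

lemma count_list_concat: "count_list (concat S) l = (\<Sum>k<length S. count_list (S ! k) l)"
  by (induction S rule: rev_induct) (auto simp: nth_append)

text \<open>The shape is the weight of \<rho> and the rows are the sorted letters of
  \<open>b\<close>. With \<open>v\<close> beyond all letters the counting condition says that row
  lengths decrease; with \<open>v\<close> an entry of the lower row it says that the entry above is
  smaller.\<close>

lemma semistandard_tableau_of_words:
  assumes \<rho>: "\<rho> \<in> W i K" and b: "b \<in> W i K" and ss: "words.semistd {1..i} \<rho> b"
    and \<kappa>: "\<And>x. x \<in> {1..i} \<Longrightarrow> b x \<in> {1..length \<kappa>}"
      "\<And>l. l \<in> {1..length \<kappa>} \<Longrightarrow> \<kappa> ! (l - 1) = card {x\<in>{1..i}. b x = l}"
  obtains lam S where "lam \<in> partitions i" "S \<in> semistandard_tableaux lam \<kappa>"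
    "tab_matrix S = Cont i \<rho> b" "\<forall>q. sum_list (take q lam) = words.ps {1..i} \<rho> q" "length lam \<le> K"
proof -
  interpret words "{1..i}" K by (rule words_range)
  define R where "R k = {x\<in>{1..i}. \<rho> x = k}" for k
  define wt where "wt k = card (R k)" for k
  have finR: "finite (R k)" for k by (simp add: R_def)
  have bK: "b x < K" if "x \<in> {1..i}" for x using F_less[OF b that] .
  have dec: "wt (Suc k) \<le> wt k" for k
  proof -
    have "card {x\<in>{1..i}. \<rho> x = Suc k \<and> b x \<le> K} \<le> card {x\<in>{1..i}. \<rho> x = k \<and> b x < K}"
      using ss unfolding semistd_def by blast
    moreover have "{x\<in>{1..i}. \<rho> x = Suc k \<and> b x \<le> K} = R (Suc k)" using bK by (fastforce simp: R_def)
    moreover have "{x\<in>{1..i}. \<rho> x = k \<and> b x < K} = R k" using bK by (fastforce simp: R_def)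
    ultimately show ?thesis by (simp add: wt_def)
  qed
  have dec': "wt k' \<le> wt k" if "k \<le> k'" for k k' using that dec by (rule lift_Suc_antimono_le[rotated])
  have wtK: "wt K = 0"
  proof -
    have "R K = {}" using F_less[OF \<rho>] by (fastforce simp: R_def)
    then show ?thesis by (simp add: wt_def)
  qed
  \<comment> \<open>The number of nonempty rows. Trimming there keeps 0 out of the partition, and
    all later rows are empty by monotonicity.\<close>
  define m where "m = (LEAST k. wt k = 0)"
  have m0: "wt m = 0" unfolding m_def using wtK by (rule LeastI)
  have mK: "m \<le> K" unfolding m_def using wtK by (rule Least_le)
  have mpos: "wt k \<noteq> 0" if "k < m" for k using that not_less_Least unfolding m_def by blast
  have mz: "R k = {}" if "m \<le> k" for k
  proof -
    have "wt k = 0" using dec'[OF that] m0 by simp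
    then show ?thesis using finR by (simp add: wt_def)
  qed
  define lam where "lam = map wt [0..<m]"
  define S where "S = map (\<lambda>k. sort (map b (sorted_list_of_set (R k)))) [0..<m]"
  have len: "length lam = m" "length S = m" by (simp_all add: lam_def S_def)
  have Sk: "S ! k = sort (map b (sorted_list_of_set (R k)))" if "k < m" for k using that by (simp add: S_def)
  have take: "sum_list (take q lam) = ps \<rho> q" for q
  proof (induction q)
    case 0 show ?case by (simp add: ps_def)
  next
    case (Suc q)
    have e: "card {x\<in>{1..i}. \<rho> x = q} = wt q" by (simp add: wt_def R_def)
    show ?case
    proof (cases "q < m")
      case True
      then have "sum_list (take (Suc q) lam) = sum_list (take q lam) + wt q"
        using len by (simp add: sum_list_take_Suc lam_def del: upt_Suc)
      then show ?thesis using Suc ps_Suc[of \<rho> q] e by simp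
    next
      case False
      then have "sum_list (take (Suc q) lam) = sum_list (take q lam)" using len by simp
      moreover have "wt q = 0" using mz[of q] False by (simp add: wt_def)
      ultimately show ?thesis using Suc ps_Suc[of \<rho> q] e by simp
    qed
  qed
  have "sum_list lam = i"
  proof -
    have "sum_list lam = ps \<rho> K" using take[of K] mK len by simp
    also have "ps \<rho> K = card {1..i}"
      unfolding ps_def by (rule arg_cong[of _ _ card]) (use F_less[OF \<rho>] in auto)
    finally show ?thesis by simp
  qed
  moreover have "0 \<notin> set lam" using mpos by (auto simp: lam_def) (metis less_not_refl)
  moreover have "sorted_wrt (\<ge>) lam" by (auto simp: lam_def sorted_wrt_iff_nth_less intro: dec')
  ultimately have lamP: "lam \<in> partitions i" by (simp add: partitions_def)
  have mat: "tab_matrix S k l = Cont i \<rho> b k l" for k l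
  proof (cases "k < m")
    case True
    then show ?thesis unfolding tab_matrix_def len Sk[OF True] count_list_sort_map[OF finR]
      by (simp add: cont_def R_def conj_assoc)
  next
    case False
    then have "R k = {}" using mz by simp
    then have "{x\<in>{1..i}. \<rho> x = k \<and> b x = l} = {}" by (auto simp: R_def)
    then show ?thesis using False by (simp only: tab_matrix_def len cont_def if_False card.empty)
  qed
  have "count_list (concat S) l = (if l \<in> {1..length \<kappa>} then \<kappa> ! (l - 1) else 0)" for l
  proof -
    have "count_list (concat S) l = (\<Sum>k<m. card {x\<in>{1..i}. \<rho> x = k \<and> b x = l})"
      unfolding count_list_concat len
    proof (rule sum.cong[OF refl])
      fix k assume "k \<in> {..<m}"
      then show "count_list (S ! k) l = card {x\<in>{1..i}. \<rho> x = k \<and> b x = l}"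
        using mat[of k l] len by (simp add: tab_matrix_def cont_def)
    qed
    also have "\<dots> = card (\<Union>k<m. {x\<in>{1..i}. \<rho> x = k \<and> b x = l})"
      by (rule card_UN_disjoint[symmetric]) auto
    also have "(\<Union>k<m. {x\<in>{1..i}. \<rho> x = k \<and> b x = l}) = {x\<in>{1..i}. b x = l}"
    proof -
      have "\<rho> x < m" if "x \<in> {1..i}" for x using mz[of "\<rho> x"] that by (auto simp: R_def not_le[symmetric])
      then show ?thesis by auto
    qed
    finally have cc: "count_list (concat S) l = card {x\<in>{1..i}. b x = l}" .
    show ?thesis
    proof (cases "l \<in> {1..length \<kappa>}")
      case False
      then have "{x\<in>{1..i}. b x = l} = {}" using \<kappa>(1) by blast
      then show ?thesis using False cc by (simp only: if_False card.empty)
    qed (simp add: \<kappa>(2) cc)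
  qed
  moreover have "map length S = lam"
    by (simp add: S_def lam_def wt_def finR)
  moreover have "\<forall>row\<in>set S. sorted row" by (auto simp: S_def)
  moreover have "column_strict S" unfolding column_strict_def
  proof (intro allI impI)
    fix k j assume kj: "Suc k < length S \<and> j < length (S ! Suc k)"
    then have k: "Suc k < m" "k < m" using len by auto
    define v where "v = S ! Suc k ! j"
    \<comment> \<open>In a sorted row, the first \<open>j + 1\<close> entries are at most the entry
      \<open>v\<close> at index \<open>j\<close>. Hence more than \<open>j\<close> entries of the
      row above are smaller than \<open>v\<close>, in particular the one at index
      \<open>j\<close>.\<close>
    have "j < length (filter (\<lambda>y. y \<le> v) (S ! Suc k))"
      unfolding v_def using kj k by (intro sorted_less_filter_le) (auto simp: Sk)
    also have "\<dots> = card {x\<in>R (Suc k). b x \<le> v}" unfolding Sk[OF k(1)] by (rule length_filter_sort_map[OF finR])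
    also have "\<dots> \<le> card {x\<in>R k. b x < v}"
    proof -
      have "card {x\<in>{1..i}. \<rho> x = Suc k \<and> b x \<le> v} \<le> card {x\<in>{1..i}. \<rho> x = k \<and> b x < v}"
        using ss unfolding semistd_def by blast
      then show ?thesis by (simp add: R_def conj_assoc)
    qed
    also have "\<dots> = length (filter (\<lambda>y. y < v) (S ! k))"
      unfolding Sk[OF k(2)] by (rule length_filter_sort_map[OF finR, symmetric])
    finally show "S ! k ! j < S ! Suc k ! j"
      unfolding v_def[symmetric] using k by (intro sorted_nth_less_filter) (auto simp: Sk)
  qed
  ultimately have "S \<in> semistandard_tableaux lam \<kappa>" by (simp add: semistandard_tableaux_def)
  moreover have "tab_matrix S = Cont i \<rho> b" by (intro ext) (rule mat)
  moreover have "\<forall>q. sum_list (take q lam) = ps \<rho> q" using take by blast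
  moreover have "length lam \<le> K" using mK len by simp
  ultimately show thesis by (intro that[OF lamP])
qed

section \<open>Row and column coordinates of the row-reading diagram\<close>

lemma row_word_eq:
  assumes "k < length lam" "x \<in> block lam (Suc k)"
  shows "row_word lam x = k"
proof -
  have "block_number lam x = Suc k" using assms by (intro block_number_unique) auto
  moreover have "x \<in> {1..sum_list lam}" using assms(2) block_subset by blast
  ultimately show ?thesis by (simp add: row_word_def)
qed

lemma row_word_bounds:
  assumes "x \<in> {1..sum_list lam}"
  shows "row_word lam x < length lam"
    "sum_list (take (row_word lam x) lam) < x" "x \<le> sum_list (take (Suc (row_word lam x)) lam)"
proof -
  have "block_number lam x = Suc (row_word lam x)"
    using block_number_in(1)[OF assms] assms by (auto simp: row_word_def)
  then show "row_word lam x < length lam"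
    "sum_list (take (row_word lam x) lam) < x" "x \<le> sum_list (take (Suc (row_word lam x)) lam)"
    using block_number_in[OF assms] by (auto simp: block_def)
qed

lemma row_word_in_W: "length lam \<le> K \<Longrightarrow> row_word lam \<in> W (sum_list lam) K"
proof -
  interpret words "{1..sum_list lam}" K by (rule words_range)
  assume "length lam \<le> K"
  then show ?thesis unfolding F_def
    by (intro PiE_I) (use row_word_bounds(1) in \<open>fastforce simp: row_word_def\<close>)+
qed

lemma ps_row_word: "words.ps {1..sum_list lam} (row_word lam) q = sum_list (take q lam)"
proof -
  interpret words "{1..sum_list lam}" 0 by (rule words_range)
  have "{x\<in>{1..sum_list lam}. row_word lam x < q} = {1..sum_list (take q lam)}"
  proof (intro equalityI subsetI)
    fix x assume x: "x \<in> {x\<in>{1..sum_list lam}. row_word lam x < q}"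
    then have "x \<le> sum_list (take (Suc (row_word lam x)) lam)" using row_word_bounds(3) by blast
    also have "\<dots> \<le> sum_list (take q lam)" using x by (intro sum_list_take_mono) auto
    finally show "x \<in> {1..sum_list (take q lam)}" using x by auto
  next
    fix x assume x: "x \<in> {1..sum_list (take q lam)}"
    have "sum_list (take q lam) \<le> sum_list lam" using sum_list_take_mono[of q "max q (length lam)" lam] by simp
    then have xi: "x \<in> {1..sum_list lam}" using x by auto
    have "row_word lam x < q"
    proof (rule ccontr)
      assume "\<not> ?thesis"
      then have "sum_list (take q lam) \<le> sum_list (take (row_word lam x) lam)" by (intro sum_list_take_mono) simp
      then show False using row_word_bounds(2)[OF xi] x by simp
    qed
    then show "x \<in> {x\<in>{1..sum_list lam}. row_word lam x < q}" using xi by blast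
  qed
  then show ?thesis unfolding ps_def by (simp only: card_atLeastAtMost diff_Suc_1)
qed

definition col_word :: "nat list \<Rightarrow> nat \<Rightarrow> nat" where
  "col_word lam x = x - Suc (sum_list (take (row_word lam x) lam))"

lemma row_col_word:
  assumes "x \<in> {1..sum_list lam}"
  shows "x = sum_list (take (row_word lam x) lam) + col_word lam x + 1"
    "col_word lam x < lam ! row_word lam x"
  using row_word_bounds[OF assms] sum_list_take_Suc[OF row_word_bounds(1)[OF assms]]
  by (auto simp: col_word_def)

lemma row_word_at:
  assumes "k < length lam" "c < lam ! k"
  shows "sum_list (take k lam) + c + 1 \<in> {1..sum_list lam}"
    "row_word lam (sum_list (take k lam) + c + 1) = k" "col_word lam (sum_list (take k lam) + c + 1) = c"
proof -
  have b: "sum_list (take k lam) + c + 1 \<in> block lam (Suc k)"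
    using assms sum_list_take_Suc[OF assms(1)] by (simp add: block_def)
  then show "sum_list (take k lam) + c + 1 \<in> {1..sum_list lam}" using block_subset by blast
  show r: "row_word lam (sum_list (take k lam) + c + 1) = k" using assms(1) b by (rule row_word_eq)
  show "col_word lam (sum_list (take k lam) + c + 1) = c" by (simp add: col_word_def r[simplified])
qed

lemma diagram_row_col:
  assumes "lam \<in> partitions i" "length lam \<le> K"
  shows "words.diagram {1..i} K (row_word lam) (col_word lam)"
proof -
  interpret words "{1..i}" K by (rule words_range)
  have lam: "sum_list lam = i" "sorted_wrt (\<ge>) lam" using assms(1) by (auto simp: partitions_def)
  have inj: "x = y" if h: "x \<in> {1..i}" "y \<in> {1..i}" "row_word lam x = row_word lam y" "col_word lam x = col_word lam y" for x y
    using row_col_word(1)[of x lam] row_col_word(1)[of y lam] h lam(1) by simp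
  have down: "\<exists>y\<in>{1..i}. row_word lam y = k \<and> col_word lam y = col_word lam x"
    if h: "x \<in> {1..i}" "row_word lam x = Suc k" for x k
  proof -
    have x: "x \<in> {1..sum_list lam}" using h(1) lam(1) by simp
    have k: "Suc k < length lam" using row_word_bounds(1)[OF x] h(2) by simp
    have "lam ! Suc k \<le> lam ! k" using sorted_wrt_nth_less[OF lam(2), of k "Suc k"] k by simp
    then have "col_word lam x < lam ! k" using row_col_word(2)[OF x] h(2) by simp
    from row_word_at[OF _ this] show ?thesis using k lam(1) by (metis Suc_lessD)
  qed
  show ?thesis unfolding diagram_def
    using inj down row_word_in_W[OF assms(2)] lam(1) by blast
qed

text \<open>Letters of later rows exceed those of earlier ones, so one letter \<le> v in row
  \<open>k + 1\<close> puts all of row \<open>k\<close> below \<open>v\<close>, and decreasing row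
  lengths do the rest.\<close>

lemma semistd_row_word:
  assumes "lam \<in> partitions i"
    and sep: "\<And>x y. x \<in> {1..i} \<Longrightarrow> y \<in> {1..i} \<Longrightarrow> row_word lam x < row_word lam y \<Longrightarrow> b x < b y"
  shows "words.semistd {1..i} (row_word lam) b"
proof -
  interpret words "{1..i}" 0 by (rule words_range)
  have lam: "sum_list lam = i" "sorted_wrt (\<ge>) lam" using assms(1) by (auto simp: partitions_def)
  show ?thesis unfolding semistd_def
  proof (intro allI)
    fix k v
    show "card {x\<in>{1..i}. row_word lam x = Suc k \<and> b x \<le> v} \<le> card {x\<in>{1..i}. row_word lam x = k \<and> b x < v}"
    proof (cases "{x\<in>{1..i}. row_word lam x = Suc k \<and> b x \<le> v} = {}")
      case True
      then show ?thesis by (simp only: card.empty le0)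
    next
      case False
      then obtain x where x: "x \<in> {1..i}" "row_word lam x = Suc k" "b x \<le> v" by blast
      have k: "Suc k < length lam" using row_word_bounds(1)[of x lam] x lam(1) by simp
      have "{y\<in>{1..i}. row_word lam y = k} \<subseteq> {y\<in>{1..i}. row_word lam y = k \<and> b y < v}"
        using sep[OF _ x(1)] x(2,3) by fastforce
      then have 1: "card {y\<in>{1..i}. row_word lam y = k} \<le> card {y\<in>{1..i}. row_word lam y = k \<and> b y < v}"
        by (intro card_mono) auto
      have 2: "card {x\<in>{1..i}. row_word lam x = Suc k \<and> b x \<le> v} \<le> card {x\<in>{1..i}. row_word lam x = Suc k}"
        by (intro card_mono) auto
      have c: "card {x\<in>{1..i}. row_word lam x = q} = lam ! q" if "q < length lam" for q
        using card_level[of "row_word lam" q] ps_row_word[of lam] sum_list_take_Suc[OF that] lam(1) by simp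
      have "lam ! Suc k \<le> lam ! k" using sorted_wrt_nth_less[OF lam(2), of k "Suc k"] k by simp
      then show ?thesis using 1 2 c[of k] c[of "Suc k"] k by linarith
    qed
  qed
qed

section \<open>Transformations and their labels\<close>

definition img :: "tmap \<Rightarrow> nat set" where "img \<alpha> = range \<alpha> - {0}"

definition fibs :: "tmap \<Rightarrow> nat set set" where "fibs \<alpha> = (\<lambda>c. \<alpha> -` {c}) ` img \<alpha>"

text \<open>\<open>la\<close> and \<open>lb\<close> are the two label words of a map: the blocks of
  its image points and the orbit numbers of the fibres over them. Image points are taken in
  increasing order, so \<open>la\<close> is weakly increasing, while \<open>lb\<close> need not
  be.\<close>

definition la :: "nat list \<Rightarrow> tmap \<Rightarrow> nat \<Rightarrow> nat" where
  "la \<mu> \<alpha> = restrict (\<lambda>j. block_number \<mu> (phi (img \<alpha>) j)) {1..map_index \<alpha>}"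

definition lb :: "nat list \<Rightarrow> tmap \<Rightarrow> nat \<Rightarrow> nat" where
  "lb \<nu> \<alpha> = restrict (\<lambda>j. oidx \<nu> (\<alpha> -` {phi (img \<alpha>) j})) {1..map_index \<alpha>}"

text \<open>The table of \<open>la\<close> against \<open>lb\<close> (\<open>Cont_la_lb\<close>) and
  a complete invariant of the double coset (\<open>double_coset_iff\<close>). It is the bridge
  between basis vectors of the algebra and orbit indicators on words.\<close>

definition dcm :: "nat list \<Rightarrow> nat list \<Rightarrow> tmap \<Rightarrow> nat \<Rightarrow> nat \<Rightarrow> nat" where
  "dcm \<mu> \<nu> \<alpha> k l = card {c\<in>img \<alpha>. block_number \<mu> c = k \<and> oidx \<nu> (\<alpha> -` {c}) = l}"

lemma full_transfD:
  assumes "\<alpha> \<in> full_transf r"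
  shows "x \<in> {1..r} \<Longrightarrow> \<alpha> x \<in> {1..r}" "x \<notin> {1..r} \<Longrightarrow> \<alpha> x = 0"
  using assms by (auto simp: full_transf_def)

lemma img_eq: "\<alpha> \<in> full_transf r \<Longrightarrow> img \<alpha> = \<alpha> ` {1..r}"
  unfolding img_def
proof (intro equalityI subsetI)
  assume a: "\<alpha> \<in> full_transf r"
  fix y
  show "y \<in> range \<alpha> - {0} \<Longrightarrow> y \<in> \<alpha> ` {1..r}" using full_transfD(2)[OF a] by blast
  assume "y \<in> \<alpha> ` {1..r}"
  then obtain x where "x \<in> {1..r}" "y = \<alpha> x" by blast
  then show "y \<in> range \<alpha> - {0}" using full_transfD(1)[OF a, of x] by auto
qed

lemma img_subset: "\<alpha> \<in> full_transf r \<Longrightarrow> img \<alpha> \<subseteq> {1..r}"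
  using full_transfD(1) by (fastforce simp: img_eq)

lemma finite_img: "\<alpha> \<in> full_transf r \<Longrightarrow> finite (img \<alpha>)"
  using img_subset finite_subset by blast

lemma map_index_card: "map_index \<alpha> = card (img \<alpha>)"
  by (simp add: map_index_def img_def)

lemma map_index_le: "\<alpha> \<in> full_transf r \<Longrightarrow> map_index \<alpha> \<le> r"
  using card_mono[OF _ img_subset, of r \<alpha>] by (simp add: map_index_card)

lemma map_index_pos: "\<alpha> \<in> full_transf r \<Longrightarrow> 1 \<le> r \<Longrightarrow> 1 \<le> map_index \<alpha>"
  unfolding map_index_card by (simp add: img_eq Suc_le_eq card_gt_0_iff One_nat_def)

lemma in_img: "\<alpha> \<in> full_transf r \<Longrightarrow> x \<in> {1..r} \<Longrightarrow> \<alpha> x \<in> img \<alpha>"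
  by (simp add: img_eq)

lemma img_nz: "c \<in> img \<alpha> \<Longrightarrow> c \<noteq> 0"
  by (simp add: img_def)

lemma fibre_subset: "\<alpha> \<in> full_transf r \<Longrightarrow> c \<in> img \<alpha> \<Longrightarrow> \<alpha> -` {c} \<subseteq> {1..r}"
  using full_transfD(2) img_nz by (metis singletonD subsetI vimageE)

lemma fibre_nonempty: "c \<in> img \<alpha> \<Longrightarrow> \<alpha> -` {c} \<noteq> {}"
  by (auto simp: img_def)

lemma fibs_inj: "inj_on (\<lambda>c. \<alpha> -` {c}) (img \<alpha>)"
  by (auto simp: inj_on_def img_def)

lemma card_phi:
  assumes "finite C"
  shows "card {j\<in>{1..card C}. P (phi C j)} = card {c\<in>C. P c}"
proof -
  have "phi C ` {j\<in>{1..card C}. P (phi C j)} = {c\<in>phi C ` {1..card C}. P c}" by blast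
  also have "\<dots> = {c\<in>C. P c}" unfolding bij_betw_imp_surj_on[OF phi_bij[OF assms]] ..
  finally have e: "phi C ` {j\<in>{1..card C}. P (phi C j)} = {c\<in>C. P c}" .
  have "inj_on (phi C) {j\<in>{1..card C}. P (phi C j)}"
    by (rule inj_on_subset[OF bij_betw_imp_inj_on[OF phi_bij[OF assms]]]) blast
  from card_image[OF this] show ?thesis unfolding e by simp
qed

lemma Cont_la_lb:
  assumes "\<alpha> \<in> full_transf r"
  shows "Cont (map_index \<alpha>) (la \<mu> \<alpha>) (lb \<nu> \<alpha>) = dcm \<mu> \<nu> \<alpha>"
proof (intro ext)
  fix k l
  interpret words "{1..map_index \<alpha>}" 0 by (rule words_range)
  have "{x\<in>{1..map_index \<alpha>}. la \<mu> \<alpha> x = k \<and> lb \<nu> \<alpha> x = l} =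
    {j\<in>{1..card (img \<alpha>)}. block_number \<mu> (phi (img \<alpha>) j) = k \<and> oidx \<nu> (\<alpha> -` {phi (img \<alpha>) j}) = l}"
    by (auto simp: la_def lb_def map_index_card)
  then show "Cont (map_index \<alpha>) (la \<mu> \<alpha>) (lb \<nu> \<alpha>) k l = dcm \<mu> \<nu> \<alpha> k l"
    unfolding cont_def dcm_def
    using card_phi[OF finite_img[OF assms], of "\<lambda>c. block_number \<mu> c = k \<and> oidx \<nu> (\<alpha> -` {c}) = l"] by simp
qed

lemma permutes_0: "\<sigma> permutes {1..r::nat} \<Longrightarrow> \<sigma> 0 = 0"
  by (erule permutes_not_in) simp

lemma full_transf_comp:
  assumes "\<alpha> \<in> full_transf r" "\<rho> permutes {1..r}" "\<pi> permutes {1..r}"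
  shows "\<rho> \<circ> \<alpha> \<circ> \<pi> \<in> full_transf r"
proof -
  have "\<rho> (\<alpha> (\<pi> x)) \<in> {1..r}" if "x \<in> {1..r}" for x
  proof -
    have "\<pi> x \<in> {1..r}" using permutes_in_image[OF assms(3)] that by blast
    then have "\<alpha> (\<pi> x) \<in> {1..r}" by (rule full_transfD(1)[OF assms(1)])
    then show ?thesis using permutes_in_image[OF assms(2)] by blast
  qed
  moreover have "\<rho> (\<alpha> (\<pi> x)) = 0" if "x \<notin> {1..r}" for x
    using permutes_not_in[OF assms(3) that] full_transfD(2)[OF assms(1) that] permutes_0[OF assms(2)] by simp
  ultimately show ?thesis by (simp add: full_transf_def)
qed

lemma img_comp:
  assumes "\<alpha> \<in> full_transf r" "\<rho> permutes {1..r}" "\<pi> permutes {1..r}"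
  shows "img (\<rho> \<circ> \<alpha> \<circ> \<pi>) = \<rho> ` img \<alpha>"
  unfolding img_eq[OF full_transf_comp[OF assms]] img_eq[OF assms(1)] image_comp[symmetric]
  by (simp only: permutes_image[OF assms(3)])

lemma fibre_comp:
  assumes "\<rho> permutes {1..r::nat}"
  shows "(\<rho> \<circ> \<alpha> \<circ> \<pi>) -` {\<rho> c} = \<pi> -` (\<alpha> -` {c})"
  using permutes_inj[OF assms] by (auto simp: inj_eq)

lemma oidx_vimage:
  assumes "\<pi> \<in> young \<nu>" "d \<subseteq> {1..sum_list \<nu>}"
  shows "oidx \<nu> (\<pi> -` d) = oidx \<nu> d"
proof -
  have "\<pi> -` d \<in> subset_orbit \<nu> d" using assms(1) by (auto simp: subset_orbit_def)
  then show ?thesis using subset_orbit_iff[OF assms(2)] oidx_eq_iff[OF _ assms(2)] by blast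
qed

lemma dcm_comp:
  assumes "\<alpha> \<in> full_transf r" "\<rho> \<in> young \<mu>" "\<pi> \<in> young \<nu>" "sum_list \<mu> = r" "sum_list \<nu> = r"
  shows "dcm \<mu> \<nu> (\<rho> \<circ> \<alpha> \<circ> \<pi>) = dcm \<mu> \<nu> \<alpha>"
proof (intro ext)
  fix k l
  have \<rho>: "\<rho> permutes {1..r}" and \<pi>: "\<pi> permutes {1..r}"
    using young_permutes[OF assms(2)] young_permutes[OF assms(3)] assms(4,5) by simp_all
  have "{c\<in>img (\<rho> \<circ> \<alpha> \<circ> \<pi>). block_number \<mu> c = k \<and> oidx \<nu> ((\<rho> \<circ> \<alpha> \<circ> \<pi>) -` {c}) = l} =
    \<rho> ` {c\<in>img \<alpha>. block_number \<mu> (\<rho> c) = k \<and> oidx \<nu> ((\<rho> \<circ> \<alpha> \<circ> \<pi>) -` {\<rho> c}) = l}"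
    unfolding img_comp[OF assms(1) \<rho> \<pi>] by blast
  also have "{c\<in>img \<alpha>. block_number \<mu> (\<rho> c) = k \<and> oidx \<nu> ((\<rho> \<circ> \<alpha> \<circ> \<pi>) -` {\<rho> c}) = l} =
    {c\<in>img \<alpha>. block_number \<mu> c = k \<and> oidx \<nu> (\<alpha> -` {c}) = l}"
  proof (rule Collect_cong, rule conj_cong[OF refl])
    fix c assume c: "c \<in> img \<alpha>"
    have "block_number \<mu> (\<rho> c) = block_number \<mu> c"
      using img_subset[OF assms(1)] c assms(4) by (intro young_block_number[OF assms(2)]) auto
    moreover have "oidx \<nu> ((\<rho> \<circ> \<alpha> \<circ> \<pi>) -` {\<rho> c}) = oidx \<nu> (\<alpha> -` {c})"
      unfolding fibre_comp[OF \<rho>] using fibre_subset[OF assms(1) c] assms(5) by (intro oidx_vimage assms(3)) simp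
    ultimately show "(block_number \<mu> (\<rho> c) = k \<and> oidx \<nu> ((\<rho> \<circ> \<alpha> \<circ> \<pi>) -` {\<rho> c}) = l) =
      (block_number \<mu> c = k \<and> oidx \<nu> (\<alpha> -` {c}) = l)" by simp
  qed
  finally show "dcm \<mu> \<nu> (\<rho> \<circ> \<alpha> \<circ> \<pi>) k l = dcm \<mu> \<nu> \<alpha> k l"
    unfolding dcm_def using card_image[OF permutes_inj_on[OF \<rho>]] by metis
qed

text \<open>Corresponding fibres have the same orbit number, hence the same block content.
  Block-preserving bijections between them fit together to one element of the Young group because
  the fibres partition \<open>{1..r}\<close>.\<close>

lemma fibre_glue:
  assumes \<alpha>: "\<alpha> \<in> full_transf r" and \<beta>: "\<beta> \<in> full_transf r" and \<nu>: "sum_list \<nu> = r"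
    and g: "bij_betw g (img \<alpha>) (img \<beta>)"
    and ty: "\<And>c. c \<in> img \<alpha> \<Longrightarrow> oidx \<nu> (\<beta> -` {g c}) = oidx \<nu> (\<alpha> -` {c})"
  obtains \<pi> where "\<pi> \<in> young \<nu>" "\<And>x. x \<in> {1..r} \<Longrightarrow> \<alpha> (\<pi> x) \<in> img \<alpha> \<and> g (\<alpha> (\<pi> x)) = \<beta> x"
proof -
  have "\<exists>h. bij_betw h (\<beta> -` {g c}) (\<alpha> -` {c}) \<and> (\<forall>x\<in>\<beta> -` {g c}. block_number \<nu> (h x) = block_number \<nu> x)"
    if c: "c \<in> img \<alpha>" for c
  proof -
    have gc: "g c \<in> img \<beta>" using bij_betwE[OF g] c by blast
    have s: "\<beta> -` {g c} \<subseteq> {1..r}" "\<alpha> -` {c} \<subseteq> {1..r}"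
      using fibre_subset[OF \<beta> gc] fibre_subset[OF \<alpha> c] by auto
    have "cnt \<nu> (\<beta> -` {g c}) = cnt \<nu> (\<alpha> -` {c})"
      using oidx_eq_iff[of "\<beta> -` {g c}" \<nu> "\<alpha> -` {c}"] ty[OF c] s \<nu> by simp
    then show ?thesis
      using cnt_eq_bij[of \<nu> "\<beta> -` {g c}" "\<alpha> -` {c}"] finite_subset[OF s(1)] finite_subset[OF s(2)]
      by (metis finite_atLeastAtMost)
  qed
  then obtain h where h: "\<And>c. c \<in> img \<alpha> \<Longrightarrow> bij_betw (h c) (\<beta> -` {g c}) (\<alpha> -` {c})"
    "\<And>c x. c \<in> img \<alpha> \<Longrightarrow> x \<in> \<beta> -` {g c} \<Longrightarrow> block_number \<nu> (h c x) = block_number \<nu> x"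
    by metis
  define gi where "gi = inv_into (img \<alpha>) g"
  define f where "f x = h (gi (\<beta> x)) x" for x
  have gi: "gi (\<beta> x) \<in> img \<alpha>" "g (gi (\<beta> x)) = \<beta> x" if x: "x \<in> {1..r}" for x
  proof -
    have "\<beta> x \<in> g ` img \<alpha>" using in_img[OF \<beta> x] bij_betw_imp_surj_on[OF g] by simp
    then show "gi (\<beta> x) \<in> img \<alpha>" "g (gi (\<beta> x)) = \<beta> x"
      unfolding gi_def by (rule inv_into_into, rule f_inv_into_f)
  qed
  have mem: "x \<in> \<beta> -` {g (gi (\<beta> x))}" if x: "x \<in> {1..r}" for x using gi(2)[OF x] by simp
  have \<alpha>f: "\<alpha> (f x) = gi (\<beta> x)" if x: "x \<in> {1..r}" for x
    using bij_betwE[OF h(1)[OF gi(1)[OF x]]] mem[OF x] unfolding f_def by blast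
  have fr: "f x \<in> {1..r}" if x: "x \<in> {1..r}" for x
    using full_transfD(2)[OF \<alpha>, of "f x"] \<alpha>f[OF x] img_nz[OF gi(1)[OF x]] by metis
  have "inj_on f {1..r}"
  proof (rule inj_onI)
    fix x y assume xy: "x \<in> {1..r}" "y \<in> {1..r}" "f x = f y"
    then have e: "gi (\<beta> x) = gi (\<beta> y)" using \<alpha>f by metis
    then have "\<beta> x = \<beta> y" using gi(2) xy by metis
    then show "x = y" using bij_betw_imp_inj_on[OF h(1)[OF gi(1)[OF xy(1)]]] mem xy e
      unfolding f_def inj_on_def by metis
  qed
  then have "bij_betw f {1..r} {1..r}"
    using fr by (intro bij_betw_imageI endo_inj_surj) auto
  from bij_betw_permutes_extend[OF this] have p: "(\<lambda>x. if x \<in> {1..r} then f x else x) permutes {1..r}" .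
  show thesis
  proof (rule that)
    show "(\<lambda>x. if x \<in> {1..r} then f x else x) \<in> young \<nu>"
      unfolding young_iff \<nu> using p h(2)[OF gi(1) mem] by (simp add: f_def)
    show "\<alpha> (if x \<in> {1..r} then f x else x) \<in> img \<alpha> \<and> g (\<alpha> (if x \<in> {1..r} then f x else x)) = \<beta> x"
      if x: "x \<in> {1..r}" for x using \<alpha>f[OF x] gi[OF x] x by simp
  qed
qed

text \<open>Equal tables give a bijection of the images that matches blocks and fibre orbits. It
  extends to \<rho> on the left, and the matched fibres are glued to \<pi> on the right.\<close>

lemma double_coset_iff:
  assumes "\<alpha> \<in> full_transf r" "\<beta> \<in> full_transf r" "sum_list \<mu> = r" "sum_list \<nu> = r"
  shows "\<beta> \<in> double_coset \<mu> \<nu> \<alpha> \<longleftrightarrow> dcm \<mu> \<nu> \<beta> = dcm \<mu> \<nu> \<alpha>"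
proof
  assume "\<beta> \<in> double_coset \<mu> \<nu> \<alpha>"
  then show "dcm \<mu> \<nu> \<beta> = dcm \<mu> \<nu> \<alpha>"
    using dcm_comp[OF assms(1) _ _ assms(3,4)] by (auto simp: double_coset_def)
next
  assume eq: "dcm \<mu> \<nu> \<beta> = dcm \<mu> \<nu> \<alpha>"
  have "card {c\<in>img \<alpha>. (block_number \<mu> c, oidx \<nu> (\<alpha> -` {c})) = p} =
      card {c\<in>img \<beta>. (block_number \<mu> c, oidx \<nu> (\<beta> -` {c})) = p}" for p
    using fun_cong[OF fun_cong[OF eq, of "fst p"], of "snd p"] by (simp add: dcm_def prod_eq_iff)
  then obtain g where g: "bij_betw g (img \<alpha>) (img \<beta>)"
    "\<And>c. c \<in> img \<alpha> \<Longrightarrow> (block_number \<mu> (g c), oidx \<nu> (\<beta> -` {g c})) = (block_number \<mu> c, oidx \<nu> (\<alpha> -` {c}))"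
    using bij_betw_same_label_counts[OF finite_img[OF assms(1)] finite_img[OF assms(2)],
      of "\<lambda>c. (block_number \<mu> c, oidx \<nu> (\<alpha> -` {c}))" "\<lambda>c. (block_number \<mu> c, oidx \<nu> (\<beta> -` {c}))"] by blast
  obtain \<rho> where \<rho>: "\<rho> \<in> young \<mu>" "\<And>c. c \<in> img \<alpha> \<Longrightarrow> \<rho> c = g c"
    using young_extend[OF _ _ g(1), of \<mu>] g(2) img_subset[OF assms(1)] img_subset[OF assms(2)] assms(3) by auto
  obtain \<pi> where \<pi>: "\<pi> \<in> young \<nu>" "\<And>x. x \<in> {1..r} \<Longrightarrow> \<alpha> (\<pi> x) \<in> img \<alpha> \<and> g (\<alpha> (\<pi> x)) = \<beta> x"
    using fibre_glue[OF assms(1,2,4) g(1)] g(2) by blast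
  have p: "\<rho> permutes {1..r}" "\<pi> permutes {1..r}"
    using young_permutes[OF \<rho>(1)] young_permutes[OF \<pi>(1)] assms(3,4) by simp_all
  have "\<rho> (\<alpha> (\<pi> x)) = \<beta> x" for x
  proof (cases "x \<in> {1..r}")
    case True
    then show ?thesis using \<pi>(2)[OF True] \<rho>(2) by metis
  next
    case False
    then show ?thesis using permutes_not_in[OF p(2) False] full_transfD(2)[OF assms(1) False]
      full_transfD(2)[OF assms(2) False] permutes_0[OF p(1)] by simp
  qed
  then have "\<beta> = \<rho> \<circ> \<alpha> \<circ> \<pi>" by auto
  then show "\<beta> \<in> double_coset \<mu> \<nu> \<alpha>" unfolding double_coset_def using \<rho>(1) \<pi>(1) by blast
qed

lemma double_coset_self: "\<alpha> \<in> double_coset \<mu> \<nu> \<alpha>"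
  unfolding double_coset_def mem_Collect_eq by (intro exI[of _ id]) simp

lemma double_coset_subset:
  assumes "\<alpha> \<in> full_transf r" "sum_list \<mu> = r" "sum_list \<nu> = r"
  shows "double_coset \<mu> \<nu> \<alpha> \<subseteq> full_transf r"
  unfolding double_coset_def
  using full_transf_comp[OF assms(1)] young_permutes[of _ \<mu>] young_permutes[of _ \<nu>] assms(2,3) by auto

lemma double_coset_eq_iff:
  assumes "\<alpha> \<in> full_transf r" "\<beta> \<in> full_transf r" "sum_list \<mu> = r" "sum_list \<nu> = r"
  shows "double_coset \<mu> \<nu> \<alpha> = double_coset \<mu> \<nu> \<beta> \<longleftrightarrow> dcm \<mu> \<nu> \<alpha> = dcm \<mu> \<nu> \<beta>"
proof
  assume "double_coset \<mu> \<nu> \<alpha> = double_coset \<mu> \<nu> \<beta>"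
  then have "\<alpha> \<in> double_coset \<mu> \<nu> \<beta>" using double_coset_self by blast
  then show "dcm \<mu> \<nu> \<alpha> = dcm \<mu> \<nu> \<beta>" using double_coset_iff[OF assms(2,1,3,4)] by simp
next
  assume eq: "dcm \<mu> \<nu> \<alpha> = dcm \<mu> \<nu> \<beta>"
  have "\<gamma> \<in> double_coset \<mu> \<nu> \<alpha> \<longleftrightarrow> \<gamma> \<in> double_coset \<mu> \<nu> \<beta>" for \<gamma>
    using double_coset_iff[OF assms(1) _ assms(3,4), of \<gamma>] double_coset_iff[OF assms(2) _ assms(3,4), of \<gamma>]
      double_coset_subset[OF assms(1,3,4)] double_coset_subset[OF assms(2,3,4)] eq by auto
  then show "double_coset \<mu> \<nu> \<alpha> = double_coset \<mu> \<nu> \<beta>" by blast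
qed

lemma map_index_double_coset:
  assumes "\<alpha> \<in> full_transf r" "\<beta> \<in> double_coset \<mu> \<nu> \<alpha>" "sum_list \<mu> = r" "sum_list \<nu> = r"
  shows "map_index \<beta> = map_index \<alpha>"
proof -
  obtain \<rho> \<pi> where e: "\<beta> = \<rho> \<circ> \<alpha> \<circ> \<pi>" "\<rho> \<in> young \<mu>" "\<pi> \<in> young \<nu>"
    using assms(2) by (auto simp: double_coset_def)
  have p: "\<rho> permutes {1..r}" "\<pi> permutes {1..r}"
    using young_permutes[OF e(2)] young_permutes[OF e(3)] assms(3,4) by simp_all
  show ?thesis unfolding map_index_card e(1) img_comp[OF assms(1) p]
    by (rule card_image[OF permutes_inj_on[OF p(1)]])
qed

lemma finite_full_transf: "finite (full_transf r)"
proof -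
  have "inj_on (\<lambda>\<alpha>. restrict \<alpha> {1..r}) (full_transf r)"
  proof (rule inj_onI, rule ext)
    fix \<alpha> \<beta> x assume h: "\<alpha> \<in> full_transf r" "\<beta> \<in> full_transf r" "restrict \<alpha> {1..r} = restrict \<beta> {1..r}"
    show "\<alpha> x = \<beta> x"
    proof (cases "x \<in> {1..r}")
      case True then show ?thesis using h(3) by (metis restrict_apply')
    next
      case False then show ?thesis using full_transfD(2)[OF h(1)] full_transfD(2)[OF h(2)] by metis
    qed
  qed
  moreover have "(\<lambda>\<alpha>. restrict \<alpha> {1..r}) ` full_transf r \<subseteq> {1..r} \<rightarrow>\<^sub>E {1..r}"
    using full_transfD(1) by fastforce
  then have "finite ((\<lambda>\<alpha>. restrict \<alpha> {1..r}) ` full_transf r)" by (rule finite_subset) (simp add: finite_PiE)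
  ultimately show ?thesis by (rule finite_imageD[rotated])
qed

subsection \<open>Factorisation through the index\<close>

lemma factor_props:
  assumes \<alpha>: "\<alpha> \<in> full_transf r" and D: "D \<in> Dsets i r" and C: "C \<in> Csets i r" and w: "w permutes {1..i}"
    and eq: "\<alpha> = phi C \<circ> w \<circ> psi \<nu> D" and \<nu>: "sum_list \<nu> = r"
  shows "\<Union>D = {1..r}" "img \<alpha> = C" "fibs \<alpha> = D" "map_index \<alpha> = i"
    "\<And>j. j \<in> {1..i} \<Longrightarrow> \<alpha> -` {phi C (w j)} = psi \<nu> D -` {j}"
proof -
  have Dp: "finite D" "\<forall>d\<in>D. d \<noteq> {} \<and> d \<subseteq> {1..sum_list \<nu>}" "pairwise disjnt D" "card D = i"
    using D \<nu> by (auto simp: Dsets_def)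
  note psi = psi_props[OF Dp(1-3), unfolded Dp(4)]
  have Cp: "C \<subseteq> {1..r}" "card C = i" "finite C" using C finite_subset by (auto simp: Csets_def)
  note bijC = phi_bij[OF Cp(3), unfolded Cp(2)]
  have "\<Union>D \<subseteq> {1..r}" using Dp(2) \<nu> by blast
  moreover have "{1..r} \<subseteq> \<Union>D"
  proof
    fix x assume x: "x \<in> {1..r}"
    show "x \<in> \<Union>D"
    proof (rule ccontr)
      assume "x \<notin> \<Union>D"
      \<comment> \<open>A point outside all members of \<open>D\<close> would be sent to 0, which no
        map of the full transformation semigroup does on \<open>{1..r}\<close>.\<close>
      then have "\<alpha> x = phi C (w 0)" using psi(3) eq by simp
      also have "\<dots> = 0" by (simp add: permutes_0[OF w] phi_def)
      finally show False using full_transfD(1)[OF \<alpha> x] by simp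
    qed
  qed
  ultimately show U: "\<Union>D = {1..r}" by blast
  have psi_img: "psi \<nu> D ` {1..r} = {1..i}"
  proof (intro equalityI subsetI)
    fix j assume "j \<in> psi \<nu> D ` {1..r}" then show "j \<in> {1..i}" using psi(2) U by blast
  next
    fix j assume j: "j \<in> {1..i}"
    then have "psi \<nu> D -` {j} \<in> D" using bij_betwE[OF psi(1)] by blast
    then obtain x where "x \<in> psi \<nu> D -` {j}" "x \<in> \<Union>D" using Dp(2) by blast
    then show "j \<in> psi \<nu> D ` {1..r}" using U by auto
  qed
  have "\<alpha> ` {1..r} = phi C ` (w ` (psi \<nu> D ` {1..r}))" unfolding eq by (simp only: image_comp comp_assoc)
  then show im: "img \<alpha> = C"
    unfolding img_eq[OF \<alpha>] psi_img permutes_image[OF w] bij_betw_imp_surj_on[OF bijC] .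
  show "map_index \<alpha> = i" by (simp add: map_index_card im Cp(2))
  show fib: "\<alpha> -` {phi C (w j)} = psi \<nu> D -` {j}" if j: "j \<in> {1..i}" for j
  proof -
    have wj: "w j \<in> {1..i}" using permutes_in_image[OF w] j by blast
    have "\<alpha> x = phi C (w j) \<longleftrightarrow> psi \<nu> D x = j" for x
    proof (cases "x \<in> \<Union>D")
      case True
      then have "w (psi \<nu> D x) \<in> {1..i}" using psi(2)[OF True] permutes_in_image[OF w] by blast
      then have "phi C (w (psi \<nu> D x)) = phi C (w j) \<longleftrightarrow> w (psi \<nu> D x) = w j"
        using bij_betw_imp_inj_on[OF bijC] wj by (simp add: inj_on_eq_iff)
      also have "\<dots> \<longleftrightarrow> psi \<nu> D x = j" using permutes_inj[OF w] by (simp add: inj_eq)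
      finally show ?thesis by (simp add: eq)
    next
      case False
      then have "\<alpha> x = 0" using psi(3) eq permutes_0[OF w] by (simp add: phi_def)
      moreover have "phi C (w j) \<noteq> 0" using bij_betwE[OF bijC] wj Cp(1) by fastforce
      ultimately show ?thesis using psi(3)[OF False] j by auto
    qed
    then show ?thesis by auto
  qed
  have "fibs \<alpha> = (\<lambda>c. \<alpha> -` {c}) ` (phi C ` w ` {1..i})"
    unfolding fibs_def im permutes_image[OF w] bij_betw_imp_surj_on[OF bijC] ..
  also have "\<dots> = (\<lambda>j. psi \<nu> D -` {j}) ` {1..i}" unfolding image_image using fib by (intro image_cong) auto
  also have "\<dots> = D" using bij_betw_imp_surj_on[OF psi(1)] .
  finally show "fibs \<alpha> = D" .
qed

lemma fibs_Dsets:
  assumes "\<alpha> \<in> full_transf r"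
  shows "fibs \<alpha> \<in> Dsets (map_index \<alpha>) r" "\<Union>(fibs \<alpha>) = {1..r}"
proof -
  have "card (fibs \<alpha>) = map_index \<alpha>" unfolding fibs_def map_index_card by (rule card_image[OF fibs_inj])
  moreover have "finite (fibs \<alpha>)" using finite_img[OF assms] by (simp add: fibs_def)
  moreover have "d \<noteq> {} \<and> d \<subseteq> {1..r}" if "d \<in> fibs \<alpha>" for d
    using that fibre_nonempty fibre_subset[OF assms] unfolding fibs_def by blast
  moreover have "pairwise disjnt (fibs \<alpha>)"
    unfolding pairwise_def disjnt_def fibs_def by auto
  ultimately show "fibs \<alpha> \<in> Dsets (map_index \<alpha>) r" by (simp add: Dsets_def)
  show "\<Union>(fibs \<alpha>) = {1..r}"
    using fibre_subset[OF assms] in_img[OF assms] unfolding fibs_def by fastforce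
qed

lemma img_Csets: "\<alpha> \<in> full_transf r \<Longrightarrow> img \<alpha> \<in> Csets (map_index \<alpha>) r"
  using img_subset by (simp add: Csets_def map_index_card)

text \<open>The permutation compares two numberings of the fibres: the one by \<open>psi\<close>,
  and the one by the image points they lie over.\<close>

lemma factor_exists:
  assumes \<alpha>: "\<alpha> \<in> full_transf r" and \<nu>: "sum_list \<nu> = r"
  obtains w where "w permutes {1..map_index \<alpha>}" "\<alpha> = phi (img \<alpha>) \<circ> w \<circ> psi \<nu> (fibs \<alpha>)"
proof -
  let ?i = "map_index \<alpha>" and ?D = "fibs \<alpha>" and ?C = "img \<alpha>"
  have Dp: "finite ?D" "\<forall>d\<in>?D. d \<noteq> {} \<and> d \<subseteq> {1..sum_list \<nu>}" "pairwise disjnt ?D" "card ?D = ?i"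
    using fibs_Dsets(1)[OF \<alpha>] \<nu> by (auto simp: Dsets_def)
  note psi = psi_props[OF Dp(1-3), unfolded Dp(4)]
  note bijC = phi_bij[OF finite_img[OF \<alpha>], folded map_index_card]
  have bijF: "bij_betw (\<lambda>c. \<alpha> -` {c}) ?C ?D" unfolding bij_betw_def fibs_def using fibs_inj by blast
  define v where "v = inv_into {1..?i} (phi ?C) \<circ> (inv_into ?C (\<lambda>c. \<alpha> -` {c}) \<circ> (\<lambda>j. psi \<nu> ?D -` {j}))"
  have "bij_betw v {1..?i} {1..?i}"
    unfolding v_def
    by (intro bij_betw_trans[OF bij_betw_trans[OF psi(1) bij_betw_inv_into[OF bijF]] bij_betw_inv_into[OF bijC]])
  from bij_betw_permutes_extend[OF this] have w: "(\<lambda>x. if x \<in> {1..?i} then v x else x) permutes {1..?i}" .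
  have "\<alpha> x = phi ?C (if psi \<nu> ?D x \<in> {1..?i} then v (psi \<nu> ?D x) else psi \<nu> ?D x)" for x
  proof (cases "x \<in> {1..r}")
    case True
    then have j: "psi \<nu> ?D x \<in> {1..?i}" using psi(2) fibs_Dsets(2)[OF \<alpha>] by blast
    define d where "d = psi \<nu> ?D -` {psi \<nu> ?D x}"
    have d: "d \<in> ?D" "x \<in> d" using bij_betwE[OF psi(1)] j by (auto simp: d_def)
    have "\<alpha> x \<in> ?C" "\<alpha> -` {\<alpha> x} \<in> ?D" using in_img[OF \<alpha> True] by (auto simp: fibs_def)
    then have "d = \<alpha> -` {\<alpha> x}" using d Dp(3) unfolding pairwise_def disjnt_def by blast
    then have "inv_into ?C (\<lambda>c. \<alpha> -` {c}) d = \<alpha> x"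
      using inv_into_f_f[OF fibs_inj \<open>\<alpha> x \<in> ?C\<close>] by simp
    then have "v (psi \<nu> ?D x) = inv_into {1..?i} (phi ?C) (\<alpha> x)" by (simp add: v_def d_def)
    moreover have "\<alpha> x \<in> phi ?C ` {1..?i}" using bij_betw_imp_surj_on[OF bijC] \<open>\<alpha> x \<in> ?C\<close> by simp
    ultimately show ?thesis using j by (simp add: f_inv_into_f)
  next
    case False
    then have "psi \<nu> ?D x = 0" using psi(3) fibs_Dsets(2)[OF \<alpha>] by blast
    then show ?thesis using full_transfD(2)[OF \<alpha> False] by (simp add: phi_def)
  qed
  then have "\<alpha> = phi ?C \<circ> (\<lambda>x. if x \<in> {1..?i} then v x else x) \<circ> psi \<nu> ?D" unfolding comp_def by (rule ext)
  then show thesis by (rule that[OF w])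
qed

lemma DMsets_iff:
  assumes "sum_list \<nu> = r"
  shows "D \<in> DMsets (full_transf r) i \<nu> \<longleftrightarrow> (\<exists>\<alpha>\<in>full_transf r. map_index \<alpha> = i \<and> fibs \<alpha> = D)"
proof
  assume "D \<in> DMsets (full_transf r) i \<nu>"
  then obtain \<alpha> C \<sigma> where "\<alpha> \<in> full_transf r" "D \<in> Dsets i r" "C \<in> Csets i r" "\<sigma> permutes {1..i}"
    "\<alpha> = phi C \<circ> \<sigma> \<circ> psi \<nu> D" using assms unfolding DMsets_def by blast
  note f = factor_props[OF this assms]
  show "\<exists>\<alpha>\<in>full_transf r. map_index \<alpha> = i \<and> fibs \<alpha> = D"
    using f(3,4) \<open>\<alpha> \<in> full_transf r\<close> by blast
next
  assume "\<exists>\<alpha>\<in>full_transf r. map_index \<alpha> = i \<and> fibs \<alpha> = D"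
  then obtain \<alpha> where \<alpha>: "\<alpha> \<in> full_transf r" "map_index \<alpha> = i" "fibs \<alpha> = D" by blast
  obtain w where w: "w permutes {1..map_index \<alpha>}" "\<alpha> = phi (img \<alpha>) \<circ> w \<circ> psi \<nu> (fibs \<alpha>)"
    using factor_exists[OF \<alpha>(1) assms] .
  show "D \<in> DMsets (full_transf r) i \<nu>"
    unfolding DMsets_def assms using \<alpha> w fibs_Dsets(1)[OF \<alpha>(1)] img_Csets[OF \<alpha>(1)] by blast
qed

lemma sum_of_bool_eq_card: "finite A \<Longrightarrow> (\<Sum>x\<in>A. of_bool (P x) :: int) = int (card {x\<in>A. P x})"
  by (simp add: of_bool_def sum.If_cases Int_def)

subsection \<open>Orbits and their compositions\<close>

lemma C_comp_nth:
  assumes "C \<subseteq> {1..sum_list \<mu>}"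
  shows "C_comp \<mu> C = map (cnt \<mu> C) [1..<Suc (length \<mu>)]"
  unfolding C_comp_def
proof (rule map_cong[OF refl])
  fix j assume "j \<in> set [1..<Suc (length \<mu>)]"
  then have j: "j \<in> {1..length \<mu>}" by auto
  have "block \<mu> j \<inter> C = {x\<in>C. block_number \<mu> x = j}"
    using block_number_eq_iff[OF _ j] assms by blast
  then show "card (block \<mu> j \<inter> C) = cnt \<mu> C j" by (simp add: cnt_def)
qed

lemma C_comp_eq_iff:
  assumes "C \<subseteq> {1..sum_list \<mu>}" "C' \<subseteq> {1..sum_list \<mu>}"
  shows "C_comp \<mu> C = C_comp \<mu> C' \<longleftrightarrow> cnt \<mu> C = cnt \<mu> C'"
proof
  assume "C_comp \<mu> C = C_comp \<mu> C'"
  then have e: "\<forall>l\<in>set [1..<Suc (length \<mu>)]. cnt \<mu> C l = cnt \<mu> C' l"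
    unfolding C_comp_nth[OF assms(1)] C_comp_nth[OF assms(2)] by (simp only: map_eq_conv)
  have z: "cnt \<mu> B l = 0" if "B \<subseteq> {1..sum_list \<mu>}" "l \<notin> {1..length \<mu>}" for B l
  proof -
    have "{x\<in>B. block_number \<mu> x = l} = {}" using block_number_in(1) that by blast
    then show ?thesis by (simp only: cnt_def card.empty)
  qed
  show "cnt \<mu> C = cnt \<mu> C'"
  proof
    fix l show "cnt \<mu> C l = cnt \<mu> C' l"
    proof (cases "l \<in> {1..length \<mu>}")
      case True
      then have "l \<in> set [1..<Suc (length \<mu>)]" unfolding set_upt by auto
      then show ?thesis using e by blast
    qed (simp add: z assms)
  qed
qed (simp add: C_comp_nth assms)

lemma C_orbit_mem_iff:
  assumes "C0 \<in> Csets i (sum_list \<mu>)"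
  shows "C \<in> {\<rho> ` C0 | \<rho>. \<rho> \<in> young \<mu>} \<longleftrightarrow> C \<in> Csets i (sum_list \<mu>) \<and> C_comp \<mu> C = C_comp \<mu> C0"
proof
  have C0: "C0 \<subseteq> {1..sum_list \<mu>}" "card C0 = i" "finite C0" using assms finite_subset by (auto simp: Csets_def)
  {
    assume "C \<in> {\<rho> ` C0 | \<rho>. \<rho> \<in> young \<mu>}"
    then obtain \<rho> where \<rho>: "\<rho> \<in> young \<mu>" "C = \<rho> ` C0" by blast
    note p = young_permutes[OF \<rho>(1)]
    have sub: "C \<subseteq> {1..sum_list \<mu>}" unfolding \<rho>(2) using permutes_image[OF p] C0(1) by blast
    have bij: "bij_betw \<rho> C0 C" unfolding \<rho>(2) bij_betw_def using permutes_inj_on[OF p] by blast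
    have "cnt \<mu> C0 = cnt \<mu> C"
      by (rule cnt_bij[OF bij]) (use young_block_number[OF \<rho>(1)] C0(1) in blast)
    then show "C \<in> Csets i (sum_list \<mu>) \<and> C_comp \<mu> C = C_comp \<mu> C0"
      using sub bij_betw_same_card[OF bij] C0 C_comp_eq_iff[OF sub C0(1)] by (simp add: Csets_def)
  }
  assume C: "C \<in> Csets i (sum_list \<mu>) \<and> C_comp \<mu> C = C_comp \<mu> C0"
  then have C': "C \<subseteq> {1..sum_list \<mu>}" "finite C" using finite_subset by (auto simp: Csets_def)
  then have "cnt \<mu> C0 = cnt \<mu> C" using C_comp_eq_iff[OF C'(1) C0(1)] C by simp
  then obtain g where g: "bij_betw g C0 C" "\<And>x. x \<in> C0 \<Longrightarrow> block_number \<mu> (g x) = block_number \<mu> x"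
    using cnt_eq_bij C0(3) C'(2) by blast
  obtain \<rho> where \<rho>: "\<rho> \<in> young \<mu>" "\<And>x. x \<in> C0 \<Longrightarrow> \<rho> x = g x"
    using young_extend[OF C0(1) C'(1) g] by blast
  have "\<rho> ` C0 = C" using \<rho>(2) bij_betw_imp_surj_on[OF g(1)] by auto
  then show "C \<in> {\<rho> ` C0 | \<rho>. \<rho> \<in> young \<mu>}" using \<rho>(1) by blast
qed

text \<open>The composition is constant on the orbit and separates orbits, so
  \<open>the_elem\<close> meets a singleton and membership becomes an equation between
  compositions.\<close>

lemma C_orbit_comp_eq:
  assumes "Q \<in> C_orbits i \<mu>" "C \<in> Q"
  shows "C_orbit_comp \<mu> Q = C_comp \<mu> C" "C \<in> Csets i (sum_list \<mu>)"
    "C' \<in> Q \<longleftrightarrow> C' \<in> Csets i (sum_list \<mu>) \<and> C_comp \<mu> C' = C_comp \<mu> C"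
proof -
  obtain C0 where C0: "C0 \<in> Csets i (sum_list \<mu>)" "Q = {\<rho> ` C0 | \<rho>. \<rho> \<in> young \<mu>}"
    using assms(1) by (auto simp: C_orbits_def)
  note m = C_orbit_mem_iff[OF C0(1), folded C0(2)]
  show "C \<in> Csets i (sum_list \<mu>)" using m assms(2) by blast
  have e: "C_comp \<mu> C = C_comp \<mu> C0" using m assms(2) by blast
  show "C' \<in> Q \<longleftrightarrow> C' \<in> Csets i (sum_list \<mu>) \<and> C_comp \<mu> C' = C_comp \<mu> C" using m e by simp
  have "C_comp \<mu> ` Q = {C_comp \<mu> C}" using m e assms(2) by auto
  then show "C_orbit_comp \<mu> Q = C_comp \<mu> C" by (simp add: C_orbit_comp_def)
qed

lemma C_orbit_nonempty: "Q \<in> C_orbits i \<mu> \<Longrightarrow> \<exists>C. C \<in> Q"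
  unfolding C_orbits_def using young_id by blast

lemma D_comp_fibs:
  assumes "\<alpha> \<in> full_transf r" "sum_list \<nu> = r"
  shows "D_comp \<nu> (fibs \<alpha>) = map (\<lambda>l. card {c\<in>img \<alpha>. oidx \<nu> (\<alpha> -` {c}) = l}) [1..<Suc (length (subset_orbits \<nu>))]"
proof -
  have "card {d\<in>fibs \<alpha>. oidx \<nu> d = l} = card {c\<in>img \<alpha>. oidx \<nu> (\<alpha> -` {c}) = l}" for l
  proof -
    have "{d\<in>fibs \<alpha>. oidx \<nu> d = l} = (\<lambda>c. \<alpha> -` {c}) ` {c\<in>img \<alpha>. oidx \<nu> (\<alpha> -` {c}) = l}"
      unfolding fibs_def by blast
    then show ?thesis using card_image[OF inj_on_subset[OF fibs_inj[of \<alpha>]]] by (metis (no_types, lifting) mem_Collect_eq subsetI)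
  qed
  moreover have "d \<subseteq> {1..sum_list \<nu>}" if "d \<in> fibs \<alpha>" for d
    using that fibre_subset[OF assms(1)] assms(2) by (auto simp: fibs_def)
  ultimately show ?thesis by (subst D_comp_oidx) auto
qed

lemma D_comp_fibs_eqD:
  assumes "\<alpha> \<in> full_transf r" "\<beta> \<in> full_transf r" "sum_list \<nu> = r" "D_comp \<nu> (fibs \<alpha>) = D_comp \<nu> (fibs \<beta>)"
  shows "card {c\<in>img \<alpha>. oidx \<nu> (\<alpha> -` {c}) = l} = card {c\<in>img \<beta>. oidx \<nu> (\<beta> -` {c}) = l}"
proof (cases "l \<in> {1..length (subset_orbits \<nu>)}")
  case True
  then have l: "l \<in> set [1..<Suc (length (subset_orbits \<nu>))]" unfolding set_upt by auto
  have "\<forall>l\<in>set [1..<Suc (length (subset_orbits \<nu>))].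
    card {c\<in>img \<alpha>. oidx \<nu> (\<alpha> -` {c}) = l} = card {c\<in>img \<beta>. oidx \<nu> (\<beta> -` {c}) = l}"
    using assms(4) unfolding D_comp_fibs[OF assms(1,3)] D_comp_fibs[OF assms(2,3)] by (simp only: map_eq_conv)
  then show ?thesis using l by blast
next
  case False
  have z: "{c\<in>img \<gamma>. oidx \<nu> (\<gamma> -` {c}) = l} = {}" if "\<gamma> \<in> full_transf r" for \<gamma>
    using oidx_props(1)[of _ \<nu>] fibre_subset[OF that] False assms(3) by blast
  show ?thesis unfolding z[OF assms(1)] z[OF assms(2)] ..
qed

lemma fibs_comp_right:
  assumes "\<alpha> \<in> full_transf r" "\<pi> permutes {1..r}"
  shows "fibs (\<alpha> \<circ> \<pi>) = (\<lambda>d. \<pi> -` d) ` fibs \<alpha>" "\<alpha> \<circ> \<pi> \<in> full_transf r" "img (\<alpha> \<circ> \<pi>) = img \<alpha>"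
proof -
  show "\<alpha> \<circ> \<pi> \<in> full_transf r" using full_transf_comp[OF assms(1) permutes_id assms(2)] by simp
  show im: "img (\<alpha> \<circ> \<pi>) = img \<alpha>" using img_comp[OF assms(1) permutes_id assms(2)] by simp
  show "fibs (\<alpha> \<circ> \<pi>) = (\<lambda>d. \<pi> -` d) ` fibs \<alpha>"
    unfolding fibs_def im image_image by (rule image_cong) auto
qed

text \<open>As for image sets, the composition separates orbits; families are represented by maps
  with these fibres so that \<open>fibre_glue\<close> applies.\<close>

lemma D_orbit_mem_iff:
  assumes \<alpha>: "\<alpha> \<in> full_transf r" and \<nu>: "sum_list \<nu> = r"
    and Q: "Q = {(\<lambda>d. \<pi> -` d) ` fibs \<alpha> | \<pi>. \<pi> \<in> young \<nu>}"
  shows "D \<in> Q \<longleftrightarrow> (\<exists>\<beta>\<in>full_transf r. map_index \<beta> = map_index \<alpha> \<and> fibs \<beta> = D \<and> D_comp \<nu> (fibs \<beta>) = D_comp \<nu> (fibs \<alpha>))"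
proof
  assume "D \<in> Q"
  then obtain \<pi> where \<pi>: "\<pi> \<in> young \<nu>" "D = (\<lambda>d. \<pi> -` d) ` fibs \<alpha>" using Q by blast
  have p: "\<pi> permutes {1..r}" using young_permutes[OF \<pi>(1)] \<nu> by simp
  note f = fibs_comp_right[OF \<alpha> p]
  have "D_comp \<nu> (fibs (\<alpha> \<circ> \<pi>)) = D_comp \<nu> (fibs \<alpha>)"
    unfolding D_comp_fibs[OF f(2) \<nu>] D_comp_fibs[OF \<alpha> \<nu>] f(3)
  proof (intro map_cong refl arg_cong[of _ _ card] Collect_cong conj_cong)
    fix l c assume c: "c \<in> img \<alpha>"
    have "(\<alpha> \<circ> \<pi>) -` {c} = \<pi> -` (\<alpha> -` {c})" by auto
    then show "oidx \<nu> ((\<alpha> \<circ> \<pi>) -` {c}) = l \<longleftrightarrow> oidx \<nu> (\<alpha> -` {c}) = l"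
      using oidx_vimage[OF \<pi>(1)] fibre_subset[OF \<alpha> c] \<nu> by simp
  qed
  moreover have "map_index (\<alpha> \<circ> \<pi>) = map_index \<alpha>" by (simp add: map_index_card f(3))
  ultimately show "\<exists>\<beta>\<in>full_transf r. map_index \<beta> = map_index \<alpha> \<and> fibs \<beta> = D \<and> D_comp \<nu> (fibs \<beta>) = D_comp \<nu> (fibs \<alpha>)"
    using f(1,2) \<pi>(2) by blast
next
  assume "\<exists>\<beta>\<in>full_transf r. map_index \<beta> = map_index \<alpha> \<and> fibs \<beta> = D \<and> D_comp \<nu> (fibs \<beta>) = D_comp \<nu> (fibs \<alpha>)"
  then obtain \<beta> where \<beta>: "\<beta> \<in> full_transf r" "fibs \<beta> = D" "D_comp \<nu> (fibs \<alpha>) = D_comp \<nu> (fibs \<beta>)" by force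
  obtain g where g: "bij_betw g (img \<alpha>) (img \<beta>)" "\<And>c. c \<in> img \<alpha> \<Longrightarrow> oidx \<nu> (\<beta> -` {g c}) = oidx \<nu> (\<alpha> -` {c})"
    using bij_betw_same_label_counts[OF finite_img[OF \<alpha>] finite_img[OF \<beta>(1)],
      of "\<lambda>c. oidx \<nu> (\<alpha> -` {c})" "\<lambda>c. oidx \<nu> (\<beta> -` {c})"] D_comp_fibs_eqD[OF \<alpha> \<beta>(1) \<nu> \<beta>(3)] by blast
  obtain \<pi> where \<pi>: "\<pi> \<in> young \<nu>" "\<And>x. x \<in> {1..r} \<Longrightarrow> \<alpha> (\<pi> x) \<in> img \<alpha> \<and> g (\<alpha> (\<pi> x)) = \<beta> x"
    using fibre_glue[OF \<alpha> \<beta>(1) \<nu> g] by blast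
  have p: "\<pi> permutes {1..r}" using young_permutes[OF \<pi>(1)] \<nu> by simp
  have "\<pi> -` (\<alpha> -` {c}) = \<beta> -` {g c}" if c: "c \<in> img \<alpha>" for c
  proof -
    have "\<alpha> (\<pi> x) = c \<longleftrightarrow> \<beta> x = g c" for x
    proof (cases "x \<in> {1..r}")
      case True
      then show ?thesis using \<pi>(2)[OF True] c bij_betw_imp_inj_on[OF g(1)] by (metis inj_on_eq_iff)
    next
      case False
      have "g c \<in> img \<beta>" using bij_betwE[OF g(1)] c by blast
      then show ?thesis
        using permutes_not_in[OF p False] full_transfD(2)[OF \<alpha> False] full_transfD(2)[OF \<beta>(1) False] img_nz[OF c] img_nz
        by metis
    qed
    then show ?thesis by auto
  qed
  then have "(\<lambda>d. \<pi> -` d) ` fibs \<alpha> = (\<lambda>c. \<beta> -` {g c}) ` img \<alpha>"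
    unfolding fibs_def image_image by (intro image_cong) auto
  also have "\<dots> = (\<lambda>c. \<beta> -` {c}) ` (g ` img \<alpha>)" by (simp add: image_image)
  also have "\<dots> = D" using \<beta>(2) bij_betw_imp_surj_on[OF g(1)] by (simp add: fibs_def)
  finally show "D \<in> Q" using Q \<pi>(1) by blast
qed

lemma D_orbit_comp_eq:
  assumes Q: "Q \<in> D_orbits (full_transf r) i \<nu>" and \<nu>: "sum_list \<nu> = r" and \<alpha>: "\<alpha> \<in> full_transf r" "fibs \<alpha> \<in> Q"
  shows "D_orbit_comp \<nu> Q = D_comp \<nu> (fibs \<alpha>)" "map_index \<alpha> = i"
    "D \<in> Q \<longleftrightarrow> (\<exists>\<beta>\<in>full_transf r. map_index \<beta> = i \<and> fibs \<beta> = D \<and> D_comp \<nu> (fibs \<beta>) = D_comp \<nu> (fibs \<alpha>))"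
proof -
  obtain D0 where D0: "D0 \<in> DMsets (full_transf r) i \<nu>" "Q = {(\<lambda>d. \<pi> -` d) ` D0 | \<pi>. \<pi> \<in> young \<nu>}"
    using Q by (auto simp: D_orbits_def)
  obtain \<alpha>0 where \<alpha>0: "\<alpha>0 \<in> full_transf r" "map_index \<alpha>0 = i" "fibs \<alpha>0 = D0"
    using D0(1) DMsets_iff[OF \<nu>] by blast
  note m = D_orbit_mem_iff[OF \<alpha>0(1) \<nu> D0(2)[folded \<alpha>0(3)], unfolded \<alpha>0(2)]
  have e: "D_comp \<nu> (fibs \<alpha>) = D_comp \<nu> (fibs \<alpha>0)" using m[of "fibs \<alpha>"] \<alpha>(2) by metis
  then show "D \<in> Q \<longleftrightarrow> (\<exists>\<beta>\<in>full_transf r. map_index \<beta> = i \<and> fibs \<beta> = D \<and> D_comp \<nu> (fibs \<beta>) = D_comp \<nu> (fibs \<alpha>))"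
    using m by simp
  have "D_comp \<nu> ` Q = {D_comp \<nu> (fibs \<alpha>)}" using m e \<alpha>(2) by (auto simp: image_iff) metis+
  then show "D_orbit_comp \<nu> Q = D_comp \<nu> (fibs \<alpha>)" by (simp add: D_orbit_comp_def)
  obtain \<beta> where "\<beta> \<in> full_transf r" "map_index \<beta> = i" "fibs \<beta> = fibs \<alpha>" using m[of "fibs \<alpha>"] \<alpha>(2) by metis
  moreover have "card (fibs \<gamma>) = map_index \<gamma>" for \<gamma> unfolding fibs_def map_index_card by (rule card_image[OF fibs_inj])
  ultimately show "map_index \<alpha> = i" by metis
qed

lemma D_orbit_nonempty:
  assumes "Q \<in> D_orbits (full_transf r) i \<nu>" "sum_list \<nu> = r"
  shows "\<exists>\<alpha>\<in>full_transf r. map_index \<alpha> = i \<and> fibs \<alpha> \<in> Q"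
proof -
  obtain D0 where D0: "D0 \<in> DMsets (full_transf r) i \<nu>" "Q = {(\<lambda>d. \<pi> -` d) ` D0 | \<pi>. \<pi> \<in> young \<nu>}"
    using assms(1) by (auto simp: D_orbits_def)
  have "D0 \<in> Q" unfolding D0(2) mem_Collect_eq by (intro exI[of _ id]) simp
  moreover obtain \<alpha> where "\<alpha> \<in> full_transf r" "map_index \<alpha> = i" "fibs \<alpha> = D0"
    using D0(1) unfolding DMsets_iff[OF assms(2)] by (elim bexE conjE)
  ultimately show ?thesis by metis
qed

lemma block_number_C_comp:
  assumes "\<alpha> \<in> full_transf r" "sum_list \<mu> = r"
  shows "j \<in> {1..map_index \<alpha>} \<Longrightarrow> block_number (C_comp \<mu> (img \<alpha>)) j = la \<mu> \<alpha> j"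
    and "j \<in> {1..map_index \<alpha>} \<Longrightarrow> j' \<in> {1..map_index \<alpha>} \<Longrightarrow> j \<le> j' \<Longrightarrow> la \<mu> \<alpha> j \<le> la \<mu> \<alpha> j'"
    and "j \<in> {1..map_index \<alpha>} \<Longrightarrow> la \<mu> \<alpha> j \<in> {1..length \<mu>}"
    and "l \<in> {1..length \<mu>} \<Longrightarrow> C_comp \<mu> (img \<alpha>) ! (l - 1) = card {j\<in>{1..map_index \<alpha>}. la \<mu> \<alpha> j = l}"
proof -
  let ?i = "map_index \<alpha>"
  have fin: "finite (img \<alpha>)" by (rule finite_img[OF assms(1)])
  have phi: "phi (img \<alpha>) j \<in> {1..sum_list \<mu>}" if "j \<in> {1..?i}" for j
    using phi_in[OF fin] that img_subset[OF assms(1)] assms(2) unfolding map_index_card by blast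
  show 1: "la \<mu> \<alpha> j \<in> {1..length \<mu>}" if j: "j \<in> {1..?i}" for j
    using block_number_in(1)[OF phi[OF j]] j by (simp add: la_def)
  show 2: "la \<mu> \<alpha> j \<le> la \<mu> \<alpha> j'" if j: "j \<in> {1..?i}" "j' \<in> {1..?i}" "j \<le> j'" for j j'
  proof -
    have "phi (img \<alpha>) j \<le> phi (img \<alpha>) j'"
      using phi_less[of j "img \<alpha>" j'] j fin unfolding map_index_card by (cases "j = j'") auto
    then show ?thesis using block_number_mono[OF phi[OF j(1)] phi[OF j(2)]] j by (simp add: la_def)
  qed
  have c: "cnt \<mu> (img \<alpha>) l = card {j\<in>{1..?i}. la \<mu> \<alpha> j = l}" for l
  proof -
    have "{j\<in>{1..?i}. la \<mu> \<alpha> j = l} = {j\<in>{1..card (img \<alpha>)}. block_number \<mu> (phi (img \<alpha>) j) = l}"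
      by (auto simp: la_def map_index_card)
    then show ?thesis unfolding cnt_def using card_phi[OF fin, of "\<lambda>c. block_number \<mu> c = l"] by simp
  qed
  have C: "C_comp \<mu> (img \<alpha>) = map (\<lambda>l. card {j\<in>{1..?i}. la \<mu> \<alpha> j = l}) [1..<Suc (length \<mu>)]"
    using C_comp_nth[of "img \<alpha>" \<mu>] img_subset[OF assms(1)] assms(2) c by simp
  show "block_number (C_comp \<mu> (img \<alpha>)) j = la \<mu> \<alpha> j" if "j \<in> {1..?i}" for j
    using block_number_fibre_sizes(2)[OF 1 2 C that] .
  show "C_comp \<mu> (img \<alpha>) ! (l - 1) = card {j\<in>{1..?i}. la \<mu> \<alpha> j = l}" if "l \<in> {1..length \<mu>}"
    unfolding C using that by (subst nth_map) (auto simp del: upt_Suc)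
qed

lemma lb_props:
  assumes "\<alpha> \<in> full_transf r" "sum_list \<nu> = r"
  shows "j \<in> {1..map_index \<alpha>} \<Longrightarrow> lb \<nu> \<alpha> j \<in> {1..length (subset_orbits \<nu>)}"
    and "card {j\<in>{1..map_index \<alpha>}. lb \<nu> \<alpha> j = l} = card {c\<in>img \<alpha>. oidx \<nu> (\<alpha> -` {c}) = l}"
    and "l \<in> {1..length (subset_orbits \<nu>)} \<Longrightarrow> D_comp \<nu> (fibs \<alpha>) ! (l - 1) = card {j\<in>{1..map_index \<alpha>}. lb \<nu> \<alpha> j = l}"
proof -
  let ?i = "map_index \<alpha>"
  have fin: "finite (img \<alpha>)" by (rule finite_img[OF assms(1)])
  show "lb \<nu> \<alpha> j \<in> {1..length (subset_orbits \<nu>)}" if j: "j \<in> {1..?i}" for j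
  proof -
    have "phi (img \<alpha>) j \<in> img \<alpha>" using phi_in[OF fin] j unfolding map_index_card by blast
    then show ?thesis using oidx_props(1)[of "\<alpha> -` {phi (img \<alpha>) j}" \<nu>] fibre_subset[OF assms(1)] j assms(2)
      by (simp add: lb_def)
  qed
  show c: "card {j\<in>{1..?i}. lb \<nu> \<alpha> j = l} = card {c\<in>img \<alpha>. oidx \<nu> (\<alpha> -` {c}) = l}" for l
  proof -
    have "{j\<in>{1..?i}. lb \<nu> \<alpha> j = l} = {j\<in>{1..card (img \<alpha>)}. oidx \<nu> (\<alpha> -` {phi (img \<alpha>) j}) = l}"
      by (auto simp: lb_def map_index_card)
    then show ?thesis using card_phi[OF fin, of "\<lambda>c. oidx \<nu> (\<alpha> -` {c}) = l"] by simp
  qed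
  show "D_comp \<nu> (fibs \<alpha>) ! (l - 1) = card {j\<in>{1..?i}. lb \<nu> \<alpha> j = l}" if "l \<in> {1..length (subset_orbits \<nu>)}"
    unfolding D_comp_fibs[OF assms] c using that by (subst nth_map) (auto simp del: upt_Suc)
qed

text \<open>The composition refers to the fibres in the order of \<open>psi\<close>, the label word
  to the image points in increasing order; \<open>w\<close> translates between the two
  numberings.\<close>

lemma block_number_D_comp:
  assumes \<alpha>: "\<alpha> \<in> full_transf r" and \<nu>: "sum_list \<nu> = r"
    and w: "w permutes {1..map_index \<alpha>}" "\<alpha> = phi (img \<alpha>) \<circ> w \<circ> psi \<nu> (fibs \<alpha>)"
  shows "j \<in> {1..map_index \<alpha>} \<Longrightarrow> block_number (D_comp \<nu> (fibs \<alpha>)) j = lb \<nu> \<alpha> (w j)"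
    and "j \<in> {1..map_index \<alpha>} \<Longrightarrow> j' \<in> {1..map_index \<alpha>} \<Longrightarrow> j \<le> j' \<Longrightarrow> lb \<nu> \<alpha> (w j) \<le> lb \<nu> \<alpha> (w j')"
proof -
  let ?i = "map_index \<alpha>" and ?D = "fibs \<alpha>"
  note fp = factor_props[OF \<alpha> fibs_Dsets(1)[OF \<alpha>] img_Csets[OF \<alpha>] w \<nu>]
  have Dp: "finite ?D" "\<forall>d\<in>?D. d \<noteq> {} \<and> d \<subseteq> {1..sum_list \<nu>}" "pairwise disjnt ?D" "card ?D = ?i"
    using fibs_Dsets(1)[OF \<alpha>] \<nu> by (auto simp: Dsets_def)
  note psi = psi_props[OF Dp(1-3), unfolded Dp(4)]
  have wi: "w j \<in> {1..?i}" if "j \<in> {1..?i}" for j using permutes_in_image[OF w(1)] that by blast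
  have lbw: "lb \<nu> \<alpha> (w j) = oidx \<nu> (psi \<nu> ?D -` {j})" if "j \<in> {1..?i}" for j
    using wi[OF that] fp(5)[OF that] by (simp add: lb_def)
  show 2: "lb \<nu> \<alpha> (w j) \<le> lb \<nu> \<alpha> (w j')" if "j \<in> {1..?i}" "j' \<in> {1..?i}" "j \<le> j'" for j j'
    using lbw psi(4) that by simp
  have 1: "lb \<nu> \<alpha> (w j) \<in> {1..length (subset_orbits \<nu>)}" if "j \<in> {1..?i}" for j
    using lb_props(1)[OF \<alpha> \<nu> wi[OF that]] .
  have "card {c\<in>img \<alpha>. oidx \<nu> (\<alpha> -` {c}) = l} = card {x\<in>{1..?i}. lb \<nu> \<alpha> (w x) = l}" for l
    unfolding lb_props(2)[OF \<alpha> \<nu>, symmetric]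
    using card_permutes_Collect[OF w(1), of "\<lambda>j. lb \<nu> \<alpha> j = l"] by simp
  then have D: "D_comp \<nu> ?D = map (\<lambda>l. card {x\<in>{1..?i}. lb \<nu> \<alpha> (w x) = l}) [1..<Suc (length (subset_orbits \<nu>))]"
    unfolding D_comp_fibs[OF \<alpha> \<nu>] by simp
  show "block_number (D_comp \<nu> ?D) j = lb \<nu> \<alpha> (w j)" if "j \<in> {1..?i}" for j
    using block_number_fibre_sizes(2)[where h = "\<lambda>j. lb \<nu> \<alpha> (w j)", OF 1 2 D that] .
qed

subsection \<open>Coordinates\<close>

lemma lookup_coset_sum: "finite D \<Longrightarrow> lookup (coset_sum D) m = of_bool (m \<in> D)"
  by (simp add: coset_sum_def lookup_sum lookup_single when_def)

lemma finite_double_cosets [simp]: "finite (double_cosets (full_transf r) \<mu> \<nu>)"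
  by (simp add: double_cosets_def finite_full_transf)

definition coset_inv :: "nat \<Rightarrow> nat list \<Rightarrow> nat list \<Rightarrow> (tmap \<Rightarrow> 'b) \<Rightarrow> bool" where
  "coset_inv r \<mu> \<nu> g \<longleftrightarrow> (\<forall>\<alpha>\<in>full_transf r. \<forall>\<beta>\<in>double_coset \<mu> \<nu> \<alpha>. g \<beta> = g \<alpha>)"

text \<open>The vector whose coordinate at a double coset is the value of \<open>g\<close> there.
  For \<open>g\<close> with \<open>coset_inv\<close> the choice of a representative is
  immaterial.\<close>

definition vec :: "nat \<Rightarrow> nat list \<Rightarrow> nat list \<Rightarrow> (tmap \<Rightarrow> int) \<Rightarrow> (bkey \<Rightarrow>\<^sub>0 'k::comm_ring_1)" where
  "vec r \<mu> \<nu> g = (\<Sum>D\<in>double_cosets (full_transf r) \<mu> \<nu>.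
     single (\<mu>, \<nu>, D) (of_int (g (SOME \<alpha>. \<alpha> \<in> D))))"

text \<open>Evaluates a matrix on words at the two label words of a map. Together with
  \<open>vec\<close> it carries invariant matrices into the part of index \<open>i\<close> of the
  algebra.\<close>

definition pull :: "nat list \<Rightarrow> nat list \<Rightarrow> nat \<Rightarrow> ((nat \<Rightarrow> nat) \<Rightarrow> (nat \<Rightarrow> nat) \<Rightarrow> int) \<Rightarrow> tmap \<Rightarrow> int" where
  "pull \<mu> \<nu> i f \<alpha> = (if map_index \<alpha> = i then f (la \<mu> \<alpha>) (lb \<nu> \<alpha>) else 0)"

locale weights =
  fixes r :: nat and \<mu> \<nu> :: "nat list"
  assumes sum_\<mu> [simp]: "sum_list \<mu> = r" and sum_\<nu> [simp]: "sum_list \<nu> = r"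
begin

abbreviation "TM \<equiv> full_transf r"
abbreviation "DC \<equiv> double_cosets TM \<mu> \<nu>"

lemma DC_sub: "D \<in> DC \<Longrightarrow> D \<subseteq> TM"
  using double_coset_subset[of _ r \<mu> \<nu>] by (auto simp: double_cosets_def)

lemma DC_finite: "D \<in> DC \<Longrightarrow> finite D"
  using DC_sub finite_full_transf finite_subset by blast

lemma DC_I: "\<alpha> \<in> TM \<Longrightarrow> double_coset \<mu> \<nu> \<alpha> \<in> DC"
  by (simp add: double_cosets_def)

lemma DC_eq: "D \<in> DC \<Longrightarrow> \<alpha> \<in> D \<Longrightarrow> D = double_coset \<mu> \<nu> \<alpha>"
proof -
  assume D: "D \<in> DC" "\<alpha> \<in> D"
  then obtain \<beta> where \<beta>: "\<beta> \<in> TM" "D = double_coset \<mu> \<nu> \<beta>" by (auto simp: double_cosets_def)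
  have "\<alpha> \<in> TM" using DC_sub D by blast
  then show ?thesis using double_coset_iff[OF \<beta>(1) _ sum_\<mu> sum_\<nu>] double_coset_eq_iff[OF \<beta>(1) _ sum_\<mu> sum_\<nu>] D(2) \<beta>(2)
    by metis
qed

lemma DC_iff: "D \<in> DC \<Longrightarrow> \<alpha> \<in> TM \<Longrightarrow> \<alpha> \<in> D \<longleftrightarrow> D = double_coset \<mu> \<nu> \<alpha>"
  using DC_eq double_coset_self by blast

lemma DC_rep:
  assumes "D \<in> DC"
  shows "(SOME \<alpha>. \<alpha> \<in> D) \<in> D"
proof -
  obtain \<beta> where "D = double_coset \<mu> \<nu> \<beta>" using assms by (auto simp: double_cosets_def)
  then have "\<beta> \<in> D" by (simp add: double_coset_self)
  then show ?thesis by (rule someI[of "\<lambda>\<alpha>. \<alpha> \<in> D"])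
qed

text \<open>Double cosets partition the monoid, so a coset-invariant element has one expansion in
  coset sums, and each coefficient is the value on the coset.\<close>

lemma coords_lookup:
  assumes keys: "\<And>\<alpha>. \<alpha> \<notin> TM \<Longrightarrow> lookup f \<alpha> = 0" and inv: "coset_inv r \<mu> \<nu> (lookup f)"
    and \<alpha>: "\<alpha> \<in> TM"
  shows "lookup (coords TM \<mu> \<nu> f) (double_coset \<mu> \<nu> \<alpha>) = lookup f \<alpha>"
proof -
  let ?S = "\<lambda>c. \<Sum>D\<in>DC. frag_cmul (lookup c D) (coset_sum D)"
  let ?P = "\<lambda>c. keys c \<subseteq> DC \<and> f = ?S c"
  have S1: "lookup (?S c) \<beta> = lookup c (double_coset \<mu> \<nu> \<beta>)" if \<beta>: "\<beta> \<in> TM" for c \<beta>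
  proof -
    have "lookup (?S c) \<beta> = (\<Sum>D\<in>DC. if D = double_coset \<mu> \<nu> \<beta> then lookup c D else 0)"
      unfolding lookup_sum lookup_frag_cmul
      by (intro sum.cong refl) (simp add: lookup_coset_sum[OF DC_finite] DC_iff[OF _ \<beta>])
    also have "\<dots> = lookup c (double_coset \<mu> \<nu> \<beta>)"
      using DC_I[OF \<beta>] by simp
    finally show ?thesis .
  qed
  have S0: "lookup (?S c) \<beta> = 0" if \<beta>: "\<beta> \<notin> TM" for c \<beta>
    unfolding lookup_sum lookup_frag_cmul
    by (intro sum.neutral ballI) (use DC_sub \<beta> in \<open>auto simp: lookup_coset_sum[OF DC_finite]\<close>)
  define c where "c = (\<Sum>D\<in>DC. single D (lookup f (SOME \<alpha>. \<alpha> \<in> D)))"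
  have cl: "lookup c D = (if D \<in> DC then lookup f (SOME \<alpha>. \<alpha> \<in> D) else 0)" for D
    by (simp add: c_def lookup_sum lookup_single when_def)
  have cf: "lookup c (double_coset \<mu> \<nu> \<beta>) = lookup f \<beta>" if \<beta>: "\<beta> \<in> TM" for \<beta>
    using DC_rep[OF DC_I[OF \<beta>]] inv \<beta> by (simp add: cl DC_I coset_inv_def)
  have P: "?P c"
  proof
    show "keys c \<subseteq> DC" by (auto simp: in_keys_iff cl split: if_splits)
    show "f = ?S c"
    proof (rule poly_mapping_eqI)
      fix \<beta> show "lookup f \<beta> = lookup (?S c) \<beta>"
        by (cases "\<beta> \<in> TM") (simp_all add: S1 S0 cf keys)
    qed
  qed
  have uniq: "c' = c" if P': "?P c'" for c'
  proof (rule poly_mapping_eqI)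
    fix D show "lookup c' D = lookup c D"
    proof (cases "D \<in> DC")
      case True
      then obtain \<beta> where \<beta>: "\<beta> \<in> TM" "D = double_coset \<mu> \<nu> \<beta>" by (auto simp: double_cosets_def)
      have "lookup c' D = lookup (?S c') \<beta>" using S1[OF \<beta>(1)] \<beta>(2) by simp
      also have "?S c' = ?S c" using P P' by (metis (no_types, lifting))
      also have "lookup (?S c) \<beta> = lookup c D" using S1[OF \<beta>(1)] \<beta>(2) by simp
      finally show ?thesis .
    next
      case False
      then show ?thesis using P P' by (metis in_keys_iff subsetD)
    qed
  qed
  have "coords TM \<mu> \<nu> f = c" unfolding coords_def
    by (rule the_equality[where P = ?P and a = c]) (rule P, rule uniq)
  then show ?thesis using cf[OF \<alpha>] by simp
qed

lemma lookup_vec: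
  assumes "coset_inv r \<mu> \<nu> g" "\<alpha> \<in> TM"
  shows "lookup (vec r \<mu> \<nu> g :: bkey \<Rightarrow>\<^sub>0 'k::comm_ring_1) (\<mu>, \<nu>, double_coset \<mu> \<nu> \<alpha>) = of_int (g \<alpha>)"
proof -
  have "lookup (vec r \<mu> \<nu> g :: bkey \<Rightarrow>\<^sub>0 'k) (\<mu>, \<nu>, double_coset \<mu> \<nu> \<alpha>) =
    of_int (g (SOME \<beta>. \<beta> \<in> double_coset \<mu> \<nu> \<alpha>))"
    using DC_I[OF assms(2)] by (simp add: vec_def lookup_sum lookup_single when_def)
  then show ?thesis using DC_rep[OF DC_I[OF assms(2)]] assms by (simp add: coset_inv_def)
qed

lemma lookup_vec_other:
  assumes "\<And>D. D \<in> DC \<Longrightarrow> x \<noteq> (\<mu>, \<nu>, D)"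
  shows "lookup (vec r \<mu> \<nu> g :: bkey \<Rightarrow>\<^sub>0 'k::comm_ring_1) x = 0"
  unfolding vec_def lookup_sum by (intro sum.neutral ballI) (use assms in \<open>auto simp: lookup_single when_def\<close>)

lemma vec_cong: "(\<And>\<alpha>. \<alpha> \<in> TM \<Longrightarrow> g \<alpha> = g' \<alpha>) \<Longrightarrow> vec r \<mu> \<nu> g = (vec r \<mu> \<nu> g' :: bkey \<Rightarrow>\<^sub>0 'k::comm_ring_1)"
  unfolding vec_def by (intro sum.cong refl) (use DC_rep DC_sub in \<open>metis subsetD\<close>)

lemma vec_comb: "vec r \<mu> \<nu> (\<lambda>\<alpha>. c * g \<alpha> + h \<alpha>) =
    scale (of_int c) (vec r \<mu> \<nu> g) + (vec r \<mu> \<nu> h :: bkey \<Rightarrow>\<^sub>0 'k::comm_ring_1)"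
  by (rule poly_mapping_eqI)
    (simp add: vec_def lookup_add lookup_sum lookup_single sum_distrib_left sum.distrib[symmetric] when_def if_distrib cong: if_cong)

lemma embed_vec:
  assumes keys: "\<And>\<alpha>. \<alpha> \<notin> TM \<Longrightarrow> lookup f \<alpha> = 0"
    and g: "coset_inv r \<mu> \<nu> g" "\<And>\<alpha>. \<alpha> \<in> TM \<Longrightarrow> lookup f \<alpha> = g \<alpha>"
  shows "embed TM \<mu> \<nu> f = (vec r \<mu> \<nu> g :: bkey \<Rightarrow>\<^sub>0 'k::comm_ring_1)"
proof -
  have inv: "coset_inv r \<mu> \<nu> (lookup f)"
    using g double_coset_subset[OF _ sum_\<mu> sum_\<nu>] unfolding coset_inv_def by (metis subsetD)
  show ?thesis unfolding embed_def vec_def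
  proof (rule sum.cong[OF refl])
    fix D assume D: "D \<in> DC"
    have "(SOME \<alpha>. \<alpha> \<in> D) \<in> TM" "D = double_coset \<mu> \<nu> (SOME \<alpha>. \<alpha> \<in> D)"
      using DC_rep[OF D] DC_sub[OF D] DC_eq[OF D] by auto
    then have "lookup (coords TM \<mu> \<nu> f) D = g (SOME \<alpha>. \<alpha> \<in> D)"
      using coords_lookup[OF keys inv] g(2) by metis
    then show "single (\<mu>, \<nu>, D) (of_int (lookup (coords TM \<mu> \<nu> f) D) :: 'k) =
      single (\<mu>, \<nu>, D) (of_int (g (SOME \<alpha>. \<alpha> \<in> D)))" by simp
  qed
qed

end

lemma la_lb_in_W:
  assumes "\<alpha> \<in> full_transf r" "sum_list \<mu> = r" "sum_list \<nu> = r" "length \<mu> < K" "2 ^ r < K"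
  shows "la \<mu> \<alpha> \<in> W (map_index \<alpha>) K" "lb \<nu> \<alpha> \<in> W (map_index \<alpha>) K"
proof -
  interpret words "{1..map_index \<alpha>}" K by (rule words_range)
  show "la \<mu> \<alpha> \<in> W (map_index \<alpha>) K" unfolding F_def
  proof (rule PiE_I)
    fix x assume "x \<in> {1..map_index \<alpha>}"
    from block_number_C_comp(3)[OF assms(1,2) this] show "la \<mu> \<alpha> x \<in> {..<K}" using assms(4) by simp
  qed (auto simp: la_def)
  show "lb \<nu> \<alpha> \<in> W (map_index \<alpha>) K" unfolding F_def
  proof (rule PiE_I)
    fix x assume "x \<in> {1..map_index \<alpha>}"
    from lb_props(1)[OF assms(1,3) this] show "lb \<nu> \<alpha> x \<in> {..<K}"
      using assms(3,5) length_subset_orbits[of \<nu>] by simp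
  qed (auto simp: lb_def)
qed

text \<open>Members of one double coset have the same table of labels, and an invariant matrix
  depends on the table only.\<close>

lemma (in weights) coset_inv_pull:
  assumes "words.Inv {1..i} K f" "length \<mu> < K" "2 ^ r < K"
  shows "coset_inv r \<mu> \<nu> (pull \<mu> \<nu> i f)"
  unfolding coset_inv_def
proof (intro ballI)
  fix \<alpha> \<beta> assume \<alpha>: "\<alpha> \<in> full_transf r" and \<beta>: "\<beta> \<in> double_coset \<mu> \<nu> \<alpha>"
  interpret words "{1..i}" K by (rule words_range)
  have \<beta>M: "\<beta> \<in> full_transf r" using double_coset_subset[OF \<alpha> sum_\<mu> sum_\<nu>] \<beta> by blast
  have mi: "map_index \<beta> = map_index \<alpha>" by (rule map_index_double_coset[OF \<alpha> \<beta> sum_\<mu> sum_\<nu>])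
  show "pull \<mu> \<nu> i f \<beta> = pull \<mu> \<nu> i f \<alpha>"
  proof (cases "map_index \<alpha> = i")
    case True
    have "Cont i (la \<mu> \<beta>) (lb \<nu> \<beta>) = Cont i (la \<mu> \<alpha>) (lb \<nu> \<alpha>)"
      using Cont_la_lb[OF \<alpha>] Cont_la_lb[OF \<beta>M] double_coset_iff[OF \<alpha> \<beta>M sum_\<mu> sum_\<nu>] \<beta> mi True by metis
    then have "f (la \<mu> \<beta>) (lb \<nu> \<beta>) = f (la \<mu> \<alpha>) (lb \<nu> \<alpha>)"
      by (rule Inv_cont_eq[OF assms(1)])
        (use la_lb_in_W[OF \<alpha> sum_\<mu> sum_\<nu> assms(2,3)] la_lb_in_W[OF \<beta>M sum_\<mu> sum_\<nu> assms(2,3)] mi True in simp_all)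
    then show ?thesis using mi by (simp add: pull_def)
  qed (simp add: pull_def mi)
qed

subsection \<open>The monoid ring\<close>

lemma ring_mult_superset:
  assumes "finite A" "finite B" "keys f \<subseteq> A" "keys g \<subseteq> B"
  shows "f \<star> g = (\<Sum>x\<in>A. \<Sum>y\<in>B. single (x \<circ> y) (lookup f x * lookup g y))"
proof -
  have "f \<star> g = (\<Sum>x\<in>keys f. \<Sum>y\<in>B. single (x \<circ> y) (lookup f x * lookup g y))"
    unfolding ring_mult_def by (intro sum.cong refl sum.mono_neutral_left) (use assms in \<open>auto simp: in_keys_iff\<close>)
  also have "\<dots> = (\<Sum>x\<in>A. \<Sum>y\<in>B. single (x \<circ> y) (lookup f x * lookup g y))"
    by (intro sum.mono_neutral_left) (use assms in \<open>auto simp: in_keys_iff\<close>)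
  finally show ?thesis .
qed

lemma ring_mult_add_left: "(f + f') \<star> g = f \<star> g + f' \<star> g"
proof -
  let ?A = "keys f \<union> keys f'" and ?B = "keys g"
  have "keys (f + f') \<subseteq> ?A" by (rule keys_add)
  then show ?thesis
    by (subst (1 2 3) ring_mult_superset[of ?A ?B]) (auto simp: sum.distrib[symmetric] lookup_add algebra_simps single_add)
qed

lemma ring_mult_add_right: "g \<star> (f + f') = g \<star> f + g \<star> f'"
proof -
  let ?A = "keys f \<union> keys f'" and ?B = "keys g"
  have "keys (f + f') \<subseteq> ?A" by (rule keys_add)
  then show ?thesis
    by (subst (1 2 3) ring_mult_superset[of ?B ?A]) (auto simp: sum.distrib[symmetric] lookup_add algebra_simps single_add)
qed

lemma ring_mult_0 [simp]: "0 \<star> g = 0" "g \<star> 0 = 0"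
  by (simp_all add: ring_mult_def)

lemma ring_mult_sum_left: "(\<Sum>j\<in>A. f j) \<star> g = (\<Sum>j\<in>A. f j \<star> g)"
  by (induction A rule: infinite_finite_induct) (auto simp: ring_mult_add_left)

lemma ring_mult_sum_right: "g \<star> (\<Sum>j\<in>A. f j) = (\<Sum>j\<in>A. g \<star> f j)"
  by (induction A rule: infinite_finite_induct) (auto simp: ring_mult_add_right)

lemma ring_mult_single [simp]: "single x 1 \<star> single y 1 = single (x \<circ> y) 1"
  by (simp add: ring_mult_def)

lemma lookup_single_1: "lookup (single x (1::int)) y = of_bool (x = y)"
  by (simp add: lookup_single when_def)

subsection \<open>The cell basis in terms of labels\<close>

lemma cell_raw:
  "(\<Sum>C\<in>Q. \<Sum>D\<in>Q'. single (phi C) 1 \<star> murphy_sum lam \<kappa> S \<kappa>' T \<star> single (psi \<nu> D) 1) =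
   (\<Sum>C\<in>Q. \<Sum>D\<in>Q'. \<Sum>s\<in>standard_of_type lam \<kappa> S. \<Sum>t\<in>standard_of_type lam \<kappa>' T. \<Sum>\<sigma>\<in>young lam.
     single (phi C \<circ> (tab_perm lam s \<circ> \<sigma> \<circ> inv (tab_perm lam t)) \<circ> psi \<nu> D) 1)"
  by (simp add: murphy_sum_def murphy_def ring_mult_sum_left ring_mult_sum_right o_assoc)

lemma factor_inj:
  assumes D: "D \<in> Dsets i r" and C: "C \<in> Csets i r" and w: "w permutes {1..i}" "w' permutes {1..i}"
    and \<nu>: "sum_list \<nu> = r" and eq: "phi C \<circ> w \<circ> psi \<nu> D = phi C \<circ> w' \<circ> psi \<nu> D"
  shows "w = w'"
proof
  fix j
  have Dp: "finite D" "\<forall>d\<in>D. d \<noteq> {} \<and> d \<subseteq> {1..sum_list \<nu>}" "pairwise disjnt D" "card D = i"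
    using D \<nu> by (auto simp: Dsets_def)
  note psi = psi_props[OF Dp(1-3), unfolded Dp(4)]
  have Cp: "card C = i" "finite C" using C finite_subset by (auto simp: Csets_def)
  note bijC = phi_bij[OF Cp(2), unfolded Cp(1)]
  show "w j = w' j"
  proof (cases "j \<in> {1..i}")
    case True
    then have "psi \<nu> D -` {j} \<noteq> {}" using bij_betwE[OF psi(1)] Dp(2) by blast
    then obtain x where "psi \<nu> D x = j" by auto
    then have "phi C (w j) = phi C (w' j)" using fun_cong[OF eq, of x] by simp
    moreover have "w j \<in> {1..i}" "w' j \<in> {1..i}" using True permutes_in_image w by metis+
    ultimately show ?thesis using bij_betw_imp_inj_on[OF bijC] by (auto dest: inj_onD)
  qed (use permutes_not_in w in metis)
qed

lemma factor_in_full_transf: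
  assumes D: "D \<in> Dsets i r" "\<Union>D = {1..r}" and C: "C \<in> Csets i r" and w: "w permutes {1..i}" and \<nu>: "sum_list \<nu> = r"
  shows "phi C \<circ> w \<circ> psi \<nu> D \<in> full_transf r"
proof -
  have Dp: "finite D" "\<forall>d\<in>D. d \<noteq> {} \<and> d \<subseteq> {1..sum_list \<nu>}" "pairwise disjnt D" "card D = i"
    using D \<nu> by (auto simp: Dsets_def)
  note psi = psi_props[OF Dp(1-3), unfolded Dp(4)]
  have Cp: "card C = i" "finite C" "C \<subseteq> {1..r}" using C finite_subset by (auto simp: Csets_def)
  note bijC = phi_bij[OF Cp(2), unfolded Cp(1)]
  have "phi C (w (psi \<nu> D x)) \<in> {1..r}" if "x \<in> {1..r}" for x
  proof -
    have "w (psi \<nu> D x) \<in> {1..i}" using psi(2)[of x] that D(2) permutes_in_image[OF w] by blast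
    then show ?thesis using bij_betwE[OF bijC] Cp(3) by blast
  qed
  moreover have "phi C (w (psi \<nu> D x)) = 0" if "x \<notin> {1..r}" for x
  proof -
    have "psi \<nu> D x = 0" using psi(3)[of x] that D(2) by blast
    then show ?thesis by (simp add: permutes_0[OF w] phi_def)
  qed
  ultimately show ?thesis by (simp add: full_transf_def)
qed

text \<open>Composing \<open>tab_word s\<close> with the permutation of \<open>s\<close> gives the
  row word, for every standard \<open>s\<close>. So the only candidate for \<sigma>, obtained by
  solving for it, preserves rows exactly when the words of \<open>s\<close> and \<open>t\<close>
  match along \<open>w\<close>.\<close>

lemma row_stabiliser_iff:
  assumes s: "s \<in> standard_tableaux lam" and t: "t \<in> standard_tableaux lam" and w: "w permutes {1..sum_list lam}"
  shows "(\<exists>\<sigma>\<in>young lam. tab_perm lam s \<circ> \<sigma> \<circ> inv (tab_perm lam t) = w) \<longleftrightarrow> tab_word s \<circ> w = tab_word t"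
    and "\<sigma> \<in> young lam \<Longrightarrow> \<sigma>' \<in> young lam \<Longrightarrow> tab_perm lam s \<circ> \<sigma> \<circ> inv (tab_perm lam t) = tab_perm lam s \<circ> \<sigma>' \<circ> inv (tab_perm lam t) \<Longrightarrow> \<sigma> = \<sigma>'"
proof -
  let ?i = "sum_list lam"
  define a where "a = tab_perm lam s"
  define b where "b = tab_perm lam t"
  have a: "a permutes {1..?i}" and b: "b permutes {1..?i}"
    unfolding a_def b_def using tab_perm_props(1)[OF s] tab_perm_props(1)[OF t] by auto
  have ts: "tab_word s (a x) = row_word lam x" and tt: "tab_word t (b x) = row_word lam x" if "x \<in> {1..?i}" for x
    unfolding a_def b_def using tab_word_tab_perm[OF s that] tab_word_tab_perm[OF t that] by auto
  have ia: "inv a \<circ> a = id" "a \<circ> inv a = id" and ib: "inv b \<circ> b = id" "b \<circ> inv b = id"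
    using permutes_inv_o[OF a] permutes_inv_o[OF b] by auto
  define \<tau> where "\<tau> = inv a \<circ> w \<circ> b"
  have \<tau>: "\<tau> permutes {1..?i}" unfolding \<tau>_def by (intro permutes_compose a b w permutes_inv)
  have e: "a \<circ> \<sigma> \<circ> inv b = w \<longleftrightarrow> \<sigma> = \<tau>" for \<sigma>
  proof
    assume "a \<circ> \<sigma> \<circ> inv b = w"
    then have "\<tau> = (inv a \<circ> a) \<circ> \<sigma> \<circ> (inv b \<circ> b)" unfolding \<tau>_def by (auto simp: fun_eq_iff)
    then show "\<sigma> = \<tau>" by (simp add: ia ib)
  next
    assume "\<sigma> = \<tau>"
    then have "a \<circ> \<sigma> \<circ> inv b = (a \<circ> inv a) \<circ> w \<circ> (b \<circ> inv b)" unfolding \<tau>_def by (auto simp: fun_eq_iff)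
    then show "a \<circ> \<sigma> \<circ> inv b = w" by (simp add: ia ib)
  qed
  have aw: "a (\<tau> x) = w (b x)" for x using fun_cong[OF ia(2), of "w (b x)"] by (simp add: \<tau>_def)
  have "\<tau> \<in> young lam \<longleftrightarrow> (\<forall>x\<in>{1..?i}. row_word lam (\<tau> x) = row_word lam x)"
    by (rule young_row_word[OF \<tau>])
  also have "\<dots> \<longleftrightarrow> (\<forall>x\<in>{1..?i}. tab_word s (w (b x)) = tab_word t (b x))"
  proof (rule ball_cong[OF refl])
    fix x assume x: "x \<in> {1..?i}"
    have "\<tau> x \<in> {1..?i}" using permutes_in_image[OF \<tau>] x by blast
    then show "row_word lam (\<tau> x) = row_word lam x \<longleftrightarrow> tab_word s (w (b x)) = tab_word t (b x)"
      using ts[of "\<tau> x"] tt[OF x] aw by simp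
  qed
  also have "\<dots> \<longleftrightarrow> (\<forall>x\<in>{1..?i}. tab_word s (w x) = tab_word t x)"
    by (rule ball_permutes[OF b, where P = "\<lambda>x. tab_word s (w x) = tab_word t x"])
  also have "\<dots> \<longleftrightarrow> tab_word s \<circ> w = tab_word t"
  proof
    assume h: "\<forall>x\<in>{1..?i}. tab_word s (w x) = tab_word t x"
    show "tab_word s \<circ> w = tab_word t"
    proof
      fix x
      have st: "set (concat s) = {1..?i}" "set (concat t) = {1..?i}" using s t by (auto simp: standard_tableaux_def)
      show "(tab_word s \<circ> w) x = tab_word t x"
      proof (cases "x \<in> {1..?i}")
        case False
        then have "w x = x" using permutes_not_in[OF w] by blast
        then show ?thesis using False unfolding comp_apply tab_word_def st by (simp only: restrict_def if_False)
      qed (use h in simp)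
    qed
  qed (metis comp_apply)
  finally have y: "\<tau> \<in> young lam \<longleftrightarrow> tab_word s \<circ> w = tab_word t" .
  show "(\<exists>\<sigma>\<in>young lam. tab_perm lam s \<circ> \<sigma> \<circ> inv (tab_perm lam t) = w) \<longleftrightarrow> tab_word s \<circ> w = tab_word t"
    unfolding a_def[symmetric] b_def[symmetric] e y[symmetric] by simp
  show "\<sigma> = \<sigma>'" if "tab_perm lam s \<circ> \<sigma> \<circ> inv (tab_perm lam t) = tab_perm lam s \<circ> \<sigma>' \<circ> inv (tab_perm lam t)"
  proof -
    have "inv a \<circ> (a \<circ> \<sigma> \<circ> inv b) \<circ> b = inv a \<circ> (a \<circ> \<sigma>' \<circ> inv b) \<circ> b"
      using that unfolding a_def[symmetric] b_def[symmetric] by simp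
    then have "(inv a \<circ> a) \<circ> \<sigma> \<circ> (inv b \<circ> b) = (inv a \<circ> a) \<circ> \<sigma>' \<circ> (inv b \<circ> b)" by (simp add: o_assoc)
    then show ?thesis by (simp add: ia ib)
  qed
qed

lemma sum_of_bool_unique:
  assumes "finite A" "\<And>x y. x \<in> A \<Longrightarrow> y \<in> A \<Longrightarrow> P x \<Longrightarrow> P y \<Longrightarrow> x = y"
  shows "(\<Sum>x\<in>A. of_bool (P x) :: int) = of_bool (\<exists>x\<in>A. P x)"
proof (cases "\<exists>x\<in>A. P x")
  case True
  then obtain x where x: "x \<in> A" "P x" by blast
  then have "(\<Sum>y\<in>A. of_bool (P y) :: int) = (\<Sum>y\<in>A. if y = x then 1 else 0)"
    using assms(2) by (intro sum.cong refl) (auto simp: of_bool_def)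
  then show ?thesis using assms(1) x by auto
qed (auto intro!: sum.neutral)

text \<open>The coefficient at \<alpha> counts triples of \<open>s\<close>, \<open>t\<close> and
  \<sigma> whose Murphy term is the permutation \<open>w\<close> of \<alpha>. By
  \<open>row_stabiliser_iff\<close> these amount to pairs of words \<rho> and
  \<open>\<rho> \<circ> w\<close>, and by \<open>standard_of_type_bij\<close> the conditions on them
  are two tables; summing over \<rho> gives a matrix product.\<close>

theorem cell_elt_vec:
  assumes lam: "lam \<in> partitions i" and i: "1 \<le> i"
    and L: "(\<mu>, Q, S) \<in> Lset r n lam" and R: "(\<nu>, Q', T) \<in> Rset (full_transf r) r n lam"
    and K: "length lam \<le> K" "n < K" "2 ^ r < K"
  shows "cell_elt (full_transf r) lam (\<mu>, Q, S) (\<nu>, Q', T) = (vec r \<mu> \<nu> (pull \<mu> \<nu> i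
     (words.mm {1..i} K (words.tr (words.xi {1..i} (tab_matrix S))) (words.xi {1..i} (tab_matrix T)))) :: bkey \<Rightarrow>\<^sub>0 'k::comm_ring_1)"
proof -
  interpret words "{1..i}" K by (rule words_range)
  have sl: "sum_list lam = i" "sorted_wrt (\<ge>) lam" using lam by (auto simp: partitions_def)
  have \<mu>: "sum_list \<mu> = r" "length \<mu> = n" and Q: "Q \<in> C_orbits i \<mu>" and S: "S \<in> semistandard_tableaux lam (C_orbit_comp \<mu> Q)"
    using L sl by (auto simp: Lset_def compositions_def)
  have \<nu>: "sum_list \<nu> = r" "length \<nu> = n" and Q': "Q' \<in> D_orbits (full_transf r) i \<nu>" and T: "T \<in> semistandard_tableaux lam (D_orbit_comp \<nu> Q')"
    using R sl by (auto simp: Rset_def compositions_def)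
  interpret weights r \<mu> \<nu> by unfold_locales (fact \<mu> \<nu>)+
  let ?\<kappa> = "C_orbit_comp \<mu> Q" and ?\<kappa>' = "D_orbit_comp \<nu> Q'"
  let ?f = "mm (tr (xi (tab_matrix S))) (xi (tab_matrix T))"
  let ?A = "standard_of_type lam ?\<kappa> S" and ?B = "standard_of_type lam ?\<kappa>' T"
  let ?w = "\<lambda>s t \<sigma>. tab_perm lam s \<circ> \<sigma> \<circ> inv (tab_perm lam t)"
  let ?E = "\<Sum>C\<in>Q. \<Sum>D\<in>Q'. single (phi C) 1 \<star> murphy_sum lam ?\<kappa> S ?\<kappa>' T \<star> single (psi \<nu> D) 1"
  \<comment> \<open>The contribution of one image set and one family of fibres. It vanishes unless
    they are those of \<alpha>.\<close>
  define N where "N C D \<alpha> = (\<Sum>s\<in>?A. \<Sum>t\<in>?B. \<Sum>\<sigma>\<in>young lam. of_bool (phi C \<circ> ?w s t \<sigma> \<circ> psi \<nu> D = \<alpha>) :: int)" for C D \<alpha>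
  have lE: "lookup ?E \<alpha> = (\<Sum>C\<in>Q. \<Sum>D\<in>Q'. N C D \<alpha>)" for \<alpha>
    unfolding cell_raw N_def by (simp only: lookup_sum lookup_single_1)
  have stA: "s \<in> standard_tableaux lam" if "s \<in> ?A" for s using that by (simp add: standard_of_type_def)
  have stB: "t \<in> standard_tableaux lam" if "t \<in> ?B" for t using that by (simp add: standard_of_type_def)
  have wperm: "?w s t \<sigma> permutes {1..i}" if "s \<in> ?A" "t \<in> ?B" "\<sigma> \<in> young lam" for s t \<sigma>
    using tab_perm_props(1)[OF stA[OF that(1)]] tab_perm_props(1)[OF stB[OF that(2)]] young_permutes[OF that(3)] sl
    by (intro permutes_compose permutes_inv) auto
  have CQ: "C \<in> Csets i r" if "C \<in> Q" for C using C_orbit_comp_eq(2)[OF Q that] \<mu> by simp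
  have DQ: "D \<in> Dsets i r" "\<Union>D = {1..r}" if D: "D \<in> Q'" for D
  proof -
    obtain \<alpha>0 where a0: "\<alpha>0 \<in> full_transf r" "map_index \<alpha>0 = i" "fibs \<alpha>0 \<in> Q'"
      using D_orbit_nonempty[OF Q' \<nu>(1)] by blast
    obtain \<beta> where "\<beta> \<in> full_transf r" "map_index \<beta> = i" "fibs \<beta> = D"
      using D_orbit_comp_eq(3)[OF Q' \<nu>(1) a0(1,3)] D by metis
    then show "D \<in> Dsets i r" "\<Union>D = {1..r}" using fibs_Dsets by metis+
  qed
  have Nz: "N C D \<alpha> = 0" if h: "C \<in> Q" "D \<in> Q'" "\<not> (\<alpha> \<in> full_transf r \<and> map_index \<alpha> = i \<and> img \<alpha> = C \<and> fibs \<alpha> = D)" for C D \<alpha>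
    unfolding N_def
  proof (intro sum.neutral ballI)
    fix s t \<sigma> assume st: "s \<in> ?A" "t \<in> ?B" "\<sigma> \<in> young lam"
    have "phi C \<circ> ?w s t \<sigma> \<circ> psi \<nu> D \<noteq> \<alpha>"
    proof
      assume eq: "phi C \<circ> ?w s t \<sigma> \<circ> psi \<nu> D = \<alpha>"
      have M: "\<alpha> \<in> full_transf r"
        unfolding eq[symmetric] by (rule factor_in_full_transf[OF DQ[OF h(2)] CQ[OF h(1)] wperm[OF st] \<nu>(1)])
      show False using factor_props[OF M DQ(1)[OF h(2)] CQ[OF h(1)] wperm[OF st] eq[symmetric] \<nu>(1)] M h(3) by blast
    qed
    then show "of_bool (phi C \<circ> ?w s t \<sigma> \<circ> psi \<nu> D = \<alpha>) = (0::int)" by simp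
  qed
  have finQ: "finite Q" using CQ by (intro finite_subset[of Q "Pow {1..r}"]) (auto simp: Csets_def)
  have finQ': "finite Q'"
  proof (rule finite_subset)
    show "Q' \<subseteq> Pow (Pow {1..r})" using DQ(2) by blast
  qed simp
  have main: "lookup ?E \<alpha> = pull \<mu> \<nu> i ?f \<alpha>" if \<alpha>: "\<alpha> \<in> full_transf r" for \<alpha>
  proof (cases "map_index \<alpha> = i")
    case False
    then have "lookup ?E \<alpha> = 0" unfolding lE using Nz by (intro sum.neutral ballI) blast
    then show ?thesis using False by (simp add: pull_def)
  next
    case mi: True
    have laW: "la \<mu> \<alpha> \<in> F" and lbW: "lb \<nu> \<alpha> \<in> F"
      using la_lb_in_W[OF \<alpha> \<mu>(1) \<nu>(1), of K] \<mu>(2) K mi by auto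
    show ?thesis
    proof (cases "img \<alpha> \<in> Q \<and> fibs \<alpha> \<in> Q'")
      case True
      then have kap: "?\<kappa> = C_comp \<mu> (img \<alpha>)" "?\<kappa>' = D_comp \<nu> (fibs \<alpha>)"
        using C_orbit_comp_eq(1)[OF Q] D_orbit_comp_eq(1)[OF Q' \<nu>(1) \<alpha>] by auto
      have "lookup ?E \<alpha> = (\<Sum>C\<in>Q. if C = img \<alpha> then (\<Sum>D\<in>Q'. N C D \<alpha>) else 0)"
        unfolding lE using Nz by (intro sum.cong refl) (auto intro!: sum.neutral)
      also have "\<dots> = (\<Sum>D\<in>Q'. N (img \<alpha>) D \<alpha>)" using finQ True by simp
      also have "\<dots> = (\<Sum>D\<in>Q'. if D = fibs \<alpha> then N (img \<alpha>) D \<alpha> else 0)"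
        using Nz True by (intro sum.cong refl) auto
      also have "\<dots> = N (img \<alpha>) (fibs \<alpha>) \<alpha>" using finQ' True by simp
      finally have E: "lookup ?E \<alpha> = N (img \<alpha>) (fibs \<alpha>) \<alpha>" .
      obtain w where w: "w permutes {1..i}" "\<alpha> = phi (img \<alpha>) \<circ> w \<circ> psi \<nu> (fibs \<alpha>)"
        using factor_exists[OF \<alpha> \<nu>(1)] mi by metis
      have "N (img \<alpha>) (fibs \<alpha>) \<alpha> = (\<Sum>s\<in>?A. \<Sum>t\<in>?B. of_bool (tab_word s \<circ> w = tab_word t))"
        unfolding N_def
      proof (intro sum.cong refl)
        fix s t assume st: "s \<in> ?A" "t \<in> ?B"
        have "(\<Sum>\<sigma>\<in>young lam. of_bool (phi (img \<alpha>) \<circ> ?w s t \<sigma> \<circ> psi \<nu> (fibs \<alpha>) = \<alpha>) :: int)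
            = (\<Sum>\<sigma>\<in>young lam. of_bool (?w s t \<sigma> = w))"
        proof (intro sum.cong refl arg_cong[of _ _ of_bool])
          fix \<sigma> assume "\<sigma> \<in> young lam"
          note wp = wperm[OF st this]
          have "?w s t \<sigma> = w" if "phi (img \<alpha>) \<circ> ?w s t \<sigma> \<circ> psi \<nu> (fibs \<alpha>) = \<alpha>"
            by (rule factor_inj[OF _ _ wp w(1) \<nu>(1)]) (use fibs_Dsets(1)[OF \<alpha>] img_Csets[OF \<alpha>] mi w(2) that in auto)
          then show "phi (img \<alpha>) \<circ> ?w s t \<sigma> \<circ> psi \<nu> (fibs \<alpha>) = \<alpha> \<longleftrightarrow> ?w s t \<sigma> = w" using w(2) by metis
        qed
        also have "\<dots> = of_bool (\<exists>\<sigma>\<in>young lam. ?w s t \<sigma> = w)"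
          by (rule sum_of_bool_unique) (use row_stabiliser_iff(2)[OF stA[OF st(1)] stB[OF st(2)]] w(1) sl in auto)
        also have "\<dots> = of_bool (tab_word s \<circ> w = tab_word t)"
          using row_stabiliser_iff(1)[OF stA[OF st(1)] stB[OF st(2)], of w] w(1) sl by simp
        finally show "(\<Sum>\<sigma>\<in>young lam. of_bool (phi (img \<alpha>) \<circ> ?w s t \<sigma> \<circ> psi \<nu> (fibs \<alpha>) = \<alpha>) :: int) = of_bool (tab_word s \<circ> w = tab_word t)" .
      qed
      also have "\<dots> = ?f (la \<mu> \<alpha>) (lb \<nu> \<alpha>)"
      proof -
        let ?X = "{\<rho> \<in> W i K. Cont i \<rho> (la \<mu> \<alpha>) = tab_matrix S}"
        let ?Y = "{\<rho> \<in> W i K. Cont i \<rho> (lb \<nu> \<alpha> \<circ> w) = tab_matrix T}"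
        have bA: "bij_betw tab_word ?A ?X"
          unfolding kap
          by (rule standard_of_type_bij[OF sl _ _ _ K(1)])
            (use block_number_C_comp(1,2)[OF \<alpha> \<mu>(1)] S kap mi in auto)
        have bB: "bij_betw tab_word ?B ?Y"
          unfolding kap
          by (rule standard_of_type_bij[OF sl _ _ _ K(1)])
            (use block_number_D_comp[OF \<alpha> \<nu>(1), of w] w T kap mi in auto)
        have "(\<Sum>s\<in>?A. \<Sum>t\<in>?B. of_bool (tab_word s \<circ> w = tab_word t) :: int)
          = (\<Sum>\<rho>\<in>?X. \<Sum>\<rho>'\<in>?Y. of_bool (\<rho> \<circ> w = \<rho>'))"
          unfolding sum.reindex_bij_betw[OF bA, symmetric] sum.reindex_bij_betw[OF bB, symmetric] ..
        also have "\<dots> = (\<Sum>\<rho>\<in>?X. of_bool (Cont i \<rho> (lb \<nu> \<alpha>) = tab_matrix T))"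
        proof (rule sum.cong[OF refl])
          fix \<rho> assume r: "\<rho> \<in> ?X"
          then have rw: "\<rho> \<circ> w \<in> F" using w(1) by (auto intro: F_comp)
          have "(\<Sum>\<rho>'\<in>?Y. of_bool (\<rho> \<circ> w = \<rho>') :: int) = (\<Sum>\<rho>'\<in>?Y. if \<rho>' = \<rho> \<circ> w then 1 else 0)"
            by (rule sum.cong) (auto simp: of_bool_def)
          also have "\<dots> = of_bool (\<rho> \<circ> w \<in> ?Y)" by (subst sum.delta) (auto simp: of_bool_def)
          also have "\<dots> = of_bool (Cont i \<rho> (lb \<nu> \<alpha>) = tab_matrix T)"
            using rw cont_comp[OF w(1), of \<rho> "lb \<nu> \<alpha>"] by simp
          finally show "(\<Sum>\<rho>'\<in>?Y. of_bool (\<rho> \<circ> w = \<rho>') :: int) = of_bool (Cont i \<rho> (lb \<nu> \<alpha>) = tab_matrix T)" .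
        qed
        also have "\<dots> = (\<Sum>\<rho>\<in>F. of_bool (Cont i \<rho> (la \<mu> \<alpha>) = tab_matrix S) * of_bool (Cont i \<rho> (lb \<nu> \<alpha>) = tab_matrix T))"
          by (rule sum.mono_neutral_cong_left) auto
        also have "\<dots> = ?f (la \<mu> \<alpha>) (lb \<nu> \<alpha>)"
          by (simp add: mm_def tr_def xi_def)
        finally show ?thesis .
      qed
      finally show ?thesis using E mi by (simp add: pull_def)
    next
      case False
      have "lookup ?E \<alpha> = 0" unfolding lE
      proof (intro sum.neutral ballI)
        fix C D assume "C \<in> Q" "D \<in> Q'"
        then show "N C D \<alpha> = 0" by (rule Nz) (use \<open>C \<in> Q\<close> \<open>D \<in> Q'\<close> False in auto)
      qed
      \<comment> \<open>Off the given orbits the matrix entry must vanish too: a contributing word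
        would force the label counts of \<alpha> to equal the contents of \<open>S\<close> and
        \<open>T\<close>, and the compositions determine the orbits.\<close>
      moreover have "?f (la \<mu> \<alpha>) (lb \<nu> \<alpha>) = 0"
      proof (rule ccontr)
        assume "?f (la \<mu> \<alpha>) (lb \<nu> \<alpha>) \<noteq> 0"
        then obtain \<rho> where r: "\<rho> \<in> F" "Cont i \<rho> (la \<mu> \<alpha>) = tab_matrix S" "Cont i \<rho> (lb \<nu> \<alpha>) = tab_matrix T"
          by (elim mm_nonzeroE) (auto simp: tr_def xi_def)
        have col: "card {x\<in>{1..i}. c x = l} = count_list (concat U) l"
          if U: "map length U = lam" "Cont i \<rho> c = tab_matrix U" for c l U
        proof -
          have lU: "length U = length lam" using U(1) by (metis length_map)
          have "{x\<in>{1..i}. c x = l} = (\<Union>k<K. {x\<in>{1..i}. \<rho> x = k \<and> c x = l})"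
            using F_less[OF r(1)] by auto
          then have "card {x\<in>{1..i}. c x = l} = (\<Sum>k<K. card {x\<in>{1..i}. \<rho> x = k \<and> c x = l})"
            by (simp only:) (rule card_UN_disjoint, auto)
          also have "\<dots> = (\<Sum>k<K. tab_matrix U k l)" using U(2) by (auto simp: cont_def fun_eq_iff)
          also have "\<dots> = (\<Sum>k<length U. tab_matrix U k l)"
            by (rule sum.mono_neutral_right) (use lU K in \<open>auto simp: tab_matrix_def\<close>)
          also have "\<dots> = count_list (concat U) l" by (simp add: count_list_concat tab_matrix_def)
          finally show ?thesis .
        qed
        obtain C0 where C0: "C0 \<in> Q" using C_orbit_nonempty[OF Q] by blast
        have lk: "length ?\<kappa> = n" using C_orbit_comp_eq(1)[OF Q C0] \<mu>(2) by (simp add: C_comp_def del: upt_Suc)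
        have "C_comp \<mu> (img \<alpha>) = ?\<kappa>"
        proof (rule nth_equalityI)
          show "length (C_comp \<mu> (img \<alpha>)) = length ?\<kappa>" using lk \<mu>(2) by (simp add: C_comp_def del: upt_Suc)
          fix l assume "l < length (C_comp \<mu> (img \<alpha>))"
          then have l: "Suc l \<in> {1..length \<mu>}" "Suc l \<in> {1..length ?\<kappa>}" using lk \<mu>(2) by (auto simp: C_comp_def simp del: upt_Suc)
          have "C_comp \<mu> (img \<alpha>) ! l = card {x\<in>{1..i}. la \<mu> \<alpha> x = Suc l}"
            using block_number_C_comp(4)[OF \<alpha> \<mu>(1) l(1)] mi by simp
          also have "\<dots> = count_list (concat S) (Suc l)"
            using S by (intro col r) (simp add: semistandard_tableaux_def)
          also have "\<dots> = ?\<kappa> ! l" using S l(2) by (simp add: semistandard_tableaux_def)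
          finally show "C_comp \<mu> (img \<alpha>) ! l = ?\<kappa> ! l" .
        qed
        then have "img \<alpha> \<in> Q"
          using C_orbit_comp_eq(1)[OF Q C0] C_orbit_comp_eq(3)[OF Q C0, of "img \<alpha>"] img_Csets[OF \<alpha>] \<mu>(1) mi by simp
        moreover have "fibs \<alpha> \<in> Q'"
        proof -
          obtain \<alpha>0 where a0: "\<alpha>0 \<in> full_transf r" "map_index \<alpha>0 = i" "fibs \<alpha>0 \<in> Q'"
            using D_orbit_nonempty[OF Q' \<nu>(1)] by blast
          note k' = D_orbit_comp_eq(1)[OF Q' \<nu>(1) a0(1,3)]
          have lk': "length ?\<kappa>' = length (subset_orbits \<nu>)" unfolding k' by (simp add: D_comp_def)
          have "D_comp \<nu> (fibs \<alpha>) = ?\<kappa>'"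
          proof (rule nth_equalityI)
            show "length (D_comp \<nu> (fibs \<alpha>)) = length ?\<kappa>'" using lk' by (simp add: D_comp_def)
            fix l assume "l < length (D_comp \<nu> (fibs \<alpha>))"
            then have l: "Suc l \<in> {1..length (subset_orbits \<nu>)}" "Suc l \<in> {1..length ?\<kappa>'}" using lk' by (auto simp: D_comp_def)
            have "D_comp \<nu> (fibs \<alpha>) ! l = card {x\<in>{1..i}. lb \<nu> \<alpha> x = Suc l}"
              using lb_props(3)[OF \<alpha> \<nu>(1) l(1)] mi by simp
            also have "\<dots> = count_list (concat T) (Suc l)"
              using T by (intro col r) (simp add: semistandard_tableaux_def)
            also have "\<dots> = ?\<kappa>' ! l" using T l(2) by (simp add: semistandard_tableaux_def)
            finally show "D_comp \<nu> (fibs \<alpha>) ! l = ?\<kappa>' ! l" .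
          qed
          then show ?thesis using D_orbit_comp_eq(3)[OF Q' \<nu>(1) a0(1,3), of "fibs \<alpha>"] \<alpha> mi k' by auto
        qed
        ultimately show False using False by blast
      qed
      ultimately show ?thesis by (simp add: pull_def)
    qed
  qed
  have "cell_elt (full_transf r) lam (\<mu>, Q, S) (\<nu>, Q', T) = (embed (full_transf r) \<mu> \<nu> ?E :: bkey \<Rightarrow>\<^sub>0 'k)" by simp
  also have "\<dots> = vec r \<mu> \<nu> (pull \<mu> \<nu> i ?f)"
  proof (rule embed_vec)
    show "lookup ?E \<alpha> = 0" if "\<alpha> \<notin> full_transf r" for \<alpha>
      unfolding lE using Nz that by (intro sum.neutral ballI) blast
    show "coset_inv r \<mu> \<nu> (pull \<mu> \<nu> i ?f)"
      by (rule coset_inv_pull[where K = K]) (use \<mu>(2) K in \<open>simp_all add: Inv_mm Inv_tr\<close>)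
  qed (rule main)
  finally show ?thesis .
qed

section \<open>Spanning by cell elements of larger shape\<close>

lemma (in words) semistd_comp:
  assumes "\<sigma> permutes I"
  shows "semistd (\<rho> \<circ> \<sigma>) (b \<circ> \<sigma>) \<longleftrightarrow> semistd \<rho> b"
proof -
  have "card {x\<in>I. (\<rho> \<circ> \<sigma>) x = k \<and> (b \<circ> \<sigma>) x \<le> v} = card {x\<in>I. \<rho> x = k \<and> b x \<le> v}"
    "card {x\<in>I. (\<rho> \<circ> \<sigma>) x = k \<and> (b \<circ> \<sigma>) x < v} = card {x\<in>I. \<rho> x = k \<and> b x < v}" for k v
    using card_permutes_Collect[OF assms, of "\<lambda>x. \<rho> x = k \<and> b x \<le> v"]
      card_permutes_Collect[OF assms, of "\<lambda>x. \<rho> x = k \<and> b x < v"] by simp_all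
  then show ?thesis unfolding semistd_def by simp
qed

lemma partition_eqI:
  assumes "lam \<in> partitions i" "lam' \<in> partitions i'" "\<And>q. sum_list (take q lam) = sum_list (take q lam')"
  shows "lam = lam'"
proof -
  have grow: "sum_list (take q l) < sum_list (take (Suc q) l) \<longleftrightarrow> q < length l" if "l \<in> partitions j" for q j l
  proof (cases "q < length l")
    case True
    then have "l ! q \<noteq> 0" using that nth_mem[OF True] unfolding partitions_def by (metis (mono_tags, lifting) mem_Collect_eq)
    then show ?thesis using sum_list_take_Suc[OF True] True by simp
  qed simp
  have "q < length lam \<longleftrightarrow> q < length lam'" for q
    using grow[OF assms(1), of q] grow[OF assms(2), of q] assms(3) by simp
  then have len: "length lam = length lam'" by (metis nat_neq_iff)
  show ?thesis
  proof (rule nth_equalityI[OF len])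
    fix q assume q: "q < length lam"
    show "lam ! q = lam' ! q"
      using sum_list_take_Suc[OF q] sum_list_take_Suc[of q lam'] q len assms(3)[of q] assms(3)[of "Suc q"] by simp
  qed
qed

lemma length_partition: "lam \<in> partitions i \<Longrightarrow> length lam \<le> i"
proof -
  assume lam: "lam \<in> partitions i"
  have "length lam \<le> sum_list lam" if "0 \<notin> set lam" for lam :: "nat list"
    using that by (induction lam) (auto simp: Suc_le_eq)
  then show ?thesis using lam by (auto simp: partitions_def)
qed

text \<open>Summing a row of the table over all letters gives the row length. This turns the order
  on shapes into the order on \<open>ps\<close>.\<close>

lemma (in words) ps_tab_matrix:
  assumes "\<rho> \<in> F" "a \<in> F" "cont \<rho> a = tab_matrix S" "map length S = lam"
  shows "ps \<rho> q = sum_list (take q lam)"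
proof (induction q)
  case 0 show ?case by (simp add: ps_def)
next
  case (Suc q)
  have lS: "length S = length lam" using assms(4) by (metis length_map)
  have "{x\<in>I. \<rho> x = q} = (\<Union>l<K. {x\<in>I. \<rho> x = q \<and> a x = l})" using F_less[OF assms(2)] by auto
  then have "card {x\<in>I. \<rho> x = q} = (\<Sum>l<K. card {x\<in>I. \<rho> x = q \<and> a x = l})"
    by (simp only:) (rule card_UN_disjoint, auto)
  also have "\<dots> = (\<Sum>l<K. tab_matrix S q l)" using assms(3) by (auto simp: cont_def fun_eq_iff)
  finally have c: "card {x\<in>I. \<rho> x = q} = (\<Sum>l<K. tab_matrix S q l)" .
  show ?case
  proof (cases "q < length lam")
    case True
    have z: "count_list (S ! q) l = 0" if "\<not> l < K" for l
    proof -
      have "{x\<in>I. \<rho> x = q \<and> a x = l} = {}" using F_less[OF assms(2)] that by auto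
      then have "cont \<rho> a q l = 0" by (simp only: cont_def card.empty)
      then show ?thesis using assms(3) True lS by (simp add: tab_matrix_def)
    qed
    have "(\<Sum>l<K. count_list (S ! q) l) = (\<Sum>l\<in>set (S ! q). count_list (S ! q) l)"
    proof (rule sum.mono_neutral_right)
      show "set (S ! q) \<subseteq> {..<K}" using z by (metis count_list_0_iff lessThan_iff subsetI)
    qed (auto simp: count_list_0_iff)
    also have "\<dots> = length (S ! q)" by (simp add: sum_count_set)
    also have "\<dots> = lam ! q" using assms(4) True lS by (metis nth_map)
    finally have "card {x\<in>I. \<rho> x = q} = lam ! q" using c True lS by (simp add: tab_matrix_def)
    then show ?thesis using Suc ps_Suc[of \<rho> q] sum_list_take_Suc[OF True] by simp
  next
    case False
    then show ?thesis using Suc ps_Suc[of \<rho> q] c lS by (simp add: tab_matrix_def)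
  qed
qed

text \<open>A word that is semistandard against both label words of one map yields tableaux
  \<open>S\<close> and \<open>T\<close> of a common shape; the orbits are those of the image and of
  the fibres of that map.\<close>

lemma cell_keys_exist:
  assumes \<alpha>: "\<alpha> \<in> full_transf r" and c: "\<mu> \<in> compositions r n" "\<nu> \<in> compositions r n"
    and K: "n < K" "2 ^ r < K" and mi: "map_index \<alpha> = i"
    and \<tau>: "\<tau> \<in> W i K" "words.semistd {1..i} \<tau> (la \<mu> \<alpha>)" "words.semistd {1..i} \<tau> (lb \<nu> \<alpha>)"
  obtains lam Q S Q' T where "lam \<in> partitions i" "(\<mu>, Q, S) \<in> Lset r n lam" "(\<nu>, Q', T) \<in> Rset (full_transf r) r n lam"
    "tab_matrix S = Cont i \<tau> (la \<mu> \<alpha>)" "tab_matrix T = Cont i \<tau> (lb \<nu> \<alpha>)"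
    "\<forall>q. sum_list (take q lam) = words.ps {1..i} \<tau> q" "length lam \<le> K"
proof -
  interpret words "{1..i}" K by (rule words_range)
  have \<mu>: "sum_list \<mu> = r" "length \<mu> = n" and \<nu>: "sum_list \<nu> = r" "length \<nu> = n" using c by (auto simp: compositions_def)
  have lW: "la \<mu> \<alpha> \<in> W i K" "lb \<nu> \<alpha> \<in> W i K" using la_lb_in_W[OF \<alpha> \<mu>(1) \<nu>(1), of K] \<mu>(2) K mi by auto
  let ?\<kappa> = "C_comp \<mu> (img \<alpha>)" and ?\<kappa>' = "D_comp \<nu> (fibs \<alpha>)"
  have len: "length ?\<kappa> = length \<mu>" "length ?\<kappa>' = length (subset_orbits \<nu>)" by (simp_all add: C_comp_def D_comp_def del: upt_Suc)
  have h1: "la \<mu> \<alpha> x \<in> {1..length ?\<kappa>}" "lb \<nu> \<alpha> x \<in> {1..length ?\<kappa>'}" if "x \<in> {1..i}" for x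
    using block_number_C_comp(3)[OF \<alpha> \<mu>(1)] lb_props(1)[OF \<alpha> \<nu>(1)] mi that unfolding len by blast+
  have h2: "?\<kappa> ! (l - 1) = card {x\<in>{1..i}. la \<mu> \<alpha> x = l}" if "l \<in> {1..length ?\<kappa>}" for l
    using block_number_C_comp(4)[OF \<alpha> \<mu>(1)] mi that unfolding len by simp
  have h3: "?\<kappa>' ! (l - 1) = card {x\<in>{1..i}. lb \<nu> \<alpha> x = l}" if "l \<in> {1..length ?\<kappa>'}" for l
    using lb_props(3)[OF \<alpha> \<nu>(1)] mi that unfolding len by simp
  obtain lam S where S: "lam \<in> partitions i" "S \<in> semistandard_tableaux lam ?\<kappa>" "tab_matrix S = Cont i \<tau> (la \<mu> \<alpha>)"
    "\<forall>q. sum_list (take q lam) = ps \<tau> q" "length lam \<le> K"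
    by (rule semistandard_tableau_of_words[OF \<tau>(1) lW(1) \<tau>(2) h1(1) h2])
  obtain lam' T where T: "lam' \<in> partitions i" "T \<in> semistandard_tableaux lam' ?\<kappa>'" "tab_matrix T = Cont i \<tau> (lb \<nu> \<alpha>)"
    "\<forall>q. sum_list (take q lam') = ps \<tau> q" "length lam' \<le> K"
    by (rule semistandard_tableau_of_words[OF \<tau>(1) lW(2) \<tau>(3) h1(2) h3])
  have "lam' = lam" by (rule partition_eqI[OF T(1) S(1)]) (simp add: S(4) T(4))
  have sl: "sum_list lam = i" using S(1) by (simp add: partitions_def)
  define Q where "Q = {\<rho> ` img \<alpha> | \<rho>. \<rho> \<in> young \<mu>}"
  define Q' where "Q' = {(\<lambda>d. \<pi> -` d) ` fibs \<alpha> | \<pi>. \<pi> \<in> young \<nu>}"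
  have "Q \<in> C_orbits i \<mu>" unfolding C_orbits_def Q_def using img_Csets[OF \<alpha>] mi \<mu>(1) by blast
  moreover have "img \<alpha> \<in> Q" unfolding Q_def mem_Collect_eq by (intro exI[of _ id]) simp
  ultimately have L: "(\<mu>, Q, S) \<in> Lset r n lam"
    using S(2) c(1) sl C_orbit_comp_eq(1) by (simp add: Lset_def)
  have "fibs \<alpha> \<in> DMsets (full_transf r) i \<nu>" using \<alpha> mi DMsets_iff[OF \<nu>(1)] by blast
  then have "Q' \<in> D_orbits (full_transf r) i \<nu>" unfolding D_orbits_def Q'_def by blast
  moreover have "fibs \<alpha> \<in> Q'" unfolding Q'_def mem_Collect_eq by (intro exI[of _ id]) simp
  ultimately have R: "(\<nu>, Q', T) \<in> Rset (full_transf r) r n lam"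
    using T(2) c(2) sl D_orbit_comp_eq(1)[OF _ \<nu>(1) \<alpha>] \<open>lam' = lam\<close> by (simp add: Rset_def)
  show thesis by (rule that[OF S(1) L R S(3) T(3) S(4,5)])
qed

text \<open>The letters cover block numbers up to \<open>n\<close> and orbit numbers up to
  \<open>2 ^ r\<close>. Above them, \<open>K - 1\<close> is the parking row of straightening, and
  \<open>K - 2\<close> is the letter of the constant word that bounds all weights from below in
  \<open>single_in_upper\<close>.\<close>

locale transf_algebra =
  fixes r n K :: nat and type_k :: "'k::field itself"
  assumes r1: "1 \<le> r" and rn: "r \<le> n" and Kdef: "K = n + 2 ^ r + 3"
begin

abbreviation "M \<equiv> full_transf r"

sublocale VS: vector_space "scale :: 'k \<Rightarrow> (bkey \<Rightarrow>\<^sub>0 'k) \<Rightarrow> _"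
  by (rule vector_space_scale)

abbreviation cell :: "nat list \<Rightarrow> lkey \<Rightarrow> rkey \<Rightarrow> (bkey \<Rightarrow>\<^sub>0 'k)" where
  "cell \<equiv> cell_elt M"

abbreviation U :: "nat list \<Rightarrow> (bkey \<Rightarrow>\<^sub>0 'k) set" where
  "U \<equiv> cell_data.upper scale (Lambda M) Lambda_gt (Lset r n) (Rset M r n) cell"

lemma U_def: "U lam = VS.span {cell \<mu> s t | \<mu> s t. \<mu> \<in> Lambda M \<and> Lambda_gt \<mu> lam \<and> s \<in> Lset r n \<mu> \<and> t \<in> Rset M r n \<mu>}"
  by (simp add: cell_data.upper_def)

lemma KK: "n < K" "2 ^ r < K" "n < K - 2" by (simp_all add: Kdef)

lemma compD: "\<mu> \<in> compositions r n \<Longrightarrow> sum_list \<mu> = r \<and> length \<mu> = n"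
  by (simp add: compositions_def)

lemma weightsI: "\<mu> \<in> compositions r n \<Longrightarrow> \<nu> \<in> compositions r n \<Longrightarrow> weights r \<mu> \<nu>"
  by (simp add: weights_def compositions_def)

lemma la_lb_W:
  assumes "\<alpha> \<in> M" "\<mu> \<in> compositions r n" "\<nu> \<in> compositions r n"
  shows "la \<mu> \<alpha> \<in> W (map_index \<alpha>) K" "lb \<nu> \<alpha> \<in> W (map_index \<alpha>) K"
  using la_lb_in_W[OF assms(1), of \<mu> \<nu> K] compD[OF assms(2)] compD[OF assms(3)] KK by auto

lemma cell_vec:
  assumes lam: "lam \<in> partitions i" "1 \<le> i" "i \<le> r"
    and L: "(\<mu>, Q, S) \<in> Lset r n lam" and R: "(\<nu>, Q', T) \<in> Rset M r n lam"
  shows "cell lam (\<mu>, Q, S) (\<nu>, Q', T) = vec r \<mu> \<nu> (pull \<mu> \<nu> i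
     (words.mm {1..i} K (words.tr (words.xi {1..i} (tab_matrix S))) (words.xi {1..i} (tab_matrix T))))"
proof (rule cell_elt_vec[OF lam(1,2) L R _ KK(1,2)])
  show "length lam \<le> K" using length_partition[OF lam(1)] lam(3) rn KK(1) by simp
qed

text \<open>\<open>J_subset_span\<close> transported to the algebra. A codeterminant that is nonzero
  at the labels of some map is the cell element of the tableaux built from that map; one that is
  zero at all label pairs becomes the zero vector.\<close>

lemma J_in_span:
  assumes i: "1 \<le> i" "i \<le> r" and w: "\<forall>q\<ge>K - 1. w q = i"
    and c: "\<mu> \<in> compositions r n" "\<nu> \<in> compositions r n"
    and f: "f \<in> words.J {1..i} K w"
  shows "(vec r \<mu> \<nu> (pull \<mu> \<nu> i f) :: bkey \<Rightarrow>\<^sub>0 'k) \<in> VS.span {cell lam s t | lam s t. lam \<in> partitions i \<and>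
    w < (\<lambda>q. sum_list (take q lam)) \<and> s \<in> Lset r n lam \<and> t \<in> Rset M r n lam}" (is "_ \<in> VS.span ?G")
proof -
  interpret words "{1..i}" K by (rule words_range)
  interpret weights r \<mu> \<nu> using c by (rule weightsI)
  have labF: "la \<mu> \<alpha> \<in> F" "lb \<nu> \<alpha> \<in> F" if "\<alpha> \<in> full_transf r" "map_index \<alpha> = i" for \<alpha>
    using la_lb_W[OF that(1) c] that(2) by auto
  have "f \<in> lin (semistd_prods w)"
    using J_subset_span[of "K - 1" w] w f KK by auto
  then show ?thesis
  proof (induction rule: lin.induct)
    case zero
    have "vec r \<mu> \<nu> (pull \<mu> \<nu> i (\<lambda>a b. 0)) = (0 :: bkey \<Rightarrow>\<^sub>0 'k)" by (simp add: vec_def pull_def)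
    then show ?case by (simp add: VS.span_zero)
  next
    case (gen g)
    then obtain \<rho> a \<rho>' b where g: "g = mm (tr (xi (cont \<rho> a))) (xi (cont \<rho>' b))" "\<rho> \<in> F" "a \<in> F" "\<rho>' \<in> F" "b \<in> F"
      "semistd \<rho> a" "semistd \<rho>' b" "ps \<rho> = ps \<rho>'" "w < ps \<rho>"
      unfolding semistd_prods_def by blast
    show ?case
    proof (cases "\<exists>\<alpha>\<in>full_transf r. map_index \<alpha> = i \<and> g (la \<mu> \<alpha>) (lb \<nu> \<alpha>) \<noteq> 0")
      case False
      then have "vec r \<mu> \<nu> (pull \<mu> \<nu> i g) = (vec r \<mu> \<nu> (\<lambda>\<alpha>. 0) :: bkey \<Rightarrow>\<^sub>0 'k)"
        by (intro vec_cong) (auto simp: pull_def)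
      also have "\<dots> = 0" by (simp add: vec_def)
      finally show ?thesis by (simp add: VS.span_zero)
    next
      case True
      then obtain \<alpha> where \<alpha>: "\<alpha> \<in> full_transf r" "map_index \<alpha> = i" "g (la \<mu> \<alpha>) (lb \<nu> \<alpha>) \<noteq> 0" by blast
      obtain \<tau> where \<tau>: "\<tau> \<in> F" "cont \<tau> (la \<mu> \<alpha>) = cont \<rho> a" "cont \<tau> (lb \<nu> \<alpha>) = cont \<rho>' b"
        using \<alpha>(3) unfolding g(1) by (elim mm_nonzeroE) (auto simp: tr_def xi_def)
      have 1: "semistd \<tau> (la \<mu> \<alpha>)"
        using cont_eqE[OF \<tau>(2,1) labF(1)[OF \<alpha>(1,2)] g(2,3)] semistd_comp g(6) by metis
      have 2: "semistd \<tau> (lb \<nu> \<alpha>)"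
        using cont_eqE[OF \<tau>(3,1) labF(2)[OF \<alpha>(1,2)] g(4,5)] semistd_comp g(7) by metis
      have ps: "ps \<tau> = ps \<rho>" using cont_imp_ps_left(1)[OF \<tau>(2,1) labF(1)[OF \<alpha>(1,2)] g(2,3)] .
      obtain lam Q S Q' T where k: "lam \<in> partitions i" "(\<mu>, Q, S) \<in> Lset r n lam" "(\<nu>, Q', T) \<in> Rset (full_transf r) r n lam"
        "tab_matrix S = Cont i \<tau> (la \<mu> \<alpha>)" "tab_matrix T = Cont i \<tau> (lb \<nu> \<alpha>)"
        "\<forall>q. sum_list (take q lam) = ps \<tau> q"
        by (rule cell_keys_exist[OF \<alpha>(1) c KK(1,2) \<alpha>(2) \<tau>(1) 1 2])
      have "cell lam (\<mu>, Q, S) (\<nu>, Q', T) = vec r \<mu> \<nu> (pull \<mu> \<nu> i g)"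
        using cell_vec[OF k(1) i k(2,3)] k(4,5) \<tau>(2,3) g(1) by simp
      moreover have "w < (\<lambda>q. sum_list (take q lam))" using g(9) ps k(6) by simp
      ultimately have "vec r \<mu> \<nu> (pull \<mu> \<nu> i g) \<in> ?G" using k(1-3) by (auto intro!: exI)
      then show ?thesis by (rule VS.span_base)
    qed
  next
    case (comb f g c)
    have "pull \<mu> \<nu> i (\<lambda>a b. c * f a b + g a b) = (\<lambda>\<alpha>. c * pull \<mu> \<nu> i f \<alpha> + pull \<mu> \<nu> i g \<alpha>)"
      by (auto simp: pull_def)
    then show ?case using comb.IH by (simp add: vec_comb VS.span_add VS.span_scale)
  next
    case (eqv f g)
    have "vec r \<mu> \<nu> (pull \<mu> \<nu> i g) = (vec r \<mu> \<nu> (pull \<mu> \<nu> i f) :: bkey \<Rightarrow>\<^sub>0 'k)"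
      using eqv.hyps(2) labF by (intro vec_cong) (auto simp: pull_def)
    then show ?case using eqv.IH by simp
  qed
qed

lemma J_in_upper:
  assumes lam: "lam \<in> Lambda M" "lam \<in> partitions i" and c: "\<mu> \<in> compositions r n" "\<nu> \<in> compositions r n"
    and f: "f \<in> words.J {1..i} K (\<lambda>q. sum_list (take q lam))"
  shows "vec r \<mu> \<nu> (pull \<mu> \<nu> i f) \<in> U lam"
proof -
  have sl: "sum_list lam = i" using lam(2) by (simp add: partitions_def)
  have im: "i \<in> map_index ` M" using lam sl by (auto simp: Lambda_def partitions_def)
  then have i: "1 \<le> i" "i \<le> r" using map_index_pos r1 map_index_le by auto
  have full: "\<forall>q\<ge>K - 1. sum_list (take q lam) = i"
    using length_partition[OF lam(2)] i rn KK sl by auto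
  show ?thesis
    unfolding U_def
  proof (rule subsetD[OF VS.span_mono J_in_span[OF i full c f]], clarify)
    fix mu s t assume mu: "mu \<in> partitions i" "(\<lambda>q. sum_list (take q lam)) < (\<lambda>q. sum_list (take q mu))"
      and st: "s \<in> Lset r n mu" "t \<in> Rset M r n mu"
    have "mu \<in> Lambda M" using mu(1) im by (auto simp: Lambda_def)
    moreover have "Lambda_gt mu lam"
      using mu sl le_funD[OF less_imp_le[OF mu(2)]] by (auto simp: Lambda_gt_def dominates_def partitions_def)
    ultimately show "\<exists>\<mu> s' t'. cell mu s t = cell \<mu> s' t' \<and> \<mu> \<in> Lambda M \<and> Lambda_gt \<mu> lam \<and> s' \<in> Lset r n \<mu> \<and> t' \<in> Rset M r n \<mu>"
      using st by blast
  qed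
qed

text \<open>Every partition of a smaller index is larger than \<open>lam\<close>, so it suffices
  that the cell elements of index \<open>i\<close> span everything of that index.
  \<open>Inv_in_J\<close> with the least weight shows this; the orbit indicator of the labels of
  \<alpha> is pulled back to the basis vector of its double coset.\<close>

lemma single_in_upper:
  assumes \<alpha>: "\<alpha> \<in> M" and lt: "map_index \<alpha> < sum_list lam" and c: "\<mu> \<in> compositions r n" "\<nu> \<in> compositions r n"
  shows "single (\<mu>, \<nu>, double_coset \<mu> \<nu> \<alpha>) z \<in> U lam"
proof -
  define i where "i = map_index \<alpha>"
  have i: "1 \<le> i" "i \<le> r" using map_index_pos[OF \<alpha> r1] map_index_le[OF \<alpha>] by (auto simp: i_def)
  interpret words "{1..i}" K by (rule words_range)
  interpret weights r \<mu> \<nu> using c by (rule weightsI)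
  have laF: "la \<mu> \<alpha> \<in> F" "lb \<nu> \<alpha> \<in> F" using la_lb_W[OF \<alpha> c] by (auto simp: i_def)
  define f where "f = xi (cont (la \<mu> \<alpha>) (lb \<nu> \<alpha>))"
  have "f \<in> J (\<lambda>q. if K - 1 \<le> q then card {1..i} else 0)"
  proof (rule Inv_in_J)
    show "ps a (K - 1 - 1) = card {1..i}" if "a \<in> F" "b \<in> F" "f a b \<noteq> 0" for a b
    proof -
      have "ps a = ps (la \<mu> \<alpha>)" using xi_ps[OF laF that(1,2)] that(3) by (simp add: f_def)
      moreover have "la \<mu> \<alpha> x < K - 1 - 1" if "x \<in> {1..i}" for x
        using block_number_C_comp(3)[OF \<alpha> sum_\<mu> that[unfolded i_def]] compD[OF c(1)] KK by simp
      then have "{x\<in>{1..i}. la \<mu> \<alpha> x < K - 1 - 1} = {1..i}" by blast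
      ultimately show ?thesis by (simp add: ps_def)
    qed
  qed (use i KK in \<open>auto simp: f_def\<close>)
  then have J: "f \<in> J (\<lambda>q. if K - 1 \<le> q then i else 0)" by (simp cong: if_cong)
  have "vec r \<mu> \<nu> (pull \<mu> \<nu> i f) \<in> U lam"
    unfolding U_def
  proof (rule subsetD[OF VS.span_mono J_in_span[OF i _ c J]], clarify)
    fix mu s t assume mu: "mu \<in> partitions i" and st: "s \<in> Lset r n mu" "t \<in> Rset M r n mu"
    have "mu \<in> Lambda M" using mu \<alpha> by (auto simp: Lambda_def i_def)
    moreover have "Lambda_gt mu lam" using mu lt by (auto simp: Lambda_gt_def partitions_def i_def)
    ultimately show "\<exists>\<mu> s' t'. cell mu s t = cell \<mu> s' t' \<and> \<mu> \<in> Lambda M \<and> Lambda_gt \<mu> lam \<and> s' \<in> Lset r n \<mu> \<and> t' \<in> Rset M r n \<mu>"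
      using st by blast
  qed simp
  moreover have "vec r \<mu> \<nu> (pull \<mu> \<nu> i f) = (single (\<mu>, \<nu>, double_coset \<mu> \<nu> \<alpha>) 1 :: bkey \<Rightarrow>\<^sub>0 'k)"
  proof (rule poly_mapping_eqI)
    fix x
    have inv: "coset_inv r \<mu> \<nu> (pull \<mu> \<nu> i f)"
      by (rule coset_inv_pull[where K = K]) (use compD[OF c(1)] KK in \<open>auto simp: f_def\<close>)
    show "lookup (vec r \<mu> \<nu> (pull \<mu> \<nu> i f)) x = lookup (single (\<mu>, \<nu>, double_coset \<mu> \<nu> \<alpha>) (1::'k)) x"
    proof (cases "\<exists>\<beta>\<in>full_transf r. x = (\<mu>, \<nu>, double_coset \<mu> \<nu> \<beta>)")
      case True
      then obtain \<beta> where \<beta>: "\<beta> \<in> full_transf r" "x = (\<mu>, \<nu>, double_coset \<mu> \<nu> \<beta>)" by blast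
      have "pull \<mu> \<nu> i f \<beta> = of_bool (double_coset \<mu> \<nu> \<alpha> = double_coset \<mu> \<nu> \<beta>)"
      proof (cases "map_index \<beta> = i")
        case mi: True
        have "pull \<mu> \<nu> i f \<beta> = of_bool (dcm \<mu> \<nu> \<beta> = dcm \<mu> \<nu> \<alpha>)"
          using Cont_la_lb[OF \<beta>(1), of \<mu> \<nu>, unfolded mi] Cont_la_lb[OF \<alpha>, of \<mu> \<nu>, folded i_def] mi
          by (simp add: pull_def f_def xi_def)
        then show ?thesis using double_coset_eq_iff[OF \<alpha> \<beta>(1) sum_\<mu> sum_\<nu>] by (auto simp: eq_commute)
      next
        case False
        then have "double_coset \<mu> \<nu> \<alpha> \<noteq> double_coset \<mu> \<nu> \<beta>"
          using map_index_double_coset[OF \<alpha> _ sum_\<mu> sum_\<nu>, of \<beta>] double_coset_self[of \<beta> \<mu> \<nu>] by (auto simp: i_def)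
        then show ?thesis using False by (simp add: pull_def)
      qed
      then show ?thesis unfolding \<beta>(2) lookup_vec[OF inv \<beta>(1)] by (simp add: lookup_single when_def)
    next
      case False
      then have "\<And>D. D \<in> double_cosets (full_transf r) \<mu> \<nu> \<Longrightarrow> x \<noteq> (\<mu>, \<nu>, D)" by (auto simp: double_cosets_def)
      then have "lookup (vec r \<mu> \<nu> (pull \<mu> \<nu> i f) :: bkey \<Rightarrow>\<^sub>0 'k) x = 0" by (rule lookup_vec_other)
      moreover have "x \<noteq> (\<mu>, \<nu>, double_coset \<mu> \<nu> \<alpha>)" using False \<alpha> by blast
      ultimately show ?thesis by (simp add: lookup_single when_def)
    qed
  qed
  ultimately have "single (\<mu>, \<nu>, double_coset \<mu> \<nu> \<alpha>) 1 \<in> U lam" by simp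
  then have "scale z (single (\<mu>, \<nu>, double_coset \<mu> \<nu> \<alpha>) 1) \<in> U lam"
    unfolding U_def by (rule VS.span_scale)
  moreover have "scale z (single x 1) = single x z" for x
    by (rule poly_mapping_eqI) (simp add: lookup_single when_def)
  ultimately show ?thesis by simp
qed

lemma lower_in_upper:
  assumes c: "\<mu> \<in> compositions r n" "\<nu> \<in> compositions r n"
    and x: "\<And>y. lookup x y \<noteq> 0 \<Longrightarrow> \<exists>\<alpha>\<in>M. y = (\<mu>, \<nu>, double_coset \<mu> \<nu> \<alpha>) \<and> map_index \<alpha> < sum_list lam"
  shows "x \<in> U lam"
proof -
  have "x = (\<Sum>y\<in>keys x. single y (lookup x y))"
    by (rule poly_mapping_eqI) (simp add: lookup_sum lookup_single when_def in_keys_iff)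
  moreover have "(\<Sum>y\<in>keys x. single y (lookup x y)) \<in> U lam"
    unfolding U_def
  proof (rule VS.span_sum)
    fix y assume "y \<in> keys x"
    then have "lookup x y \<noteq> 0" by (simp add: in_keys_iff)
    from x[OF this] obtain \<alpha> where "\<alpha> \<in> M" "y = (\<mu>, \<nu>, double_coset \<mu> \<nu> \<alpha>)" "map_index \<alpha> < sum_list lam"
      by blast
    then show "single y (lookup x y) \<in> VS.span {cell \<mu> s t | \<mu> s t. \<mu> \<in> Lambda M \<and> Lambda_gt \<mu> lam \<and> s \<in> Lset r n \<mu> \<and> t \<in> Rset M r n \<mu>}"
      using single_in_upper[OF _ _ c] unfolding U_def by blast
  qed
  ultimately show ?thesis by simp
qed

end

subsection \<open>A distinguished composition and map for each partition\<close>

text \<open>The blocks are the rows of the row-reading diagram, followed by one block for the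
  surplus points if there are any. The conditional keeps the length within \<open>n\<close>, since a
  nonempty surplus means \<open>length lam < r\<close>.\<close>

definition spec :: "nat \<Rightarrow> nat \<Rightarrow> nat list \<Rightarrow> nat list" where
  "spec r n lam = lam @ (if sum_list lam < r then [r - sum_list lam] else [])
     @ replicate (n - length lam - (if sum_list lam < r then 1 else 0)) 0"

text \<open>A retraction onto \<open>{1..i}\<close>; the point \<open>z\<close> receives all surplus
  points and thereby selects a row.\<close>

definition merge :: "nat \<Rightarrow> nat \<Rightarrow> nat \<Rightarrow> tmap" where
  "merge r i z x = (if x \<in> {1..i} then x else if x \<in> {1..r} then z else 0)"

lemma phi_initial: "j \<in> {1..i} \<Longrightarrow> phi {1..i} j = j"
proof -
  assume j: "j \<in> {1..i}"
  have "sorted_list_of_set {1..i} = [1..<Suc i]"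
    by (metis atLeastLessThanSuc_atLeastAtMost sorted_list_of_set_range)
  then show ?thesis using j by (simp add: phi_def nth_upt del: upt_Suc)
qed

context
  fixes r n i :: nat and lam :: "nat list"
  assumes lam: "lam \<in> partitions i" and i: "1 \<le> i" "i \<le> r" and rn: "r \<le> n"
begin

lemma sum_shape: "sum_list lam = i"
  using lam by (simp add: partitions_def)

lemma length_lam: "length lam \<le> i"
  using lam by (rule length_partition)

lemma spec_comp: "spec r n lam \<in> compositions r n"
  using length_lam sum_shape i rn by (auto simp: spec_def compositions_def)

lemma spec_sum: "sum_list (spec r n lam) = r"
  using spec_comp by (simp add: compositions_def)

lemma spec_block_number: "x \<in> {1..i} \<Longrightarrow> block_number (spec r n lam) x = Suc (row_word lam x)"
proof -
  assume "x \<in> {1..i}"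
  then have x: "x \<in> {1..sum_list lam}" using sum_shape by simp
  have "row_word lam x < length lam" by (rule row_word_bounds(1)[OF x])
  then show ?thesis using row_word_bounds(2,3)[OF x]
    by (intro block_number_unique) (auto simp: block_def spec_def)
qed

lemma merge_in: "z \<in> {1..i} \<Longrightarrow> merge r i z \<in> full_transf r"
  using i by (auto simp: merge_def full_transf_def)

lemma merge_img: "z \<in> {1..i} \<Longrightarrow> img (merge r i z) = {1..i}"
  using i by (subst img_eq[OF merge_in]) (auto simp: merge_def image_iff)

lemma merge_index: "z \<in> {1..i} \<Longrightarrow> map_index (merge r i z) = i"
  by (simp add: map_index_card merge_img)

lemma merge_fibre: "z \<in> {1..i} \<Longrightarrow> c \<in> {1..i} \<Longrightarrow> merge r i z -` {c} = insert c (if c = z then {Suc i..r} else {})"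
  using i by (auto simp: merge_def split: if_splits)

lemma la_merge: "z \<in> {1..i} \<Longrightarrow> x \<in> {1..i} \<Longrightarrow> la (spec r n lam) (merge r i z) x = Suc (row_word lam x)"
  by (simp add: la_def merge_index merge_img phi_initial spec_block_number)

lemma lb_merge: "z \<in> {1..i} \<Longrightarrow> x \<in> {1..i} \<Longrightarrow> lb \<nu> (merge r i z) x = oidx \<nu> (merge r i z -` {x})"
  by (simp add: lb_def merge_index merge_img phi_initial)

text \<open>Surplus points exceed \<open>i\<close>, so \<open>c\<close> is the least point of its
  fibre and its block opens the string. Fibres over different rows are therefore compared at the
  first letter.\<close>

lemma merge_string:
  assumes "z \<in> {1..i}" "c \<in> {1..i}"
  obtains xs where "block_string (spec r n lam) (merge r i z -` {c}) = Suc (row_word lam c) # xs"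
proof -
  let ?A = "merge r i z -` {c}"
  have fin: "finite ?A" "?A \<noteq> {}" using merge_fibre[OF assms] by auto
  have "Min ?A = c"
    using fin assms(2) unfolding merge_fibre[OF assms] by (intro Min_eqI) (auto split: if_splits)
  then have "sorted_list_of_set ?A = c # sorted_list_of_set (?A - {c})"
    using sorted_list_of_set_nonempty[OF fin] by simp
  then show thesis using that spec_block_number[OF assms(2)] by (simp add: block_string_def)
qed

lemma lb_merge_less:
  assumes "z \<in> {1..i}" "x \<in> {1..i}" "y \<in> {1..i}" "row_word lam x < row_word lam y"
  shows "lb (spec r n lam) (merge r i z) x < lb (spec r n lam) (merge r i z) y"
proof -
  obtain xs ys where "block_string (spec r n lam) (merge r i z -` {x}) = Suc (row_word lam x) # xs"
    "block_string (spec r n lam) (merge r i z -` {y}) = Suc (row_word lam y) # ys"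
    using merge_string[OF assms(1,2)] merge_string[OF assms(1,3)] by metis
  then have "ord_class.lexordp (block_string (spec r n lam) (merge r i z -` {x})) (block_string (spec r n lam) (merge r i z -` {y}))"
    using assms(4) by simp
  moreover have "merge r i z -` {c} \<subseteq> {1..sum_list (spec r n lam)}" if "c \<in> {1..i}" for c
    using fibre_subset[OF merge_in[OF assms(1)], of c] merge_img[OF assms(1)] that spec_sum by simp
  ultimately show ?thesis using lb_merge assms(1-3) by (simp add: oidx_less)
qed

text \<open>A permutation of the image points twists the fibre labels and leaves the image labels
  alone. In this way every column permutation of the second label word is realised by a map.\<close>

lemma merge_perm:
  assumes "z \<in> {1..i}" "\<pi> permutes {1..i}"
  shows "\<pi> \<circ> merge r i z \<in> full_transf r" "img (\<pi> \<circ> merge r i z) = {1..i}" "map_index (\<pi> \<circ> merge r i z) = i"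
    and "la \<mu> (\<pi> \<circ> merge r i z) = la \<mu> (merge r i z)"
    and "lb \<nu> (\<pi> \<circ> merge r i z) = lb \<nu> (merge r i z) \<circ> inv \<pi>"
proof -
  have pr: "\<pi> permutes {1..r}" by (rule permutes_subset[OF assms(2)]) (use i in auto)
  note fc = full_transf_comp[OF merge_in[OF assms(1)] pr permutes_id] img_comp[OF merge_in[OF assms(1)] pr permutes_id]
  show 1: "\<pi> \<circ> merge r i z \<in> full_transf r" using fc(1) by simp
  show 2: "img (\<pi> \<circ> merge r i z) = {1..i}"
    using fc(2) merge_img[OF assms(1)] permutes_image[OF assms(2)] by simp
  show 3: "map_index (\<pi> \<circ> merge r i z) = i" by (simp add: map_index_card 2)
  show "la \<mu> (\<pi> \<circ> merge r i z) = la \<mu> (merge r i z)"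
    unfolding la_def 2 3 merge_img[OF assms(1)] merge_index[OF assms(1)] ..
  have ip: "inv \<pi> permutes {1..i}" by (rule permutes_inv[OF assms(2)])
  show "lb \<nu> (\<pi> \<circ> merge r i z) = lb \<nu> (merge r i z) \<circ> inv \<pi>"
  proof
    fix x
    show "lb \<nu> (\<pi> \<circ> merge r i z) x = (lb \<nu> (merge r i z) \<circ> inv \<pi>) x"
    proof (cases "x \<in> {1..i}")
      case True
      have ix: "inv \<pi> x \<in> {1..i}" using permutes_in_image[OF ip] True by blast
      have "(\<pi> \<circ> merge r i z) -` {x} = merge r i z -` {inv \<pi> x}"
        using permutes_inverses[OF assms(2)] by (auto simp: permutes_inv_eq[OF assms(2)] eq_commute)
      then show ?thesis using True ix assms(1) by (simp add: lb_def 2 3 merge_img merge_index phi_initial)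
    next
      case False
      then have "inv \<pi> x = x" by (rule permutes_not_in[OF ip])
      then show ?thesis using False unfolding comp_apply lb_def 3 merge_index[OF assms(1)]
        by (simp only: restrict_def if_False)
    qed
  qed
qed

end

section \<open>Uniqueness of the bracket scalar\<close>

context transf_algebra
begin

text \<open>Both label words of \<open>merge\<close> increase strictly from row to row, so the row
  word is semistandard against each of them.\<close>

lemma special_keys:
  assumes lam: "lam \<in> partitions i" and i: "1 \<le> i" "i \<le> r" and z: "z \<in> {1..i}"
  obtains Q S Q' T where "(spec r n lam, Q, S) \<in> Lset r n lam" "(spec r n lam, Q', T) \<in> Rset M r n lam"
    "tab_matrix S = Cont i (row_word lam) (la (spec r n lam) (merge r i z))"
    "tab_matrix T = Cont i (row_word lam) (lb (spec r n lam) (merge r i z))"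
proof -
  note c = spec_comp[OF lam i rn]
  note m = merge_in[OF lam i rn z] merge_index[OF lam i rn z]
  have K: "length lam \<le> K" using length_partition[OF lam] i rn KK by simp
  have row: "row_word lam \<in> W i K" using row_word_in_W[OF K] sum_shape[OF lam i rn] by simp
  have 1: "words.semistd {1..i} (row_word lam) (la (spec r n lam) (merge r i z))"
    by (rule semistd_row_word[OF lam]) (simp add: la_merge[OF lam i rn z])
  have 2: "words.semistd {1..i} (row_word lam) (lb (spec r n lam) (merge r i z))"
    by (rule semistd_row_word[OF lam]) (rule lb_merge_less[OF lam i rn z])
  obtain lam' Q S Q' T where k: "lam' \<in> partitions i" "(spec r n lam, Q, S) \<in> Lset r n lam'" "(spec r n lam, Q', T) \<in> Rset M r n lam'"
    "tab_matrix S = Cont i (row_word lam) (la (spec r n lam) (merge r i z))"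
    "tab_matrix T = Cont i (row_word lam) (lb (spec r n lam) (merge r i z))"
    "\<forall>q. sum_list (take q lam') = words.ps {1..i} (row_word lam) q" "length lam' \<le> K"
    by (rule cell_keys_exist[OF m(1) c c KK(1,2) m(2) row 1 2])
  have "lam' = lam"
    by (rule partition_eqI[OF k(1) lam]) (use k(6) ps_row_word[of lam] sum_shape[OF lam i rn] in simp)
  then show thesis using that k by blast
qed

lemma Lambda_index:
  assumes "lam \<in> Lambda M"
  shows "lam \<in> partitions (sum_list lam)" "1 \<le> sum_list lam" "sum_list lam \<le> r" "sum_list lam \<in> map_index ` M"
  using assms map_index_pos r1 map_index_le by (auto simp: Lambda_def partitions_def)

text \<open>The column antisymmetriser separates a cell element of shape \<open>lam\<close> from the cell elements of
  larger shape and of smaller index, so that the scalar in the bracket is unique.\<close>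

lemma special_not_in_upper:
  assumes lamL: "lam \<in> Lambda M" and iz: "i = sum_list lam" "z \<in> {1..i}"
    and s: "(spec r n lam, Q, S) \<in> Lset r n lam" and t: "(spec r n lam, Q', T) \<in> Rset M r n lam"
    and S: "tab_matrix S = Cont i (row_word lam) (la (spec r n lam) (merge r i z))"
    and T: "tab_matrix T = Cont i (row_word lam) (lb (spec r n lam) (merge r i z))"
  shows "cell lam (spec r n lam, Q, S) (spec r n lam, Q', T) \<notin> U lam"
proof -
  note lam = Lambda_index(1)[OF lamL, folded iz(1)] and i = Lambda_index(2,3)[OF lamL, folded iz(1)]
  interpret words "{1..i}" K by (rule words_range)
  define \<nu> where "\<nu> = spec r n lam"
  have c: "\<nu> \<in> compositions r n" unfolding \<nu>_def by (rule spec_comp[OF lam i rn])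
  interpret weights r \<nu> \<nu> using c c by (rule weightsI)
  define m where "m = merge r i z"
  define a where "a = la \<nu> m"
  define b where "b = lb \<nu> m"
  define row where "row = row_word lam"
  define col where "col = col_word lam"
  have mM: "m \<in> M" "map_index m = i" using merge_in[OF lam i rn iz(2)] merge_index[OF lam i rn iz(2)] by (auto simp: m_def)
  have abF: "a \<in> F" "b \<in> F" using la_lb_W[OF mM(1) c c] mM(2) by (auto simp: a_def b_def)
  have K: "length lam \<le> K" using length_partition[OF lam] i rn KK by simp
  have d: "diagram row col" unfolding row_def col_def by (rule diagram_row_col[OF lam K])
  have rowF: "row \<in> F" using d by (simp add: diagram_def)
  have psrow: "ps row = (\<lambda>q. sum_list (take q lam))"
    using ps_row_word[of lam] iz(1) by (auto simp: row_def)
  define \<beta> where "\<beta> \<sigma> = inv \<sigma> \<circ> m" for \<sigma> :: "nat \<Rightarrow> nat"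
  have \<beta>: "\<beta> \<sigma> \<in> M" "map_index (\<beta> \<sigma>) = i" "la \<nu> (\<beta> \<sigma>) = a" "lb \<nu> (\<beta> \<sigma>) = b \<circ> \<sigma>" if "\<sigma> permutes {1..i}" for \<sigma>
    using merge_perm[OF lam i rn iz(2) permutes_inv[OF that]] inv_inv_eq[OF permutes_bij[OF that]]
    by (auto simp: \<beta>_def m_def a_def b_def)
  \<comment> \<open>The column antisymmetriser as a functional on coordinates:
    \<open>\<beta> \<sigma>\<close> has the label words \<open>a\<close> and
    \<open>b \<circ> \<sigma>\<close>, so the signed sum over its double cosets is
    \<open>alternating\<close> at \<open>a\<close> and \<open>b\<close>.\<close>
  define \<Phi> where "\<Phi> x = (\<Sum>\<sigma>\<in>col_group col. of_int (sign \<sigma>) * lookup x (\<nu>, \<nu>, double_coset \<nu> \<nu> (\<beta> \<sigma>)) :: 'k)" for x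
  have \<Phi>vec: "\<Phi> (vec r \<nu> \<nu> (pull \<nu> \<nu> i f)) = of_int (alternating col f a b)" if f: "Inv f" for f
  proof -
    have inv: "coset_inv r \<nu> \<nu> (pull \<nu> \<nu> i f)"
      by (rule coset_inv_pull[OF f]) (use compD[OF c] KK in auto)
    show ?thesis unfolding \<Phi>_def alternating_def of_int_sum
    proof (rule sum.cong[OF refl])
      fix \<sigma> assume "\<sigma> \<in> col_group col"
      then have sg: "\<sigma> permutes {1..i}" by (simp add: col_group_def)
      show "of_int (sign \<sigma>) * lookup (vec r \<nu> \<nu> (pull \<nu> \<nu> i f)) (\<nu>, \<nu>, double_coset \<nu> \<nu> (\<beta> \<sigma>)) =
        (of_int (sign \<sigma> * f a (b \<circ> \<sigma>)) :: 'k)"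
        unfolding lookup_vec[OF inv \<beta>(1)[OF sg]] using \<beta>(2-4)[OF sg] by (simp add: pull_def)
    qed
  qed
  have zero: "\<Phi> x = 0" if "x \<in> U lam" for x
    using that unfolding U_def
  proof (induction rule: VS.span_induct_alt)
    case base show ?case by (simp add: \<Phi>_def)
  next
    case (step k x y)
    have add: "\<Phi> (scale k x + y) = k * \<Phi> x + \<Phi> y"
      by (simp add: \<Phi>_def lookup_add sum.distrib sum_distrib_left algebra_simps)
    from step(1) obtain mu s t where x: "x = cell mu s t" "mu \<in> Lambda M" "Lambda_gt mu lam" "s \<in> Lset r n mu" "t \<in> Rset M r n mu"
      by blast
    obtain \<mu>1 Q1 S1 where s1: "s = (\<mu>1, Q1, S1)" by (cases s)
    obtain \<mu>2 Q2 T2 where t1: "t = (\<mu>2, Q2, T2)" by (cases t)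
    note mu = Lambda_index(1-3)[OF x(2)]
    have vx: "x = vec r \<mu>1 \<mu>2 (pull \<mu>1 \<mu>2 (sum_list mu) (words.mm {1..sum_list mu} K (words.tr (words.xi {1..sum_list mu} (tab_matrix S1))) (words.xi {1..sum_list mu} (tab_matrix T2))))"
      unfolding x(1) s1 t1 using x(4,5) s1 t1 by (intro cell_vec mu) auto
    have c12: "\<mu>1 \<in> compositions r n" "\<mu>2 \<in> compositions r n" using x(4,5) s1 t1 by (auto simp: Lset_def Rset_def)
    have "\<Phi> x = 0"
    proof (cases "\<mu>1 = \<nu> \<and> \<mu>2 = \<nu>")
      case False
      interpret w12: weights r \<mu>1 \<mu>2 using c12 by (rule weightsI)
      have "lookup x (\<nu>, \<nu>, D) = 0" for D
        unfolding vx by (rule w12.lookup_vec_other) (use False in auto)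
      then show ?thesis by (simp add: \<Phi>_def)
    next
      case e: True
      show ?thesis
      \<comment> \<open>A cell element of another index has zero coordinates at maps of index
        \<open>i\<close>; one of equal index and larger shape lies in the dominating ideal.\<close>
      proof (cases "sum_list mu = i")
        case False
        have inv: "coset_inv r \<nu> \<nu> (pull \<nu> \<nu> (sum_list mu) (words.mm {1..sum_list mu} K (words.tr (words.xi {1..sum_list mu} (tab_matrix S1))) (words.xi {1..sum_list mu} (tab_matrix T2))))"
          by (rule coset_inv_pull[where K = K])
            (use compD[OF c] KK words.Inv_mm[OF words_range] words.Inv_tr[OF words_range] words.Inv_xi[OF words_range] in auto)
        show ?thesis unfolding \<Phi>_def
        proof (rule sum.neutral, rule ballI)
          fix \<sigma> assume "\<sigma> \<in> col_group col"
          then have sg: "\<sigma> permutes {1..i}" by (simp add: col_group_def)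
          show "of_int (sign \<sigma>) * lookup x (\<nu>, \<nu>, double_coset \<nu> \<nu> (\<beta> \<sigma>)) = 0"
            unfolding vx e[THEN conjunct1] e[THEN conjunct2] lookup_vec[OF inv \<beta>(1)[OF sg]]
            using \<beta>(2)[OF sg] False by (simp add: pull_def)
        qed
      next
        case True
        let ?X = "mm (tr (xi (tab_matrix S1))) (xi (tab_matrix T2))"
        have S1: "map length S1 = mu" using x(4) s1 by (auto simp: Lset_def semistandard_tableaux_def)
        have "?X \<in> J (ps row)"
        proof (rule J_I)
          fix a' \<rho> assume h: "a' \<in> F" "\<rho> \<in> F" "tr (xi (tab_matrix S1)) a' \<rho> \<noteq> 0"
          then have "cont \<rho> a' = tab_matrix S1" by (simp add: tr_def xi_def)
          then have p: "ps \<rho> = (\<lambda>q. sum_list (take q mu))" using ps_tab_matrix[OF h(2,1) _ S1] by blast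
          have "ps row \<le> ps \<rho>" using x(3) True iz(1) unfolding psrow p Lambda_gt_def dominates_def le_fun_def by auto
          moreover have "ps row \<noteq> ps \<rho>"
          proof
            assume "ps row = ps \<rho>"
            then have "mu = lam" using partition_eqI[OF mu(1) lam] unfolding psrow p by metis
            then show False using x(3) by (simp add: Lambda_gt_def)
          qed
          ultimately show "ps row < ps \<rho>" by simp
        qed (simp_all add: Inv_tr)
        then have "alternating col ?X a b = 0" by (rule alternating_J[OF d _ abF])
        moreover have "\<Phi> x = of_int (alternating col ?X a b)"
          unfolding vx e[THEN conjunct1] e[THEN conjunct2] True by (rule \<Phi>vec) (simp add: Inv_mm Inv_tr)
        ultimately show ?thesis by simp
      qed
    qed
    then show ?case using add step by simp
  qed
  have asep: "row x = row y" if "x \<in> {1..i}" "y \<in> {1..i}" "a x = a y" for x y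
    using that la_merge[OF lam i rn iz(2)] by (simp add: a_def m_def \<nu>_def row_def)
  have bsep: "\<forall>x\<in>{1..i}. \<forall>y\<in>{1..i}. b x = b y \<longrightarrow> row x = row y"
    using lb_merge_less[OF lam i rn iz(2)] unfolding b_def m_def \<nu>_def row_def by (metis less_irrefl nat_neq_iff)
  let ?X = "mm (tr (xi (cont row a))) (xi (cont row b))"
  \<comment> \<open>The letters of \<open>a\<close> determine the rows, so \<open>row\<close> is the
    only middle word and the left factor contributes 1. Hence \<Phi> takes the value 1 on the cell
    element, in every characteristic.\<close>
  have X: "?X a c' = xi (cont row b) row c'" if "c' \<in> F" for c'
  proof -
    have "?X a c' = tr (xi (cont row a)) a row * xi (cont row b) row c'"
    proof (rule mm_unique[OF rowF])
      fix \<rho> assume h: "\<rho> \<in> F" "tr (xi (cont row a)) a \<rho> \<noteq> 0"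
      then have e: "cont \<rho> a = cont row a" by (simp add: tr_def xi_def)
      show "\<rho> = row"
      proof (rule F_eqI[OF h(1) rowF])
        fix x assume x: "x \<in> {1..i}"
        have "card {y\<in>{1..i}. \<rho> y = \<rho> x \<and> a y = a x} = card {y\<in>{1..i}. row y = \<rho> x \<and> a y = a x}"
          using fun_cong[OF fun_cong[OF e, of "\<rho> x"], of "a x"] by (simp add: cont_def)
        moreover have "card {y\<in>{1..i}. \<rho> y = \<rho> x \<and> a y = a x} \<noteq> 0" using x by auto
        ultimately have "{y\<in>{1..i}. row y = \<rho> x \<and> a y = a x} \<noteq> {}" by (metis card.empty)
        then obtain y where "y \<in> {1..i}" "row y = \<rho> x" "a y = a x" by blast
        then show "\<rho> x = row x" using asep x by metis
      qed
    qed
    then show ?thesis by (simp add: tr_def xi_def)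
  qed
  have "alternating col ?X a b = alternating col (xi (cont row b)) row b"
    unfolding alternating_def by (intro sum.cong refl) (use X F_comp[OF abF(2)] in \<open>auto simp: col_group_def\<close>)
  also have "\<dots> = 1" by (rule alternating_cont[OF d abF(2) bsep])
  finally have "\<Phi> (vec r \<nu> \<nu> (pull \<nu> \<nu> i ?X)) = 1" by (subst \<Phi>vec) (simp_all add: Inv_mm Inv_tr)
  moreover have "cell lam (\<nu>, Q, S) (\<nu>, Q', T) = vec r \<nu> \<nu> (pull \<nu> \<nu> i ?X)"
    using cell_vec[OF lam i s t] S T by (simp add: \<nu>_def a_def b_def m_def row_def)
  ultimately have "\<Phi> (cell lam (\<nu>, Q, S) (\<nu>, Q', T)) \<noteq> 0" by simp
  then show ?thesis using zero unfolding \<nu>_def by blast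
qed

end

subsection \<open>Sections of embeddings\<close>

definition Emb :: "nat \<Rightarrow> nat \<Rightarrow> nat list \<Rightarrow> (nat \<Rightarrow> nat) \<Rightarrow> (nat \<Rightarrow> nat) set" where
  "Emb r i \<nu> l = {e \<in> {1..i} \<rightarrow>\<^sub>E {1..r}. inj_on e {1..i} \<and> (\<forall>j\<in>{1..i}. block_number \<nu> (e j) = l j)}"

text \<open>For an embedding \<open>e\<close>, only the \<open>r - i\<close> points outside its
  image are free. In a product of two maps, the embedding stems from the right factor and the
  section from the left one.\<close>

definition Sec :: "nat \<Rightarrow> nat \<Rightarrow> (nat \<Rightarrow> nat) \<Rightarrow> (nat \<Rightarrow> nat) set" where
  "Sec r i e = {m \<in> {1..r} \<rightarrow>\<^sub>E {1..i}. \<forall>j\<in>{1..i}. m (e j) = j}"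

text \<open>The fibre labels of a section, in the role of \<open>lb\<close> (see
  \<open>post_props\<close>).\<close>

definition ty :: "nat \<Rightarrow> nat \<Rightarrow> nat list \<Rightarrow> (nat \<Rightarrow> nat) \<Rightarrow> nat \<Rightarrow> nat" where
  "ty r i \<nu> m = restrict (\<lambda>j. oidx \<nu> {x\<in>{1..r}. m x = j}) {1..i}"

definition HS :: "nat \<Rightarrow> nat \<Rightarrow> nat list \<Rightarrow> (nat \<Rightarrow> nat \<Rightarrow> nat) \<Rightarrow> (nat \<Rightarrow> nat) \<Rightarrow> (nat \<Rightarrow> nat) \<Rightarrow> int" where
  "HS r i \<nu> N e \<rho> = (\<Sum>m\<in>Sec r i e. words.xi {1..i} N \<rho> (ty r i \<nu> m))"

text \<open>\<open>HH\<close> is the matrix that the product inserts between two cell elements. The choice of the embedding is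
  immaterial.\<close>

definition HH :: "nat \<Rightarrow> nat \<Rightarrow> nat list \<Rightarrow> (nat \<Rightarrow> nat \<Rightarrow> nat) \<Rightarrow> (nat \<Rightarrow> nat) \<Rightarrow> (nat \<Rightarrow> nat) \<Rightarrow> int" where
  "HH r i \<nu> N \<rho> l = (if Emb r i \<nu> l = {} then 0 else HS r i \<nu> N (SOME e. e \<in> Emb r i \<nu> l) \<rho>)"

lemma finite_Sec [simp]: "finite (Sec r i e)"
  unfolding Sec_def by (rule finite_subset[of _ "{1..r} \<rightarrow>\<^sub>E {1..i}"]) (auto intro: finite_PiE)

lemma finite_Emb [simp]: "finite (Emb r i \<nu> l)"
  unfolding Emb_def by (rule finite_subset[of _ "{1..i} \<rightarrow>\<^sub>E {1..r}"]) (auto intro: finite_PiE)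

lemma Emb_in: "e \<in> Emb r i \<nu> l \<Longrightarrow> j \<in> {1..i} \<Longrightarrow> e j \<in> {1..r}"
  by (auto simp: Emb_def)

text \<open>A permutation of positions and a Young permutation of points act together on sections,
  moving them from one embedding to another.\<close>

definition twist :: "nat \<Rightarrow> (nat \<Rightarrow> nat) \<Rightarrow> (nat \<Rightarrow> nat) \<Rightarrow> (nat \<Rightarrow> nat) \<Rightarrow> nat \<Rightarrow> nat" where
  "twist r \<tau> \<pi> m = restrict (\<lambda>x. inv \<tau> (m (\<pi> x))) {1..r}"

lemma Sec_twist:
  assumes \<pi>: "\<pi> permutes {1..r}" and \<tau>: "\<tau> permutes {1..i}"
    and e: "\<And>j. j \<in> {1..i} \<Longrightarrow> \<pi> (e' j) = e (\<tau> j)" "\<And>j. j \<in> {1..i} \<Longrightarrow> e' j \<in> {1..r}"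
    and m: "m \<in> Sec r i e"
  shows "twist r \<tau> \<pi> m \<in> Sec r i e'"
proof -
  have mi: "m x \<in> {1..i}" if "x \<in> {1..r}" for x using m that by (auto simp: Sec_def)
  have it: "inv \<tau> permutes {1..i}" by (rule permutes_inv[OF \<tau>])
  have "twist r \<tau> \<pi> m x \<in> {1..i}" if x: "x \<in> {1..r}" for x
  proof -
    have "m (\<pi> x) \<in> {1..i}" using mi permutes_in_image[OF \<pi>] x by blast
    then have "inv \<tau> (m (\<pi> x)) \<in> {1..i}" using permutes_in_image[OF it] by blast
    then show ?thesis using x by (simp add: twist_def)
  qed
  moreover have "twist r \<tau> \<pi> m (e' j) = j" if j: "j \<in> {1..i}" for j
  proof -
    have "\<tau> j \<in> {1..i}" using permutes_in_image[OF \<tau>] j by blast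
    then have "m (e (\<tau> j)) = \<tau> j" using m by (simp add: Sec_def)
    then show ?thesis using e[OF j] j permutes_inverses(2)[OF \<tau>] by (simp add: twist_def)
  qed
  moreover have "twist r \<tau> \<pi> m \<in> extensional {1..r}" by (simp add: twist_def)
  ultimately show ?thesis by (auto simp: Sec_def PiE_iff)
qed

lemma twist_twist:
  assumes "\<pi> permutes {1..r}" "\<tau> permutes {1..i}" "m \<in> {1..r} \<rightarrow>\<^sub>E A"
  shows "twist r (inv \<tau>) (inv \<pi>) (twist r \<tau> \<pi> m) = m"
proof
  fix x
  show "twist r (inv \<tau>) (inv \<pi>) (twist r \<tau> \<pi> m) x = m x"
  proof (cases "x \<in> {1..r}")
    case True
    then have "inv \<pi> x \<in> {1..r}" using permutes_in_image[OF permutes_inv[OF assms(1)]] by blast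
    then show ?thesis using True permutes_inverses[OF assms(1)] permutes_inverses[OF assms(2)]
      inv_inv_eq[OF permutes_bij[OF assms(2)]] by (simp add: twist_def)
  next
    case False
    then have "m x = undefined" using assms(3) by (metis PiE_arb)
    then show ?thesis using False unfolding twist_def by (simp only: restrict_def if_False)
  qed
qed

lemma ty_twist:
  assumes \<pi>: "\<pi> \<in> young \<nu>" and \<nu>: "sum_list \<nu> = r" and \<tau>: "\<tau> permutes {1..i}"
  shows "ty r i \<nu> (twist r \<tau> \<pi> m) = ty r i \<nu> m \<circ> \<tau>"
proof
  fix j
  have p: "\<pi> permutes {1..r}" using young_permutes[OF \<pi>] \<nu> by simp
  show "ty r i \<nu> (twist r \<tau> \<pi> m) j = (ty r i \<nu> m \<circ> \<tau>) j"
  proof (cases "j \<in> {1..i}")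
    case True
    have tj: "\<tau> j \<in> {1..i}" using permutes_in_image[OF \<tau>] True by blast
    have "{x\<in>{1..r}. twist r \<tau> \<pi> m x = j} = \<pi> -` {x\<in>{1..r}. m x = \<tau> j}"
    proof (intro set_eqI)
      fix x
      have "\<pi> x \<in> {1..r} \<longleftrightarrow> x \<in> {1..r}" by (rule permutes_in_image[OF p])
      moreover have "inv \<tau> y = j \<longleftrightarrow> y = \<tau> j" for y using permutes_inv_eq[OF \<tau>] by auto
      ultimately show "x \<in> {x\<in>{1..r}. twist r \<tau> \<pi> m x = j} \<longleftrightarrow> x \<in> \<pi> -` {x\<in>{1..r}. m x = \<tau> j}"
        by (auto simp: twist_def)
    qed
    moreover have "oidx \<nu> (\<pi> -` {x\<in>{1..r}. m x = \<tau> j}) = oidx \<nu> {x\<in>{1..r}. m x = \<tau> j}"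
      by (rule oidx_vimage[OF \<pi>]) (use \<nu> in auto)
    ultimately show ?thesis using True tj by (simp add: ty_def)
  next
    case False
    then have "\<tau> j = j" by (rule permutes_not_in[OF \<tau>])
    then show ?thesis using False unfolding comp_apply ty_def by (simp only: restrict_def if_False)
  qed
qed

text \<open>The Young permutation keeps the orbit numbers of fibres, and the permutation of
  positions acts on both words at once, which tables ignore. Independence of the chosen embedding is
  the case of trivial \<tau>, invariance of \<open>HH\<close> that of trivial \<pi>.\<close>

lemma HS_twist:
  assumes \<pi>: "\<pi> \<in> young \<nu>" and \<nu>: "sum_list \<nu> = r" and \<tau>: "\<tau> permutes {1..i}"
    and e: "\<And>j. j \<in> {1..i} \<Longrightarrow> \<pi> (e' j) = e (\<tau> j)" "\<And>j. j \<in> {1..i} \<Longrightarrow> e' j \<in> {1..r}"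
      "\<And>j. j \<in> {1..i} \<Longrightarrow> e j \<in> {1..r}"
  shows "HS r i \<nu> N e' (\<rho> \<circ> \<tau>) = HS r i \<nu> N e \<rho>"
proof -
  interpret words "{1..i}" 0 by (rule words_range)
  have p: "\<pi> permutes {1..r}" using young_permutes[OF \<pi>] \<nu> by simp
  have ip: "inv \<pi> permutes {1..r}" and it: "inv \<tau> permutes {1..i}" using permutes_inv p \<tau> by blast+
  have e': "inv \<pi> (e j) = e' (inv \<tau> j)" if j: "j \<in> {1..i}" for j
  proof -
    have "inv \<tau> j \<in> {1..i}" using permutes_in_image[OF it] j by blast
    from e(1)[OF this] have "\<pi> (e' (inv \<tau> j)) = e j" by (simp add: permutes_inverses(1)[OF \<tau>])
    then show ?thesis using permutes_inverses(2)[OF p] by metis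
  qed
  have bij: "bij_betw (twist r \<tau> \<pi>) (Sec r i e) (Sec r i e')"
  proof (rule bij_betwI[where g = "twist r (inv \<tau>) (inv \<pi>)"])
    show "twist r \<tau> \<pi> \<in> Sec r i e \<rightarrow> Sec r i e'" by (rule funcsetI, rule Sec_twist[where e=e and e'=e' and \<tau>=\<tau> and \<pi>=\<pi>]) (use p \<tau> e in auto)
    show "twist r (inv \<tau>) (inv \<pi>) \<in> Sec r i e' \<rightarrow> Sec r i e" by (rule funcsetI, rule Sec_twist[where e=e' and e'=e and \<tau>="inv \<tau>" and \<pi>="inv \<pi>"]) (use ip it e' e in auto)
    show "twist r (inv \<tau>) (inv \<pi>) (twist r \<tau> \<pi> m) = m" if "m \<in> Sec r i e" for m
      using that by (intro twist_twist[OF p \<tau>]) (auto simp: Sec_def)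
    show "twist r \<tau> \<pi> (twist r (inv \<tau>) (inv \<pi>) m) = m" if "m \<in> Sec r i e'" for m
      using twist_twist[OF ip it, of m "{1..i}"] that inv_inv_eq[OF permutes_bij[OF p]] inv_inv_eq[OF permutes_bij[OF \<tau>]]
      by (auto simp: Sec_def)
  qed
  have "HS r i \<nu> N e' (\<rho> \<circ> \<tau>) = (\<Sum>m\<in>Sec r i e. xi N (\<rho> \<circ> \<tau>) (ty r i \<nu> (twist r \<tau> \<pi> m)))"
    unfolding HS_def by (rule sum.reindex_bij_betw[OF bij, symmetric])
  also have "\<dots> = HS r i \<nu> N e \<rho>"
    unfolding HS_def ty_twist[OF \<pi> \<nu> \<tau>] xi_def cont_comp[OF \<tau>] ..
  finally show ?thesis .
qed

lemma Emb_young: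
  assumes \<nu>: "sum_list \<nu> = r" and e: "e \<in> Emb r i \<nu> l" "e' \<in> Emb r i \<nu> l"
  obtains \<pi> where "\<pi> \<in> young \<nu>" "\<And>j. j \<in> {1..i} \<Longrightarrow> \<pi> (e' j) = e j"
proof -
  have inj: "inj_on e {1..i}" "inj_on e' {1..i}" using e by (auto simp: Emb_def)
  have sub: "e ` {1..i} \<subseteq> {1..sum_list \<nu>}" "e' ` {1..i} \<subseteq> {1..sum_list \<nu>}" using e Emb_in \<nu> by blast+
  have bij: "bij_betw (e \<circ> inv_into {1..i} e') (e' ` {1..i}) (e ` {1..i})"
    by (rule bij_betw_trans[OF bij_betw_inv_into]) (auto intro: inj_on_imp_bij_betw inj)
  have lab: "block_number \<nu> ((e \<circ> inv_into {1..i} e') x) = block_number \<nu> x" if x: "x \<in> e' ` {1..i}" for x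
  proof -
    obtain j where j: "j \<in> {1..i}" "x = e' j" using x by blast
    have "inv_into {1..i} e' x = j" unfolding j(2) by (rule inv_into_f_f[OF inj(2) j(1)])
    then show ?thesis using e j by (simp add: Emb_def)
  qed
  obtain \<pi> where \<pi>: "\<pi> \<in> young \<nu>" "\<And>x. x \<in> e' ` {1..i} \<Longrightarrow> \<pi> x = (e \<circ> inv_into {1..i} e') x"
    using young_extend[OF sub(2,1) bij lab] by blast
  show thesis
  proof (rule that[OF \<pi>(1)])
    fix j assume j: "j \<in> {1..i}"
    show "\<pi> (e' j) = e j" using \<pi>(2)[of "e' j"] j inv_into_f_f[OF inj(2) j] by simp
  qed
qed

lemma HH_eq:
  assumes "sum_list \<nu> = r" "e \<in> Emb r i \<nu> l"
  shows "HH r i \<nu> N \<rho> l = HS r i \<nu> N e \<rho>"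
proof -
  define e' where "e' = (SOME e. e \<in> Emb r i \<nu> l)"
  have e': "e' \<in> Emb r i \<nu> l" unfolding e'_def by (rule someI[of "\<lambda>e. e \<in> Emb r i \<nu> l", OF assms(2)])
  obtain \<pi> where \<pi>: "\<pi> \<in> young \<nu>" "\<And>j. j \<in> {1..i} \<Longrightarrow> \<pi> (e' j) = e j"
    using Emb_young[OF assms e'] by blast
  have "HS r i \<nu> N e' (\<rho> \<circ> id) = HS r i \<nu> N e \<rho>"
    by (rule HS_twist[OF \<pi>(1) assms(1) permutes_id]) (use \<pi>(2) Emb_in[OF e'] Emb_in[OF assms(2)] in auto)
  then show ?thesis using assms(2) by (auto simp: HH_def e'_def)
qed

lemma Emb_comp:
  assumes "e \<in> Emb r i \<nu> l" "\<tau> permutes {1..i}"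
  shows "e \<circ> \<tau> \<in> Emb r i \<nu> (l \<circ> \<tau>)"
proof -
  have t: "\<tau> j \<in> {1..i}" if "j \<in> {1..i}" for j using permutes_in_image[OF assms(2)] that by blast
  have out: "(e \<circ> \<tau>) j = undefined" if h: "j \<notin> {1..i}" for j
  proof -
    have "e j = undefined" using assms(1) h unfolding Emb_def PiE_iff extensional_def by blast
    then show ?thesis by (simp add: permutes_not_in[OF assms(2) h])
  qed
  have inj: "inj_on (e \<circ> \<tau>) {1..i}"
    using assms(1) by (intro comp_inj_on permutes_inj_on[OF assms(2)]) (simp add: Emb_def permutes_image[OF assms(2)])
  have lab: "block_number \<nu> ((e \<circ> \<tau>) j) = (l \<circ> \<tau>) j" if h: "j \<in> {1..i}" for j
    using assms(1) t[OF h] by (simp add: Emb_def)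
  have val: "(e \<circ> \<tau>) j \<in> {1..r}" if h: "j \<in> {1..i}" for j using Emb_in[OF assms(1) t[OF h]] by simp
  show ?thesis unfolding Emb_def mem_Collect_eq
    by (intro conjI ballI PiE_I) (rule val inj lab out; assumption?)+
qed

lemma Inv_HH:
  assumes "sum_list \<nu> = r"
  shows "words.Inv {1..i} K (HH r i \<nu> N)"
proof -
  interpret words "{1..i}" K by (rule words_range)
  show ?thesis unfolding Inv_def
  proof (intro allI impI)
    fix \<tau> \<rho> l assume \<tau>: "\<tau> permutes {1..i}"
    show "HH r i \<nu> N (\<rho> \<circ> \<tau>) (l \<circ> \<tau>) = HH r i \<nu> N \<rho> l"
    proof (cases "Emb r i \<nu> l = {}")
      case True
      have "Emb r i \<nu> (l \<circ> \<tau>) = {}"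
      proof (rule ccontr)
        assume "Emb r i \<nu> (l \<circ> \<tau>) \<noteq> {}"
        then obtain e where "e \<in> Emb r i \<nu> (l \<circ> \<tau>)" by blast
        from Emb_comp[OF this permutes_inv[OF \<tau>]] show False
          using True by (simp add: o_assoc[symmetric] permutes_inv_o(1)[OF \<tau>])
      qed
      then show ?thesis using True by (simp add: HH_def)
    next
      case False
      then obtain e where e: "e \<in> Emb r i \<nu> l" by blast
      note e' = Emb_comp[OF e \<tau>]
      have "HS r i \<nu> N (e \<circ> \<tau>) (\<rho> \<circ> \<tau>) = HS r i \<nu> N e \<rho>"
        by (rule HS_twist[OF young_id assms \<tau>]) (use Emb_in[OF e'] Emb_in[OF e] in auto)
      then show ?thesis using HH_eq[OF assms e] HH_eq[OF assms e'] by simp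
    qed
  qed
qed

text \<open>A fixed-point-free \<open>\<zeta>\<close> of order \<open>p\<close> that preserves rows and labels acts freely on the sections: a
  point outside the image of \<open>e\<close>, which exists because \<open>i < r\<close>, would have to map to a fixed point.\<close>

lemma dvd_HH:
  assumes \<nu>: "sum_list \<nu> = r" and p: "prime p" and ir: "i < r"
    and \<zeta>: "\<zeta> permutes {1..i}" "(\<zeta> ^^ p) = id" "\<And>x. x \<in> {1..i} \<Longrightarrow> \<zeta> x \<noteq> x"
    and row: "row \<circ> \<zeta> = row" and l: "l \<circ> \<zeta> = l"
  shows "int p dvd HH r i \<nu> N row l"
proof (cases "Emb r i \<nu> l = {}")
  case False
  then obtain e where e: "e \<in> Emb r i \<nu> l" by blast
  interpret words "{1..i}" 0 by (rule words_range)
  have inj: "inj_on e {1..i}" using e by (simp add: Emb_def)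
  have er: "e j \<in> {1..r}" if "j \<in> {1..i}" for j using Emb_in[OF e that] .
  have \<zeta>i: "\<zeta> j \<in> {1..i}" if "j \<in> {1..i}" for j using permutes_in_image[OF \<zeta>(1)] that by blast
  \<comment> \<open>\<zeta> is carried over to the image of \<open>e\<close> and extended by the
    identity; the result lies in the Young group because \<open>l\<close> is constant along
    \<zeta>.\<close>
  define g where "g = e \<circ> \<zeta> \<circ> inv_into {1..i} e"
  define \<pi> where "\<pi> x = (if x \<in> e ` {1..i} then g x else x)" for x
  have ge: "g (e j) = e (\<zeta> j)" if "j \<in> {1..i}" for j by (simp add: g_def inv_into_f_f[OF inj that])
  have "bij_betw g (e ` {1..i}) (e ` {1..i})"
    unfolding g_def comp_assoc[symmetric]
    using bij_betw_trans[OF bij_betw_trans[OF bij_betw_inv_into[OF inj_on_imp_bij_betw[OF inj]] permutes_imp_bij[OF \<zeta>(1)]] inj_on_imp_bij_betw[OF inj]]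
    by (simp only: comp_assoc)
  from bij_betw_permutes_extend[OF this] have "\<pi> permutes e ` {1..i}" unfolding \<pi>_def .
  then have \<pi>p: "\<pi> permutes {1..r}" by (rule permutes_subset) (use er in blast)
  have "block_number \<nu> (\<pi> x) = block_number \<nu> x" for x
  proof (cases "x \<in> e ` {1..i}")
    case True
    then obtain j where j: "j \<in> {1..i}" "x = e j" by blast
    have "block_number \<nu> (e (\<zeta> j)) = l (\<zeta> j)" using e \<zeta>i[OF j(1)] by (simp add: Emb_def)
    also have "\<dots> = l j" using fun_cong[OF l, of j] by simp
    also have "\<dots> = block_number \<nu> (e j)" using e j(1) by (simp add: Emb_def)
    finally show ?thesis using True j ge by (simp add: \<pi>_def)
  qed (simp add: \<pi>_def)
  then have \<pi>: "\<pi> \<in> young \<nu>" using \<pi>p \<nu> by (simp add: young_iff)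
  have \<pi>e: "\<pi> (e j) = e (\<zeta> j)" if "j \<in> {1..i}" for j using ge[OF that] that by (simp add: \<pi>_def)
  let ?T = "twist r \<zeta> \<pi>"
  have pow\<pi>: "(\<pi> ^^ k) (e j) = e ((\<zeta> ^^ k) j) \<and> (\<zeta> ^^ k) j \<in> {1..i}" if "j \<in> {1..i}" for k j
    using that \<pi>e \<zeta>i by (induction k) auto
  have pow\<pi>': "(\<pi> ^^ k) x = x" if "x \<notin> e ` {1..i}" for k x using that by (induction k) (auto simp: \<pi>_def)
  have \<pi>pow: "(\<pi> ^^ p) x = x" for x
  proof (cases "x \<in> e ` {1..i}")
    case True
    then obtain j where "j \<in> {1..i}" "x = e j" by blast
    then show ?thesis using pow\<pi>[of j p] \<zeta>(2) by simp
  qed (simp add: pow\<pi>')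
  have ipow: "(inv \<zeta> ^^ k) ((\<zeta> ^^ k) y) = y" for k y
  proof (induction k arbitrary: y)
    case (Suc k)
    have "(inv \<zeta> ^^ Suc k) ((\<zeta> ^^ Suc k) y) = (inv \<zeta> ^^ k) (inv \<zeta> (\<zeta> ((\<zeta> ^^ k) y)))"
      by (simp add: funpow_swap1)
    then show ?case using Suc permutes_inverses(2)[OF \<zeta>(1)] by simp
  qed simp
  have "int p dvd (\<Sum>m\<in>Sec r i e. xi N row (ty r i \<nu> m))"
  proof (rule dvd_sum_cyclic_action[OF p finite_Sec, where T = ?T])
    fix m assume m: "m \<in> Sec r i e"
    note ST = Sec_twist[where e=e and e'=e and \<tau>=\<zeta> and \<pi>=\<pi>, OF \<pi>p \<zeta>(1) \<pi>e er]
    show "?T m \<in> Sec r i e" by (rule ST[OF _ _ m])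
    have "(?T ^^ k) m x = (inv \<zeta> ^^ k) (m ((\<pi> ^^ k) x)) " if "x \<in> {1..r}" for k x
      using that
    proof (induction k arbitrary: x)
      case (Suc k)
      have "\<pi> x \<in> {1..r}" using permutes_in_image[OF \<pi>p] Suc.prems by blast
      then show ?case using Suc by (simp add: twist_def funpow_swap1)
    qed simp
    then have on: "(?T ^^ p) m x = m x" if "x \<in> {1..r}" for x
      using that ipow[of p] \<zeta>(2) by (simp add: \<pi>pow)
    have "(?T ^^ p) m \<in> Sec r i e"
    proof -
      have "(?T ^^ k) m \<in> Sec r i e" for k
        by (induction k) (use m ST in auto)
      then show ?thesis .
    qed
    then show "(?T ^^ p) m = m" using m on unfolding Sec_def by (intro PiE_ext[of _ "{1..r}" "\<lambda>_. {1..i}"]) auto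
    have "xi N row (ty r i \<nu> (?T m)) = xi N (row \<circ> \<zeta>) (ty r i \<nu> m \<circ> \<zeta>)"
      unfolding ty_twist[OF \<pi> \<nu> \<zeta>(1)] row ..
    also have "\<dots> = xi N row (ty r i \<nu> m)" unfolding xi_def cont_comp[OF \<zeta>(1)] ..
    finally show "xi N row (ty r i \<nu> (?T m)) = xi N row (ty r i \<nu> m)" .
    assume fixed: "?T m = m"
    have "card (e ` {1..i}) < card {1..r}" using card_image[OF inj] ir by simp
    then have "\<not> {1..r} \<subseteq> e ` {1..i}" using card_mono[of "e ` {1..i}" "{1..r}"] by (metis finite_atLeastAtMost finite_imageI not_le)
    then obtain x where x: "x \<in> {1..r}" "x \<notin> e ` {1..i}" by blast
    have mx: "m x \<in> {1..i}" using m x by (auto simp: Sec_def)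
    have "m x = inv \<zeta> (m x)" using fun_cong[OF fixed, of x] x by (simp add: twist_def \<pi>_def)
    then have "\<zeta> (m x) = m x" using permutes_inverses(1)[OF \<zeta>(1)] by metis
    then show "int p dvd xi N row (ty r i \<nu> m)" using \<zeta>(3)[OF mx] by simp
  qed
  then show ?thesis unfolding HH_eq[OF \<nu> e] HS_def .
qed (simp add: HH_def)

subsection \<open>Structure constants\<close>

definition pos :: "nat \<Rightarrow> tmap \<Rightarrow> nat \<Rightarrow> nat" where
  "pos i \<alpha> x = inv_into {1..i} (phi (img \<alpha>)) (\<alpha> x)"

text \<open>In a factorisation of \<alpha>, \<open>lift\<close> is the right factor: it has the
  fibres of \<alpha>, with the image moved by \<open>e\<close>. The left factor is
  \<open>post\<close>: it has the image of \<alpha> and the fibres of \<open>m\<close>. Their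
  composite is \<alpha> because \<open>m\<close> inverts \<open>e\<close>.\<close>

definition lift :: "nat \<Rightarrow> nat \<Rightarrow> tmap \<Rightarrow> (nat \<Rightarrow> nat) \<Rightarrow> tmap" where
  "lift r i \<alpha> e x = (if x \<in> {1..r} then e (pos i \<alpha> x) else 0)"

definition post :: "nat \<Rightarrow> tmap \<Rightarrow> (nat \<Rightarrow> nat) \<Rightarrow> tmap" where
  "post r \<alpha> m x = (if x \<in> {1..r} then phi (img \<alpha>) (m x) else 0)"

definition lab :: "nat \<Rightarrow> nat list \<Rightarrow> (nat \<Rightarrow> nat) \<Rightarrow> nat \<Rightarrow> nat" where
  "lab i \<nu> e = restrict (\<lambda>j. block_number \<nu> (e j)) {1..i}"

context
  fixes r i :: nat and \<alpha> :: tmap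
  assumes \<alpha>: "\<alpha> \<in> full_transf r" and mi: "map_index \<alpha> = i"
begin

lemma phi_img_bij: "bij_betw (phi (img \<alpha>)) {1..i} (img \<alpha>)"
  using phi_bij[OF finite_img[OF \<alpha>]] mi by (simp add: map_index_card)

lemma phi_img_in: "j \<in> {1..i} \<Longrightarrow> phi (img \<alpha>) j \<in> img \<alpha>"
  by (rule bij_betwE[OF phi_img_bij, rule_format])

lemma phi_img_eq: "j \<in> {1..i} \<Longrightarrow> j' \<in> {1..i} \<Longrightarrow> phi (img \<alpha>) j = phi (img \<alpha>) j' \<longleftrightarrow> j = j'"
  by (rule inj_on_eq_iff[OF bij_betw_imp_inj_on[OF phi_img_bij]])

lemma pos:
  assumes "x \<in> {1..r}"
  shows "pos i \<alpha> x \<in> {1..i}" "phi (img \<alpha>) (pos i \<alpha> x) = \<alpha> x"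
proof -
  have "\<alpha> x \<in> phi (img \<alpha>) ` {1..i}" using in_img[OF \<alpha> assms] phi_img_bij by (simp add: bij_betw_def)
  then show "pos i \<alpha> x \<in> {1..i}" "phi (img \<alpha>) (pos i \<alpha> x) = \<alpha> x"
    unfolding pos_def by (rule inv_into_into, rule f_inv_into_f)
qed

lemma pos_eqI:
  assumes "x \<in> {1..r}" "j \<in> {1..i}" "phi (img \<alpha>) j = \<alpha> x"
  shows "pos i \<alpha> x = j"
  using phi_img_eq[OF pos(1)[OF assms(1)] assms(2)] pos(2)[OF assms(1)] assms(3) by simp

lemma pos_surj:
  assumes "j \<in> {1..i}"
  obtains x where "x \<in> {1..r}" "pos i \<alpha> x = j"
proof -
  have "phi (img \<alpha>) j \<in> \<alpha> ` {1..r}" using phi_img_in[OF assms] img_eq[OF \<alpha>] by simp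
  then obtain x where "x \<in> {1..r}" "phi (img \<alpha>) j = \<alpha> x" by blast
  then show thesis using that pos_eqI assms by blast
qed

lemma fibre_pos:
  assumes "j \<in> {1..i}"
  shows "\<alpha> -` {phi (img \<alpha>) j} = {x\<in>{1..r}. pos i \<alpha> x = j}"
proof -
  have 1: "x \<in> {1..r}" if "\<alpha> x = phi (img \<alpha>) j" for x
    using fibre_subset[OF \<alpha> phi_img_in[OF assms]] that by blast
  have 2: "\<alpha> x = phi (img \<alpha>) j \<longleftrightarrow> pos i \<alpha> x = j" if "x \<in> {1..r}" for x
    using pos[OF that] phi_img_eq[OF pos(1)[OF that] assms] by simp
  show ?thesis
  proof (rule set_eqI)
    fix x show "x \<in> \<alpha> -` {phi (img \<alpha>) j} \<longleftrightarrow> x \<in> {x\<in>{1..r}. pos i \<alpha> x = j}"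
      using 1[of x] 2[of x] unfolding vimage_singleton_eq mem_Collect_eq by argo
  qed
qed

lemma lift_props:
  assumes e: "e \<in> {1..i} \<rightarrow>\<^sub>E {1..r}" "inj_on e {1..i}"
  shows "lift r i \<alpha> e \<in> full_transf r" "img (lift r i \<alpha> e) = e ` {1..i}" "map_index (lift r i \<alpha> e) = i"
    "dcm \<nu> \<pi> (lift r i \<alpha> e) = Cont i (lab i \<nu> e) (lb \<pi> \<alpha>)"
proof -
  interpret words "{1..i}" 0 by (rule words_range)
  have er: "e j \<in> {1..r}" if "j \<in> {1..i}" for j using e(1) that by blast
  show 1: "lift r i \<alpha> e \<in> full_transf r"
    unfolding full_transf_def mem_Collect_eq by (auto simp: lift_def simp del: atLeastAtMost_iff intro: er[OF pos(1)])
  show 2: "img (lift r i \<alpha> e) = e ` {1..i}"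
  proof
    show "img (lift r i \<alpha> e) \<subseteq> e ` {1..i}" unfolding img_eq[OF 1] using pos(1) by (auto simp: lift_def simp del: atLeastAtMost_iff)
    show "e ` {1..i} \<subseteq> img (lift r i \<alpha> e)" unfolding img_eq[OF 1]
    proof (rule image_subsetI)
      fix j assume "j \<in> {1..i}"
      then obtain x where "x \<in> {1..r}" "pos i \<alpha> x = j" by (rule pos_surj)
      then show "e j \<in> lift r i \<alpha> e ` {1..r}" by (intro image_eqI[of _ _ x]) (auto simp: lift_def)
    qed
  qed
  show "map_index (lift r i \<alpha> e) = i" by (simp add: map_index_card 2 card_image[OF e(2)])
  have fib: "lift r i \<alpha> e -` {e j} = \<alpha> -` {phi (img \<alpha>) j}" if j: "j \<in> {1..i}" for j
  proof -
    have "e j \<noteq> 0" using er[OF j] by simp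
    moreover have "e (pos i \<alpha> x) = e j \<longleftrightarrow> pos i \<alpha> x = j" if "x \<in> {1..r}" for x
      by (rule inj_on_eq_iff[OF e(2) pos(1)[OF that] j])
    ultimately show ?thesis unfolding fibre_pos[OF j] by (auto simp: lift_def simp del: atLeastAtMost_iff split: if_splits)
  qed
  show "dcm \<nu> \<pi> (lift r i \<alpha> e) = Cont i (lab i \<nu> e) (lb \<pi> \<alpha>)"
  proof (intro ext)
    fix k l
    have "{c\<in>e ` {1..i}. block_number \<nu> c = k \<and> oidx \<pi> (lift r i \<alpha> e -` {c}) = l}
      = e ` {j\<in>{1..i}. lab i \<nu> e j = k \<and> lb \<pi> \<alpha> j = l}"
      using fib by (auto simp: lab_def lb_def mi simp del: atLeastAtMost_iff)
    then show "dcm \<nu> \<pi> (lift r i \<alpha> e) k l = Cont i (lab i \<nu> e) (lb \<pi> \<alpha>) k l"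
      unfolding dcm_def 2 cont_def
      using card_image[OF inj_on_subset[OF e(2), of "{j\<in>{1..i}. lab i \<nu> e j = k \<and> lb \<pi> \<alpha> j = l}"]] by force
  qed
qed

lemma post_props:
  assumes m: "m \<in> Sec r i e" and e: "\<And>j. j \<in> {1..i} \<Longrightarrow> e j \<in> {1..r}"
  shows "post r \<alpha> m \<in> full_transf r" "map_index (post r \<alpha> m) = i"
    "la \<mu> (post r \<alpha> m) = la \<mu> \<alpha>" "lb \<nu> (post r \<alpha> m) = ty r i \<nu> m"
proof -
  have mi': "m x \<in> {1..i}" if "x \<in> {1..r}" for x using m that unfolding Sec_def by blast
  have sub: "phi (img \<alpha>) j \<in> {1..r}" if "j \<in> {1..i}" for j using phi_img_in[OF that] img_subset[OF \<alpha>] by blast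
  show 1: "post r \<alpha> m \<in> full_transf r"
    unfolding full_transf_def mem_Collect_eq by (auto simp: post_def simp del: atLeastAtMost_iff intro: sub[OF mi'])
  have 2: "img (post r \<alpha> m) = img \<alpha>"
  proof
    show "img (post r \<alpha> m) \<subseteq> img \<alpha>"
      unfolding img_eq[OF 1] by (auto simp: post_def simp del: atLeastAtMost_iff intro: phi_img_in[OF mi'])
    show "img \<alpha> \<subseteq> img (post r \<alpha> m)"
    proof
      fix c assume "c \<in> img \<alpha>"
      then obtain j where j: "j \<in> {1..i}" "c = phi (img \<alpha>) j"
        using bij_betw_imp_surj_on[OF phi_img_bij] by blast
      have "post r \<alpha> m (e j) = c" using m e[OF j(1)] j by (simp add: post_def Sec_def)
      then show "c \<in> img (post r \<alpha> m)" using e[OF j(1)] unfolding img_eq[OF 1] by blast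
    qed
  qed
  show 3: "map_index (post r \<alpha> m) = i" using mi by (simp add: map_index_card 2)
  show "la \<mu> (post r \<alpha> m) = la \<mu> \<alpha>" by (simp add: la_def 2 3 mi)
  have "post r \<alpha> m -` {phi (img \<alpha>) j} = {x\<in>{1..r}. m x = j}" if j: "j \<in> {1..i}" for j
  proof -
    have "phi (img \<alpha>) j \<noteq> 0" using img_nz[OF phi_img_in[OF j]] .
    moreover have "phi (img \<alpha>) (m x) = phi (img \<alpha>) j \<longleftrightarrow> m x = j" if "x \<in> {1..r}" for x
      by (rule phi_img_eq[OF mi'[OF that] j])
    ultimately show ?thesis by (auto simp: post_def simp del: atLeastAtMost_iff split: if_splits)
  qed
  then show "lb \<nu> (post r \<alpha> m) = ty r i \<nu> m"
    unfolding lb_def ty_def 2 3 by (intro restrict_ext) simp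
qed

text \<open>Left translation by the Young group keeps the fibres and moves the image points within
  their blocks; what varies is an embedding with the labels of \<alpha>. This expresses
  \<open>n_L\<close> through embeddings.\<close>

lemma card_young_orbit:
  assumes \<mu>: "sum_list \<mu> = r"
  shows "card ((\<lambda>\<rho>. \<rho> \<circ> \<alpha>) ` young \<mu>) = card (Emb r i \<mu> (la \<mu> \<alpha>))"
proof (rule bij_betw_same_card[symmetric], rule bij_betwI')
  have phr: "phi (img \<alpha>) j \<in> {1..r}" if "j \<in> {1..i}" for j using phi_img_in[OF that] img_subset[OF \<alpha>] by blast
  fix e assume e: "e \<in> Emb r i \<mu> (la \<mu> \<alpha>)"
  {
    fix e' assume e': "e' \<in> Emb r i \<mu> (la \<mu> \<alpha>)"
    show "lift r i \<alpha> e = lift r i \<alpha> e' \<longleftrightarrow> e = e'"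
    proof
      assume eq: "lift r i \<alpha> e = lift r i \<alpha> e'"
      show "e = e'"
      proof (rule PiE_ext[of e "{1..i}" "\<lambda>_. {1..r}" e'])
        fix j assume "j \<in> {1..i}"
        then obtain x where "x \<in> {1..r}" "pos i \<alpha> x = j" by (rule pos_surj)
        then show "e j = e' j" using fun_cong[OF eq, of x] by (simp add: lift_def)
      qed (use e e' in \<open>simp_all add: Emb_def\<close>)
    qed simp
  }
  define e0 where "e0 = restrict (phi (img \<alpha>)) {1..i}"
  have e0: "e0 \<in> Emb r i \<mu> (la \<mu> \<alpha>)"
    unfolding Emb_def mem_Collect_eq
  proof (intro conjI ballI PiE_I)
    show "inj_on e0 {1..i}" unfolding e0_def inj_on_restrict_eq by (rule bij_betw_imp_inj_on[OF phi_img_bij])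
  qed (use phr in \<open>auto simp: e0_def la_def mi simp del: atLeastAtMost_iff\<close>)
  obtain \<rho> where \<rho>: "\<rho> \<in> young \<mu>" "\<And>j. j \<in> {1..i} \<Longrightarrow> \<rho> (e0 j) = e j"
    using Emb_young[OF \<mu> e e0] by blast
  have "lift r i \<alpha> e = \<rho> \<circ> \<alpha>"
  proof
    fix x show "lift r i \<alpha> e x = (\<rho> \<circ> \<alpha>) x"
    proof (cases "x \<in> {1..r}")
      case True
      then show ?thesis using pos[OF True] \<rho>(2)[OF pos(1)[OF True]] by (simp add: lift_def e0_def del: atLeastAtMost_iff)
    next
      case False
      then show ?thesis using full_transfD(2)[OF \<alpha> False] permutes_0[OF young_permutes[OF \<rho>(1)]] by (simp add: lift_def del: atLeastAtMost_iff)
    qed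
  qed
  then show "lift r i \<alpha> e \<in> (\<lambda>\<rho>. \<rho> \<circ> \<alpha>) ` young \<mu>" using \<rho>(1) by blast
next
  have phr: "phi (img \<alpha>) j \<in> {1..r}" if "j \<in> {1..i}" for j using phi_img_in[OF that] img_subset[OF \<alpha>] by blast
  fix \<beta> assume "\<beta> \<in> (\<lambda>\<rho>. \<rho> \<circ> \<alpha>) ` young \<mu>"
  then obtain \<rho> where \<rho>: "\<rho> \<in> young \<mu>" "\<beta> = \<rho> \<circ> \<alpha>" by blast
  have p: "\<rho> permutes {1..r}" using young_permutes[OF \<rho>(1)] \<mu> by simp
  define e where "e = restrict (\<lambda>j. \<rho> (phi (img \<alpha>) j)) {1..i}"
  have "e \<in> Emb r i \<mu> (la \<mu> \<alpha>)"
    unfolding Emb_def mem_Collect_eq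
  proof (intro conjI ballI PiE_I)
    show "inj_on e {1..i}" unfolding e_def inj_on_restrict_eq
      using phi_img_eq injD[OF permutes_inj[OF p]] by (auto intro!: inj_onI simp del: atLeastAtMost_iff)
    fix j assume j: "j \<in> {1..i}"
    show "e j \<in> {1..r}" using permutes_in_image[OF p, of "phi (img \<alpha>) j"] phr[OF j] j by (simp add: e_def)
    show "block_number \<mu> (e j) = la \<mu> \<alpha> j"
      using young_block_number[OF \<rho>(1), unfolded \<mu>, OF phr[OF j]] j by (simp add: e_def la_def mi)
  qed (auto simp: e_def)
  moreover have "\<beta> = lift r i \<alpha> e"
  proof
    fix x show "\<beta> x = lift r i \<alpha> e x"
    proof (cases "x \<in> {1..r}")
      case True
      then show ?thesis using pos[OF True] \<rho>(2) by (simp add: lift_def e_def del: atLeastAtMost_iff)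
    next
      case False
      then show ?thesis using full_transfD(2)[OF \<alpha> False] permutes_0[OF p] \<rho>(2) by (simp add: lift_def del: atLeastAtMost_iff)
    qed
  qed
  ultimately show "\<exists>e\<in>Emb r i \<mu> (la \<mu> \<alpha>). \<beta> = lift r i \<alpha> e" by blast
qed

text \<open>A factorisation of \<open>\<alpha>\<close> through two maps of the same index as \<open>\<alpha>\<close> amounts to an embedding of
  \<open>{1..i}\<close> together with one of its sections.\<close>

lemma factorisation_bij:
  assumes D: "D1 \<subseteq> full_transf r" "D2 \<subseteq> full_transf r" "\<And>m. m \<in> D1 \<Longrightarrow> map_index m = i" "\<And>m. m \<in> D2 \<Longrightarrow> map_index m = i"
  shows "bij_betw (\<lambda>(e, m). (post r \<alpha> m, lift r i \<alpha> e))
    {(e, m). e \<in> {1..i} \<rightarrow>\<^sub>E {1..r} \<and> inj_on e {1..i} \<and> m \<in> Sec r i e \<and> lift r i \<alpha> e \<in> D2 \<and> post r \<alpha> m \<in> D1}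
    {(m1, m2). m1 \<in> D1 \<and> m2 \<in> D2 \<and> m1 \<circ> m2 = \<alpha>}" (is "bij_betw ?f ?A ?B")
proof (rule bij_betwI')
  fix a b assume ab: "a \<in> ?A" "b \<in> ?A"
  show "?f a = ?f b \<longleftrightarrow> a = b"
  proof
    assume eq: "?f a = ?f b"
    obtain e m where a: "a = (e, m)" by (cases a)
    obtain e' m' where b: "b = (e', m')" by (cases b)
    have A: "e \<in> {1..i} \<rightarrow>\<^sub>E {1..r}" "e' \<in> {1..i} \<rightarrow>\<^sub>E {1..r}" "m \<in> {1..r} \<rightarrow>\<^sub>E {1..i}" "m' \<in> {1..r} \<rightarrow>\<^sub>E {1..i}"
      using ab unfolding a b Sec_def by blast+
    have eq': "post r \<alpha> m = post r \<alpha> m'" "lift r i \<alpha> e = lift r i \<alpha> e'" using eq unfolding a b by auto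
    have "e = e'"
    proof (rule PiE_ext[OF A(1,2)])
      fix j assume "j \<in> {1..i}"
      then obtain x where "x \<in> {1..r}" "pos i \<alpha> x = j" by (rule pos_surj)
      then show "e j = e' j" using fun_cong[OF eq'(2), of x] by (simp add: lift_def)
    qed
    moreover have "m = m'"
    proof (rule PiE_ext[OF A(3,4)])
      fix x assume x: "x \<in> {1..r}"
      then have "m x \<in> {1..i}" "m' x \<in> {1..i}" using A(3,4) by blast+
      then show "m x = m' x" using fun_cong[OF eq'(1), of x] x phi_img_eq by (simp add: post_def)
    qed
    ultimately show "a = b" by (simp add: a b)
  qed simp
next
  fix a assume a: "a \<in> ?A"
  obtain e m where em: "a = (e, m)" by (cases a)
  have A: "m \<in> Sec r i e" "lift r i \<alpha> e \<in> D2" "post r \<alpha> m \<in> D1" "e \<in> {1..i} \<rightarrow>\<^sub>E {1..r}" using a unfolding em by blast+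
  have "post r \<alpha> m \<circ> lift r i \<alpha> e = \<alpha>"
  proof
    fix x show "(post r \<alpha> m \<circ> lift r i \<alpha> e) x = \<alpha> x"
    proof (cases "x \<in> {1..r}")
      case True
      have "e (pos i \<alpha> x) \<in> {1..r}" "m (e (pos i \<alpha> x)) = pos i \<alpha> x"
        using A(1,4) pos(1)[OF True] unfolding Sec_def by blast+
      then show ?thesis using True pos(2)[OF True] by (simp add: post_def lift_def)
    next
      case False
      then show ?thesis using full_transfD(2)[OF \<alpha> False] by (simp add: lift_def post_def del: atLeastAtMost_iff) simp
    qed
  qed
  then show "?f a \<in> ?B" using A em by simp
next
  fix b assume b: "b \<in> ?B"
  obtain m1 m2 where mm: "b = (m1, m2)" by (cases b)
  have m: "m1 \<in> D1" "m2 \<in> D2" and comp: "m1 \<circ> m2 = \<alpha>" using b unfolding mm by auto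
  have m1: "m1 \<in> full_transf r" "map_index m1 = i" and m2: "m2 \<in> full_transf r" "map_index m2 = i" using m D by blast+
  have im: "img \<alpha> = m1 ` img m2"
    using comp unfolding img_eq[OF \<alpha>] img_eq[OF m2(1)] image_comp by simp
  \<comment> \<open>All three maps have index \<open>i\<close>, so \<open>m1\<close> identifies no
    two points of the image of \<open>m2\<close>, and its image is that of \<alpha>.\<close>
  have inj: "inj_on m1 (img m2)"
    by (rule eq_card_imp_inj_on[OF finite_img[OF m2(1)]]) (use im m2(2) mi in \<open>simp add: map_index_card\<close>)
  have im1: "img m1 = img \<alpha>"
  proof (rule card_subset_eq[OF finite_img[OF m1(1)], symmetric])
    show "img \<alpha> \<subseteq> img m1" unfolding im img_eq[OF m1(1)] by (rule image_mono[OF img_subset[OF m2(1)]])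
    show "card (img \<alpha>) = card (img m1)" using mi m1(2) by (simp add: map_index_card)
  qed
  define sel where "sel j = (SOME x. x \<in> {1..r} \<and> pos i \<alpha> x = j)" for j
  have sel: "sel j \<in> {1..r} \<and> pos i \<alpha> (sel j) = j" if "j \<in> {1..i}" for j
    unfolding sel_def by (rule someI_ex) (use pos_surj[OF that] in blast)
  define e where "e = restrict (\<lambda>j. m2 (sel j)) {1..i}"
  define m' where "m' = restrict (\<lambda>x. inv_into {1..i} (phi (img \<alpha>)) (m1 x)) {1..r}"
  have m'1: "m' x \<in> {1..i}" "phi (img \<alpha>) (m' x) = m1 x" if x: "x \<in> {1..r}" for x
  proof -
    have "m1 x \<in> phi (img \<alpha>) ` {1..i}" using in_img[OF m1(1) x] im1 phi_img_bij by (simp add: bij_betw_def)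
    then have "inv_into {1..i} (phi (img \<alpha>)) (m1 x) \<in> {1..i}" "phi (img \<alpha>) (inv_into {1..i} (phi (img \<alpha>)) (m1 x)) = m1 x"
      by (rule inv_into_into, rule f_inv_into_f)
    then show "m' x \<in> {1..i}" "phi (img \<alpha>) (m' x) = m1 x" using x by (simp_all add: m'_def)
  qed
  have er: "e j \<in> {1..r}" if j: "j \<in> {1..i}" for j
    using full_transfD(1)[OF m2(1)] sel[OF j] j by (simp add: e_def)
  have m1e: "m1 (e j) = phi (img \<alpha>) j" if j: "j \<in> {1..i}" for j
    using fun_cong[OF comp, of "sel j"] pos(2)[of "sel j"] sel[OF j] j by (simp add: e_def)
  have e: "e \<in> {1..i} \<rightarrow>\<^sub>E {1..r}" by (rule PiE_I) (use er in \<open>auto simp: e_def simp del: atLeastAtMost_iff\<close>)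
  have einj: "inj_on e {1..i}"
  proof (rule inj_onI)
    fix j j' assume j: "j \<in> {1..i}" "j' \<in> {1..i}" "e j = e j'"
    then show "j = j'" using m1e[OF j(1)] m1e[OF j(2)] phi_img_eq[OF j(1,2)] by simp
  qed
  have lift: "lift r i \<alpha> e = m2"
  proof
    fix x show "lift r i \<alpha> e x = m2 x"
    proof (cases "x \<in> {1..r}")
      case True
      note px = pos[OF True]
      have "m1 (e (pos i \<alpha> x)) = m1 (m2 x)" using m1e[OF px(1)] px(2) fun_cong[OF comp, of x] by simp
      moreover have "e (pos i \<alpha> x) \<in> img m2" using sel[OF px(1)] in_img[OF m2(1)] px(1) by (simp add: e_def)
      ultimately have "e (pos i \<alpha> x) = m2 x" using inj_on_eq_iff[OF inj] in_img[OF m2(1) True] by blast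
      then show ?thesis using True by (simp add: lift_def)
    next
      case False
      then show ?thesis using full_transfD(2)[OF m2(1) False] by (simp add: lift_def del: atLeastAtMost_iff)
    qed
  qed
  have post: "post r \<alpha> m' = m1"
    using m'1(2) full_transfD(2)[OF m1(1)] by (intro ext) (simp add: post_def del: atLeastAtMost_iff)
  have "m' \<in> Sec r i e"
  proof -
    have "m' (e j) = j" if j: "j \<in> {1..i}" for j
      using m'1[OF er[OF j]] m1e[OF j] phi_img_eq[OF m'1(1)[OF er[OF j]] j] by simp
    moreover have "m' \<in> {1..r} \<rightarrow>\<^sub>E {1..i}" by (rule PiE_I) (use m'1(1) in \<open>auto simp: m'_def simp del: atLeastAtMost_iff\<close>)
    ultimately show ?thesis by (simp add: Sec_def)
  qed
  then have "(e, m') \<in> ?A" using e einj m lift post by simp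
  then show "\<exists>a\<in>?A. b = ?f a" unfolding mm by (rule bexI[rotated]) (simp add: lift post)
qed

end

lemma card_Emb_comp:
  assumes "\<tau> permutes {1..i}"
  shows "card (Emb r i \<nu> (l \<circ> \<tau>)) = card (Emb r i \<nu> l)"
proof (rule bij_betw_same_card[symmetric], rule bij_betwI[where g = "\<lambda>e. e \<circ> inv \<tau>"])
  show "(\<lambda>e. e \<circ> \<tau>) \<in> Emb r i \<nu> l \<rightarrow> Emb r i \<nu> (l \<circ> \<tau>)" using Emb_comp[OF _ assms] by blast
  have "l \<circ> \<tau> \<circ> inv \<tau> = l" by (simp add: comp_assoc permutes_inv_o(1)[OF assms])
  then show "(\<lambda>e. e \<circ> inv \<tau>) \<in> Emb r i \<nu> (l \<circ> \<tau>) \<rightarrow> Emb r i \<nu> l"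
    using Emb_comp[OF _ permutes_inv[OF assms], of _ r \<nu> "l \<circ> \<tau>"] by (intro funcsetI) metis
qed (simp_all add: comp_assoc permutes_inv_o[OF assms])

lemma card_Emb_cont:
  assumes "Cont i l b = Cont i l' b'" "l \<in> W i K" "b \<in> W i K" "l' \<in> W i K" "b' \<in> W i K"
  shows "card (Emb r i \<nu> l) = card (Emb r i \<nu> l')"
proof -
  interpret words "{1..i}" K by (rule words_range)
  obtain \<sigma> where "\<sigma> permutes {1..i}" "l = l' \<circ> \<sigma>" using cont_eqE[OF assms] by blast
  then show ?thesis using card_Emb_comp by simp
qed

section \<open>Left orbit sizes\<close>

context transf_algebra
begin

text \<open>Members of one double coset have the same label table, so their label words differ by a
  permutation of positions and admit equally many embeddings; hence \<open>the_elem\<close> meets a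
  singleton.\<close>

lemma n_L_eq:
  assumes c: "\<mu> \<in> compositions r n" "\<nu> \<in> compositions r n" and D: "D \<in> double_cosets M \<mu> \<nu>" and m: "m \<in> D"
  shows "n_L \<mu> D = card (Emb r (map_index m) \<mu> (la \<mu> m))" "0 < n_L \<mu> D"
proof -
  interpret weights r \<mu> \<nu> by (rule weightsI[OF c])
  have val: "card ((\<lambda>\<rho>. \<rho> \<circ> m') ` young \<mu>) = card (Emb r (map_index m) \<mu> (la \<mu> m))" if m': "m' \<in> D" for m'
  proof -
    have M: "m \<in> M" "m' \<in> M" using DC_sub[OF D] m m' by blast+
    have m'd: "m' \<in> double_coset \<mu> \<nu> m" using DC_eq[OF D m] m' by simp
    have mi: "map_index m' = map_index m" by (rule map_index_double_coset[OF M(1) m'd sum_\<mu> sum_\<nu>])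
    have "Cont (map_index m) (la \<mu> m') (lb \<nu> m') = Cont (map_index m) (la \<mu> m) (lb \<nu> m)"
      using Cont_la_lb[OF M(1), of \<mu> \<nu>] Cont_la_lb[OF M(2), of \<mu> \<nu>] mi double_coset_iff[OF M sum_\<mu> sum_\<nu>] m'd by simp
    then have "card (Emb r (map_index m) \<mu> (la \<mu> m')) = card (Emb r (map_index m) \<mu> (la \<mu> m))"
      by (rule card_Emb_cont[where K = K]) (use la_lb_W[OF M(1) c] la_lb_W[OF M(2) c] mi in simp_all)
    then show ?thesis using card_young_orbit[OF M(2) mi sum_\<mu>] by simp
  qed
  then have "(\<lambda>m. card ((\<lambda>\<rho>. \<rho> \<circ> m) ` young \<mu>)) ` D = {card (Emb r (map_index m) \<mu> (la \<mu> m))}"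
    using m by (auto simp: image_iff)
  then show eq: "n_L \<mu> D = card (Emb r (map_index m) \<mu> (la \<mu> m))" by (simp add: n_L_def)
  have "(\<lambda>\<rho>. \<rho> \<circ> m) ` young \<mu> \<noteq> {}" using young_id by blast
  then show "0 < n_L \<mu> D" unfolding eq val[OF m, symmetric] by (simp add: card_gt_0_iff)
qed

end

lemma lookup_coset_sum_mult:
  assumes "finite D1" "finite D2"
  shows "lookup (coset_sum D1 \<star> coset_sum D2) \<alpha> = int (card {(m1, m2). m1 \<in> D1 \<and> m2 \<in> D2 \<and> m1 \<circ> m2 = \<alpha>})"
proof -
  have "coset_sum D1 \<star> coset_sum D2 = (\<Sum>m1\<in>D1. \<Sum>m2\<in>D2. single (m1 \<circ> m2) 1)"
    unfolding coset_sum_def ring_mult_sum_left ring_mult_sum_right ring_mult_single by (rule sum.swap)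
  then have "lookup (coset_sum D1 \<star> coset_sum D2) \<alpha> = (\<Sum>x\<in>D1 \<times> D2. of_bool (fst x \<circ> snd x = \<alpha>))"
    by (simp add: lookup_sum lookup_single_1 sum.cartesian_product split_def of_bool_def eq_commute[of \<alpha>])
  also have "\<dots> = int (card {x\<in>D1 \<times> D2. fst x \<circ> snd x = \<alpha>})"
    using assms by (intro sum_of_bool_eq_card) simp
  also have "{x\<in>D1 \<times> D2. fst x \<circ> snd x = \<alpha>} = {(m1, m2). m1 \<in> D1 \<and> m2 \<in> D2 \<and> m1 \<circ> m2 = \<alpha>}" by auto
  finally show ?thesis .
qed

lemma SL_mult_superset:
  fixes f g :: "bkey \<Rightarrow>\<^sub>0 'k::comm_ring_1"
  assumes "finite A" "finite B" "keys f \<subseteq> A" "keys g \<subseteq> B"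
  shows "SL_mult M f g = (\<Sum>x\<in>A. \<Sum>y\<in>B. scale (lookup f x * lookup g y) (basis_mult M x y))"
proof -
  have 0: "scale 0 h = (0 :: bkey \<Rightarrow>\<^sub>0 'k)" for h by (rule poly_mapping_eqI) simp
  have "SL_mult M f g = (\<Sum>x\<in>keys f. \<Sum>y\<in>B. scale (lookup f x * lookup g y) (basis_mult M x y))"
    unfolding SL_mult_def by (intro sum.cong refl sum.mono_neutral_left) (use assms in \<open>auto simp: in_keys_iff 0\<close>)
  also have "\<dots> = (\<Sum>x\<in>A. \<Sum>y\<in>B. scale (lookup f x * lookup g y) (basis_mult M x y))"
    by (intro sum.mono_neutral_left) (use assms in \<open>auto simp: in_keys_iff 0\<close>)
  finally show ?thesis .
qed

section \<open>Structure constants as counts of factorisations\<close>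

context transf_algebra
begin

abbreviation facts :: "tmap set \<Rightarrow> tmap set \<Rightarrow> tmap \<Rightarrow> (tmap \<times> tmap) set" where
  "facts D1 D2 \<alpha> \<equiv> {(m1, m2). m1 \<in> D1 \<and> m2 \<in> D2 \<and> m1 \<circ> m2 = \<alpha>}"

lemma finite_factorisations: "finite D1 \<Longrightarrow> finite D2 \<Longrightarrow> finite (facts D1 D2 \<alpha>)"
  by (rule finite_subset[of _ "D1 \<times> D2"]) auto

text \<open>Factorisations are transported by \<rho> on the left factor and \<sigma> on the right
  one. Applied in both directions, this shows that their number is constant on double
  cosets.\<close>

lemma card_factorisations_le:
  assumes c: "\<mu> \<in> compositions r n" "\<nu> \<in> compositions r n" "\<pi> \<in> compositions r n"
    and D: "D1 \<in> double_cosets M \<mu> \<nu>" "D2 \<in> double_cosets M \<nu> \<pi>" and \<beta>: "\<beta> \<in> double_coset \<mu> \<pi> \<alpha>"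
  shows "card (facts D1 D2 \<alpha>) \<le> card (facts D1 D2 \<beta>)"
proof -
  interpret A: weights r \<mu> \<nu> by (rule weightsI[OF c(1,2)])
  interpret B: weights r \<nu> \<pi> by (rule weightsI[OF c(2,3)])
  obtain \<rho> \<sigma> where \<rho>: "\<rho> \<in> young \<mu>" and \<sigma>: "\<sigma> \<in> young \<pi>" and eq: "\<beta> = \<rho> \<circ> \<alpha> \<circ> \<sigma>"
    using \<beta> by (auto simp: double_coset_def)
  note p = young_permutes[OF \<rho>] young_permutes[OF \<sigma>]
  show ?thesis
  proof (rule card_inj_on_le[where f = "\<lambda>(m1, m2). (\<rho> \<circ> m1, m2 \<circ> \<sigma>)"])
    show "inj_on (\<lambda>(m1, m2). (\<rho> \<circ> m1, m2 \<circ> \<sigma>)) (facts D1 D2 \<alpha>)"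
    proof (rule inj_onI, clarify)
      fix a b a' b' :: tmap assume e: "\<rho> \<circ> a = \<rho> \<circ> a'" "b \<circ> \<sigma> = b' \<circ> \<sigma>"
      have "inv \<rho> \<circ> (\<rho> \<circ> a) = inv \<rho> \<circ> (\<rho> \<circ> a')" "b \<circ> \<sigma> \<circ> inv \<sigma> = b' \<circ> \<sigma> \<circ> inv \<sigma>" using e by simp_all
      then show "a = a' \<and> b = b'" by (simp add: o_assoc permutes_inv_o(2)[OF p(1)]) (simp add: comp_assoc permutes_inv_o(1)[OF p(2)])
    qed
    show "(\<lambda>(m1, m2). (\<rho> \<circ> m1, m2 \<circ> \<sigma>)) ` facts D1 D2 \<alpha> \<subseteq> facts D1 D2 \<beta>"
    proof clarify
      fix a b assume ab: "a \<in> D1" "b \<in> D2" "\<alpha> = a \<circ> b"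
      have "\<rho> \<circ> a \<circ> id \<in> double_coset \<mu> \<nu> a" "id \<circ> b \<circ> \<sigma> \<in> double_coset \<nu> \<pi> b"
        using \<rho> \<sigma> young_id unfolding double_coset_def by blast+
      then show "\<rho> \<circ> a \<in> D1 \<and> b \<circ> \<sigma> \<in> D2 \<and> \<rho> \<circ> a \<circ> (b \<circ> \<sigma>) = \<beta>"
        using A.DC_eq[OF D(1) ab(1)] B.DC_eq[OF D(2) ab(2)] eq ab(3) by (simp add: o_assoc)
    qed
    show "finite (facts D1 D2 \<beta>)" by (rule finite_factorisations[OF A.DC_finite[OF D(1)] B.DC_finite[OF D(2)]])
  qed
qed

lemma struct_const_card:
  assumes c: "\<mu> \<in> compositions r n" "\<nu> \<in> compositions r n" "\<pi> \<in> compositions r n"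
    and D: "D1 \<in> double_cosets M \<mu> \<nu>" "D2 \<in> double_cosets M \<nu> \<pi>" and \<alpha>: "\<alpha> \<in> M"
  shows "struct_const M \<mu> \<nu> \<pi> D1 D2 (double_coset \<mu> \<pi> \<alpha>) =
    (int (n_L \<mu> (double_coset \<mu> \<pi> \<alpha>)) * int (card (facts D1 D2 \<alpha>))) div (int (n_L \<mu> D1) * int (n_L \<nu> D2))"
proof -
  interpret A: weights r \<mu> \<nu> by (rule weightsI[OF c(1,2)])
  interpret B: weights r \<nu> \<pi> by (rule weightsI[OF c(2,3)])
  interpret C: weights r \<mu> \<pi> by (rule weightsI[OF c(1,3)])
  have l: "lookup (coset_sum D1 \<star> coset_sum D2) \<alpha>' = int (card (facts D1 D2 \<alpha>'))" for \<alpha>'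
    by (rule lookup_coset_sum_mult[OF A.DC_finite[OF D(1)] B.DC_finite[OF D(2)]])
  have "lookup (coords M \<mu> \<pi> (coset_sum D1 \<star> coset_sum D2)) (double_coset \<mu> \<pi> \<alpha>) = lookup (coset_sum D1 \<star> coset_sum D2) \<alpha>"
  proof (rule C.coords_lookup[OF _ _ \<alpha>])
    fix \<alpha>' assume \<alpha>': "\<alpha>' \<notin> M"
    have "m1 \<circ> m2 \<in> M" if "m1 \<in> D1" "m2 \<in> D2" for m1 m2
    proof -
      have m: "m1 \<in> M" "m2 \<in> M" using that A.DC_sub[OF D(1)] B.DC_sub[OF D(2)] by blast+
      have "m1 0 = 0" using full_transfD(2)[OF m(1), of 0] by simp
      then show ?thesis using m unfolding full_transf_def mem_Collect_eq comp_apply by (auto simp del: atLeastAtMost_iff)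
    qed
    then have "facts D1 D2 \<alpha>' = {}" using \<alpha>' by blast
    then show "lookup (coset_sum D1 \<star> coset_sum D2) \<alpha>' = 0" unfolding l by (simp only: card.empty of_nat_0)
  next
    show "coset_inv r \<mu> \<pi> (lookup (coset_sum D1 \<star> coset_sum D2))"
      unfolding coset_inv_def l
    proof (intro ballI arg_cong[of _ _ int] antisym)
      fix \<alpha> \<beta> assume \<alpha>: "\<alpha> \<in> M" and \<beta>: "\<beta> \<in> double_coset \<mu> \<pi> \<alpha>"
      show "card (facts D1 D2 \<alpha>) \<le> card (facts D1 D2 \<beta>)" by (rule card_factorisations_le[OF c D \<beta>])
      have "\<alpha> \<in> double_coset \<mu> \<pi> \<beta>" using C.DC_eq[OF C.DC_I[OF \<alpha>] \<beta>] double_coset_self by blast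
      then show "card (facts D1 D2 \<beta>) \<le> card (facts D1 D2 \<alpha>)" by (rule card_factorisations_le[OF c D])
    qed
  qed
  then show ?thesis unfolding struct_const_def l by simp
qed

text \<open>In top index the left orbit sizes of \<open>D1\<close> and of the product cancel, and each orbit of embeddings
  contributes \<open>n\<^sub>L(D2)\<close> equal terms, so the division is visibly exact.\<close>

lemma struct_const_top:
  assumes c: "\<mu> \<in> compositions r n" "\<nu> \<in> compositions r n" "\<pi> \<in> compositions r n"
    and D: "D1 \<in> double_cosets M \<mu> \<nu>" "D2 \<in> double_cosets M \<nu> \<pi>"
    and m1: "m1 \<in> D1" "map_index m1 = i" and m2: "m2 \<in> D2" "map_index m2 = i"
    and \<alpha>: "\<alpha> \<in> M" "map_index \<alpha> = i"
  shows "struct_const M \<mu> \<nu> \<pi> D1 D2 (double_coset \<mu> \<pi> \<alpha>) =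
    words.mm {1..i} K (HH r i \<nu> (dcm \<mu> \<nu> m1)) (words.xi {1..i} (dcm \<nu> \<pi> m2)) (la \<mu> \<alpha>) (lb \<pi> \<alpha>)" (is "_ = ?X")
proof -
  interpret A: weights r \<mu> \<nu> by (rule weightsI[OF c(1,2)])
  interpret B: weights r \<nu> \<pi> by (rule weightsI[OF c(2,3)])
  interpret C: weights r \<mu> \<pi> by (rule weightsI[OF c(1,3)])
  interpret words "{1..i}" K by (rule words_range)
  let ?N1 = "dcm \<mu> \<nu> m1" and ?N2 = "dcm \<nu> \<pi> m2"
  let ?E = "{e \<in> {1..i} \<rightarrow>\<^sub>E {1..r}. inj_on e {1..i}}"
  have m1M: "m1 \<in> M" and m2M: "m2 \<in> M" using m1(1) m2(1) A.DC_sub[OF D(1)] B.DC_sub[OF D(2)] by blast+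
  have D1: "D1 = double_coset \<mu> \<nu> m1" and D2: "D2 = double_coset \<nu> \<pi> m2"
    using A.DC_eq[OF D(1) m1(1)] B.DC_eq[OF D(2) m2(1)] .
  have in1: "\<beta> \<in> D1 \<longleftrightarrow> dcm \<mu> \<nu> \<beta> = ?N1" if "\<beta> \<in> M" for \<beta>
    unfolding D1 by (rule double_coset_iff[OF m1M that A.sum_\<mu> A.sum_\<nu>])
  have in2: "\<beta> \<in> D2 \<longleftrightarrow> dcm \<nu> \<pi> \<beta> = ?N2" if "\<beta> \<in> M" for \<beta>
    unfolding D2 by (rule double_coset_iff[OF m2M that B.sum_\<mu> B.sum_\<nu>])
  have ix1: "map_index m = i" if "m \<in> D1" for m
    using map_index_double_coset[OF m1M that[unfolded D1] A.sum_\<mu> A.sum_\<nu>] m1(2) by simp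
  have ix2: "map_index m = i" if "m \<in> D2" for m
    using map_index_double_coset[OF m2M that[unfolded D2] B.sum_\<mu> B.sum_\<nu>] m2(2) by simp
  have labF: "lab i \<nu> e \<in> F" if "e \<in> ?E" for e
  proof -
    have "block_number \<nu> (e j) < K" if j: "j \<in> {1..i}" for j
    proof -
      have "e j \<in> {1..sum_list \<nu>}" using \<open>e \<in> ?E\<close> j by auto
      from block_number_in(1)[OF this] show ?thesis using compD[OF c(2)] KK by simp
    qed
    then show ?thesis unfolding F_def lab_def by auto
  qed
  have Emb_eq: "{e\<in>?E. lab i \<nu> e = l} = Emb r i \<nu> l" if l: "l \<in> F" for l
  proof -
    have "lab i \<nu> e = l \<longleftrightarrow> (\<forall>j\<in>{1..i}. block_number \<nu> (e j) = l j)" for e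
    proof
      assume h: "\<forall>j\<in>{1..i}. block_number \<nu> (e j) = l j"
      have "l j = undefined" if "j \<notin> {1..i}" for j using l that unfolding F_def by (rule PiE_arb)
      then show "lab i \<nu> e = l" using h by (intro ext) (auto simp: lab_def simp del: atLeastAtMost_iff)
    qed (auto simp: lab_def)
    then show ?thesis by (auto simp: Emb_def)
  qed
  have finE: "finite ?E" by (rule finite_subset[of _ "{1..i} \<rightarrow>\<^sub>E {1..r}"]) (auto intro: finite_PiE)
  have cardS: "int (card {m\<in>Sec r i e. post r \<alpha> m \<in> D1}) = HH r i \<nu> ?N1 (la \<mu> \<alpha>) (lab i \<nu> e)" if e: "e \<in> ?E" for e
  proof -
    have er: "e j \<in> {1..r}" if "j \<in> {1..i}" for j using e that by auto
    have "post r \<alpha> m \<in> D1 \<longleftrightarrow> cont (la \<mu> \<alpha>) (ty r i \<nu> m) = ?N1" if m: "m \<in> Sec r i e" for m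
      using post_props[OF \<alpha> m er] in1 Cont_la_lb[of "post r \<alpha> m" r \<mu> \<nu>] by simp
    then have "int (card {m\<in>Sec r i e. post r \<alpha> m \<in> D1}) = (\<Sum>m\<in>Sec r i e. of_bool (cont (la \<mu> \<alpha>) (ty r i \<nu> m) = ?N1))"
      by (subst sum_of_bool_eq_card[OF finite_Sec]) (intro arg_cong[of _ _ "\<lambda>A. int (card A)"] Collect_cong, blast)
    also have "\<dots> = HH r i \<nu> ?N1 (la \<mu> \<alpha>) (lab i \<nu> e)"
    proof -
      have "e \<in> Emb r i \<nu> (lab i \<nu> e)" using Emb_eq[OF labF[OF e]] e by blast
      then show ?thesis by (simp only: HH_eq[OF A.sum_\<nu>] HS_def xi_def)
    qed
    finally show ?thesis .
  qed
  have "int (card (facts D1 D2 \<alpha>)) = int (card (SIGMA e:{e\<in>?E. lift r i \<alpha> e \<in> D2}. {m\<in>Sec r i e. post r \<alpha> m \<in> D1}))"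
  proof -
    have "(SIGMA e:{e\<in>?E. lift r i \<alpha> e \<in> D2}. {m\<in>Sec r i e. post r \<alpha> m \<in> D1}) =
      {(e, m). e \<in> {1..i} \<rightarrow>\<^sub>E {1..r} \<and> inj_on e {1..i} \<and> m \<in> Sec r i e \<and> lift r i \<alpha> e \<in> D2 \<and> post r \<alpha> m \<in> D1}"
      by blast
    then show ?thesis
      using bij_betw_same_card[OF factorisation_bij[OF \<alpha> A.DC_sub[OF D(1)] B.DC_sub[OF D(2)] ix1 ix2]] by (simp only:)
  qed
  also have "\<dots> = (\<Sum>e\<in>{e\<in>?E. lift r i \<alpha> e \<in> D2}. int (card {m\<in>Sec r i e. post r \<alpha> m \<in> D1}))"
  proof -
    have "finite {e\<in>?E. lift r i \<alpha> e \<in> D2}" by (rule finite_subset[OF _ finE]) blast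
    then have "card (SIGMA e:{e\<in>?E. lift r i \<alpha> e \<in> D2}. {m\<in>Sec r i e. post r \<alpha> m \<in> D1}) =
      (\<Sum>e\<in>{e\<in>?E. lift r i \<alpha> e \<in> D2}. card {m\<in>Sec r i e. post r \<alpha> m \<in> D1})"
      by (rule card_SigmaI) simp
    then show ?thesis by (simp only: of_nat_sum)
  qed
  also have "\<dots> = (\<Sum>e\<in>?E. xi ?N2 (lab i \<nu> e) (lb \<pi> \<alpha>) * HH r i \<nu> ?N1 (la \<mu> \<alpha>) (lab i \<nu> e))"
  proof (rule sum.mono_neutral_cong_left[OF finE])
    have l: "lift r i \<alpha> e \<in> D2 \<longleftrightarrow> cont (lab i \<nu> e) (lb \<pi> \<alpha>) = ?N2" if "e \<in> ?E" for e
      using lift_props[OF \<alpha>, of e] in2 that by auto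
    show "\<forall>e\<in>?E - {e\<in>?E. lift r i \<alpha> e \<in> D2}. xi ?N2 (lab i \<nu> e) (lb \<pi> \<alpha>) * HH r i \<nu> ?N1 (la \<mu> \<alpha>) (lab i \<nu> e) = 0"
      using l by (auto simp: xi_def)
    show "int (card {m\<in>Sec r i e. post r \<alpha> m \<in> D1}) = xi ?N2 (lab i \<nu> e) (lb \<pi> \<alpha>) * HH r i \<nu> ?N1 (la \<mu> \<alpha>) (lab i \<nu> e)"
      if "e \<in> {e\<in>?E. lift r i \<alpha> e \<in> D2}" for e
      using cardS[of e] l[of e] that by (simp add: xi_def)
  qed auto
  also have "\<dots> = (\<Sum>l\<in>F. \<Sum>e\<in>{e\<in>?E. lab i \<nu> e = l}. xi ?N2 (lab i \<nu> e) (lb \<pi> \<alpha>) * HH r i \<nu> ?N1 (la \<mu> \<alpha>) (lab i \<nu> e))"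
    by (rule sum.group[symmetric]) (use finE labF in auto)
  also have "\<dots> = (\<Sum>l\<in>F. int (n_L \<nu> D2) * (HH r i \<nu> ?N1 (la \<mu> \<alpha>) l * xi ?N2 l (lb \<pi> \<alpha>)))"
  proof (rule sum.cong[OF refl])
    fix l assume l: "l \<in> F"
    have lbF: "lb \<pi> \<alpha> \<in> F" using la_lb_W(2)[OF \<alpha>(1) c(1,3)] \<alpha>(2) by simp
    have "(\<Sum>e\<in>{e\<in>?E. lab i \<nu> e = l}. xi ?N2 (lab i \<nu> e) (lb \<pi> \<alpha>) * HH r i \<nu> ?N1 (la \<mu> \<alpha>) (lab i \<nu> e)) =
       int (card (Emb r i \<nu> l)) * (xi ?N2 l (lb \<pi> \<alpha>) * HH r i \<nu> ?N1 (la \<mu> \<alpha>) l)"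
      unfolding Emb_eq[OF l, symmetric] by simp
    also have "\<dots> = int (n_L \<nu> D2) * (HH r i \<nu> ?N1 (la \<mu> \<alpha>) l * xi ?N2 l (lb \<pi> \<alpha>))"
    proof (cases "cont l (lb \<pi> \<alpha>) = ?N2")
      case True
      have "cont l (lb \<pi> \<alpha>) = cont (la \<nu> m2) (lb \<pi> m2)" using True Cont_la_lb[OF m2M, of \<nu> \<pi>] m2(2) by simp
      then have "card (Emb r i \<nu> l) = card (Emb r i \<nu> (la \<nu> m2))"
        by (rule card_Emb_cont[where K = K]) (use l lbF la_lb_W[OF m2M c(2,3)] m2(2) in simp_all)
      then show ?thesis using n_L_eq(1)[OF c(2,3) D(2) m2(1)] m2(2) by simp
    qed (simp add: xi_def)
    finally show "(\<Sum>e\<in>{e\<in>?E. lab i \<nu> e = l}. xi ?N2 (lab i \<nu> e) (lb \<pi> \<alpha>) * HH r i \<nu> ?N1 (la \<mu> \<alpha>) (lab i \<nu> e)) =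
      int (n_L \<nu> D2) * (HH r i \<nu> ?N1 (la \<mu> \<alpha>) l * xi ?N2 l (lb \<pi> \<alpha>))" .
  qed
  also have "\<dots> = int (n_L \<nu> D2) * ?X" by (simp add: mm_def sum_distrib_left)
  finally have a: "int (card (facts D1 D2 \<alpha>)) = int (n_L \<nu> D2) * ?X" .
  note pos1 = n_L_eq(2)[OF c(1,2) D(1) m1(1)] and pos2 = n_L_eq(2)[OF c(2,3) D(2) m2(1)]
  show ?thesis
  proof (cases "facts D1 D2 \<alpha> = {}")
    case True
    then have "int (card (facts D1 D2 \<alpha>)) = 0" by (simp only: card.empty of_nat_0)
    then show ?thesis using a pos2 struct_const_card[OF c D \<alpha>(1)] by simp
  next
    case False
    then obtain a1 a2 where f: "a1 \<in> D1" "a2 \<in> D2" "a1 \<circ> a2 = \<alpha>" by blast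
    have aM: "a1 \<in> M" "a2 \<in> M" using f A.DC_sub[OF D(1)] B.DC_sub[OF D(2)] by blast+
    \<comment> \<open>Any factorisation shows that \<alpha> and its left factor have the same image,
      hence the same left labels; this is the cancellation of orbit sizes.\<close>
    have "img \<alpha> = img a1"
    proof (rule card_subset_eq[OF finite_img[OF aM(1)]])
      show "img \<alpha> \<subseteq> img a1" using f(3) by (auto simp: img_def)
      show "card (img \<alpha>) = card (img a1)" using \<alpha>(2) ix1[OF f(1)] by (simp add: map_index_card)
    qed
    then have "la \<mu> \<alpha> = la \<mu> a1" using \<alpha>(2) ix1[OF f(1)] by (simp add: la_def)
    then have "n_L \<mu> (double_coset \<mu> \<pi> \<alpha>) = n_L \<mu> D1"
      using n_L_eq(1)[OF c(1,3) C.DC_I[OF \<alpha>(1)] double_coset_self] n_L_eq(1)[OF c(1,2) D(1) f(1)] \<alpha>(2) ix1[OF f(1)] by simp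
    then show ?thesis using pos1 pos2 unfolding struct_const_card[OF c D \<alpha>(1)] a by simp
  qed
qed

text \<open>The image of a composite lies in the image of its left factor, so the index cannot
  rise.\<close>

lemma struct_const_high:
  assumes c: "\<mu> \<in> compositions r n" "\<nu> \<in> compositions r n" "\<pi> \<in> compositions r n"
    and D: "D1 \<in> double_cosets M \<mu> \<nu>" "D2 \<in> double_cosets M \<nu> \<pi>"
    and m1: "m1 \<in> D1" and \<alpha>: "\<alpha> \<in> M" "map_index m1 < map_index \<alpha>"
  shows "struct_const M \<mu> \<nu> \<pi> D1 D2 (double_coset \<mu> \<pi> \<alpha>) = 0"
proof -
  interpret A: weights r \<mu> \<nu> by (rule weightsI[OF c(1,2)])
  have "m \<circ> m' \<noteq> \<alpha>" if m: "m \<in> D1" for m m'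
  proof
    assume eq: "m \<circ> m' = \<alpha>"
    have M: "m1 \<in> M" "m \<in> M" using m1 m A.DC_sub[OF D(1)] by blast+
    have "map_index m = map_index m1"
      using map_index_double_coset[OF M(1) _ A.sum_\<mu> A.sum_\<nu>] A.DC_eq[OF D(1) m1] m by blast
    moreover have "card (img \<alpha>) \<le> card (img m)"
      by (rule card_mono[OF finite_img[OF M(2)]]) (use eq in \<open>auto simp: img_def\<close>)
    ultimately show False using \<alpha>(2) by (simp add: map_index_card)
  qed
  then have "facts D1 D2 \<alpha> = {}" by blast
  then have "int (card (facts D1 D2 \<alpha>)) = 0" by (simp only: card.empty of_nat_0)
  then show ?thesis using struct_const_card[OF c D \<alpha>(1)] by simp
qed

end

section \<open>Products modulo larger shapes\<close>

context transf_algebra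
begin

lemma keys_vec:
  assumes "\<mu> \<in> compositions r n" "\<nu> \<in> compositions r n"
  shows "keys (vec r \<mu> \<nu> x :: bkey \<Rightarrow>\<^sub>0 'k) \<subseteq> (\<lambda>D. (\<mu>, \<nu>, D)) ` double_cosets M \<mu> \<nu>"
proof
  fix z assume "z \<in> keys (vec r \<mu> \<nu> x :: bkey \<Rightarrow>\<^sub>0 'k)"
  then have "lookup (vec r \<mu> \<nu> x :: bkey \<Rightarrow>\<^sub>0 'k) z \<noteq> 0" by (simp add: in_keys_iff)
  then show "z \<in> (\<lambda>D. (\<mu>, \<nu>, D)) ` double_cosets M \<mu> \<nu>"
    using weights.lookup_vec_other[OF weightsI[OF assms], of z x] by blast
qed

lemma SL_mult_vec_other:
  assumes c: "\<mu> \<in> compositions r n" "\<nu> \<in> compositions r n" "\<nu>' \<in> compositions r n" "\<pi> \<in> compositions r n" and ne: "\<nu> \<noteq> \<nu>'"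
  shows "SL_mult M (vec r \<mu> \<nu> x) (vec r \<nu>' \<pi> y) = (0 :: bkey \<Rightarrow>\<^sub>0 'k)"
proof -
  have "scale a 0 = (0 :: bkey \<Rightarrow>\<^sub>0 'k)" for a by (rule poly_mapping_eqI) simp
  then show ?thesis
    by (subst SL_mult_superset[OF _ _ keys_vec[OF c(1,2)] keys_vec[OF c(3,4)]]) (simp_all add: sum.reindex inj_on_def ne)
qed

lemma SL_mult_vec:
  assumes c: "\<mu> \<in> compositions r n" "\<nu> \<in> compositions r n" "\<pi> \<in> compositions r n"
  shows "\<alpha> \<in> M \<Longrightarrow> lookup (SL_mult M (vec r \<mu> \<nu> x) (vec r \<nu> \<pi> y) :: bkey \<Rightarrow>\<^sub>0 'k) (\<mu>, \<pi>, double_coset \<mu> \<pi> \<alpha>) =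
    of_int (\<Sum>D1\<in>double_cosets M \<mu> \<nu>. \<Sum>D2\<in>double_cosets M \<nu> \<pi>.
      x (SOME m. m \<in> D1) * y (SOME m. m \<in> D2) * struct_const M \<mu> \<nu> \<pi> D1 D2 (double_coset \<mu> \<pi> \<alpha>))"
    and "(\<And>\<alpha>. \<alpha> \<in> M \<Longrightarrow> z \<noteq> (\<mu>, \<pi>, double_coset \<mu> \<pi> \<alpha>)) \<Longrightarrow>
      lookup (SL_mult M (vec r \<mu> \<nu> x) (vec r \<nu> \<pi> y) :: bkey \<Rightarrow>\<^sub>0 'k) z = 0"
proof -
  have l: "lookup (vec r \<mu> \<nu> x :: bkey \<Rightarrow>\<^sub>0 'k) (\<mu>, \<nu>, D) = of_int (x (SOME m. m \<in> D))"
    if "D \<in> double_cosets M \<mu> \<nu>" for \<mu> \<nu> x D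
    using that by (simp add: vec_def lookup_sum lookup_single when_def)
  have eq: "(SL_mult M (vec r \<mu> \<nu> x) (vec r \<nu> \<pi> y) :: bkey \<Rightarrow>\<^sub>0 'k) =
    (\<Sum>D1\<in>double_cosets M \<mu> \<nu>. \<Sum>D2\<in>double_cosets M \<nu> \<pi>. scale (of_int (x (SOME m. m \<in> D1)) * of_int (y (SOME m. m \<in> D2)))
      (\<Sum>D\<in>double_cosets M \<mu> \<pi>. single (\<mu>, \<pi>, D) (of_int (struct_const M \<mu> \<nu> \<pi> D1 D2 D))))"
    by (subst SL_mult_superset[OF _ _ keys_vec[OF c(1,2)] keys_vec[OF c(2,3)]]) (simp_all add: sum.reindex inj_on_def l)
  show "lookup (SL_mult M (vec r \<mu> \<nu> x) (vec r \<nu> \<pi> y) :: bkey \<Rightarrow>\<^sub>0 'k) (\<mu>, \<pi>, double_coset \<mu> \<pi> \<alpha>) =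
    of_int (\<Sum>D1\<in>double_cosets M \<mu> \<nu>. \<Sum>D2\<in>double_cosets M \<nu> \<pi>.
      x (SOME m. m \<in> D1) * y (SOME m. m \<in> D2) * struct_const M \<mu> \<nu> \<pi> D1 D2 (double_coset \<mu> \<pi> \<alpha>))" if "\<alpha> \<in> M"
    using weights.DC_I[OF weightsI[OF c(1,3)] that] unfolding eq by (simp add: lookup_sum lookup_single when_def)
  show "lookup (SL_mult M (vec r \<mu> \<nu> x) (vec r \<nu> \<pi> y) :: bkey \<Rightarrow>\<^sub>0 'k) z = 0"
    if h: "\<And>\<alpha>. \<alpha> \<in> M \<Longrightarrow> z \<noteq> (\<mu>, \<pi>, double_coset \<mu> \<pi> \<alpha>)"
  proof -
    have "z \<noteq> (\<mu>, \<pi>, D)" if "D \<in> double_cosets M \<mu> \<pi>" for D using h that by (auto simp: double_cosets_def)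
    then have "lookup (\<Sum>D\<in>double_cosets M \<mu> \<pi>. single (\<mu>, \<pi>, D) (of_int (g D) :: 'k)) z = 0" for g
      unfolding lookup_sum by (intro sum.neutral ballI) (auto simp: lookup_single when_def)
    then show ?thesis unfolding eq by (simp add: lookup_sum[of _ "double_cosets M \<mu> \<nu>"] lookup_sum[of _ "double_cosets M \<nu> \<pi>"])
  qed
qed

text \<open>Exactly one double coset has the table of \<beta>, so the sum picks out one value; this
  undoes the expansion of a vector in the basis.\<close>

lemma sum_double_cosets:
  assumes c: "\<mu> \<in> compositions r n" "\<nu> \<in> compositions r n" and g: "coset_inv r \<mu> \<nu> g" and \<beta>: "\<beta> \<in> M"
  shows "(\<Sum>D\<in>double_cosets M \<mu> \<nu>. g (SOME m. m \<in> D) * of_bool (dcm \<mu> \<nu> \<beta> = dcm \<mu> \<nu> (SOME m. m \<in> D))) = (g \<beta> :: int)"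
proof -
  interpret A: weights r \<mu> \<nu> by (rule weightsI[OF c])
  have "dcm \<mu> \<nu> \<beta> = dcm \<mu> \<nu> (SOME m. m \<in> D) \<longleftrightarrow> D = double_coset \<mu> \<nu> \<beta>" if D: "D \<in> double_cosets M \<mu> \<nu>" for D
  proof -
    note R = A.DC_rep[OF D]
    have "(SOME m. m \<in> D) \<in> M" using R A.DC_sub[OF D] by blast
    from double_coset_eq_iff[OF \<beta> this A.sum_\<mu> A.sum_\<nu>] show ?thesis using A.DC_eq[OF D R] by auto
  qed
  then have "(\<Sum>D\<in>double_cosets M \<mu> \<nu>. g (SOME m. m \<in> D) * of_bool (dcm \<mu> \<nu> \<beta> = dcm \<mu> \<nu> (SOME m. m \<in> D))) =
    (\<Sum>D\<in>double_cosets M \<mu> \<nu>. if D = double_coset \<mu> \<nu> \<beta> then g (SOME m. m \<in> D) else 0)"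
    by (intro sum.cong refl) simp
  also have "\<dots> = g (SOME m. m \<in> double_coset \<mu> \<nu> \<beta>)" using A.DC_I[OF \<beta>] by simp
  also have "\<dots> = g \<beta>" using A.DC_rep[OF A.DC_I[OF \<beta>]] g \<beta> by (simp add: coset_inv_def)
  finally show ?thesis .
qed

text \<open>Coordinates of index above \<open>i\<close> vanish and those below lie in the span of
  larger shapes, so only index \<open>i\<close> has to be computed. There the double sum over cosets
  splits, for each label word \<open>l\<close> of the middle embedding, into the value of
  \<open>f2\<close> at \<open>l\<close> and a sum over sections. The product form of
  \<open>f1\<close> lets its right half be merged with that sum into \<open>HH\<close>.\<close>

lemma product_mod_upper:
  assumes c: "\<mu> \<in> compositions r n" "\<nu> \<in> compositions r n" "\<pi> \<in> compositions r n" and i: "i = sum_list lam"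
    and f2: "words.Inv {1..i} K f2" and f1: "f1 = words.mm {1..i} K (words.tr (words.xi {1..i} NA)) (words.xi {1..i} NB)"
  shows "(SL_mult M (vec r \<mu> \<nu> (pull \<mu> \<nu> i f1)) (vec r \<nu> \<pi> (pull \<nu> \<pi> i f2)) :: bkey \<Rightarrow>\<^sub>0 'k) -
    vec r \<mu> \<pi> (pull \<mu> \<pi> i (words.mm {1..i} K (words.mm {1..i} K (words.tr (words.xi {1..i} NA)) (HH r i \<nu> NB)) f2)) \<in> U lam"
proof -
  interpret words "{1..i}" K by (rule words_range)
  interpret A: weights r \<mu> \<nu> by (rule weightsI[OF c(1,2)])
  interpret B: weights r \<nu> \<pi> by (rule weightsI[OF c(2,3)])
  interpret C: weights r \<mu> \<pi> by (rule weightsI[OF c(1,3)])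
  let ?R = "\<lambda>D. SOME m. m \<in> D"
  let ?x = "pull \<mu> \<nu> i f1" and ?y = "pull \<nu> \<pi> i f2"
  define G where "G = mm (tr (xi NA)) (HH r i \<nu> NB)"
  have len: "length \<mu> < K" "length \<nu> < K" "2 ^ r < K" using compD[OF c(1)] compD[OF c(2)] KK by simp_all
  have f1I: "Inv f1" unfolding f1 by (intro Inv_mm Inv_tr Inv_xi)
  note xI = A.coset_inv_pull[OF f1I len(1,3)] and yI = B.coset_inv_pull[OF f2 len(2,3)]
  have PI: "coset_inv r \<mu> \<pi> (pull \<mu> \<pi> i (mm G f2))"
    unfolding G_def by (intro C.coset_inv_pull[OF _ len(1,3)] Inv_mm Inv_tr Inv_xi f2 Inv_HH[OF A.sum_\<nu>])
  let ?s = "\<lambda>\<alpha>. \<Sum>D1\<in>double_cosets M \<mu> \<nu>. \<Sum>D2\<in>double_cosets M \<nu> \<pi>. ?x (?R D1) * ?y (?R D2) * struct_const M \<mu> \<nu> \<pi> D1 D2 (double_coset \<mu> \<pi> \<alpha>)"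
  have high: "?s \<alpha> = 0" if \<alpha>: "\<alpha> \<in> M" "i < map_index \<alpha>" for \<alpha>
  proof (intro sum.neutral ballI)
    fix D1 D2 assume D: "D1 \<in> double_cosets M \<mu> \<nu>" "D2 \<in> double_cosets M \<nu> \<pi>"
    show "?x (?R D1) * ?y (?R D2) * struct_const M \<mu> \<nu> \<pi> D1 D2 (double_coset \<mu> \<pi> \<alpha>) = 0"
      using struct_const_high[OF c D A.DC_rep[OF D(1)] \<alpha>(1)] \<alpha>(2) by (cases "map_index (?R D1) = i") (simp_all add: pull_def)
  qed
  have top: "?s \<alpha> = mm G f2 (la \<mu> \<alpha>) (lb \<pi> \<alpha>)" if \<alpha>: "\<alpha> \<in> M" "map_index \<alpha> = i" for \<alpha>
  proof -
    let ?a = "la \<mu> \<alpha>" and ?b = "lb \<pi> \<alpha>"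
    let ?h = "\<lambda>D1 l. HH r i \<nu> (dcm \<mu> \<nu> (?R D1)) ?a l" and ?k = "\<lambda>D2 l. xi (dcm \<nu> \<pi> (?R D2)) l ?b"
    have bF: "?b \<in> F" using la_lb_W(2)[OF \<alpha>(1) c(1,3)] \<alpha>(2) by simp
    have "?s \<alpha> = (\<Sum>D1\<in>double_cosets M \<mu> \<nu>. \<Sum>D2\<in>double_cosets M \<nu> \<pi>. \<Sum>l\<in>F. (?x (?R D1) * ?h D1 l) * (?y (?R D2) * ?k D2 l))"
    proof (intro sum.cong refl)
      fix D1 D2 assume D: "D1 \<in> double_cosets M \<mu> \<nu>" "D2 \<in> double_cosets M \<nu> \<pi>"
      show "?x (?R D1) * ?y (?R D2) * struct_const M \<mu> \<nu> \<pi> D1 D2 (double_coset \<mu> \<pi> \<alpha>) = (\<Sum>l\<in>F. (?x (?R D1) * ?h D1 l) * (?y (?R D2) * ?k D2 l))"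
      proof (cases "map_index (?R D1) = i \<and> map_index (?R D2) = i")
        case True
        then have "struct_const M \<mu> \<nu> \<pi> D1 D2 (double_coset \<mu> \<pi> \<alpha>) = (\<Sum>l\<in>F. ?h D1 l * ?k D2 l)"
          using struct_const_top[OF c D A.DC_rep[OF D(1)] _ B.DC_rep[OF D(2)] _ \<alpha>] by (simp add: mm_def)
        then show ?thesis by (simp add: sum_distrib_left mult_ac)
      qed (auto simp: pull_def)
    qed
    also have "\<dots> = (\<Sum>D1\<in>double_cosets M \<mu> \<nu>. \<Sum>l\<in>F. \<Sum>D2\<in>double_cosets M \<nu> \<pi>. (?x (?R D1) * ?h D1 l) * (?y (?R D2) * ?k D2 l))"
      by (intro sum.cong refl sum.swap)
    also have "\<dots> = (\<Sum>l\<in>F. \<Sum>D1\<in>double_cosets M \<mu> \<nu>. \<Sum>D2\<in>double_cosets M \<nu> \<pi>. (?x (?R D1) * ?h D1 l) * (?y (?R D2) * ?k D2 l))"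
      by (rule sum.swap)
    also have "\<dots> = (\<Sum>l\<in>F. (\<Sum>D1\<in>double_cosets M \<mu> \<nu>. ?x (?R D1) * ?h D1 l) * (\<Sum>D2\<in>double_cosets M \<nu> \<pi>. ?y (?R D2) * ?k D2 l))"
      by (simp only: sum_product)
    also have "\<dots> = (\<Sum>l\<in>F. G ?a l * f2 l ?b)"
    proof (rule sum.cong[OF refl])
      fix l assume l: "l \<in> F"
      show "(\<Sum>D1\<in>double_cosets M \<mu> \<nu>. ?x (?R D1) * ?h D1 l) * (\<Sum>D2\<in>double_cosets M \<nu> \<pi>. ?y (?R D2) * ?k D2 l) = G ?a l * f2 l ?b"
      \<comment> \<open>Label words that no embedding has contribute nothing, because
        \<open>HH\<close> is set to 0 there.\<close>
      proof (cases "Emb r i \<nu> l = {}")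
        case True
        then show ?thesis by (simp add: HH_def G_def mm_def)
      next
        case False
        then obtain e where e: "e \<in> Emb r i \<nu> l" by blast
        have eE: "e \<in> {1..i} \<rightarrow>\<^sub>E {1..r}" "inj_on e {1..i}" using e by (auto simp: Emb_def)
        have el: "lab i \<nu> e = l"
        proof (rule F_eqI[OF _ l])
          have "lab i \<nu> e j = l j" if "j \<in> {1..i}" for j using e that by (simp add: lab_def Emb_def)
          then show "lab i \<nu> e \<in> F" "\<And>j. j \<in> {1..i} \<Longrightarrow> lab i \<nu> e j = l j"
            using l unfolding F_def by (auto simp: lab_def PiE_iff simp del: atLeastAtMost_iff)
        qed
        note lp = lift_props[OF \<alpha> eE]
        have "(\<Sum>D2\<in>double_cosets M \<nu> \<pi>. ?y (?R D2) * ?k D2 l) = ?y (lift r i \<alpha> e)"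
          using sum_double_cosets[OF c(2,3) yI lp(1)] lp(4)[of \<nu> \<pi>] el by (simp add: xi_def)
        also have "\<dots> = f2 (la \<nu> (lift r i \<alpha> e)) (lb \<pi> (lift r i \<alpha> e))" using lp(3) by (simp add: pull_def)
        also have "\<dots> = f2 l ?b"
          by (rule Inv_cont_eq[OF f2]) (use Cont_la_lb[OF lp(1), of \<nu> \<pi>] lp(3,4) el l bF la_lb_W[OF lp(1) c(2,3)] in simp_all)
        finally have 2: "(\<Sum>D2\<in>double_cosets M \<nu> \<pi>. ?y (?R D2) * ?k D2 l) = f2 l ?b" .
        have "(\<Sum>D1\<in>double_cosets M \<mu> \<nu>. ?x (?R D1) * ?h D1 l) =
          (\<Sum>D1\<in>double_cosets M \<mu> \<nu>. \<Sum>m\<in>Sec r i e. ?x (?R D1) * xi (dcm \<mu> \<nu> (?R D1)) ?a (ty r i \<nu> m))"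
          unfolding HH_eq[OF A.sum_\<nu> e] HS_def sum_distrib_left ..
        also have "\<dots> = (\<Sum>m\<in>Sec r i e. \<Sum>D1\<in>double_cosets M \<mu> \<nu>. ?x (?R D1) * xi (dcm \<mu> \<nu> (?R D1)) ?a (ty r i \<nu> m))"
          by (rule sum.swap)
        also have "\<dots> = (\<Sum>m\<in>Sec r i e. f1 ?a (ty r i \<nu> m))"
        proof (rule sum.cong[OF refl])
          fix m assume m: "m \<in> Sec r i e"
          have pp: "post r \<alpha> m \<in> M" "map_index (post r \<alpha> m) = i" "la \<mu> (post r \<alpha> m) = ?a" "lb \<nu> (post r \<alpha> m) = ty r i \<nu> m"
            using post_props[OF \<alpha> m Emb_in[OF e]] by simp_all
          have "cont ?a (ty r i \<nu> m) = dcm \<mu> \<nu> (post r \<alpha> m)"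
            using Cont_la_lb[OF pp(1), of \<mu> \<nu>] unfolding pp(2-4) .
          then have "(\<Sum>D1\<in>double_cosets M \<mu> \<nu>. ?x (?R D1) * xi (dcm \<mu> \<nu> (?R D1)) ?a (ty r i \<nu> m)) = ?x (post r \<alpha> m)"
            using sum_double_cosets[OF c(1,2) xI pp(1)] by (simp add: xi_def)
          then show "(\<Sum>D1\<in>double_cosets M \<mu> \<nu>. ?x (?R D1) * xi (dcm \<mu> \<nu> (?R D1)) ?a (ty r i \<nu> m)) = f1 ?a (ty r i \<nu> m)"
            using pp by (simp add: pull_def)
        qed
        also have "\<dots> = (\<Sum>\<rho>\<in>F. \<Sum>m\<in>Sec r i e. tr (xi NA) ?a \<rho> * xi NB \<rho> (ty r i \<nu> m))"
          unfolding f1 mm_def by (rule sum.swap)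
        also have "\<dots> = G ?a l"
          unfolding G_def mm_def HH_eq[OF A.sum_\<nu> e] HS_def sum_distrib_left ..
        finally show ?thesis using 2 by simp
      qed
    qed
    also have "\<dots> = mm G f2 ?a ?b" by (simp add: mm_def)
    finally show ?thesis .
  qed
  show ?thesis unfolding G_def[symmetric]
  proof (rule lower_in_upper[OF c(1,3)])
    fix z
    let ?P = "SL_mult M (vec r \<mu> \<nu> ?x) (vec r \<nu> \<pi> ?y) :: bkey \<Rightarrow>\<^sub>0 'k"
    assume nz: "lookup (?P - vec r \<mu> \<pi> (pull \<mu> \<pi> i (mm G f2))) z \<noteq> 0"
    have "\<exists>\<alpha>\<in>M. z = (\<mu>, \<pi>, double_coset \<mu> \<pi> \<alpha>)"
    proof (rule ccontr)
      assume h: "\<not> (\<exists>\<alpha>\<in>M. z = (\<mu>, \<pi>, double_coset \<mu> \<pi> \<alpha>))"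
      have "lookup ?P z = 0" by (rule SL_mult_vec(2)[OF c]) (use h in blast)
      moreover have "lookup (vec r \<mu> \<pi> (pull \<mu> \<pi> i (mm G f2)) :: bkey \<Rightarrow>\<^sub>0 'k) z = 0"
        by (rule C.lookup_vec_other) (use h in \<open>auto simp: double_cosets_def\<close>)
      ultimately show False using nz by (simp add: lookup_minus)
    qed
    then obtain \<alpha> where \<alpha>: "\<alpha> \<in> M" "z = (\<mu>, \<pi>, double_coset \<mu> \<pi> \<alpha>)" by blast
    have "(of_int (?s \<alpha>) :: 'k) \<noteq> of_int (pull \<mu> \<pi> i (mm G f2) \<alpha>)"
      using nz unfolding \<alpha>(2) lookup_minus SL_mult_vec(1)[OF c \<alpha>(1)] C.lookup_vec[OF PI \<alpha>(1)] by simp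
    then have "?s \<alpha> \<noteq> pull \<mu> \<pi> i (mm G f2) \<alpha>" by (rule contrapos_nn) simp
    then have "map_index \<alpha> \<noteq> i" "\<not> i < map_index \<alpha>"
      using top[OF \<alpha>(1)] high[OF \<alpha>(1)] by (auto simp: pull_def)
    then show "\<exists>\<alpha>\<in>M. z = (\<mu>, \<pi>, double_coset \<mu> \<pi> \<alpha>) \<and> map_index \<alpha> < sum_list lam" using \<alpha> i by (intro bexI[of _ \<alpha>]) simp_all
  qed
qed

end

subsection \<open>A rotation of the row-reading diagram\<close>

text \<open>Cyclic shift inside each segment of \<open>p\<close> consecutive numbers that starts at
  a multiple of \<open>p\<close>.\<close>

definition rot :: "nat \<Rightarrow> nat \<Rightarrow> nat" where
  "rot p c = p * (c div p) + (c mod p + 1) mod p"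

lemma rot_funpow:
  assumes "0 < p"
  shows "(rot p ^^ k) c = p * (c div p) + (c mod p + k) mod p"
proof (induction k)
  case (Suc k)
  have "(rot p ^^ Suc k) c = rot p (p * (c div p) + (c mod p + k) mod p)" using Suc by simp
  also have "\<dots> = p * (c div p) + (c mod p + Suc k) mod p" using assms by (simp add: rot_def Suc_eq_plus1 mod_add_left_eq add.assoc)
  finally show ?case .
qed simp

lemma rot_period: "0 < p \<Longrightarrow> (rot p ^^ p) c = c"
  by (simp add: rot_funpow)

lemma rot_inj: "0 < p \<Longrightarrow> rot p c = rot p c' \<longleftrightarrow> c = c'"
proof -
  assume p: "0 < p"
  have "c = c'" if "rot p c = rot p c'"
  proof -
    have "(rot p ^^ (p - 1)) (rot p c) = (rot p ^^ (p - 1)) (rot p c')" using that by simp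
    moreover have "(rot p ^^ (p - 1)) (rot p x) = x" for x
      using rot_period[OF p, of x] p funpow_Suc_right[of "p - 1" "rot p"] by simp
    ultimately show ?thesis by simp
  qed
  then show ?thesis by blast
qed

lemma rot_add: "0 < p \<Longrightarrow> rot p (p * a + c) = p * a + rot p c"
  by (simp add: rot_def algebra_simps)

lemma rot_neq: "1 < p \<Longrightarrow> rot p c \<noteq> c"
proof
  assume p: "1 < p" and "rot p c = c"
  then have "rot p c mod p = c mod p" by simp
  then have eq: "(c mod p + 1) mod p = c mod p" by (simp add: rot_def)
  have "c mod p < p" using p by simp
  then consider "c mod p + 1 = p" | "c mod p + 1 < p" by linarith
  then show False
  proof cases
    case 1
    then have "c mod p = 0" using eq by (metis mod_self)
    then show False using 1 p by linarith
  next
    case 2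
    then have "(c mod p + 1) mod p = c mod p + 1" by (rule mod_less)
    then show False using eq by linarith
  qed
qed

lemma rot_less: "0 < p \<Longrightarrow> c < p * b \<Longrightarrow> rot p c < p * b"
proof -
  assume p: "0 < p" and c: "c < p * b"
  have "c div p < b" using c by (simp add: less_mult_imp_div_less mult.commute)
  then have le: "p * (c div p + 1) \<le> p * b" by (intro mult_le_mono2) simp
  have "rot p c < p * (c div p + 1)" using mod_less_divisor[OF p, of "c mod p + 1"] by (simp add: rot_def distrib_left)
  from less_le_trans[OF this le] show ?thesis .
qed

context
  fixes i p :: nat and lam :: "nat list"
  assumes lam: "lam \<in> partitions i" and p: "1 < p" and dvd: "\<And>j. j < length lam \<Longrightarrow> p dvd lam ! j"
begin

text \<open>Since \<open>p\<close> divides all parts, every row starts at a multiple of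
  \<open>p\<close> when positions are counted from 0. So one rotation of all positions stays inside
  rows and acts on column numbers by the same formula in every row; boxes of one column stay in one
  column.\<close>

definition row_rot :: "nat \<Rightarrow> nat" where
  "row_rot x = (if x \<in> {1..i} then Suc (rot p (x - 1)) else x)"

lemma dvd_take: "p dvd sum_list (take k lam)"
proof (induction k)
  case (Suc k)
  then show ?case by (cases "k < length lam") (simp_all add: sum_list_take_Suc dvd dvd_add)
qed simp

lemma row_rot:
  assumes x: "x \<in> {1..i}"
  shows "row_rot x \<in> {1..i}" "row_word lam (row_rot x) = row_word lam x"
    "col_word lam (row_rot x) = rot p (col_word lam x)" "row_rot x \<noteq> x"
proof -
  have sl: "sum_list lam = i" using lam by (simp add: partitions_def)
  define k where "k = row_word lam x"
  have x': "x \<in> {1..sum_list lam}" using x sl by simp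
  have k: "k < length lam" unfolding k_def by (rule row_word_bounds(1)[OF x'])
  obtain a where a: "sum_list (take k lam) = p * a" using dvd_take by (auto elim: dvdE)
  obtain b where b: "lam ! k = p * b" using dvd[OF k] by (auto elim: dvdE)
  define c where "c = col_word lam x"
  have xc: "x = p * a + c + 1" "c < p * b" using row_col_word[OF x'] a b by (simp_all add: k_def c_def)
  have r: "row_rot x = sum_list (take k lam) + rot p c + 1"
    using x xc(1) p rot_add[of p a c] a by (simp add: row_rot_def)
  have rc: "rot p c < lam ! k" using rot_less[of p c b] xc(2) p b by simp
  note ra = row_word_at[OF k rc]
  show "row_rot x \<in> {1..i}" "row_word lam (row_rot x) = row_word lam x"
    "col_word lam (row_rot x) = rot p (col_word lam x)" using ra sl unfolding r by (simp_all add: k_def c_def)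
  show "row_rot x \<noteq> x" using rot_neq[OF p, of c] r xc(1) a by simp
qed

lemma row_rot_period: "row_rot ^^ p = id"
proof
  fix x show "(row_rot ^^ p) x = id x"
  proof (cases "x \<in> {1..i}")
    case True
    have "(row_rot ^^ k) x = Suc ((rot p ^^ k) (x - 1)) \<and> (row_rot ^^ k) x \<in> {1..i}" for k
    proof (induction k)
      case (Suc k)
      have "row_rot ((row_rot ^^ k) x) = Suc (rot p ((row_rot ^^ k) x - 1))" using Suc unfolding row_rot_def by metis
      then show ?case using Suc row_rot(1)[of "(row_rot ^^ k) x"] by simp
    qed (use True in simp)
    from this[of p] show ?thesis using rot_period[of p "x - 1"] p True by simp
  next
    case False
    have "(row_rot ^^ k) x = x" for k
    proof (induction k)
      case (Suc k) then show ?case using False unfolding funpow.simps comp_apply row_rot_def by (simp only: if_False)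
    qed simp
    then show ?thesis by simp
  qed
qed

lemma row_rot_permutes: "row_rot permutes {1..i}"
proof (rule inj_imp_permutes)
  show "inj_on row_rot {1..i}"
  proof (rule inj_onI)
    fix x y assume "row_rot x = row_rot y"
    then have "(row_rot ^^ (p - 1)) (row_rot x) = (row_rot ^^ (p - 1)) (row_rot y)" by simp
    moreover have "(row_rot ^^ (p - 1)) (row_rot x) = x" for x
      using fun_cong[OF row_rot_period, of x] p funpow_Suc_right[of "p - 1" row_rot] by simp
    ultimately show "x = y" by simp
  qed
qed (use row_rot(1) in \<open>auto simp: row_rot_def simp del: atLeastAtMost_iff\<close>)

end

subsection \<open>The special bracket\<close>

context
  fixes r n i K z :: nat and lam :: "nat list"
  assumes lam: "lam \<in> partitions i" and i: "1 \<le> i" "i \<le> r" and rn: "r \<le> n" and K: "K = n + 2 ^ r + 3" and z: "z \<in> {1..i}"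
begin

lemma merge_conj:
  assumes "j \<in> {1..i}"
  shows "merge r i j x = Transposition.transpose j z (merge r i z (Transposition.transpose j z x))"
  using assms z i by (auto simp: merge_def Transposition.transpose_def)

text \<open>A section of the identity embedding is the identity on \<open>{1..i}\<close>. The least
  point of its fibre over \<open>j\<close> is \<open>j\<close>, so the first letter of the block
  string recovers the row, which pins down \<rho>. The fibre matching the one over \<open>z\<close>
  must be as large, so it contains all surplus points.\<close>

lemma sections_of_special:
  assumes m: "m \<in> Sec r i (restrict id {1..i})" and \<rho>: "\<rho> \<in> W i K"
  shows "Cont i \<rho> (ty r i (spec r n lam) m) = Cont i (row_word lam) (lb (spec r n lam) (merge r i z)) \<longleftrightarrow>
     \<rho> = row_word lam \<and> m \<in> (\<lambda>j. restrict (merge r i j) {1..r}) ` {j\<in>{1..i}. row_word lam j = row_word lam z}" (is "?C = ?R")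
proof -
  interpret words "{1..i}" K by (rule words_range)
  define \<nu> where "\<nu> = spec r n lam"
  define b0 where "b0 = lb \<nu> (merge r i z)"
  have s: "sum_list \<nu> = r" unfolding \<nu>_def by (rule spec_sum[OF lam i rn])
  have ln: "length \<nu> = n" using spec_comp[OF lam i rn] by (simp add: compositions_def \<nu>_def)
  have sl: "sum_list lam = i" by (rule sum_shape[OF lam i rn])
  have rowF: "row_word lam \<in> F" using row_word_in_W[of lam K] length_partition[OF lam] i rn K sl by simp
  note mg = merge_in[OF lam i rn z] merge_index[OF lam i rn z]
  have b0F: "b0 \<in> F" unfolding b0_def
    using la_lb_in_W(2)[OF mg(1) s s, of K] mg(2) ln K by simp
  have orb: "oidx \<nu> d < K" if "d \<subseteq> {1..r}" for d
    using oidx_props(1)[of d \<nu>] length_subset_orbits[of \<nu>] that K unfolding s by simp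
  have tyF: "ty r i \<nu> m \<in> F" unfolding F_def ty_def by (auto intro!: orb)
  have mj: "m j = j" if "j \<in> {1..i}" for j using m that unfolding Sec_def by simp
  have b0j: "b0 j = oidx \<nu> (merge r i z -` {j})" if "j \<in> {1..i}" for j
    unfolding b0_def by (rule lb_merge[OF lam i rn z that])
  have mfs: "merge r i z -` {j} \<subseteq> {1..sum_list \<nu>}" if "j \<in> {1..i}" for j
    using fibre_subset[OF mg(1), of j] merge_img[OF lam i rn z] that s by simp
  show ?thesis
  proof
    assume ?C
    then have C: "cont \<rho> (ty r i \<nu> m) = cont (row_word lam) b0" by (simp add: \<nu>_def b0_def)
    obtain \<tau> where \<tau>: "\<tau> permutes {1..i}" "\<rho> = row_word lam \<circ> \<tau>" "ty r i \<nu> m = b0 \<circ> \<tau>"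
      using cont_eqE[OF C \<rho> tyF rowF b0F] by blast
    have ti: "\<tau> j \<in> {1..i}" if "j \<in> {1..i}" for j using permutes_in_image[OF \<tau>(1)] that by blast
    have cnt: "cnt \<nu> {x\<in>{1..r}. m x = j} = cnt \<nu> (merge r i z -` {\<tau> j})" if j: "j \<in> {1..i}" for j
    proof -
      have "oidx \<nu> {x\<in>{1..r}. m x = j} = oidx \<nu> (merge r i z -` {\<tau> j})"
        using fun_cong[OF \<tau>(3), of j] b0j[OF ti[OF j]] j by (simp add: ty_def)
      moreover have "{x\<in>{1..r}. m x = j} \<subseteq> {1..sum_list \<nu>}" using s by auto
      ultimately show ?thesis using oidx_eq_iff[OF _ mfs[OF ti[OF j]]] by blast
    qed
    have row: "\<rho> j = row_word lam j" if j: "j \<in> {1..i}" for j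
    proof -
      let ?A = "{x\<in>{1..r}. m x = j}"
      have A: "?A \<subseteq> {1..sum_list \<nu>}" using s by auto
      have jA: "j \<in> ?A" using mj[OF j] j i by simp
      have fin: "finite ?A" by simp
      have ne: "?A \<noteq> {}" using jA by blast
      have "Min ?A = j"
      proof (rule Min_eqI[OF fin])
        fix y assume "y \<in> ?A"
        then show "j \<le> y" using mj[of y] j by (cases "y \<in> {1..i}") auto
      qed (rule jA)
      then have "sorted_list_of_set ?A = j # sorted_list_of_set (?A - {j})"
        using sorted_list_of_set_nonempty[OF fin ne] by simp
      then have "hd (block_string \<nu> ?A) = Suc (row_word lam j)"
        using spec_block_number[OF lam i rn j] by (simp add: block_string_def \<nu>_def)
      moreover obtain xs where "block_string \<nu> (merge r i z -` {\<tau> j}) = Suc (row_word lam (\<tau> j)) # xs"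
        using merge_string[OF lam i rn z ti[OF j]] unfolding \<nu>_def by blast
      moreover have "block_string \<nu> ?A = block_string \<nu> (merge r i z -` {\<tau> j})"
        using block_string_eq_iff[OF A mfs[OF ti[OF j]]] cnt[OF j] by simp
      ultimately show ?thesis by (simp add: \<tau>(2))
    qed
    have \<rho>row: "\<rho> = row_word lam" by (rule F_eqI[OF \<rho> rowF row])
    \<comment> \<open>The position whose fibre corresponds to the fibre of \<open>merge\<close> over
      \<open>z\<close>; it lies in the row of \<open>z\<close>, and by size its fibre collects every
      surplus point.\<close>
    define j where "j = inv \<tau> z"
    have j: "j \<in> {1..i}" unfolding j_def using permutes_in_image[OF permutes_inv[OF \<tau>(1)]] z by blast
    have tj: "\<tau> j = z" by (simp add: j_def permutes_inverses(1)[OF \<tau>(1)])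
    have rj: "row_word lam j = row_word lam z" using row[OF j] \<tau>(2) tj by simp
    have "finite (merge r i z -` {z})" using mfs[OF z] finite_subset by blast
    then obtain g where "bij_betw g {x\<in>{1..r}. m x = j} (merge r i z -` {z})"
      using cnt_eq_bij[OF cnt[OF j, unfolded tj]] by auto
    then have "card {x\<in>{1..r}. m x = j} = card (insert z {Suc i..r})"
      using bij_betw_same_card merge_fibre[OF lam i rn z z] by fastforce
    also have "\<dots> = card (insert j {Suc i..r})" using j z by simp
    finally have "{x\<in>{1..r}. m x = j} = insert j {Suc i..r}"
    proof (intro card_subset_eq)
      show "{x\<in>{1..r}. m x = j} \<subseteq> insert j {Suc i..r}"
      proof
        fix x assume x: "x \<in> {x\<in>{1..r}. m x = j}"
        then show "x \<in> insert j {Suc i..r}" using mj[of x] by (cases "x \<in> {1..i}") auto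
      qed
    qed simp_all
    then have mo: "m x = j" if "x \<in> {Suc i..r}" for x using that by blast
    have "m = restrict (merge r i j) {1..r}"
    proof
      fix x show "m x = restrict (merge r i j) {1..r} x"
      proof (cases "x \<in> {1..r}")
        case True
        then show ?thesis using mj[of x] mo[of x] by (cases "x \<in> {1..i}") (auto simp: merge_def)
      next
        case False
        have "m \<in> {1..r} \<rightarrow>\<^sub>E {1..i}" using m by (simp add: Sec_def)
        then have "m x = undefined" using False by (rule PiE_arb)
        then show ?thesis using False by (simp only: restrict_def if_False)
      qed
    qed
    then show ?R using \<rho>row j rj by blast
  next
    assume ?R
    then obtain j where \<rho>row: "\<rho> = row_word lam" and j: "j \<in> {1..i}" "row_word lam j = row_word lam z"
      and mr: "m = restrict (merge r i j) {1..r}" by blast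
    \<comment> \<open>Exchanging \<open>j\<close> and \<open>z\<close>, which lie in one block,
      carries one section to the other and belongs to the Young group.\<close>
    let ?t = "Transposition.transpose j z"
    have tp: "?t permutes {1..i}" using j(1) z by (rule permutes_swap_id)
    have tpr: "?t permutes {1..r}" by (rule permutes_subset[OF tp]) (use i in auto)
    have rt: "row_word lam (?t x) = row_word lam x" for x using j(2) by (simp add: Transposition.transpose_def)
    have ty: "?t \<in> young \<nu>"
    proof -
      have "block_number \<nu> j = block_number \<nu> z"
        using spec_block_number[OF lam i rn j(1)] spec_block_number[OF lam i rn z] j(2) by (simp add: \<nu>_def)
      then show ?thesis using tpr s by (simp add: young_iff Transposition.transpose_def)
    qed
    have "ty r i \<nu> m x = (b0 \<circ> ?t) x" if x: "x \<in> {1..i}" for x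
    proof -
      have tx: "?t x \<in> {1..i}" using permutes_in_image[OF tp] x by blast
      have "{y\<in>{1..r}. m y = x} = merge r i j -` {x}" using x i unfolding mr by (auto simp: merge_def split: if_splits)
      also have "\<dots> = ?t -` (merge r i z -` {?t x})"
        using merge_conj[OF j(1)] by (auto simp: Transposition.transpose_eq_iff)
      finally show ?thesis using oidx_vimage[OF ty mfs[OF tx]] b0j[OF tx] x by (simp add: ty_def)
    qed
    then have "ty r i \<nu> m = b0 \<circ> ?t" by (intro F_eqI[OF tyF F_comp[OF b0F tp]])
    moreover have "row_word lam \<circ> ?t = row_word lam" using rt by auto
    ultimately have "cont (row_word lam) (ty r i \<nu> m) = cont (row_word lam) b0"
      using cont_comp[OF tp, of "row_word lam" b0] by simp
    then show ?C by (simp add: \<rho>row \<nu>_def b0_def)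
  qed
qed

text \<open>Counts the maps and not the points \<open>j\<close>: when there are no surplus points,
  all choices of \<open>j\<close> give the same map and the value drops to 1.\<close>

definition theta :: nat where
  "theta = card ((\<lambda>j. restrict (merge r i j) {1..r}) ` {j\<in>{1..i}. row_word lam j = row_word lam z})"

lemma theta_full: "i = r \<Longrightarrow> theta = 1"
proof -
  assume ir: "i = r"
  have "restrict (merge r i j) {1..r} = restrict id {1..r}" for j using ir by (intro restrict_ext) (simp add: merge_def)
  then have "(\<lambda>j. restrict (merge r i j) {1..r}) ` {j\<in>{1..i}. row_word lam j = row_word lam z} = {restrict id {1..r}}"
    using z by auto
  then show ?thesis by (simp add: theta_def)
qed

lemma theta_less: "i < r \<Longrightarrow> theta = lam ! row_word lam z"
proof -
  assume ir: "i < r"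
  interpret words "{1..i}" K by (rule words_range)
  have sl: "sum_list lam = i" by (rule sum_shape[OF lam i rn])
  have k: "row_word lam z < length lam" using row_word_bounds(1)[of z lam] z sl by simp
  have "inj_on (\<lambda>j. restrict (merge r i j) {1..r}) {j\<in>{1..i}. row_word lam j = row_word lam z}"
  proof (rule inj_onI)
    fix j j' assume "restrict (merge r i j) {1..r} = restrict (merge r i j') {1..r}"
    from fun_cong[OF this, of r] show "j = j'" using ir by (simp add: merge_def)
  qed
  then have "theta = card {j\<in>{1..i}. row_word lam j = row_word lam z}" unfolding theta_def by (rule card_image)
  also have "\<dots> = lam ! row_word lam z"
    using card_level[of "row_word lam" "row_word lam z"] ps_row_word[of lam] sl sum_list_take_Suc[OF k] by simp
  finally show ?thesis .
qed

text \<open>For the distinguished tableaux the inserted matrix is a multiple of the identity of the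
  weight space exactly, not only modulo \<open>J\<close>. By invariance only the column of the row
  word has to be computed, and there the identity embedding may be used.\<close>

lemma special_theta:
  assumes \<rho>: "\<rho>1 \<in> W i K" "\<rho>2 \<in> W i K"
  shows "words.mm {1..i} K (HH r i (spec r n lam) (Cont i (row_word lam) (lb (spec r n lam) (merge r i z))))
      (words.tr (words.xi {1..i} (Cont i (row_word lam) (la (spec r n lam) (merge r i z))))) \<rho>1 \<rho>2 =
    int theta * words.xi {1..i} (Cont i (row_word lam) (row_word lam)) \<rho>1 \<rho>2"
proof -
  interpret words "{1..i}" K by (rule words_range)
  define \<nu> where "\<nu> = spec r n lam"
  define a0 where "a0 = la \<nu> (merge r i z)"
  define NT where "NT = cont (row_word lam) (lb \<nu> (merge r i z))"
  let ?row = "row_word lam"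
  let ?Th = "mm (HH r i \<nu> NT) (tr (xi (cont ?row a0)))"
  have s: "sum_list \<nu> = r" unfolding \<nu>_def by (rule spec_sum[OF lam i rn])
  have ln: "length \<nu> = n" using spec_comp[OF lam i rn] by (simp add: compositions_def \<nu>_def)
  have sl: "sum_list lam = i" by (rule sum_shape[OF lam i rn])
  have rowF: "?row \<in> F" using row_word_in_W[of lam K] length_partition[OF lam] i rn K sl by simp
  note mg = merge_in[OF lam i rn z] merge_index[OF lam i rn z]
  have a0F: "a0 \<in> F" unfolding a0_def using la_lb_in_W(1)[OF mg(1) s s, of K] mg(2) ln K by simp
  have a0j: "a0 j = Suc (?row j)" if "j \<in> {1..i}" for j
    unfolding a0_def \<nu>_def by (rule la_merge[OF lam i rn z that])
  have InvT: "Inv ?Th" by (intro Inv_mm Inv_HH Inv_tr Inv_xi s)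
  define e0 where "e0 = restrict id {1..i}"
  have e0: "e0 \<in> Emb r i \<nu> a0"
    using spec_block_number[OF lam i rn] a0j i by (auto simp: Emb_def e0_def \<nu>_def inj_on_def)
  have base: "?Th \<rho> ?row = int theta * xi (cont ?row ?row) \<rho> ?row" if \<rho>: "\<rho> \<in> F" for \<rho>
  proof -
    have "?Th \<rho> ?row = HH r i \<nu> NT \<rho> a0 * tr (xi (cont ?row a0)) a0 ?row"
    proof (rule mm_unique[OF a0F])
      fix l assume l: "l \<in> F" "tr (xi (cont ?row a0)) l ?row \<noteq> 0"
      then have "cont ?row l = cont ?row a0" by (simp add: tr_def xi_def split: if_splits)
      then obtain \<tau> where t: "\<tau> permutes {1..i}" "?row = ?row \<circ> \<tau>" "l = a0 \<circ> \<tau>"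
        using cont_eqE[OF _ rowF l(1) rowF a0F] by blast
      show "l = a0"
      proof (rule F_eqI[OF l(1) a0F])
        fix j assume j: "j \<in> {1..i}"
        have "\<tau> j \<in> {1..i}" using permutes_in_image[OF t(1)] j by blast
        then show "l j = a0 j" using a0j j t(3) fun_cong[OF t(2), of j] by simp
      qed
    qed
    also have "\<dots> = HS r i \<nu> NT e0 \<rho>" using HH_eq[OF s e0] by (simp add: tr_def xi_def)
    also have "\<dots> = (\<Sum>m\<in>Sec r i e0. of_bool (\<rho> = ?row \<and> m \<in> (\<lambda>j. restrict (merge r i j) {1..r}) ` {j\<in>{1..i}. ?row j = ?row z}))"
      unfolding HS_def xi_def NT_def \<nu>_def e0_def
      by (intro sum.cong refl arg_cong[of _ _ of_bool] sections_of_special) (use \<rho> in auto)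
    also have "\<dots> = (if \<rho> = ?row then int (card {m\<in>Sec r i e0. m \<in> (\<lambda>j. restrict (merge r i j) {1..r}) ` {j\<in>{1..i}. ?row j = ?row z}}) else 0)"
      by (cases "\<rho> = ?row") (simp_all only: simp_thms if_True if_False of_bool_eq sum_of_bool_eq_card[OF finite_Sec] sum.neutral_const)
    also have "{m\<in>Sec r i e0. m \<in> (\<lambda>j. restrict (merge r i j) {1..r}) ` {j\<in>{1..i}. ?row j = ?row z}} =
       (\<lambda>j. restrict (merge r i j) {1..r}) ` {j\<in>{1..i}. ?row j = ?row z}"
    proof -
      have "restrict (merge r i j) {1..r} \<in> Sec r i e0" if "j \<in> {1..i}" for j
        using that i by (auto simp: Sec_def merge_def e0_def)
      then show ?thesis by blast
    qed
    also have "xi (cont ?row ?row) \<rho> ?row = of_bool (\<rho> = ?row)"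
    proof -
      have "\<rho> = ?row" if c: "cont \<rho> ?row = cont ?row ?row"
        using cont_eqE[OF c \<rho> rowF rowF rowF] by metis
      then show ?thesis by (auto simp: xi_def)
    qed
    then have "(if \<rho> = ?row then int (card ((\<lambda>j. restrict (merge r i j) {1..r}) ` {j\<in>{1..i}. ?row j = ?row z})) else 0) =
      int theta * xi (cont ?row ?row) \<rho> ?row" by (simp add: theta_def)
    finally show ?thesis .
  qed
  have "?Th \<rho>1 \<rho>2 = int theta * xi (cont ?row ?row) \<rho>1 \<rho>2"
  \<comment> \<open>The words of weight \<open>lam\<close> are the rearrangements of the row word;
    for any other \<rho>2 both sides vanish.\<close>
  proof (cases "\<exists>\<tau>. \<tau> permutes {1..i} \<and> \<rho>2 = ?row \<circ> \<tau>")
    case True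
    then obtain \<tau> where t: "\<tau> permutes {1..i}" "\<rho>2 = ?row \<circ> \<tau>" by blast
    define \<rho> where "\<rho> = \<rho>1 \<circ> inv \<tau>"
    have \<rho>F: "\<rho> \<in> F" unfolding \<rho>_def by (rule F_comp[OF \<rho>(1) permutes_inv[OF t(1)]])
    have r1: "\<rho>1 = \<rho> \<circ> \<tau>" by (simp add: \<rho>_def comp_assoc permutes_inv_o(2)[OF t(1)])
    have "?Th \<rho>1 \<rho>2 = ?Th \<rho> ?row" using InvT t(1) \<rho>F rowF unfolding Inv_def r1 t(2) by blast
    also have "\<dots> = int theta * xi (cont ?row ?row) \<rho>1 \<rho>2"
      unfolding base[OF \<rho>F] r1 t(2) xi_def cont_comp[OF t(1)] ..
    finally show ?thesis .
  next
    case False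
    have ne: "cont \<rho>2 a \<noteq> cont ?row b" if "a \<in> F" "b \<in> F" for a b
    proof
      assume c: "cont \<rho>2 a = cont ?row b"
      from cont_eqE[OF c \<rho>(2) that(1) rowF that(2)] show False using False by metis
    qed
    have "?Th \<rho>1 \<rho>2 = 0"
      unfolding mm_def by (intro sum.neutral ballI) (simp add: tr_def xi_def ne[OF _ a0F])
    moreover have "cont \<rho>1 \<rho>2 \<noteq> cont ?row ?row"
    proof
      assume c: "cont \<rho>1 \<rho>2 = cont ?row ?row"
      from cont_eqE[OF c \<rho> rowF rowF] show False using False by metis
    qed
    ultimately show ?thesis by (simp add: xi_def)
  qed
  then show ?thesis by (simp add: \<nu>_def a0_def NT_def)
qed

end

subsection \<open>The bracket\<close>

lemma (in words) ps_eq_cont_diag: "ps \<rho> = ps row \<Longrightarrow> cont \<rho> \<rho> = cont row row"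
  by (intro ext) (simp add: cont_diag card_level)

lemma Inv_HH_support:
  assumes "sum_list \<nu> = r" "HH r i \<nu> N \<rho> l \<noteq> 0" "2 ^ r < K"
  obtains b where "b \<in> W i K" "Cont i \<rho> b = N"
proof -
  interpret words "{1..i}" K by (rule words_range)
  obtain e where e: "e \<in> Emb r i \<nu> l" using assms(2) by (auto simp: HH_def split: if_splits)
  have "(\<Sum>m\<in>Sec r i e. xi N \<rho> (ty r i \<nu> m)) \<noteq> 0" using assms(2) HH_eq[OF assms(1) e] by (simp add: HS_def)
  then obtain m where "xi N \<rho> (ty r i \<nu> m) \<noteq> 0" by (rule sum.not_neutral_contains_not_neutral)
  then have "cont \<rho> (ty r i \<nu> m) = N" by (simp add: xi_def split: if_splits)
  moreover have orb: "oidx \<nu> d < K" if "d \<subseteq> {1..r}" for d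
    using oidx_props(1)[of d \<nu>] length_subset_orbits[of \<nu>] that assms(1,3) by simp
  have "ty r i \<nu> m \<in> F" unfolding F_def ty_def by (auto intro!: orb)
  ultimately show thesis using that by blast
qed

lemma pull_comb: "pull \<mu> \<nu> i (\<lambda>a b. c * f a b + g a b) = (\<lambda>\<alpha>. c * pull \<mu> \<nu> i f \<alpha> + pull \<mu> \<nu> i g \<alpha>)"
  by (rule ext) (simp add: pull_def)

context transf_algebra
begin

abbreviation bracket :: "nat list \<Rightarrow> rkey \<Rightarrow> lkey \<Rightarrow> 'k" where
  "bracket \<equiv> cell_data.bracket scale (SL_mult M) (Lambda M) Lambda_gt (Lset r n) (Rset M r n) cell"

text \<open>Two admissible scalars would put a nonzero multiple of the distinguished cell element
  into the span of larger shapes, against \<open>special_not_in_upper\<close>.\<close>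

lemma bracket_eqI:
  assumes lam: "lam \<in> Lambda M"
    and h: "\<And>s' t'. s' \<in> Lset r n lam \<Longrightarrow> t' \<in> Rset M r n lam \<Longrightarrow>
      SL_mult M (cell lam s' t) (cell lam s t') - scale c (cell lam s' t') \<in> U lam"
  shows "bracket lam t s = c"
  unfolding cell_data.bracket_def
proof (rule the_equality)
  show "\<forall>s'\<in>Lset r n lam. \<forall>t'\<in>Rset M r n lam. SL_mult M (cell lam s' t) (cell lam s t') - scale c (cell lam s' t') \<in> U lam"
    using h by blast
  fix c' assume c': "\<forall>s'\<in>Lset r n lam. \<forall>t'\<in>Rset M r n lam. SL_mult M (cell lam s' t) (cell lam s t') - scale c' (cell lam s' t') \<in> U lam"
  note L = Lambda_index[OF lam]
  define z where "z = sum_list lam"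
  have z: "z \<in> {1..sum_list lam}" using L(2) by (simp add: z_def)
  obtain Q S Q' T where k: "(spec r n lam, Q, S) \<in> Lset r n lam" "(spec r n lam, Q', T) \<in> Rset M r n lam"
    "tab_matrix S = Cont (sum_list lam) (row_word lam) (la (spec r n lam) (merge r (sum_list lam) z))"
    "tab_matrix T = Cont (sum_list lam) (row_word lam) (lb (spec r n lam) (merge r (sum_list lam) z))"
    using special_keys[OF L(1-3) z] by blast
  let ?x = "cell lam (spec r n lam, Q, S) (spec r n lam, Q', T)"
  let ?y = "SL_mult M (cell lam (spec r n lam, Q, S) t) (cell lam s (spec r n lam, Q', T))"
  have nU: "?x \<notin> U lam" by (rule special_not_in_upper[OF lam refl z k])
  have "?y - scale c ?x - (?y - scale c' ?x) \<in> U lam"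
    using VS.span_diff[OF h[OF k(1,2), unfolded U_def] c'[rule_format, OF k(1,2), unfolded U_def]] unfolding U_def .
  then have "scale c' ?x - scale c ?x \<in> U lam" by simp
  then have d: "scale (c' - c) ?x \<in> U lam" by (simp add: VS.scale_left_diff_distrib)
  show "c' = c"
  proof (rule ccontr)
    assume "c' \<noteq> c"
    have "scale (inverse (c' - c)) (scale (c' - c) ?x) \<in> U lam" using d unfolding U_def by (rule VS.span_scale)
    then show False using nU \<open>c' \<noteq> c\<close> by simp
  qed
qed

lemma product_cells:
  assumes lam: "lam \<in> Lambda M" and i: "i = sum_list lam"
    and k: "(\<mu>, Q1, S') \<in> Lset r n lam" "(\<nu>, Q2, T) \<in> Rset M r n lam" "(\<nu>, Q3, S) \<in> Lset r n lam" "(\<pi>, Q4, T') \<in> Rset M r n lam"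
  shows "SL_mult M (cell lam (\<mu>, Q1, S') (\<nu>, Q2, T)) (cell lam (\<nu>, Q3, S) (\<pi>, Q4, T')) -
    vec r \<mu> \<pi> (pull \<mu> \<pi> i (words.mm {1..i} K (words.tr (words.xi {1..i} (tab_matrix S')))
      (words.mm {1..i} K (words.mm {1..i} K (HH r i \<nu> (tab_matrix T)) (words.tr (words.xi {1..i} (tab_matrix S))))
        (words.xi {1..i} (tab_matrix T'))))) \<in> U lam"
proof -
  interpret words "{1..i}" K by (rule words_range)
  note L = Lambda_index[OF lam, folded i]
  have c: "\<mu> \<in> compositions r n" "\<nu> \<in> compositions r n" "\<pi> \<in> compositions r n" using k by (auto simp: Lset_def Rset_def)
  have I: "Inv (mm (tr (xi (tab_matrix S))) (xi (tab_matrix T')))" by (intro Inv_mm Inv_tr Inv_xi)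
  show ?thesis
    using product_mod_upper[OF c i I refl, of "tab_matrix S'" "tab_matrix T"]
    unfolding cell_vec[OF L(1-3) k(1,2)] cell_vec[OF L(1-3) k(3,4)] mm_assoc .
qed

text \<open>The inserted matrix \<Theta> is \<open>G\<close> times the identity of the weight space
  plus a remainder in \<open>J\<close>. Over the field \<open>G\<close> vanishes, and the remainder,
  multiplied from both sides, stays in the ideal and hence in the span of larger shapes.\<close>

lemma bracket_dvd_zero:
  assumes lam: "lam \<in> Lambda M" and p: "CHAR('k) = p" "prime p" and dvd: "\<And>j. j < length lam \<Longrightarrow> p dvd lam ! j"
    and ir: "sum_list lam < r" and s: "s \<in> Lset r n lam" and t: "t \<in> Rset M r n lam"
  shows "bracket lam t s = 0"
proof (rule bracket_eqI[OF lam])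
  fix s' t' assume k': "s' \<in> Lset r n lam" "t' \<in> Rset M r n lam"
  obtain \<mu> Q1 S' where s': "s' = (\<mu>, Q1, S')" by (cases s')
  obtain \<nu> Q2 T where t: "t = (\<nu>, Q2, T)" by (cases t)
  obtain \<nu>' Q3 S where s: "s = (\<nu>', Q3, S)" by (cases s)
  obtain \<pi> Q4 T' where t': "t' = (\<pi>, Q4, T')" by (cases t')
  note k = k'[unfolded s' t'] \<open>s \<in> _\<close>[unfolded s] \<open>t \<in> _\<close>[unfolded t]
  define i where "i = sum_list lam"
  note L = Lambda_index[OF lam, folded i_def]
  interpret words "{1..i}" K by (rule words_range)
  have c: "\<mu> \<in> compositions r n" "\<nu> \<in> compositions r n" "\<nu>' \<in> compositions r n" "\<pi> \<in> compositions r n"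
    using k by (auto simp: Lset_def Rset_def)
  have z0: "scale 0 x = (0 :: bkey \<Rightarrow>\<^sub>0 'k)" for x by (rule poly_mapping_eqI) simp
  show "SL_mult M (cell lam s' t) (cell lam s t') - scale 0 (cell lam s' t') \<in> U lam"
  proof (cases "\<nu>' = \<nu>")
    case False
    have "SL_mult M (cell lam s' t) (cell lam s t') = 0"
      unfolding s' t s t' cell_vec[OF L(1-3) k(1,4)] cell_vec[OF L(1-3) k(3,2)]
      by (rule SL_mult_vec_other[OF c]) (use False in simp)
    then show ?thesis by (simp add: z0 U_def VS.span_zero)
  next
    case True
    let ?row = "row_word lam" and ?col = "col_word lam"
    define H where "H = HH r i \<nu> (tab_matrix T)"
    define \<Theta> where "\<Theta> = mm H (tr (xi (tab_matrix S)))"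
    define A where "A = tr (xi (tab_matrix S'))"
    define X where "X = xi (tab_matrix T')"
    have s\<nu>: "sum_list \<nu> = r" using compD[OF c(2)] by simp
    have HI: "Inv H" unfolding H_def by (rule Inv_HH[OF s\<nu>])
    have AI: "Inv A" "Inv X" by (simp_all add: A_def X_def Inv_tr)
    have lenK: "length lam < K" using length_partition[OF L(1)] L(3) rn KK(1) by simp
    have d: "diagram ?row ?col" by (rule diagram_row_col[OF L(1)]) (use lenK in simp)
    have psr: "ps ?row = (\<lambda>q. sum_list (take q lam))" using ps_row_word[of lam] by (simp add: i_def fun_eq_iff)
    have full: "ps ?row (length lam) = card {1..i}" unfolding psr by (simp add: i_def)
    have shape: "map length S = lam" "map length T = lam" using k by (auto simp: Lset_def Rset_def semistandard_tableaux_def)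
    \<comment> \<open>The left weight of \<Theta> is the shape of \<open>T\<close> and the right
      weight that of \<open>S\<close>; both are \<open>lam\<close>.\<close>
    have supp: "ps a = ps ?row \<and> ps b = ps ?row" if ab: "a \<in> F" "b \<in> F" "\<Theta> a b \<noteq> 0" for a b
    proof -
      obtain l where l: "l \<in> F" "H a l \<noteq> 0" "tr (xi (tab_matrix S)) l b \<noteq> 0"
        using mm_nonzeroE[OF ab(3)[unfolded \<Theta>_def]] by metis
      have "cont b l = tab_matrix S" using l(3) by (simp add: tr_def xi_def split: if_splits)
      then have "ps b q = sum_list (take q lam)" for q by (rule ps_tab_matrix[OF ab(2) l(1) _ shape(1)])
      moreover obtain a' where a': "a' \<in> F" "cont a a' = tab_matrix T"
        using Inv_HH_support[OF s\<nu> l(2)[unfolded H_def] KK(2)] by blast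
      then have "ps a q = sum_list (take q lam)" for q by (intro ps_tab_matrix[OF ab(1) a'(1) _ shape(2)])
      ultimately show ?thesis by (simp add: psr fun_eq_iff)
    qed
    define G where "G = alternating ?col \<Theta> ?row ?row"
    define R where "R = (\<lambda>a b. \<Theta> a b - G * xi (cont ?row ?row) a b)"
    have R: "R \<in> J (ps ?row)" unfolding R_def G_def
      by (rule Inv_weight_reduce[OF d full lenK _ supp]) (simp_all add: \<Theta>_def Inv_mm HI Inv_tr)
    have p1: "1 < p" using prime_gt_1_nat[OF p(2)] .
    note rr = row_rot[OF L(1) p1 dvd] and rp = row_rot_permutes[OF L(1) p1 dvd] and rper = row_rot_period[OF L(1) p1 dvd]
    have rowr: "?row \<circ> row_rot i p = ?row"
    proof
      fix x show "(?row \<circ> row_rot i p) x = ?row x"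
      proof (cases "x \<in> {1..i}")
        case True then show ?thesis using rr(2) by simp
      next
        case False then show ?thesis by (simp add: permutes_not_in[OF rp])
      qed
    qed
    have "int p dvd G" unfolding G_def \<Theta>_def
    proof (rule dvd_alternating[OF d p(2) HI rp])
      show "?row (row_rot i p x) = ?row x" if "x \<in> {1..i}" for x using rr(2)[OF _ that] by simp
      show "row_rot i p ^^ p = id" by (rule rper)
      show "?col (row_rot i p x) = ?col (row_rot i p y) \<longleftrightarrow> ?col x = ?col y" if "x \<in> {1..i}" "y \<in> {1..i}" for x y
        using rr(3)[OF _ that(1)] rr(3)[OF _ that(2)] rot_inj p1 by simp
      show "int p dvd H ?row l" if "l \<in> F" "l \<circ> row_rot i p = l" for l
        unfolding H_def by (rule dvd_HH[OF s\<nu> p(2) ir[folded i_def] rp rper rr(4) rowr that(2)])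
    qed
    then have G0: "(of_int G :: 'k) = 0" using p(1) of_int_eq_0_iff_char_dvd by blast
    have \<Theta>eq: "\<Theta> = (\<lambda>a b. G * xi (cont ?row ?row) a b + R a b)" by (simp add: R_def fun_eq_iff)
    have "vec r \<mu> \<pi> (pull \<mu> \<pi> i (mm A (mm \<Theta> X))) = (vec r \<mu> \<pi> (pull \<mu> \<pi> i (mm A (mm R X))) :: bkey \<Rightarrow>\<^sub>0 'k)"
      unfolding \<Theta>eq mm_comb_left mm_comb_right pull_comb weights.vec_comb[OF weightsI[OF c(1,4)]] G0 z0 by simp
    also have "\<dots> \<in> U lam"
    proof (rule J_in_upper[OF lam L(1) c(1,4)])
      show "mm A (mm R X) \<in> J (\<lambda>q. sum_list (take q lam))"
        using J_mm_left[OF J_mm_right[OF R AI(2)] AI(1)] unfolding psr .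
    qed
    finally have v: "vec r \<mu> \<pi> (pull \<mu> \<pi> i (mm A (mm \<Theta> X))) \<in> U lam" .
    have "SL_mult M (cell lam s' t) (cell lam s t') - vec r \<mu> \<pi> (pull \<mu> \<pi> i (mm A (mm \<Theta> X))) \<in> U lam"
      using product_cells[OF lam i_def k(1,4) k(3)[unfolded True] k(2)]
      unfolding s' t s t' True A_def \<Theta>_def H_def X_def .
    from VS.span_add[OF this[unfolded U_def] v[unfolded U_def]] show ?thesis unfolding z0 U_def by simp
  qed
qed

lemma bracket_special:
  assumes lam: "lam \<in> Lambda M" and z: "z \<in> {1..sum_list lam}"
  obtains s t where "s \<in> Lset r n lam" "t \<in> Rset M r n lam" "bracket lam t s = of_nat (theta r (sum_list lam) z lam)"
proof -
  define i where "i = sum_list lam"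
  note L = Lambda_index[OF lam, folded i_def]
  have z: "z \<in> {1..i}" using assms(2) by (simp add: i_def)
  interpret words "{1..i}" K by (rule words_range)
  define \<nu> where "\<nu> = spec r n lam"
  let ?row = "row_word lam" and ?th = "theta r i z lam"
  obtain Q3 S Q2 T where k: "(\<nu>, Q3, S) \<in> Lset r n lam" "(\<nu>, Q2, T) \<in> Rset M r n lam"
    "tab_matrix S = Cont i ?row (la \<nu> (merge r i z))" "tab_matrix T = Cont i ?row (lb \<nu> (merge r i z))"
    using special_keys[OF L(1-3) z] unfolding \<nu>_def by blast
  have rowF: "?row \<in> F"
    using row_word_in_W[of lam K] length_partition[OF L(1)] L(3) rn KK(1) by (simp add: i_def)
  have psr: "ps ?row = (\<lambda>q. sum_list (take q lam))" using ps_row_word[of lam] by (simp add: i_def fun_eq_iff)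
  have "bracket lam (\<nu>, Q2, T) (\<nu>, Q3, S) = of_nat ?th"
  proof (rule bracket_eqI[OF lam])
    fix s' t' assume k': "s' \<in> Lset r n lam" "t' \<in> Rset M r n lam"
    obtain \<mu> Q1 S' where s': "s' = (\<mu>, Q1, S')" by (cases s')
    obtain \<pi> Q4 T' where t': "t' = (\<pi>, Q4, T')" by (cases t')
    note k' = k'[unfolded s' t']
    have c: "\<mu> \<in> compositions r n" "\<pi> \<in> compositions r n" using k' by (auto simp: Lset_def Rset_def)
    have shape: "map length T' = lam" using k' by (auto simp: Rset_def semistandard_tableaux_def)
    interpret C: weights r \<mu> \<pi> by (rule weightsI[OF c])
    let ?A = "tr (xi (tab_matrix S'))" and ?X = "xi (tab_matrix T')"
    let ?Th = "mm (HH r i \<nu> (tab_matrix T)) (tr (xi (tab_matrix S)))"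
    have Th: "?Th a b = int ?th * xi (cont ?row ?row) a b" if "a \<in> F" "b \<in> F" for a b
      using special_theta[OF L(1-3) rn Kdef z that] unfolding k(3,4) \<nu>_def .
    \<comment> \<open>Every word that contributes to \<open>?X\<close> from the left has weight
      \<open>lam\<close>, and there \<open>?Th\<close> is scalar.\<close>
    have ThX: "mm ?Th ?X \<rho> b = int ?th * ?X \<rho> b" if \<rho>: "\<rho> \<in> F" "b \<in> F" for \<rho> b
    proof -
      have "mm ?Th ?X \<rho> b = ?Th \<rho> \<rho> * ?X \<rho> b"
      proof (rule mm_unique[OF \<rho>(1)])
        fix \<rho>' assume r': "\<rho>' \<in> F" "?Th \<rho> \<rho>' \<noteq> 0"
        then have cc: "cont \<rho> \<rho>' = cont ?row ?row" using Th[OF \<rho>(1) r'(1)] by (simp add: xi_def split: if_splits)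
        from cont_eqE[OF this \<rho>(1) r'(1) rowF rowF] show "\<rho>' = \<rho>" by metis
      qed
      also have "\<dots> = int ?th * ?X \<rho> b"
      proof (cases "cont \<rho> b = tab_matrix T'")
        case True
        have "ps \<rho> q = sum_list (take q lam)" for q by (rule ps_tab_matrix[OF \<rho> True shape])
        then have "cont \<rho> \<rho> = cont ?row ?row" by (intro ps_eq_cont_diag) (simp add: psr fun_eq_iff)
        then show ?thesis using Th[OF \<rho>(1,1)] by (simp add: xi_def)
      qed (simp add: xi_def)
      finally show ?thesis .
    qed
    have "(vec r \<mu> \<pi> (pull \<mu> \<pi> i (mm ?A (mm ?Th ?X))) :: bkey \<Rightarrow>\<^sub>0 'k) = vec r \<mu> \<pi> (\<lambda>\<alpha>. int ?th * pull \<mu> \<pi> i (mm ?A ?X) \<alpha> + 0)"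
    proof (rule C.vec_cong)
      fix \<alpha> assume \<alpha>: "\<alpha> \<in> M"
      show "pull \<mu> \<pi> i (mm ?A (mm ?Th ?X)) \<alpha> = int ?th * pull \<mu> \<pi> i (mm ?A ?X) \<alpha> + 0"
      proof (cases "map_index \<alpha> = i")
        case True
        then have "lb \<pi> \<alpha> \<in> F" using la_lb_W(2)[OF \<alpha> c] by simp
        then show ?thesis using True ThX by (simp add: pull_def mm_def[of ?A] sum_distrib_left mult_ac)
      qed (simp add: pull_def)
    qed
    also have "\<dots> = scale (of_nat ?th) (cell lam s' t') + vec r \<mu> \<pi> (\<lambda>\<alpha>. 0)"
      unfolding C.vec_comb s' t' cell_vec[OF L(1-3) k'] by simp
    also have "vec r \<mu> \<pi> (\<lambda>\<alpha>. 0) = (0 :: bkey \<Rightarrow>\<^sub>0 'k)" by (simp add: vec_def)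
    finally have v: "(vec r \<mu> \<pi> (pull \<mu> \<pi> i (mm ?A (mm ?Th ?X))) :: bkey \<Rightarrow>\<^sub>0 'k) = scale (of_nat ?th) (cell lam s' t')" by simp
    show "SL_mult M (cell lam s' (\<nu>, Q2, T)) (cell lam (\<nu>, Q3, S) t') - scale (of_nat ?th) (cell lam s' t') \<in> U lam"
      using product_cells[OF lam i_def k'(1) k(2,1) k'(2)] unfolding v s' t' .
  qed
  then show thesis using that k(1,2) by (simp add: i_def)
qed

lemma Lambda0_eq:
  assumes p: "CHAR('k) = p" "p > 0"
  shows "Lambda_Lp p r = SL_Lambda0 TYPE('k) M r n"
proof -
  have prime: "prime p" using p prime_CHAR_semidom[where 'a = 'k] by simp
  have full: "partitions r \<subseteq> Lambda M"
  proof
    fix lam assume lam: "lam \<in> partitions r"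
    have z: "1 \<in> {1..r}" using r1 by simp
    have "map_index (merge r r 1) = r" "merge r r 1 \<in> M"
      using merge_index[OF lam r1 order_refl rn z] merge_in[OF lam r1 order_refl rn z] by blast+
    then show "lam \<in> Lambda M" using lam unfolding Lambda_def by (intro UN_I[of r]) (auto intro!: image_eqI[of _ _ "merge r r 1"])
  qed
  have eqv: "(\<exists>s\<in>Lset r n lam. \<exists>t\<in>Rset M r n lam. bracket lam t s \<noteq> 0) \<longleftrightarrow> (\<exists>j<length lam. \<not> p dvd lam ! j) \<or> lam \<in> partitions r"
    if lam: "lam \<in> Lambda M" for lam
  proof
    assume ex: "\<exists>s\<in>Lset r n lam. \<exists>t\<in>Rset M r n lam. bracket lam t s \<noteq> 0"
    show "(\<exists>j<length lam. \<not> p dvd lam ! j) \<or> lam \<in> partitions r"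
    proof (rule ccontr)
      assume h: "\<not> ((\<exists>j<length lam. \<not> p dvd lam ! j) \<or> lam \<in> partitions r)"
      then have "sum_list lam < r" using Lambda_index(1,3)[OF lam] by (metis le_neq_implies_less)
      then show False using ex bracket_dvd_zero[OF lam p(1) prime] h by blast
    qed
  next
    note L = Lambda_index[OF lam]
    assume h: "(\<exists>j<length lam. \<not> p dvd lam ! j) \<or> lam \<in> partitions r"
    \<comment> \<open>For a partition of \<open>r\<close> every choice of \<open>z\<close> gives the
      value 1. Otherwise \<open>z\<close> is the first box of a row whose length is not divisible by
      \<open>p\<close>.\<close>
    have "\<exists>z\<in>{1..sum_list lam}. \<not> p dvd theta r (sum_list lam) z lam"
    proof (cases "sum_list lam = r")
      case True
      have z: "r \<in> {1..sum_list lam}" using True r1 by simp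
      have "theta r (sum_list lam) r lam = 1" by (rule theta_full[OF L(1-3) rn Kdef z True])
      then show ?thesis using z prime by (intro bexI[of _ r]) (simp_all add: not_prime_1)
    next
      case False
      then obtain j where j: "j < length lam" "\<not> p dvd lam ! j" using h by (auto simp: partitions_def)
      have "0 < lam ! j" using j(2) by (cases "lam ! j = 0") auto
      note w = row_word_at[OF j(1) this]
      have "theta r (sum_list lam) (sum_list (take j lam) + 0 + 1) lam = lam ! j"
        using theta_less[OF L(1-3) rn Kdef w(1)] w(2) L(3) False by simp
      then show ?thesis using w(1) j(2) by (intro bexI[of _ "sum_list (take j lam) + 0 + 1"]) simp_all
    qed
    then obtain z where z: "z \<in> {1..sum_list lam}" "\<not> p dvd theta r (sum_list lam) z lam" by blast
    obtain s t where "s \<in> Lset r n lam" "t \<in> Rset M r n lam" "bracket lam t s = of_nat (theta r (sum_list lam) z lam)"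
      using bracket_special[OF lam z(1)] by blast
    moreover have "of_nat (theta r (sum_list lam) z lam) \<noteq> (0 :: 'k)" using z(2) p(1) by (simp add: of_nat_eq_0_iff_char_dvd)
    ultimately show "\<exists>s\<in>Lset r n lam. \<exists>t\<in>Rset M r n lam. bracket lam t s \<noteq> 0" by metis
  qed
  show ?thesis
  proof (rule set_eqI)
    fix lam show "lam \<in> Lambda_Lp p r \<longleftrightarrow> lam \<in> SL_Lambda0 TYPE('k) M r n"
    proof (cases "lam \<in> Lambda M")
      case True
      then show ?thesis unfolding Lambda_Lp_def SL_Lambda0_def cell_data.Lambda0_def Un_iff mem_Collect_eq eqv[OF True] by blast
    next
      case False
      then show ?thesis using full by (auto simp: Lambda_Lp_def SL_Lambda0_def cell_data.Lambda0_def)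
    qed
  qed
qed

end

theorem theorem5p3:
  fixes r n p :: nat
  assumes "1 \<le> r" and "r \<le> n"
    and "CHAR('k::field) = p" and "p > 0"
  shows "Lambda_Lp p r = SL_Lambda0 TYPE('k) (full_transf r) r n"
proof -
  interpret transf_algebra r n "n + 2 ^ r + 3" "TYPE('k)"
    by unfold_locales (use assms in simp_all)
  show ?thesis by (rule Lambda0_eq[OF assms(3,4)])
qed

end
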